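(* Let $W$ be a graphon such that $W$ and $x\mapsto W(x,x)$ are Riemann integrable and $\int_{[0,1]^2}W(x,y)\,dx\,dy>0$. Let $\beta\in(0,1/\|W\|_{\mathrm{op}})$, and let $\theta_N\in(0,1)$ satisfy $\theta_N\to\theta\in(0,1]$. Let $G_N\sim G(N,\theta_N,W)$, let $\hat\lambda_1(G_N)\ge\dots\ge\hat\lambda_N(G_N)$ be the eigenvalues of $\frac{1}{N\theta_N}A_{G_N}$, and let $\{\eta_i\}_{i\ge1}$ be i.i.d. $\mathcal N(0,1)$ independent of $G_N$. Define $$\hat U_\beta:=\frac{\beta}{2N^2\theta_N^2}\sum_{1\le i\ne j\le N}A_{G_N}(i,j)+\frac{1}{2N\theta_N}\sum_{i=1}^NA_{G_N}(i,i)+\frac{\beta^2}{2}\sum_{i=1}^N\frac{\hat\lambda_i(G_N)^3}{1-\beta\hat\lambda_i(G_N)}+\frac12\sum_{i=1}^N\frac{\hat\lambda_i(G_N)}{1-\beta\hat\lambda_i(G_N)}(\eta_i^2-1)$$ and $$U_\beta:=\beta\sigma_W^2+\frac12\int_0^1W(x,x)\,dx+\sigma_WZ_0+\frac12\sum_{\lambda\in\mathrm{Spec}(W)}\lambda\left(\frac{Z_\lambda^2}{1-\beta\lambda}-1\right),$$ where $\sigma_W^2:=\frac{1}{2\theta}\int_{[0,1]^2}W(x,y)(1-\theta W(x,y))\,dx\,dy$ and $Z_0,\{Z_\lambda\}_{\lambda\in\mathrm{Spec}(W)}$ are i.i.d. $\mathcal N(0,1)$. Then, as $N\to\infty$, the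 conditional distribution of $\hat U_\beta$ given $A_{G_N}$ converges weakly to the distribution of $U_\beta$, almost surely.
   Context: A graphon is a symmetric measurable function $W:[0,1]^2\to[0,1]$. $T_W:L^2[0,1]\to L^2[0,1]$ is the operator $(T_Wf)(x)=\int_0^1W(x,y)f(y)\,dy$; $\|W\|_{\mathrm{op}}$ is its operator norm; $\mathrm{Spec}(W)$ is the countable multiset of its non-zero eigenvalues (with multiplicity). $G_N\sim G(N,\theta_N,W)$ is the random graph (self-loops allowed) on $\{1,\dots,N\}$ with symmetric adjacency matrix $A_{G_N}$ whose entries $A_{G_N}(i,j)$, $1\le i\le j\le N$, are independent Bernoulli with parameters $\theta_NW(\frac iN,\frac jN)$. The graphs $G_N$, $N\ge1$, are defined on a common probability space, and "almost surely" refers to the randomness of the sequence $\{G_N\}$. *)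

theory Defs
  imports "HOL-Probability.Probability" "Jordan_Normal_Form.Char_Poly"
begin

definition graphon :: "(real \<Rightarrow> real \<Rightarrow> real) \<Rightarrow> bool" where
  "graphon W \<longleftrightarrow>
     (\<forall>x\<in>{0..1}. \<forall>y\<in>{0..1}. W x y = W y x \<and> 0 \<le> W x y \<and> W x y \<le> 1) \<and>
     (\<lambda>(x, y). W x y) \<in> borel_measurable (lebesgue_on ({0..1} \<times> {0..1}))"

text \<open>
  The gauge in the definition of the Henstock--Kurzweil integral is restricted to constant
  functions here, so this is classical Riemann integrability over the box \<open>cbox a b\<close>.
\<close>

definition riemann_integrable ::
    "('a::euclidean_space \<Rightarrow> real) \<Rightarrow> 'a \<Rightarrow> 'a \<Rightarrow> bool" where
  "riemann_integrable f a b \<longleftrightarrow>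
     (\<exists>I. \<forall>e>0. \<exists>d>0. \<forall>D. D tagged_division_of cbox a b \<and> (\<lambda>x. ball x d) fine D \<longrightarrow>
        \<bar>(\<Sum>(x, K)\<in>D. measure lborel K * f x) - I\<bar> < e)"


text \<open>
  Elements of \<open>L\<^sup>2[0,1]\<close> are represented by functions, with equality almost everywhere.
\<close>

definition L2 :: "(real \<Rightarrow> real) \<Rightarrow> bool" where
  "L2 f \<longleftrightarrow> f \<in> borel_measurable (lebesgue_on {0..1}) \<and>
             integrable (lebesgue_on {0..1}) (\<lambda>x. (f x)\<^sup>2)"

definition L2_norm :: "(real \<Rightarrow> real) \<Rightarrow> real" where
  "L2_norm f = sqrt (LINT x|lebesgue_on {0..1}. (f x)\<^sup>2)"

definition graphon_op :: "(real \<Rightarrow> real \<Rightarrow> real) \<Rightarrow> (real \<Rightarrow> real) \<Rightarrow> real \<Rightarrow> real" where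
  "graphon_op W f x = (LINT y|lebesgue_on {0..1}. W x y * f y)"

definition graphon_op_norm :: "(real \<Rightarrow> real \<Rightarrow> real) \<Rightarrow> real" where
  "graphon_op_norm W = (SUP f\<in>{f. L2 f \<and> L2_norm f \<le> 1}. L2_norm (graphon_op W f))"

definition eigenspace :: "(real \<Rightarrow> real \<Rightarrow> real) \<Rightarrow> real \<Rightarrow> (real \<Rightarrow> real) set" where
  "eigenspace W l =
     {f. L2 f \<and> (AE x in lebesgue_on {0..1}. graphon_op W f x = l * f x)}"

definition L2_independent :: "nat \<Rightarrow> (nat \<Rightarrow> real \<Rightarrow> real) \<Rightarrow> bool" where
  "L2_independent k f \<longleftrightarrow>
     (\<forall>c. (AE x in lebesgue_on {0..1}. (\<Sum>i<k. c i * f i x) = 0) \<longrightarrow> (\<forall>i<k. c i = 0))"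

text \<open>
  The multiset of non-zero eigenvalues is encoded as a set of pairs: \<open>l\<close> is paired with every
  \<open>k \<ge> 1\<close> that does not exceed the dimension (in \<open>L\<^sup>2[0,1]\<close>) of the eigenspace of \<open>l\<close>, so
  that \<open>l\<close> occurs in as many pairs as its multiplicity.
\<close>

definition Spec :: "(real \<Rightarrow> real \<Rightarrow> real) \<Rightarrow> (real \<times> nat) set" where
  "Spec W = {(l, k). l \<noteq> 0 \<and> k \<ge> 1 \<and>
     (\<exists>f. (\<forall>i<k. f i \<in> eigenspace W l) \<and> L2_independent k f)}"


text \<open>
  The family \<open>A\<close> is the adjacency relation of a random graph with law \<open>G(N, t, W)\<close> on
  the vertices \<open>1, \<dots>, N\<close>.
\<close>

definition random_graph ::
    "'w measure \<Rightarrow> nat \<Rightarrow> real \<Rightarrow> (real \<Rightarrow> real \<Rightarrow> real) \<Rightarrow> (nat \<Rightarrow> nat \<Rightarrow> 'w \<Rightarrow> bool) \<Rightarrow> bool" where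
  "random_graph M N t W A \<longleftrightarrow>
     (\<forall>\<omega>\<in>space M. \<forall>i\<in>{1..N}. \<forall>j\<in>{1..N}. A i j \<omega> = A j i \<omega>) \<and>
     prob_space.indep_vars M (\<lambda>_. count_space UNIV) (\<lambda>(i, j). A i j)
       {(i, j). 1 \<le> i \<and> i \<le> j \<and> j \<le> N} \<and>
     (\<forall>i j. 1 \<le> i \<and> i \<le> j \<and> j \<le> N \<longrightarrow>
        distr M (count_space UNIV) (A i j) =
          measure_pmf (bernoulli_pmf (t * W (real i / real N) (real j / real N))))"

text \<open>Matrix indices start at 0, vertices at 1.\<close>

definition adjacency_mat :: "nat \<Rightarrow> (nat \<Rightarrow> nat \<Rightarrow> 'w \<Rightarrow> bool) \<Rightarrow> 'w \<Rightarrow> real mat" where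
  "adjacency_mat N A \<omega> = mat N N (\<lambda>(i, j). of_bool (A (Suc i) (Suc j) \<omega>))"

text \<open>The \<open>i\<close>-th largest eigenvalue, for \<open>1 \<le> i \<le> N\<close>, of a symmetric \<open>N \<times> N\<close> matrix.\<close>

definition eigval :: "real mat \<Rightarrow> nat \<Rightarrow> real" where
  "eigval B i = rev (sorted_list_of_multiset (proots (char_poly B))) ! (i - 1)"

definition U_hat ::
    "real \<Rightarrow> nat \<Rightarrow> real \<Rightarrow> (nat \<Rightarrow> nat \<Rightarrow> 'w \<Rightarrow> bool) \<Rightarrow> (nat \<Rightarrow> 'w \<Rightarrow> real) \<Rightarrow> 'w \<Rightarrow> real" where
  "U_hat \<beta> N t A \<eta> \<omega> =
     (let lam = eigval ((1 / (real N * t)) \<cdot>\<^sub>m adjacency_mat N A \<omega>) in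
        \<beta> / (2 * (real N)\<^sup>2 * t\<^sup>2) *
          (\<Sum>(i, j)\<in>{(i, j). i \<in> {1..N} \<and> j \<in> {1..N} \<and> i \<noteq> j}. of_bool (A i j \<omega>))
      + 1 / (2 * real N * t) * (\<Sum>i=1..N. of_bool (A i i \<omega>))
      + \<beta>\<^sup>2 / 2 * (\<Sum>i=1..N. lam i ^ 3 / (1 - \<beta> * lam i))
      + 1 / 2 * (\<Sum>i=1..N. lam i / (1 - \<beta> * lam i) * ((\<eta> i \<omega>)\<^sup>2 - 1)))"

text \<open>
  Conditional distribution of \<open>X\<close> given a random element \<open>Y\<close> with finitely many values,
  evaluated at \<open>\<omega>\<close>: the law of \<open>X\<close> under the probability measure conditioned on the
  event that \<open>Y\<close> takes the value \<open>Y \<omega>\<close>, an event of positive probability for almost every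
  \<open>\<omega>\<close>.
\<close>

definition cond_distr :: "'w measure \<Rightarrow> ('w \<Rightarrow> real) \<Rightarrow> ('w \<Rightarrow> 'b) \<Rightarrow> 'w \<Rightarrow> real measure" where
  "cond_distr M X Y \<omega> =
     distr (uniform_measure M {\<omega>' \<in> space M. Y \<omega>' = Y \<omega>}) borel X"

definition iid_std_normal :: "'w measure \<Rightarrow> ('i \<Rightarrow> 'w \<Rightarrow> real) \<Rightarrow> 'i set \<Rightarrow> bool" where
  "iid_std_normal M X I \<longleftrightarrow>
     prob_space.indep_vars M (\<lambda>_. borel) X I \<and>
     (\<forall>i\<in>I. distributed M lborel (X i) std_normal_density)"

text \<open>
  Independence of two random elements of different types (\<open>prob_space.indep_var\<close> requires a
  common type).
\<close>

definition indep_elements ::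
    "'w measure \<Rightarrow> 'b measure \<Rightarrow> ('w \<Rightarrow> 'b) \<Rightarrow> 'c measure \<Rightarrow> ('w \<Rightarrow> 'c) \<Rightarrow> bool" where
  "indep_elements M S X T Y \<longleftrightarrow>
     X \<in> measurable M S \<and> Y \<in> measurable M T \<and>
     prob_space.indep_set M {X -` B \<inter> space M | B. B \<in> sets S} {Y -` C \<inter> space M | C. C \<in> sets T}"


text \<open>
  Unordered sum of a family of random variables in \<open>L\<^sup>2(P)\<close>. It is unique up to \<open>P\<close>-null sets.
  The eigenvalues of a graphon need not be absolutely summable, so the series in the limit need
  not converge absolutely for a fixed sample point, and \<open>infsum\<close> cannot be used pointwise.
\<close>

definition has_L2_sum :: "'v measure \<Rightarrow> ('i \<Rightarrow> 'v \<Rightarrow> real) \<Rightarrow> 'i set \<Rightarrow> ('v \<Rightarrow> real) \<Rightarrow> bool" where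
  "has_L2_sum P X I S \<longleftrightarrow> S \<in> borel_measurable P \<and>
     ((\<lambda>F. \<integral>\<^sup>+\<omega>. ennreal (((\<Sum>i\<in>F. X i \<omega>) - S \<omega>)\<^sup>2) \<partial>P) \<longlongrightarrow> 0) (finite_subsets_at_top I)"

definition L2_sum :: "'v measure \<Rightarrow> ('i \<Rightarrow> 'v \<Rightarrow> real) \<Rightarrow> 'i set \<Rightarrow> 'v \<Rightarrow> real" where
  "L2_sum P X I = (SOME S. has_L2_sum P X I S)"

definition sigma_W :: "(real \<Rightarrow> real \<Rightarrow> real) \<Rightarrow> real \<Rightarrow> real" where
  "sigma_W W \<theta> =
     sqrt (1 / (2 * \<theta>) *
       (LINT (x, y)|lebesgue_on ({0..1} \<times> {0..1}). W x y * (1 - \<theta> * W x y)))"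

definition U_lim ::
    "(real \<Rightarrow> real \<Rightarrow> real) \<Rightarrow> real \<Rightarrow> real \<Rightarrow> 'v measure \<Rightarrow>
     ('v \<Rightarrow> real) \<Rightarrow> (real \<times> nat \<Rightarrow> 'v \<Rightarrow> real) \<Rightarrow> 'v \<Rightarrow> real" where
  "U_lim W \<beta> \<theta> P Z0 Z \<omega> =
     \<beta> * (sigma_W W \<theta>)\<^sup>2 + 1 / 2 * (LINT x|lebesgue_on {0..1}. W x x)
     + sigma_W W \<theta> * Z0 \<omega>
     + 1 / 2 * L2_sum P (\<lambda>(l, k) \<omega>. l * ((Z (l, k) \<omega>)\<^sup>2 / (1 - \<beta> * l) - 1)) (Spec W) \<omega>"

end

theory Submission
  imports Defs "Jordan_Normal_Form.Schur_Decomposition"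
begin

text \<open>
  Given the graph, the estimator is a constant plus a quadratic form in independent standard
  normal variables, diagonal with entries that depend on the eigenvalues \<open>l\<close> of the normalised
  adjacency matrix (\<open>cond_distr_eq\<close>). Its characteristic function is therefore explicit
  (\<open>char_quadratic_form\<close>, \<open>normal_square_char\<close>), and so is that of the limit, whose random
  series converges in mean square (\<open>U_lim_char\<close>). By the continuity theorem of Levy it
  suffices to prove pointwise convergence of characteristic functions for almost every sequence
  of graphs (\<open>U_fixed_char_tendsto\<close>).

  The logarithm of the characteristic function at \<open>t\<close> is a sum over the eigenvalues of
  \<open>l\<^sup>2 h(l) - t\<^sup>2 l\<^sup>2 / 4\<close>, where \<open>h\<close> is continuous and vanishes at \<open>0\<close>; the remaining terms
  involve only the numbers of edges and of loops. Two limits are needed.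

  \<^item> Power sums of the eigenvalues with an exponent \<open>m \<ge> 3\<close> are traces of powers of a step kernel.
    These traces are continuous in the cut norm (\<open>ktr_kpow_tendsto\<close>), and the step kernels converge
    to \<open>W\<close> in the cut norm almost surely: the random fluctuations are controlled by Hoeffding's
    inequality over all pairs of sign vectors and the Borel--Cantelli lemma
    (\<open>random_graph_concentration\<close>), the deterministic error by Riemann integrability
    (\<open>step_kernel_L1\<close>). Polynomial approximation of \<open>h\<close> extends the convergence from power sums to
    the sums of \<open>l\<^sup>2 h(l)\<close> (\<open>complex_spectral_sum\<close>).

  \<^item> The sum of the squared eigenvalues does not converge to the sum \<open>T\<close> of the squared eigenvalues of
    \<open>W\<close>, which is the integral of \<open>W\<^sup>2\<close>. Since the entries of the adjacency matrix are \<open>0\<close> or \<open>1\<close>,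
    it is a normalised edge count and converges to \<open>w / \<theta>\<close>, where \<open>w\<close> is the integral of \<open>W\<close>. The
    difference \<open>w / \<theta> - T\<close> equals \<open>2 \<sigma>\<^sub>W\<^sup>2\<close> (\<open>sigma_W_sq\<close>). In the limit it produces the Gaussian
    term \<open>\<sigma>\<^sub>W Z\<^sub>0\<close> and, through the edge count in the estimator, the drift \<open>\<beta> \<sigma>\<^sub>W\<^sup>2\<close>.

  The spectral theory of \<open>W\<close> is derived for arbitrary bounded symmetric kernels on a probability
  space. The normalised even powers of a kernel converge to a non-zero kernel whose columns yield an
  eigenfunction (\<open>top_projection\<close>, \<open>top_eigenfunction\<close>). Splitting off eigenfunctions one after
  another gives a sequence of eigenvalues whose power sums with exponents \<open>m \<ge> 3\<close> are the traces of the
  powers (\<open>eigv_power_sums\<close>). This sequence is complete (\<open>eigf_complete\<close>), and hence enumerates the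
  spectrum of \<open>W\<close> with multiplicities (\<open>bij_betw_spec_pair\<close>).
\<close>

section \<open>Bounded kernels on a probability space\<close>

lemma discriminant_nonpos:
  fixes a b c :: real
  assumes "\<And>t. 0 \<le> a * t\<^sup>2 - 2 * b * t + c"
  shows "b\<^sup>2 \<le> a * c"
proof (cases "a = 0")
  case True
  have "b = 0"
  proof (rule ccontr)
    assume "b \<noteq> 0"
    then show False using assms[of "(c + 1) / (2 * b)"] True by simp
  qed
  then show ?thesis using True by simp
next
  case False
  have "a > 0"
  proof (rule ccontr)
    assume "\<not> a > 0"
    then have an: "a < 0" using False by simp
    define t where "t = \<bar>c\<bar> / \<bar>a\<bar> + 2 * \<bar>b\<bar> / \<bar>a\<bar> + 1"
    have t1: "t \<ge> 1" unfolding t_def by simp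
    have at: "a * t = - \<bar>c\<bar> - 2 * \<bar>b\<bar> + a" unfolding t_def using an by (simp add: field_simps)
    have "a * t\<^sup>2 = (a * t) * t" by (simp add: power2_eq_square)
    also have "\<dots> = (- \<bar>c\<bar> - 2 * \<bar>b\<bar> + a) * t" using at by simp
    finally have "a * t\<^sup>2 - 2 * b * t + c = (- \<bar>c\<bar> - 2 * \<bar>b\<bar> - 2 * b + a) * t + c" by (simp add: algebra_simps)
    also have "\<dots> \<le> (- \<bar>c\<bar> + a) * t + c" using t1 by (intro add_right_mono mult_right_mono) auto
    also have "\<dots> \<le> (- \<bar>c\<bar> + a) * 1 + c" using t1 an
      by (intro add_right_mono mult_left_mono_neg) auto
    also have "\<dots> < 0" using an by simp
    finally show False using assms[of t] by simp
  qed
  then show ?thesis using assms[of "b / a"] by (simp add: field_simps power2_eq_square)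
qed

text \<open>
  Kernels are bounded functions of two points, so that all integrals below exist and identities between
  compositions of kernels hold pointwise. Since the space is the whole type, boundedness and
  measurability need no restriction to a carrier.
\<close>

locale kernel_space = prob_space M for M :: "'a measure" +
  assumes space_UNIV [simp]: "space M = UNIV"
begin

sublocale MM: pair_prob_space M M ..

definition bfun :: "('a \<Rightarrow> real) \<Rightarrow> bool" where
  "bfun f \<longleftrightarrow> f \<in> borel_measurable M \<and> (\<exists>B. \<forall>x. \<bar>f x\<bar> \<le> B)"

definition bker :: "('a \<Rightarrow> 'a \<Rightarrow> real) \<Rightarrow> bool" where
  "bker K \<longleftrightarrow> case_prod K \<in> borel_measurable (M \<Otimes>\<^sub>M M) \<and> (\<exists>B. \<forall>x y. \<bar>K x y\<bar> \<le> B)"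

definition ip :: "('a \<Rightarrow> real) \<Rightarrow> ('a \<Rightarrow> real) \<Rightarrow> real" where
  "ip f g = (\<integral>x. f x * g x \<partial>M)"

definition app :: "('a \<Rightarrow> 'a \<Rightarrow> real) \<Rightarrow> ('a \<Rightarrow> real) \<Rightarrow> 'a \<Rightarrow> real" where
  "app K f x = (\<integral>y. K x y * f y \<partial>M)"

definition kcomp :: "('a \<Rightarrow> 'a \<Rightarrow> real) \<Rightarrow> ('a \<Rightarrow> 'a \<Rightarrow> real) \<Rightarrow> 'a \<Rightarrow> 'a \<Rightarrow> real" where
  "kcomp K L x y = (\<integral>z. K x z * L z y \<partial>M)"

definition dint :: "('a \<Rightarrow> 'a \<Rightarrow> real) \<Rightarrow> real" where
  "dint K = (\<integral>x. \<integral>y. K x y \<partial>M \<partial>M)"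

definition hs :: "('a \<Rightarrow> 'a \<Rightarrow> real) \<Rightarrow> ('a \<Rightarrow> 'a \<Rightarrow> real) \<Rightarrow> real" where
  "hs K L = dint (\<lambda>x y. K x y * L x y)"

definition ktr :: "('a \<Rightarrow> 'a \<Rightarrow> real) \<Rightarrow> real" where
  "ktr K = (\<integral>x. K x x \<partial>M)"

text \<open>
  The exponent is shifted: \<open>kpow K n\<close> is the \<open>(n + 1)\<close>-th power, since the identity operator has no
  kernel.
\<close>

fun kpow :: "('a \<Rightarrow> 'a \<Rightarrow> real) \<Rightarrow> nat \<Rightarrow> 'a \<Rightarrow> 'a \<Rightarrow> real" where
  "kpow K 0 = K"
| "kpow K (Suc n) = kcomp K (kpow K n)"

definition ksym :: "('a \<Rightarrow> 'a \<Rightarrow> real) \<Rightarrow> bool" where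
  "ksym K \<longleftrightarrow> (\<forall>x y. K x y = K y x)"

lemma bfun_measurable[measurable_dest]: "bfun f \<Longrightarrow> f \<in> borel_measurable M"
  by (simp add: bfun_def)

lemma bfunI: "f \<in> borel_measurable M \<Longrightarrow> (\<And>x. \<bar>f x\<bar> \<le> B) \<Longrightarrow> bfun f"
  by (auto simp: bfun_def)

lemma bfun_bound: assumes "bfun f" obtains B where "0 \<le> B" "\<And>x. \<bar>f x\<bar> \<le> B"
proof -
  obtain B where "\<forall>x. \<bar>f x\<bar> \<le> B" using assms by (auto simp: bfun_def)
  then have "\<And>x. \<bar>f x\<bar> \<le> \<bar>B\<bar>" by (meson abs_ge_self order_trans)
  then show thesis using that[of "\<bar>B\<bar>"] by simp
qed

lemma bkerI: "case_prod K \<in> borel_measurable (M \<Otimes>\<^sub>M M) \<Longrightarrow> (\<And>x y. \<bar>K x y\<bar> \<le> B) \<Longrightarrow> bker K"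
  by (auto simp: bker_def)

lemma bker_bound: assumes "bker f" obtains B where "0 \<le> B" "\<And>x y. \<bar>f x y\<bar> \<le> B"
proof -
  obtain B where "\<forall>x y. \<bar>f x y\<bar> \<le> B" using assms by (auto simp: bker_def)
  then have "\<And>x y. \<bar>f x y\<bar> \<le> \<bar>B\<bar>" by (meson abs_ge_self order_trans)
  then show thesis using that[of "\<bar>B\<bar>"] by simp
qed

lemma bker_measurable_compose:
  assumes "bker K" "f \<in> measurable N M" "g \<in> measurable N M"
  shows "(\<lambda>w. K (f w) (g w)) \<in> borel_measurable N"
proof -
  have "(\<lambda>w. case_prod K (f w, g w)) \<in> borel_measurable N"
    using assms by (intro measurable_compose[OF measurable_Pair]) (auto simp: bker_def)
  then show ?thesis by simp
qed

lemma bfun_const[simp]: "bfun (\<lambda>x. c)" by (auto simp: bfun_def)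
lemma bfun_mult: assumes "bfun f" "bfun g" shows "bfun (\<lambda>x. f x * g x)"
proof -
  obtain A where A: "0 \<le> A" "\<And>x. \<bar>f x\<bar> \<le> A" using bfun_bound assms(1) by metis
  obtain B where B: "0 \<le> B" "\<And>x. \<bar>g x\<bar> \<le> B" using bfun_bound assms(2) by metis
  have "\<bar>f x * g x\<bar> \<le> A * B" for x using A B by (auto simp: abs_mult intro!: mult_mono)
  then show ?thesis using assms by (intro bfunI[of _ "A * B"]) (auto simp: bfun_def)
qed
lemma bfun_add: assumes "bfun f" "bfun g" shows "bfun (\<lambda>x. f x + g x)"
proof -
  obtain A where A: "0 \<le> A" "\<And>x. \<bar>f x\<bar> \<le> A" using bfun_bound assms(1) by metis
  obtain B where B: "0 \<le> B" "\<And>x. \<bar>g x\<bar> \<le> B" using bfun_bound assms(2) by metis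
  have "\<bar>f x + g x\<bar> \<le> A + B" for x using A(2)[of x] B(2)[of x] by linarith
  then show ?thesis using assms by (intro bfunI[of _ "A + B"]) (auto simp: bfun_def)
qed
lemma bfun_cmult: "bfun f \<Longrightarrow> bfun (\<lambda>x. c * f x)" by (intro bfun_mult) auto
lemma bfun_abs: "bfun f \<Longrightarrow> bfun (\<lambda>x. \<bar>f x\<bar>)" by (auto simp: bfun_def)
lemma bfun_power2: "bfun f \<Longrightarrow> bfun (\<lambda>x. (f x)\<^sup>2)" by (simp add: power2_eq_square bfun_mult)
lemma bfun_sum: "(\<And>i. i \<in> I \<Longrightarrow> bfun (f i)) \<Longrightarrow> bfun (\<lambda>x. \<Sum>i\<in>I. f i x)"
  by (induction I rule: infinite_finite_induct) (auto intro: bfun_add)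

lemma bker_const[simp]: "bker (\<lambda>x y. c)" by (auto simp: bker_def)
lemma bker_mult: assumes "bker f" "bker g" shows "bker (\<lambda>x y. f x y * g x y)"
proof -
  obtain A where A: "0 \<le> A" "\<And>x y. \<bar>f x y\<bar> \<le> A" using bker_bound assms(1) by metis
  obtain B where B: "0 \<le> B" "\<And>x y. \<bar>g x y\<bar> \<le> B" using bker_bound assms(2) by metis
  have "\<bar>f x y * g x y\<bar> \<le> A * B" for x y using A B by (auto simp: abs_mult intro!: mult_mono)
  then show ?thesis using assms by (intro bkerI[of _ "A * B"]) (auto simp: bker_def split_beta')
qed
lemma bker_add: assumes "bker f" "bker g" shows "bker (\<lambda>x y. f x y + g x y)"
proof -
  obtain A where A: "0 \<le> A" "\<And>x y. \<bar>f x y\<bar> \<le> A" using bker_bound assms(1) by metis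
  obtain B where B: "0 \<le> B" "\<And>x y. \<bar>g x y\<bar> \<le> B" using bker_bound assms(2) by metis
  have "\<bar>f x y + g x y\<bar> \<le> A + B" for x y using A(2)[of x y] B(2)[of x y] by linarith
  then show ?thesis using assms by (intro bkerI[of _ "A + B"]) (auto simp: bker_def split_beta')
qed
lemma bker_cmult: "bker f \<Longrightarrow> bker (\<lambda>x y. c * f x y)" by (intro bker_mult) auto
lemma bker_diff: assumes "bker f" "bker g" shows "bker (\<lambda>x y. f x y - g x y)"
  using bker_add[OF assms(1) bker_cmult[OF assms(2), of "-1"]] by simp
lemma bker_divide: "bker f \<Longrightarrow> bker (\<lambda>x y. f x y / c)" using bker_cmult[of f "1/c"] by simp
lemma bker_abs: "bker f \<Longrightarrow> bker (\<lambda>x y. \<bar>f x y\<bar>)" by (auto simp: bker_def split_beta')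
lemma bker_sum: "(\<And>i. i \<in> I \<Longrightarrow> bker (f i)) \<Longrightarrow> bker (\<lambda>x y. \<Sum>i\<in>I. f i x y)"
  by (induction I rule: infinite_finite_induct) (auto intro: bker_add)
lemma bker_swap: assumes "bker K" shows "bker (\<lambda>x y. K y x)"
proof -
  obtain B where "0 \<le> B" "\<And>x y. \<bar>K x y\<bar> \<le> B" using bker_bound[OF assms] by metis
  then show ?thesis using assms
    by (intro bkerI[of _ B]) (simp_all add: split_beta' bker_measurable_compose)
qed
lemma bker_row: assumes "bker K" shows "bfun (\<lambda>y. K x y)"
proof -
  obtain B where "0 \<le> B" "\<And>x y. \<bar>K x y\<bar> \<le> B" using bker_bound[OF assms] by metis
  then show ?thesis using assms
    by (intro bfunI[of _ B] bker_measurable_compose[OF assms]) simp_all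
qed
lemma bker_col: "bker K \<Longrightarrow> bfun (\<lambda>x. K x y)"
  by (rule bker_row[OF bker_swap])
lemma bker_diag: assumes "bker K" shows "bfun (\<lambda>x. K x x)"
proof -
  obtain B where "0 \<le> B" "\<And>x y. \<bar>K x y\<bar> \<le> B" using bker_bound[OF assms] by metis
  then show ?thesis using assms
    by (intro bfunI[of _ B] bker_measurable_compose[OF assms]) simp_all
qed
lemma bker_fst: "bfun f \<Longrightarrow> bker (\<lambda>x y. f x)"
  unfolding bfun_def bker_def split_beta' by auto
lemma bker_snd: "bfun f \<Longrightarrow> bker (\<lambda>x y. f y)"
  unfolding bfun_def bker_def split_beta' by auto

lemma bfun_integrable: assumes "bfun f" shows "integrable M f"
proof -
  obtain A where A: "0 \<le> A" "\<And>x. \<bar>f x\<bar> \<le> A" using bfun_bound assms(1) by metis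
  show ?thesis using A assms by (intro integrable_const_bound[of _ A]) (auto simp: bfun_def)
qed
lemma bker_integrable: assumes "bker f" shows "integrable (M \<Otimes>\<^sub>M M) (case_prod f)"
proof -
  obtain A where A: "0 \<le> A" "\<And>x y. \<bar>f x y\<bar> \<le> A" using bker_bound assms(1) by metis
  show ?thesis using A assms by (intro MM.integrable_const_bound[of _ A]) (auto simp: bker_def)
qed

lemma integral_abs_le: assumes "bfun f" "\<And>x. \<bar>f x\<bar> \<le> B" shows "\<bar>\<integral>x. f x \<partial>M\<bar> \<le> B"
proof -
  have "\<bar>\<integral>x. f x \<partial>M\<bar> \<le> (\<integral>x. \<bar>f x\<bar> \<partial>M)" by (rule integral_abs_bound)
  also have "\<dots> \<le> (\<integral>x. B \<partial>M)"
    using assms by (intro integral_mono bfun_integrable bfun_abs) auto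
  finally show ?thesis using prob_space by simp
qed

lemma bfun_integral: assumes "bker K" shows "bfun (\<lambda>x. \<integral>y. K x y \<partial>M)"
proof -
  obtain A where A: "0 \<le> A" "\<And>x y. \<bar>K x y\<bar> \<le> A" using bker_bound assms(1) by metis
  show ?thesis
  proof (rule bfunI[of _ A])
    show "(\<lambda>x. \<integral>y. K x y \<partial>M) \<in> borel_measurable M"
      using assms by (intro borel_measurable_lebesgue_integral) (auto simp: bker_def)
    show "\<bar>\<integral>y. K x y \<partial>M\<bar> \<le> A" for x using A by (intro integral_abs_le bker_row assms) auto
  qed
qed
lemma bfun_integral': "bker K \<Longrightarrow> bfun (\<lambda>y. \<integral>x. K x y \<partial>M)"
  using bfun_integral[OF bker_swap] .

lemma integral_swap: "bker K \<Longrightarrow> (\<integral>x. \<integral>y. K x y \<partial>M \<partial>M) = (\<integral>y. \<integral>x. K x y \<partial>M \<partial>M)"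
  using MM.Fubini_integral[OF bker_integrable] by simp

lemma bfun_app: "bker K \<Longrightarrow> bfun f \<Longrightarrow> bfun (app K f)"
  unfolding app_def using bfun_integral[OF bker_mult[OF _ bker_snd]] .

text \<open>
  The composition is bounded by the product of the bounds because the total mass is \<open>1\<close>.
\<close>

lemma bker_kcomp: assumes "bker K" "bker L" shows "bker (kcomp K L)"
proof -
  obtain A where A: "0 \<le> A" "\<And>x y. \<bar>K x y\<bar> \<le> A" using bker_bound assms(1) by metis
  obtain B where B: "0 \<le> B" "\<And>x y. \<bar>L x y\<bar> \<le> B" using bker_bound assms(2) by metis
  show ?thesis
  proof (rule bkerI[of _ "A * B"])
    have [measurable]: "(\<lambda>p. K (fst (fst p)) (snd p)) \<in> borel_measurable ((M \<Otimes>\<^sub>M M) \<Otimes>\<^sub>M M)"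
      using assms by (intro bker_measurable_compose) auto
    have [measurable]: "(\<lambda>p. L (snd p) (snd (fst p))) \<in> borel_measurable ((M \<Otimes>\<^sub>M M) \<Otimes>\<^sub>M M)"
      using assms by (intro bker_measurable_compose) auto
    have "(\<lambda>p. \<integral>z. K (fst p) z * L z (snd p) \<partial>M) \<in> borel_measurable (M \<Otimes>\<^sub>M M)"
      by (intro borel_measurable_lebesgue_integral) (simp add: split_beta')
    then show "case_prod (kcomp K L) \<in> borel_measurable (M \<Otimes>\<^sub>M M)"
      by (simp add: split_beta' kcomp_def)
    have "\<bar>K x z * L z y\<bar> \<le> A * B" for x y z using A B by (auto simp: abs_mult intro!: mult_mono)
    then show "\<bar>kcomp K L x y\<bar> \<le> A * B" for x y
      unfolding kcomp_def using assms by (intro integral_abs_le bfun_mult bker_row bker_col) auto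
  qed
qed

lemma bker_kpow: "bker K \<Longrightarrow> bker (kpow K n)"
  by (induction n) (auto intro: bker_kcomp)

lemmas bk_intros = bker_mult bker_add bker_cmult bker_diff bker_divide bker_abs bker_sum
  bker_fst bker_snd bker_kcomp bker_kpow bfun_mult bfun_add bfun_cmult
  bfun_abs bfun_power2 bfun_sum bfun_integral bfun_integral' bfun_app

lemma app_kcomp: assumes "bker K" "bker L" "bfun f" shows "app (kcomp K L) f x = app K (app L f) x"
proof -
  have b: "bker (\<lambda>y z. K x z * L z y * f y)"
    by (intro bker_mult bker_snd[OF bker_row[OF assms(1)]] bker_swap[OF assms(2)] bker_fst[OF assms(3)])
  have "app (kcomp K L) f x = (\<integral>y. (\<integral>z. K x z * L z y * f y \<partial>M) \<partial>M)"
    unfolding app_def kcomp_def by simp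
  also have "\<dots> = (\<integral>z. (\<integral>y. K x z * L z y * f y \<partial>M) \<partial>M)" by (rule integral_swap[OF b])
  also have "\<dots> = app K (app L f) x" unfolding app_def by (simp add: mult.assoc)
  finally show ?thesis .
qed

lemma kcomp_eq_app: "kcomp K L x y = app K (\<lambda>z. L z y) x"
  by (simp add: kcomp_def app_def)

lemma kcomp_assoc: assumes "bker K" "bker L" "bker N"
  shows "kcomp (kcomp K L) N = kcomp K (kcomp L N)"
proof (intro ext)
  fix x y
  have "kcomp (kcomp K L) N x y = app K (app L (\<lambda>z. N z y)) x"
    unfolding kcomp_eq_app[of "kcomp K L"] by (intro app_kcomp assms bker_col)
  also have "\<dots> = kcomp K (kcomp L N) x y" by (simp add: app_def kcomp_def)
  finally show "kcomp (kcomp K L) N x y = kcomp K (kcomp L N) x y" .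
qed

lemma kpow_add: assumes "bker K" shows "kcomp (kpow K m) (kpow K n) = kpow K (Suc (m + n))"
proof (induction m)
  case (Suc m)
  have "kcomp (kpow K (Suc m)) (kpow K n) = kcomp K (kcomp (kpow K m) (kpow K n))"
    by (simp add: kcomp_assoc assms bker_kpow)
  then show ?case using Suc by simp
qed simp

lemma kcomp_swap: "ksym K \<Longrightarrow> ksym L \<Longrightarrow> kcomp K L y x = kcomp L K x y"
  unfolding kcomp_def ksym_def by (auto simp: mult.commute intro!: Bochner_Integration.integral_cong)

lemma ksym_kpow: assumes "bker K" "ksym K" shows "ksym (kpow K n)"
proof (induction n)
  case (Suc n)
  have "kcomp K (kpow K n) = kcomp (kpow K n) K"
    using kpow_add[OF assms(1), of 0 n] kpow_add[OF assms(1), of n 0] by simp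
  then show ?case using kcomp_swap[OF assms(2) Suc] unfolding ksym_def by (metis kpow.simps(2))
qed (use assms in simp)

lemma hs_eq_ktr: "ksym L \<Longrightarrow> hs K L = ktr (kcomp K L)"
  unfolding hs_def dint_def ktr_def kcomp_def ksym_def by (intro Bochner_Integration.integral_cong) auto

lemma hs_kpow: "bker K \<Longrightarrow> ksym K \<Longrightarrow> hs (kpow K m) (kpow K n) = ktr (kpow K (Suc (m + n)))"
  by (simp add: hs_eq_ktr[OF ksym_kpow] kpow_add)

lemma dint_add: assumes "bker K" "bker L" shows "dint (\<lambda>x y. K x y + L x y) = dint K + dint L"
proof -
  have "(\<integral>y. K x y + L x y \<partial>M) = (\<integral>y. K x y \<partial>M) + (\<integral>y. L x y \<partial>M)" for x
    by (intro Bochner_Integration.integral_add bfun_integrable bker_row assms)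
  then show ?thesis unfolding dint_def
    by (simp add: bfun_integrable bfun_integral assms)
qed
lemma dint_cmult: "dint (\<lambda>x y. c * K x y) = c * dint K"
  unfolding dint_def by simp
lemma dint_diff: assumes "bker K" "bker L" shows "dint (\<lambda>x y. K x y - L x y) = dint K - dint L"
  using dint_add[OF assms(1) bker_cmult[OF assms(2), of "-1"]] dint_cmult[of "-1" L] by simp
lemma dint_mono: assumes "bker K" "bker L" "\<And>x y. K x y \<le> L x y" shows "dint K \<le> dint L"
  unfolding dint_def
  by (intro integral_mono bfun_integrable bker_row bfun_integral assms)
lemma dint_nonneg: "(\<And>x y. 0 \<le> K x y) \<Longrightarrow> 0 \<le> dint K"
  unfolding dint_def by (intro integral_nonneg_AE) (auto intro!: AE_I2 integral_nonneg_AE)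

lemma ip_cauchy_schwarz: assumes "bfun f" "bfun g" shows "(ip f g)\<^sup>2 \<le> ip f f * ip g g"
proof (rule discriminant_nonpos)
  fix t
  have i: "integrable M (\<lambda>x. f x * f x)" "integrable M (\<lambda>x. f x * g x)" "integrable M (\<lambda>x. g x * g x)"
    using assms by (auto intro!: bfun_integrable bk_intros)
  have "0 \<le> (\<integral>x. (t * f x - g x)\<^sup>2 \<partial>M)" by simp
  also have "(\<integral>x. (t * f x - g x)\<^sup>2 \<partial>M)
    = (\<integral>x. t\<^sup>2 * (f x * f x) - (2 * t) * (f x * g x) + g x * g x \<partial>M)"
    by (intro Bochner_Integration.integral_cong) (auto simp: power2_eq_square algebra_simps)
  also have "\<dots> = t\<^sup>2 * ip f f - 2 * t * ip f g + ip g g"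
    unfolding ip_def using i by simp
  finally show "0 \<le> ip f f * t\<^sup>2 - 2 * ip f g * t + ip g g" by (simp add: algebra_simps)
qed

lemma hs_cauchy_schwarz: assumes "bker f" "bker g" shows "(hs f g)\<^sup>2 \<le> hs f f * hs g g"
proof (rule discriminant_nonpos)
  fix t
  have i: "bker (\<lambda>x y. f x y * f x y)" "bker (\<lambda>x y. f x y * g x y)" "bker (\<lambda>x y. g x y * g x y)"
    using assms by (auto intro!: bk_intros)
  have "0 \<le> dint (\<lambda>x y. (t * f x y - g x y)\<^sup>2)" by (intro dint_nonneg) auto
  also have "(\<lambda>x y. (t * f x y - g x y)\<^sup>2)
    = (\<lambda>x y. t\<^sup>2 * (f x y * f x y) - (2 * t) * (f x y * g x y) + g x y * g x y)"
    by (intro ext) (auto simp: power2_eq_square algebra_simps)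
  also have "dint \<dots> = t\<^sup>2 * hs f f - 2 * t * hs f g + hs g g"
    unfolding hs_def
    using dint_add[OF bker_diff[OF bker_cmult[OF i(1), of "t\<^sup>2"] bker_cmult[OF i(2), of "2 * t"]] i(3)]
      dint_diff[OF bker_cmult[OF i(1), of "t\<^sup>2"] bker_cmult[OF i(2), of "2 * t"]]
    by (simp add: dint_cmult)
  finally show "0 \<le> hs f f * t\<^sup>2 - 2 * hs f g * t + hs g g" by (simp add: algebra_simps)
qed

lemma hs_nonneg: "0 \<le> hs K K" unfolding hs_def by (intro dint_nonneg) auto
lemma ip_nonneg: "0 \<le> ip f f" unfolding ip_def by simp

text \<open>
  The Hilbert--Schmidt norm is submultiplicative: Cauchy--Schwarz for each entry of the composition.
\<close>

lemma hs_kcomp_le: assumes "bker K" "bker L" shows "hs (kcomp K L) (kcomp K L) \<le> hs K K * hs L L"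
proof -
  define a where "a x = (\<integral>z. K x z * K x z \<partial>M)" for x
  define b where "b y = (\<integral>z. L z y * L z y \<partial>M)" for y
  have ab: "bfun a" "bfun b" unfolding a_def b_def
    by (rule bfun_integral[OF bker_mult[OF assms(1) assms(1)]],
        rule bfun_integral'[OF bker_mult[OF assms(2) assms(2)]])
  have "hs (kcomp K L) (kcomp K L) \<le> dint (\<lambda>x y. a x * b y)"
    unfolding hs_def
  proof (intro dint_mono)
    show "kcomp K L x y * kcomp K L x y \<le> a x * b y" for x y
      using ip_cauchy_schwarz[OF bker_row[OF assms(1)] bker_col[OF assms(2)], of x y]
      unfolding kcomp_def a_def b_def ip_def by (simp add: power2_eq_square)
    qed (intro bker_mult bker_kcomp bker_fst bker_snd assms ab)+
  also have "\<dots> = (\<integral>x. a x \<partial>M) * (\<integral>y. b y \<partial>M)" unfolding dint_def by simp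
  also have "(\<integral>x. a x \<partial>M) = hs K K" unfolding hs_def a_def dint_def ..
  also have "(\<integral>x. b x \<partial>M) = hs L L" unfolding hs_def b_def dint_def
    by (rule integral_swap[symmetric, OF bker_mult[OF assms(2) assms(2)]])
  finally show ?thesis .
qed

lemma dint_abs_le: assumes "bker K" shows "dint (\<lambda>x y. \<bar>K x y\<bar>) \<le> sqrt (hs K K)"
proof (rule real_le_rsqrt)
  have "(hs (\<lambda>x y. \<bar>K x y\<bar>) (\<lambda>x y. 1))\<^sup>2 \<le> hs (\<lambda>x y. \<bar>K x y\<bar>) (\<lambda>x y. \<bar>K x y\<bar>) * hs (\<lambda>x y. 1) (\<lambda>x y. 1)"
    using assms by (intro hs_cauchy_schwarz bk_intros) auto
  then show "(dint (\<lambda>x y. \<bar>K x y\<bar>))\<^sup>2 \<le> hs K K"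
    using prob_space by (simp add: hs_def dint_def)
qed

end

section \<open>An eigenfunction by the power method\<close>

text \<open>
  The ratios \<open>s (m + 1) / s m\<close> increase by log-convexity and are bounded by submultiplicativity, and \<open>R\<close> is
  their limit. The normalised sequence \<open>u m = s m / R ^ (m + 1)\<close> decreases. It stays above \<open>1\<close>: dividing
  \<open>u (n + m + 1) \<le> u n * u m\<close> by \<open>u n\<close> and letting \<open>n\<close> tend to infinity gives \<open>1 \<le> u m\<close>.
\<close>

lemma log_convex_submult_growth:
  fixes s :: "nat \<Rightarrow> real"
  assumes nn: "\<And>m. 0 \<le> s m" and pos1: "0 < s 1"
    and lc: "\<And>m. (s (Suc m))\<^sup>2 \<le> s m * s (m + 2)"
    and sm: "\<And>m n. s (Suc (m + n)) \<le> s m * s n"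
  obtains R c where "0 < R" "0 < c" "(\<lambda>m. s m / R ^ Suc m) \<longlonglongrightarrow> c" "s 1 \<le> R * s 0"
    "\<And>m. s m / R ^ Suc m \<le> s 0 / R"
proof -
  have pos: "0 < s m" for m
  proof -
    have "0 < s m \<and> 0 < s (Suc m)"
    proof (induction m)
      case 0
      have "0 < (s (Suc 0))\<^sup>2" using pos1 by simp
      then have "0 < s 0 * s (0 + 2)" using lc[of 0] by linarith
      then have "s 0 \<noteq> 0" by auto
      then have "0 < s 0" using nn[of 0] by linarith
      then show ?case using pos1 by simp
    next
      case (Suc m)
      have "0 < s m * s (m + 2)" using order_less_le_trans[OF zero_less_power[of "s (Suc m)" 2] lc[of m]] Suc by simp
      then have "s (m + 2) \<noteq> 0" by auto
      then have "0 < s (m + 2)" using nn[of "m + 2"] by linarith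
      then show ?case using Suc by simp
    qed
    then show ?thesis by simp
  qed
  define r where "r m = s (Suc m) / s m" for m
  have r_pos: "0 < r m" for m unfolding r_def using pos by simp
  have inc: "incseq r"
  proof (rule incseq_SucI)
    show "r m \<le> r (Suc m)" for m
      using lc[of m] pos[of m] pos[of "Suc m"] unfolding r_def
      by (simp add: field_simps power2_eq_square)
  qed
  have rb: "r m \<le> s 0" for m
    using sm[of m 0] pos[of m] unfolding r_def by (simp add: field_simps)
  obtain R where R: "r \<longlonglongrightarrow> R" "\<And>m. r m \<le> R"
    using incseq_convergent[OF inc, of "s 0"] rb by metis
  have Rp: "0 < R" using R(2)[of 0] r_pos[of 0] by linarith
  define u where "u m = s m / R ^ Suc m" for m
  have u_pos: "0 < u m" for m unfolding u_def using pos Rp by simp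
  have u_Suc: "u (Suc m) = u m * (r m / R)" for m
    unfolding u_def r_def using pos[of m] Rp by (simp add: field_simps)
  have u_dec: "u (Suc m) \<le> u m" for m
    unfolding u_Suc using u_pos[of m] R(2)[of m] Rp by (simp add: field_simps)
  have dec: "decseq u" by (rule decseq_SucI) (rule u_dec)
  have u_sub: "u (Suc (m + n)) \<le> u m * u n" for m n
  proof -
    have "u (Suc (m + n)) \<le> (s m * s n) / R ^ Suc (Suc (m + n))"
      unfolding u_def using sm[of m n] Rp by (intro divide_right_mono) auto
    also have "\<dots> = u m * u n" unfolding u_def by (simp add: power_add)
    finally show ?thesis .
  qed
  have ratio: "(\<lambda>n. u (n + k) / u n) \<longlonglongrightarrow> 1" for k
  proof (induction k)
    case 0
    have "(\<lambda>n. u (n + 0) / u n) = (\<lambda>n. 1)" using u_pos by (auto simp: less_le)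
    then show ?case by simp
  next
    case (Suc k)
    have "(\<lambda>n. r (n + k) / R) \<longlonglongrightarrow> R / R"
      using Rp by (intro tendsto_divide LIMSEQ_ignore_initial_segment[OF R(1)] tendsto_const) auto
    then have "(\<lambda>n. r (n + k) / R * (u (n + k) / u n)) \<longlonglongrightarrow> R / R * 1"
      by (intro tendsto_mult Suc)
    moreover have "r (n + k) / R * (u (n + k) / u n) = u (n + Suc k) / u n" for n
      using u_Suc[of "n + k"] by (simp add: mult.commute)
    ultimately show ?case using Rp by simp
  qed
  have u_ge: "1 \<le> u m" for m
  proof (rule LIMSEQ_le_const2[OF ratio[of "Suc m"]])
    have "u (n + Suc m) / u n \<le> u m" for n
      using u_sub[of n m] u_pos[of n] by (simp add: field_simps)
    then show "\<exists>N. \<forall>n\<ge>N. u (n + Suc m) / u n \<le> u m" by auto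
  qed
  obtain c where c: "u \<longlonglongrightarrow> c" "\<And>i. c \<le> u i"
    using decseq_convergent[OF dec, of 1] u_ge by auto
  have "1 \<le> c" by (rule LIMSEQ_le_const[OF c(1)]) (use u_ge in auto)
  show thesis
  proof (rule that[of R c])
    show "s 1 \<le> R * s 0" using R(2)[of 0] pos[of 0] unfolding r_def by (simp add: field_simps)
    show "s m / R ^ Suc m \<le> s 0 / R" for m
      using decseqD[OF dec, of 0 m] unfolding u_def by simp
    show "(\<lambda>m. s m / R ^ Suc m) \<longlonglongrightarrow> c" using c(1) unfolding u_def[abs_def] .
  qed (use Rp \<open>1 \<le> c\<close> in auto)
qed

context kernel_space begin

lemma app_abs_le:
  assumes "bker K" "\<And>x y. \<bar>K x y\<bar> \<le> B" "bfun f"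
  shows "\<bar>app K f x\<bar> \<le> B * (\<integral>y. \<bar>f y\<bar> \<partial>M)"
proof -
  have "\<bar>app K f x\<bar> \<le> (\<integral>y. \<bar>K x y * f y\<bar> \<partial>M)" unfolding app_def by (rule integral_abs_bound)
  also have "\<dots> \<le> (\<integral>y. B * \<bar>f y\<bar> \<partial>M)"
  proof (intro integral_mono bfun_integrable)
    show "\<bar>K x y * f y\<bar> \<le> B * \<bar>f y\<bar>" for y
      using mult_right_mono[OF assms(2)[of x y], of "\<bar>f y\<bar>"] by (simp add: abs_mult)
  qed (intro bfun_abs bfun_cmult bfun_mult bker_row[OF assms(1)] assms(3))+
  finally show ?thesis by simp
qed

text \<open>
  Composing with a bounded kernel on both sides turns smallness in the Hilbert--Schmidt norm into uniform
  smallness.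
\<close>

lemma kcomp_sandwich_le:
  assumes "bker K" "\<And>x y. \<bar>K x y\<bar> \<le> B" "bker D"
  shows "\<bar>kcomp K (kcomp D K) x y\<bar> \<le> B\<^sup>2 * sqrt (hs D D)"
proof -
  have B0: "0 \<le> B" using assms(2)[of undefined undefined] by linarith
  have c: "bfun (\<lambda>u. \<integral>v. \<bar>D u v\<bar> \<partial>M)" by (intro bfun_integral bker_abs assms)
  have "\<bar>kcomp K (kcomp D K) x y\<bar> \<le> B * (\<integral>u. \<bar>kcomp D K u y\<bar> \<partial>M)"
    unfolding kcomp_eq_app[of K]
    by (intro app_abs_le assms bker_col[OF bker_kcomp])
  also have "\<dots> \<le> B * (\<integral>u. B * (\<integral>v. \<bar>D u v\<bar> \<partial>M) \<partial>M)"
  proof (intro mult_left_mono integral_mono bfun_integrable bfun_abs bker_col[OF bker_kcomp] assms bfun_cmult c B0)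
    fix u
    have "\<bar>kcomp D K u y\<bar> \<le> (\<integral>v. \<bar>D u v * K v y\<bar> \<partial>M)" unfolding kcomp_def by (rule integral_abs_bound)
    also have "\<dots> \<le> (\<integral>v. B * \<bar>D u v\<bar> \<partial>M)"
    proof (intro integral_mono bfun_integrable)
      show "\<bar>D u v * K v y\<bar> \<le> B * \<bar>D u v\<bar>" for v
        using mult_right_mono[OF assms(2)[of v y], of "\<bar>D u v\<bar>"] by (simp add: abs_mult mult.commute)
    qed (intro bfun_abs bfun_cmult bfun_mult bker_row[OF assms(3)] bker_col[OF assms(1)])+
    finally show "\<bar>kcomp D K u y\<bar> \<le> B * (\<integral>v. \<bar>D u v\<bar> \<partial>M)" by simp
  qed
  also have "\<dots> = B\<^sup>2 * dint (\<lambda>x y. \<bar>D x y\<bar>)" unfolding dint_def by (simp add: power2_eq_square)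
  also have "\<dots> \<le> B\<^sup>2 * sqrt (hs D D)" by (intro mult_left_mono dint_abs_le assms) auto
  finally show ?thesis .
qed

lemma integral_tendsto_bounded:
  assumes "\<And>m. bfun (f m)" "\<And>x. (\<lambda>m. f m x) \<longlonglongrightarrow> g x" "\<And>m x. \<bar>f m x\<bar> \<le> C"
  shows "(\<lambda>m. \<integral>x. f m x \<partial>M) \<longlonglongrightarrow> (\<integral>x. g x \<partial>M)"
proof (rule integral_dominated_convergence[where w="\<lambda>_. C"])
  show mf: "f m \<in> borel_measurable M" for m by (rule bfun_measurable[OF assms(1)])
  show "g \<in> borel_measurable M" by (rule borel_measurable_LIMSEQ_real[OF assms(2) mf])
  show "integrable M (\<lambda>_. C)" by simp
  show "AE x in M. (\<lambda>m. f m x) \<longlonglongrightarrow> g x" by (rule AE_I2) (rule assms(2))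
  show "AE x in M. norm (f m x) \<le> C" for m by (rule AE_I2) (simp add: assms(3))
qed

lemma bker_limit:
  assumes "\<And>m. bker (V m)" "\<And>x y. (\<lambda>m. V m x y) \<longlonglongrightarrow> P x y" "\<And>m x y. \<bar>V m x y\<bar> \<le> C"
  shows "bker P"
proof (rule bkerI[of _ C])
  show "case_prod P \<in> borel_measurable (M \<Otimes>\<^sub>M M)"
  proof (rule borel_measurable_LIMSEQ_real)
    show "case_prod (V m) \<in> borel_measurable (M \<Otimes>\<^sub>M M)" for m using assms(1)[of m] by (simp add: bker_def)
    show "(\<lambda>m. case_prod (V m) p) \<longlonglongrightarrow> case_prod P p" for p by (cases p) (simp add: assms(2))
  qed
  show "\<bar>P x y\<bar> \<le> C" for x y
    by (rule LIMSEQ_le_const2[OF tendsto_rabs[OF assms(2)]]) (use assms(3) in blast)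
qed

lemma kcomp_tendsto:
  assumes "bker K" "\<And>m. bker (V m)" "\<And>x y. (\<lambda>m. V m x y) \<longlonglongrightarrow> P x y" "\<And>m x y. \<bar>V m x y\<bar> \<le> C"
  shows "(\<lambda>m. kcomp K (V m) x y) \<longlonglongrightarrow> kcomp K P x y"
proof -
  obtain A where A: "0 \<le> A" "\<And>x y. \<bar>K x y\<bar> \<le> A" using bker_bound assms(1) by metis
  have "\<bar>K x z * V m z y\<bar> \<le> A * C" for m z
    by (simp only: abs_mult) (intro mult_mono' assms A abs_ge_zero)
  then show ?thesis unfolding kcomp_def
    by (intro integral_tendsto_bounded[where C="A*C"] bfun_mult bker_row[OF assms(1)] bker_col[OF assms(2)] tendsto_mult tendsto_const assms)
qed

lemma hs_tendsto:
  assumes "\<And>m. bker (V m)" "\<And>x y. (\<lambda>m. V m x y) \<longlonglongrightarrow> P x y" "\<And>m x y. \<bar>V m x y\<bar> \<le> C"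
  shows "(\<lambda>m. hs (V m) (V m)) \<longlonglongrightarrow> hs P P"
proof -
  have b: "\<bar>V m x y * V m x y\<bar> \<le> C * C" for m x y
    by (simp only: abs_mult) (intro mult_mono' assms abs_ge_zero)
  have r: "bker (\<lambda>x y. V m x y * V m x y)" for m by (intro bker_mult assms)
  show ?thesis unfolding hs_def dint_def
  proof (intro integral_tendsto_bounded[where C="C*C"])
    show "bfun (\<lambda>x. \<integral>y. V m x y * V m x y \<partial>M)" for m by (rule bfun_integral[OF r])
    show "bfun (\<lambda>y. V m x y * V m x y)" for m x by (rule bker_row[OF r])
    show "\<bar>\<integral>y. V m x y * V m x y \<partial>M\<bar> \<le> C * C" for m x
      by (intro integral_abs_le bker_row[OF r] b)
  qed (intro tendsto_mult assms b)+
qed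

lemma hs_diff: assumes "bker K" "bker L" shows "hs (\<lambda>x y. K x y - L x y) (\<lambda>x y. K x y - L x y) = hs K K - 2 * hs K L + hs L L"
proof -
  have i: "bker (\<lambda>x y. K x y * K x y)" "bker (\<lambda>x y. K x y * L x y)" "bker (\<lambda>x y. L x y * L x y)"
    using assms by (auto intro!: bker_mult)
  have e: "(\<lambda>x y. (K x y - L x y) * (K x y - L x y)) =
    (\<lambda>x y. K x y * K x y - 2 * (K x y * L x y) + L x y * L x y)"
    by (intro ext) (simp add: algebra_simps)
  show ?thesis unfolding hs_def e
    using dint_add[OF bker_diff[OF i(1) bker_cmult[OF i(2), of 2]] i(3)]
      dint_diff[OF i(1) bker_cmult[OF i(2), of 2]] by (simp add: dint_cmult)
qed

lemma hs_cmult: "hs (\<lambda>x y. c * K x y) (\<lambda>x y. d * L x y) = c * d * hs K L"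
  unfolding hs_def by (subst dint_cmult[symmetric]) (simp add: mult_ac)

lemma kcomp_cmult_right: "kcomp K (\<lambda>x y. c * L x y) = (\<lambda>x y. c * kcomp K L x y)"
  unfolding kcomp_def[abs_def] by (simp add: mult.left_commute)
lemma kcomp_cmult_left: "kcomp (\<lambda>x y. c * K x y) L = (\<lambda>x y. c * kcomp K L x y)"
  unfolding kcomp_def[abs_def] by (simp add: mult.assoc)
lemma kcomp_diff_left: assumes "bker K" "bker L" "bker N" shows
  "kcomp (\<lambda>x y. K x y - L x y) N x y = kcomp K N x y - kcomp L N x y"
  unfolding kcomp_def left_diff_distrib
  by (intro Bochner_Integration.integral_diff bfun_integrable bfun_mult bker_row[OF assms(1)] bker_row[OF assms(2)] bker_col[OF assms(3)])
lemma kcomp_diff_right: assumes "bker K" "bker L" "bker N" shows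
  "kcomp N (\<lambda>x y. K x y - L x y) x y = kcomp N K x y - kcomp N L x y"
  unfolding kcomp_def right_diff_distrib
  by (intro Bochner_Integration.integral_diff bfun_integrable bfun_mult bker_row[OF assms(3)] bker_col[OF assms(2)] bker_col[OF assms(1)])

lemma app_cmult: "app K (\<lambda>x. c * f x) x = c * app K f x"
  unfolding app_def by (simp add: mult.left_commute)
lemma app_add: assumes "bker K" "bfun f" "bfun g" shows "app K (\<lambda>x. f x + g x) x = app K f x + app K g x"
  unfolding app_def distrib_left
  by (intro Bochner_Integration.integral_add bfun_integrable bfun_mult bker_row[OF assms(1)] assms)

lemma ip_zero_AE: assumes "bfun h" "ip h h = 0" shows "AE x in M. h x = 0"
proof -
  have "AE x in M. h x * h x = 0"
    using assms unfolding ip_def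
    by (subst integral_nonneg_eq_0_iff_AE[symmetric]) (auto intro!: bfun_integrable bfun_mult)
  then show ?thesis by simp
qed

lemma app_cong_AE: assumes "bker K" "bfun f" "bfun g" "AE x in M. f x = g x" shows "app K f x = app K g x"
  unfolding app_def
  by (intro integral_cong_AE bfun_measurable bfun_mult bker_row[OF assms(1)] assms) (use assms(4) in auto)

text \<open>
  The squared Hilbert--Schmidt norms \<open>s m\<close> of the powers of \<open>K\<close> are the traces of its even powers. They are
  log-convex by Cauchy--Schwarz and submultiplicative, so they grow like \<open>c * R ^ (m + 1)\<close> with \<open>c > 0\<close>.
  Hence the even powers divided by \<open>R ^ (m + 1)\<close> form a Cauchy sequence in the Hilbert--Schmidt norm, and
  \<open>kcomp_sandwich_le\<close> makes the convergence uniform. In operator terms the limit is the orthogonal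
  projection onto the eigenvectors with eigenvalue \<open>\<plusminus> sqrt R\<close>.
\<close>

lemma top_projection:
  assumes K: "bker K" "ksym K" and pos: "0 < hs (kpow K 1) (kpow K 1)"
  obtains R P where "0 < R" "bker P" "0 < hs P P" "\<And>x y. kcomp K (kcomp K P) x y = R * P x y"
    "hs (kpow K 1) (kpow K 1) \<le> R * hs K K"
proof -
  define s where "s m = hs (kpow K m) (kpow K m)" for m
  have s_tr: "s m = ktr (kpow K (Suc (2 * m)))" for m
    unfolding s_def using hs_kpow[OF K] by (simp add: mult_2)
  have s_mix: "hs (kpow K (Suc (2 * m))) (kpow K (Suc (2 * n))) = s (Suc (m + n))" for m n
    unfolding s_tr by (simp add: hs_kpow[OF K] algebra_simps del: kpow.simps)
  have nn: "0 \<le> s m" for m unfolding s_def by (rule hs_nonneg)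
  have p1: "0 < s 1" using pos by (simp add: s_def)
  have lc: "(s (Suc m))\<^sup>2 \<le> s m * s (m + 2)" for m
  proof -
    have "hs (kpow K m) (kpow K (m + 2)) = s (Suc m)"
      unfolding s_tr hs_kpow[OF K] by (simp add: mult_2)
    then show ?thesis using hs_cauchy_schwarz[OF bker_kpow[OF K(1), of m] bker_kpow[OF K(1), of "m + 2"]]
      by (simp add: s_def)
  qed
  have sm: "s (Suc (m + n)) \<le> s m * s n" for m n
    using hs_kcomp_le[OF bker_kpow[OF K(1), of m] bker_kpow[OF K(1), of n]]
    unfolding kpow_add[OF K(1)] s_def .
  obtain R c where R: "0 < R" "0 < c" and lim: "(\<lambda>m. s m / R ^ Suc m) \<longlonglongrightarrow> c"
    and s1: "s 1 \<le> R * s 0" and sb: "\<And>m. s m / R ^ Suc m \<le> s 0 / R"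
    using log_convex_submult_growth[OF nn p1 lc sm] by blast
  \<comment> \<open>The even powers of \<open>K\<close>, normalised to have Hilbert--Schmidt products \<open>u\<close>.\<close>
  define u where "u m = s m / R ^ Suc m" for m
  define V where "V m x y = (1 / R ^ Suc m) * kpow K (Suc (2 * m)) x y" for m x y
  have bV: "bker (V m)" for m unfolding V_def by (intro bker_cmult bker_kpow K)
  have hsV: "hs (V m) (V n) = u (Suc (m + n))" for m n
    unfolding V_def hs_cmult s_mix u_def by (simp add: power_add)
  obtain B where B: "0 \<le> B" "\<And>x y. \<bar>K x y\<bar> \<le> B" using bker_bound K(1) by metis
  have V_Suc: "V (Suc m) x y = (1 / R) * kcomp K (kcomp (V m) K) x y" for m x y
  proof -
    have "kpow K (Suc (2 * Suc m)) = kcomp K (kcomp (kpow K (Suc (2 * m))) K)"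
      using kpow_add[OF K(1), of "Suc (2 * m)" 0] by (simp del: kpow.simps(2) add: kpow.simps(2)[of K "Suc (Suc (2 * m))"])
    then show ?thesis
      unfolding V_def[abs_def] kcomp_cmult_left kcomp_cmult_right by (simp del: kpow.simps)
  qed
  have V_Suc': "kcomp K (kcomp K (V m)) x y = R * V (Suc m) x y" for m x y
    using R unfolding V_def[abs_def] kcomp_cmult_right by simp
  have V_bound: "\<bar>V (Suc m) x y\<bar> \<le> (1 / R) * (B\<^sup>2 * sqrt (s 0 / R))" for m x y
  proof -
    have "\<bar>kcomp K (kcomp (V m) K) x y\<bar> \<le> B\<^sup>2 * sqrt (hs (V m) (V m))"
      by (intro kcomp_sandwich_le K B bV)
    also have "\<dots> \<le> B\<^sup>2 * sqrt (s 0 / R)"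
      unfolding hsV u_def by (intro mult_left_mono real_sqrt_le_mono sb) auto
    finally show ?thesis unfolding V_Suc using R by (simp add: abs_mult divide_right_mono)
  qed
  have V_diff: "\<bar>V (Suc m) x y - V (Suc n) x y\<bar>
      \<le> (B\<^sup>2 / R) * sqrt (\<bar>u (Suc (m + m)) - c\<bar> + 2 * \<bar>u (Suc (m + n)) - c\<bar> + \<bar>u (Suc (n + n)) - c\<bar>)" for m n x y
  proof -
    define D where "D x y = V m x y - V n x y" for x y
    have bD: "bker D" unfolding D_def by (intro bker_diff bV)
    have eq: "V (Suc m) x y - V (Suc n) x y = (1 / R) * kcomp K (kcomp D K) x y"
    proof -
      have "kcomp D K = (\<lambda>x y. kcomp (V m) K x y - kcomp (V n) K x y)"
        unfolding D_def by (intro ext kcomp_diff_left bV K)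
      then have "kcomp K (kcomp D K) x y = kcomp K (kcomp (V m) K) x y - kcomp K (kcomp (V n) K) x y"
        by (simp add: kcomp_diff_right bker_kcomp bV K)
      then show ?thesis unfolding V_Suc by (simp add: right_diff_distrib)
    qed
    have "\<bar>kcomp K (kcomp D K) x y\<bar> \<le> B\<^sup>2 * sqrt (hs D D)"
      by (intro kcomp_sandwich_le K B bD)
    moreover have "hs D D \<le> \<bar>u (Suc (m + m)) - c\<bar> + 2 * \<bar>u (Suc (m + n)) - c\<bar> + \<bar>u (Suc (n + n)) - c\<bar>"
    proof -
      have "a - 2 * b + d \<le> \<bar>a - c\<bar> + 2 * \<bar>b - c\<bar> + \<bar>d - c\<bar>" for a b d :: real
        using abs_ge_self[of "a - c"] abs_ge_minus_self[of "b - c"] abs_ge_self[of "d - c"]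
        by (simp add: algebra_simps)
      then show ?thesis unfolding D_def hs_diff[OF bV bV] hsV .
    qed
    ultimately have "\<bar>kcomp K (kcomp D K) x y\<bar> \<le> B\<^sup>2 * sqrt (\<bar>u (Suc (m + m)) - c\<bar> + 2 * \<bar>u (Suc (m + n)) - c\<bar> + \<bar>u (Suc (n + n)) - c\<bar>)"
      by (meson mult_left_mono real_sqrt_le_mono zero_le_power2 order_trans)
    then show ?thesis using R eq by (simp add: abs_mult divide_right_mono)
  qed
  have conv: "convergent (\<lambda>m. V (Suc m) x y)" for x y
  proof (rule Cauchy_convergent, rule CauchyI)
    fix e :: real assume e: "0 < e"
    define d where "d = (e / (B\<^sup>2 / R + 1))\<^sup>2 / 5"
    have bp: "0 < B\<^sup>2 / R + 1" using R by (intro add_nonneg_pos) auto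
    have d: "0 < d" unfolding d_def using e bp by (intro divide_pos_pos zero_less_power) auto
    obtain N where N: "\<And>n. n \<ge> N \<Longrightarrow> \<bar>u n - c\<bar> < d"
      using LIMSEQ_D[OF lim d] unfolding u_def real_norm_def by auto
    show "\<exists>N. \<forall>m\<ge>N. \<forall>n\<ge>N. norm (V (Suc m) x y - V (Suc n) x y) < e"
    proof (intro exI[of _ N] allI impI)
      fix m n assume mn: "N \<le> m" "N \<le> n"
      have "norm (V (Suc m) x y - V (Suc n) x y) \<le> (B\<^sup>2 / R) * sqrt (\<bar>u (Suc (m + m)) - c\<bar> + 2 * \<bar>u (Suc (m + n)) - c\<bar> + \<bar>u (Suc (n + n)) - c\<bar>)"
        using V_diff[of m x y n] by simp
      also have "\<dots> \<le> (B\<^sup>2 / R) * sqrt (5 * d)"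
        using N[of "Suc (m + m)"] N[of "Suc (m + n)"] N[of "Suc (n + n)"] mn R d
        by (intro mult_left_mono real_sqrt_le_mono) auto
      also have "sqrt (5 * d) = e / (B\<^sup>2 / R + 1)" unfolding d_def using e bp by simp
      also have "(B\<^sup>2 / R) * (e / (B\<^sup>2 / R + 1)) < e"
      proof -
        have "q * (e / (q + 1)) < e" if "0 < q + 1" for q :: real
          using e that by (simp add: field_simps)
        then show ?thesis using bp by blast
      qed
      finally show "norm (V (Suc m) x y - V (Suc n) x y) < e" .
    qed
  qed
  define P where "P x y = lim (\<lambda>m. V (Suc m) x y)" for x y
  have limP: "(\<lambda>m. V (Suc m) x y) \<longlonglongrightarrow> P x y" for x y
    unfolding P_def using conv convergent_LIMSEQ_iff by blast
  have bP: "bker P" by (rule bker_limit[OF bV limP V_bound])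
  have KK: "(\<lambda>x y. kcomp K L x y) = kcomp K L" for L by simp
  obtain C where C: "0 \<le> C" "\<And>m x y. \<bar>V (Suc m) x y\<bar> \<le> C"
    using V_bound order_trans[OF abs_ge_zero V_bound] by blast
  have "kcomp K (kcomp K P) x y = R * P x y" for x y
  proof (rule LIMSEQ_unique)
    have b2: "\<bar>kcomp K (V (Suc m)) x y\<bar> \<le> B * C" for m x y
      unfolding kcomp_def
    proof (intro integral_abs_le bfun_mult bker_row[OF K(1)] bker_col[OF bV])
      show "\<bar>K x z * V (Suc m) z y\<bar> \<le> B * C" for z
        using B C by (auto simp: abs_mult intro!: mult_mono)
    qed
    have l2: "(\<lambda>m. kcomp K (V (Suc m)) x y) \<longlonglongrightarrow> kcomp K P x y" for x y
      by (rule kcomp_tendsto[OF K(1) bV limP C(2)])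
    show "(\<lambda>m. kcomp K (kcomp K (V (Suc m))) x y) \<longlonglongrightarrow> kcomp K (kcomp K P) x y"
      by (rule kcomp_tendsto[OF K(1) bker_kcomp[OF K(1) bV] l2 b2])
    show "(\<lambda>m. kcomp K (kcomp K (V (Suc m))) x y) \<longlonglongrightarrow> R * P x y"
      unfolding V_Suc' by (rule tendsto_mult_left[OF LIMSEQ_Suc[OF limP]])
  qed
  moreover have "0 < hs P P"
  proof -
    have "(\<lambda>m. hs (V (Suc m)) (V (Suc m))) \<longlonglongrightarrow> hs P P" by (rule hs_tendsto[OF bV limP V_bound])
    moreover have "(\<lambda>m. hs (V (Suc m)) (V (Suc m))) \<longlonglongrightarrow> c"
      unfolding hsV using LIMSEQ_subseq_LIMSEQ[OF lim, of "\<lambda>m. Suc (Suc m + Suc m)"]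
      by (simp add: u_def strict_mono_def o_def)
    ultimately show ?thesis using LIMSEQ_unique R by blast
  qed
  ultimately show thesis using that[OF R(1) bP] s1 unfolding s_def by simp
qed

text \<open>
  A non-zero column \<open>g\<close> of the limit kernel satisfies \<open>K (K g) = R g\<close>. With \<open>\<rho> = sqrt R\<close>, the function
  \<open>K g + \<rho> g\<close> is an eigenfunction for \<open>\<rho>\<close>, unless it vanishes; then \<open>K g\<close> is one for \<open>- \<rho>\<close>.
\<close>

lemma top_eigenfunction:
  assumes K: "bker K" "ksym K" and pos: "0 < hs (kpow K 1) (kpow K 1)"
  obtains l f where "l \<noteq> 0" "bfun f" "ip f f = 1" "\<And>x. app K f x = l * f x"
    "hs (kpow K 1) (kpow K 1) \<le> l\<^sup>2 * hs K K"
proof -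
  obtain R P where R: "0 < R" and P: "bker P" "0 < hs P P" and KKP: "\<And>x y. kcomp K (kcomp K P) x y = R * P x y"
    and le: "hs (kpow K 1) (kpow K 1) \<le> R * hs K K" using top_projection[OF assms] by blast
  define \<rho> where "\<rho> = sqrt R"
  have \<rho>: "0 < \<rho>" "\<rho>\<^sup>2 = R" "\<rho> * \<rho> = R" using R by (auto simp: \<rho>_def)
  obtain y where y: "0 < ip (\<lambda>x. P x y) (\<lambda>x. P x y)"
  proof (rule ccontr)
    assume "\<not> thesis"
    then have z: "ip (\<lambda>x. P x y) (\<lambda>x. P x y) = 0" for y
      using that[of y] ip_nonneg[of "\<lambda>x. P x y"] by linarith
    have "hs P P = (\<integral>y. ip (\<lambda>x. P x y) (\<lambda>x. P x y) \<partial>M)"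
      unfolding hs_def dint_def ip_def by (intro integral_swap bker_mult P)
    then show False using z P by simp
  qed
  define g where "g = (\<lambda>x. P x y)"
  have g: "bfun g" unfolding g_def by (rule bker_col[OF P(1)])
  have Tg: "bfun (app K g)" by (intro bfun_app K g)
  have TT: "app K (app K g) x = R * g x" for x
    using KKP[of x y] unfolding kcomp_eq_app[of K] g_def kcomp_def by (simp add: app_def[abs_def])
  define h where "h x = app K g x + \<rho> * g x" for x
  have h: "bfun h" unfolding h_def by (intro bfun_add bfun_cmult Tg g)
  have Th: "app K h x = \<rho> * h x" for x
    unfolding h_def using app_add[OF K(1) Tg bfun_cmult[OF g, of \<rho>], of x]
    by (simp add: app_cmult TT \<rho>(3)[symmetric] algebra_simps)
  note result = that
  have normalise: thesis if "bfun k" "0 < ip k k" "\<And>x. app K k x = l * k x" "l\<^sup>2 = R" for k l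
  proof (rule result[of l "\<lambda>x. (1 / sqrt (ip k k)) * k x"])
    show "l \<noteq> 0" using \<open>l\<^sup>2 = R\<close> R by auto
    show "bfun (\<lambda>x. (1 / sqrt (ip k k)) * k x)" by (intro bfun_cmult that)
    have "ip (\<lambda>x. (1 / sqrt (ip k k)) * k x) (\<lambda>x. (1 / sqrt (ip k k)) * k x) = (1 / sqrt (ip k k))\<^sup>2 * ip k k"
      unfolding ip_def power2_eq_square by (subst integral_mult_right_zero[symmetric]) (simp add: mult_ac)
    also have "\<dots> = 1" using that(2) by (simp add: power_divide)
    finally show "ip (\<lambda>x. (1 / sqrt (ip k k)) * k x) (\<lambda>x. (1 / sqrt (ip k k)) * k x) = 1" .
    show "app K (\<lambda>x. (1 / sqrt (ip k k)) * k x) x = l * ((1 / sqrt (ip k k)) * k x)" for x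
      unfolding app_cmult that(3) by simp
    show "hs (kpow K 1) (kpow K 1) \<le> l\<^sup>2 * hs K K" using le \<open>l\<^sup>2 = R\<close> by simp
  qed
  show thesis
  proof (cases "ip h h = 0")
    case False
    then have "0 < ip h h" using ip_nonneg[of h] by linarith
    then show thesis using normalise[OF h _ Th \<rho>(2)] by blast
  next
    case True
    have ae: "AE x in M. app K g x = - \<rho> * g x"
      using ip_zero_AE[OF h True] unfolding h_def by eventually_elim linarith
    have "app K (app K g) x = - \<rho> * app K g x" for x
      using app_cong_AE[OF K(1) Tg bfun_cmult[OF g] ae] by (simp only: app_cmult)
    moreover have "ip (app K g) (app K g) = R * ip g g"
    proof -
      have "ip (app K g) (app K g) = (\<integral>x. R * (g x * g x) \<partial>M)"
        unfolding ip_def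
        by (intro integral_cong_AE bfun_measurable bfun_mult bfun_cmult Tg g)
           (use ae in \<open>auto simp: \<rho>(3)[symmetric] mult_ac\<close>)
      then show ?thesis unfolding ip_def by simp
    qed
    then have "0 < ip (app K g) (app K g)" using y R by (simp add: g_def)
    ultimately show thesis using normalise[OF Tg, of "- \<rho>"] \<rho> by simp
  qed
qed

end

section \<open>Spectral expansion by deflation\<close>

context kernel_space begin

definition tensor :: "('a \<Rightarrow> real) \<Rightarrow> ('a \<Rightarrow> real) \<Rightarrow> 'a \<Rightarrow> 'a \<Rightarrow> real" where
  "tensor f g x y = f x * g y"

lemma bker_tensor: "bfun f \<Longrightarrow> bfun g \<Longrightarrow> bker (tensor f g)"
  unfolding tensor_def[abs_def] by (intro bker_mult bker_fst bker_snd)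

lemma hs_tensor: assumes "bker K" "bfun f" "bfun g" shows "hs K (tensor f g) = ip f (app K g)"
  unfolding hs_def dint_def tensor_def ip_def app_def
  by (subst integral_mult_right_zero[symmetric]) (simp add: mult_ac)

lemma hs_tensor_tensor: "hs (tensor f g) (tensor f g) = ip f f * ip g g"
proof -
  have "(\<integral>y. f x * g y * (f x * g y) \<partial>M) = (f x * f x) * ip g g" for x
    unfolding ip_def by (subst integral_mult_right_zero[symmetric]) (simp add: mult_ac)
  then show ?thesis unfolding hs_def dint_def tensor_def ip_def by simp
qed

lemma app_selfadjoint: assumes "bker K" "ksym K" "bfun f" "bfun g" shows "ip (app K f) g = ip f (app K g)"
proof -
  have b: "bker (\<lambda>x y. K x y * f y * g x)" by (intro bker_mult bker_fst bker_snd assms)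
  have "ip (app K f) g = (\<integral>x. \<integral>y. K x y * f y * g x \<partial>M \<partial>M)" unfolding ip_def app_def by simp
  also have "\<dots> = (\<integral>y. \<integral>x. K x y * f y * g x \<partial>M \<partial>M)" by (rule integral_swap[OF b])
  also have "\<dots> = ip f (app K g)" unfolding ip_def app_def
    using assms(2) by (subst integral_mult_right_zero[symmetric]) (simp add: mult_ac ksym_def)
  finally show ?thesis .
qed

text \<open>
  The left-hand side is the Hilbert--Schmidt product of the square of \<open>K\<close> with \<open>tensor h h\<close>.
\<close>

lemma ip_app_app_le: assumes "bker K" "ksym K" "bfun h"
  shows "ip (app K h) (app K h) \<le> sqrt (hs (kpow K 1) (kpow K 1)) * ip h h"
proof -
  have "ip (app K h) (app K h) = ip h (app (kpow K 1) h)"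
    using app_selfadjoint[OF assms(1,2,3) bfun_app[OF assms(1,3)]] app_kcomp[OF assms(1,1,3)]
    by (simp add: ip_def)
  also have "\<dots> = hs (kpow K 1) (tensor h h)" by (rule hs_tensor[symmetric]) (intro bker_kpow assms)+
  also have "\<dots> \<le> sqrt ((hs (kpow K 1) (kpow K 1)) * (ip h h)\<^sup>2)"
    using hs_cauchy_schwarz[OF bker_kpow[OF assms(1), of 1] bker_tensor[OF assms(3,3)]]
    by (intro real_le_rsqrt) (simp add: hs_tensor_tensor power2_eq_square)
  also have "\<dots> = sqrt (hs (kpow K 1) (kpow K 1)) * ip h h"
    using ip_nonneg[of h] by (simp add: real_sqrt_mult)
  finally show ?thesis .
qed

lemma hs_kpow_le: assumes "bker K" shows "hs (kpow K n) (kpow K n) \<le> hs K K ^ Suc n"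
proof (induction n)
  case (Suc n)
  have "hs (kpow K (Suc n)) (kpow K (Suc n)) \<le> hs K K * hs (kpow K n) (kpow K n)"
    using hs_kcomp_le[OF assms bker_kpow[OF assms]] by simp
  also have "\<dots> \<le> hs K K * hs K K ^ Suc n" by (intro mult_left_mono Suc hs_nonneg)
  finally show ?case by simp
qed simp

definition deflate :: "('a \<Rightarrow> 'a \<Rightarrow> real) \<Rightarrow> real \<Rightarrow> ('a \<Rightarrow> real) \<Rightarrow> 'a \<Rightarrow> 'a \<Rightarrow> real" where
  "deflate K l f x y = K x y - l * (f x * f y)"

text \<open>
  The pair \<open>(0, 0)\<close> serves a kernel whose square vanishes. The last clause bounds the trace of the fourth power
  by a multiple of \<open>l\<^sup>2\<close>, so that the remainders of a deflation become small as soon as the eigenvalues do.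
\<close>

definition top_pair :: "('a \<Rightarrow> 'a \<Rightarrow> real) \<Rightarrow> real \<times> ('a \<Rightarrow> real) \<Rightarrow> bool" where
  "top_pair K p \<longleftrightarrow> (case p of (l, f) \<Rightarrow> bfun f \<and> (\<forall>x. app K f x = l * f x) \<and>
     (l = 0 \<longrightarrow> f = (\<lambda>_. 0)) \<and> (l \<noteq> 0 \<longrightarrow> ip f f = 1) \<and> hs (kpow K 1) (kpow K 1) \<le> l\<^sup>2 * hs K K)"

lemma top_pair_exists: assumes "bker K" "ksym K" shows "\<exists>p. top_pair K p"
proof (cases "hs (kpow K 1) (kpow K 1) = 0")
  case True
  then have "top_pair K (0, \<lambda>_. 0)" by (simp add: top_pair_def app_def)
  then show ?thesis by blast
next
  case False
  then have pos: "0 < hs (kpow K 1) (kpow K 1)" using hs_nonneg[of "kpow K 1"] by linarith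
  obtain l f where "l \<noteq> 0" "bfun f" "ip f f = 1" "\<And>x. app K f x = l * f x"
    "hs (kpow K 1) (kpow K 1) \<le> l\<^sup>2 * hs K K" using top_eigenfunction[OF assms pos] by blast
  then have "top_pair K (l, f)" unfolding top_pair_def by simp
  then show ?thesis by blast
qed

lemma bker_deflate: "bker K \<Longrightarrow> bfun f \<Longrightarrow> bker (deflate K l f)"
  unfolding deflate_def[abs_def] by (intro bker_diff bker_cmult bker_mult bker_fst bker_snd)

lemma ksym_deflate: "ksym K \<Longrightarrow> ksym (deflate K l f)"
  unfolding deflate_def[abs_def] ksym_def by (simp add: mult.commute)

lemma app_deflate: assumes "bker K" "bfun f" "bfun g"
  shows "app (deflate K l f) g x = app K g x - l * f x * ip f g"
proof -
  have "app (deflate K l f) g x = (\<integral>y. K x y * g y - (l * f x) * (f y * g y) \<partial>M)"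
    unfolding app_def deflate_def by (simp add: algebra_simps)
  also have "\<dots> = app K g x - (\<integral>y. (l * f x) * (f y * g y) \<partial>M)" unfolding app_def
    by (intro Bochner_Integration.integral_diff bfun_integrable bfun_mult bker_row[OF assms(1)] assms bfun_const)
  finally show ?thesis unfolding ip_def by simp
qed

text \<open>
  The rank-one kernel that is split off and the deflated kernel annihilate each other, because \<open>f\<close> is a
  normalised eigenfunction.
\<close>

lemma kpow_deflate: assumes K: "bker K" "ksym K" and p: "top_pair K (l, f)"
  shows "kpow (deflate K l f) n x y = kpow K n x y - l ^ Suc n * (f x * f y)"
proof (induction n arbitrary: x y)
  case (Suc n)
  have f: "bfun f" and ev: "\<And>x. app K f x = l * f x" and one: "l * ip f f = l"
    using p by (auto simp: top_pair_def ip_def)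
  have evn: "app (kpow K n) f x = l ^ Suc n * f x" for x n
  proof (induction n arbitrary: x)
    case (Suc n)
    have "app (kpow K (Suc n)) f x = app K (app (kpow K n) f) x"
      by (simp add: app_kcomp K bker_kpow f)
    also have "app (kpow K n) f = (\<lambda>x. l ^ Suc n * f x)" using Suc by auto
    finally show ?case by (simp only: app_cmult ev) simp
  qed (simp add: ev)
  have sw: "ip f (\<lambda>z. kpow K n z y) = l ^ Suc n * f y"
    using evn[of n y] ksym_kpow[OF K, of n] unfolding ip_def app_def ksym_def by (simp add: mult.commute)
  have "kpow (deflate K l f) (Suc n) x y = app (deflate K l f) (\<lambda>z. kpow (deflate K l f) n z y) x"
    by (simp add: kcomp_eq_app)
  also have "\<dots> = app K (\<lambda>z. kpow (deflate K l f) n z y) x - l * f x * ip f (\<lambda>z. kpow (deflate K l f) n z y)"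
    by (intro app_deflate K f bker_col[OF bker_kpow[OF bker_deflate]])
  also have "(\<lambda>z. kpow (deflate K l f) n z y) = (\<lambda>z. kpow K n z y - (l ^ Suc n * f y) * f z)"
    by (simp add: Suc mult_ac)
  also have "app K (\<lambda>z. kpow K n z y - (l ^ Suc n * f y) * f z) x = kpow K (Suc n) x y - (l ^ Suc n * f y) * (l * f x)"
  proof -
    have "app K (\<lambda>z. kpow K n z y + (- (l ^ Suc n * f y)) * f z) x = app K (\<lambda>z. kpow K n z y) x + app K (\<lambda>z. (- (l ^ Suc n * f y)) * f z) x"
      by (intro app_add K bker_col[OF bker_kpow[OF K(1)]] bfun_cmult f)
    then show ?thesis unfolding app_cmult ev by (simp add: kcomp_eq_app)
  qed
  also have "ip f (\<lambda>z. kpow K n z y - (l ^ Suc n * f y) * f z) = l ^ Suc n * f y - (l ^ Suc n * f y) * ip f f"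
  proof -
    have "ip f (\<lambda>z. kpow K n z y - (l ^ Suc n * f y) * f z) = (\<integral>z. f z * kpow K n z y - (l ^ Suc n * f y) * (f z * f z) \<partial>M)"
      unfolding ip_def by (simp add: algebra_simps)
    also have "\<dots> = ip f (\<lambda>z. kpow K n z y) - (\<integral>z. (l ^ Suc n * f y) * (f z * f z) \<partial>M)"
      unfolding ip_def by (intro Bochner_Integration.integral_diff bfun_integrable bfun_mult bfun_const f bker_col[OF bker_kpow[OF K(1)]])
    finally show ?thesis unfolding sw by (simp add: ip_def)
  qed
  also have "l * f x * (l ^ Suc n * f y - (l ^ Suc n * f y) * ip f f) = f x * l ^ Suc n * f y * (l - l * ip f f)"
    by (simp add: algebra_simps)
  finally show ?case using one by (simp add: mult_ac)
qed (simp add: deflate_def)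

lemma ktr_deflate: assumes K: "bker K" "ksym K" and p: "top_pair K (l, f)"
  shows "ktr (kpow (deflate K l f) n) = ktr (kpow K n) - l ^ Suc n"
proof -
  have f: "bfun f" using p by (auto simp: top_pair_def)
  have "ktr (kpow (deflate K l f) n) = (\<integral>x. kpow K n x x - l ^ Suc n * (f x * f x) \<partial>M)"
    unfolding ktr_def kpow_deflate[OF assms] ..
  also have "\<dots> = ktr (kpow K n) - (\<integral>x. l ^ Suc n * (f x * f x) \<partial>M)" unfolding ktr_def
    by (intro Bochner_Integration.integral_diff bfun_integrable bfun_cmult bfun_mult f bker_diag[OF bker_kpow[OF K(1)]])
  also have "(\<integral>x. l ^ Suc n * (f x * f x) \<partial>M) = l ^ Suc n * ip f f" unfolding ip_def by simp
  also have "\<dots> = l ^ Suc n" using p by (auto simp: top_pair_def)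
  finally show ?thesis .
qed

text \<open>
  The choice of a pair is written out because \<open>eigv\<close> and \<open>eigf\<close> are defined from the residuals.
\<close>

primrec residual :: "('a \<Rightarrow> 'a \<Rightarrow> real) \<Rightarrow> nat \<Rightarrow> 'a \<Rightarrow> 'a \<Rightarrow> real" where
  "residual W 0 = W"
| "residual W (Suc n) = deflate (residual W n) (fst (SOME p. top_pair (residual W n) p)) (snd (SOME p. top_pair (residual W n) p))"

definition eigv :: "('a \<Rightarrow> 'a \<Rightarrow> real) \<Rightarrow> nat \<Rightarrow> real" where
  "eigv W n = fst (SOME p. top_pair (residual W n) p)"
definition eigf :: "('a \<Rightarrow> 'a \<Rightarrow> real) \<Rightarrow> nat \<Rightarrow> 'a \<Rightarrow> real" where
  "eigf W n = snd (SOME p. top_pair (residual W n) p)"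

lemma residual_Suc: "residual W (Suc n) = deflate (residual W n) (eigv W n) (eigf W n)"
  by (simp add: eigv_def eigf_def)

text \<open>
  Approximation in the Hilbert--Schmidt norm by kernels of finite rank.
\<close>

definition separably_approximable :: "('a \<Rightarrow> 'a \<Rightarrow> real) \<Rightarrow> bool" where
  "separably_approximable W \<longleftrightarrow> (\<forall>e>0. \<exists>(S::nat set) g h. finite S \<and> (\<forall>i\<in>S. bfun (g i) \<and> bfun (h i)) \<and>
     hs (\<lambda>x y. W x y - (\<Sum>i\<in>S. tensor (g i) (h i) x y)) (\<lambda>x y. W x y - (\<Sum>i\<in>S. tensor (g i) (h i) x y)) < e)"

context
  fixes W assumes W: "bker W" "ksym W"
begin

lemma residual_top_pair: "bker (residual W n) \<and> ksym (residual W n) \<and> top_pair (residual W n) (eigv W n, eigf W n)"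
proof -
  have tp: "top_pair (residual W n) (eigv W n, eigf W n)" if "bker (residual W n)" "ksym (residual W n)" for n
    using someI_ex[OF top_pair_exists[OF that]] by (simp add: eigv_def eigf_def)
  have "bker (residual W n) \<and> ksym (residual W n)"
  proof (induction n)
    case (Suc n)
    then have "bfun (eigf W n)" using tp[of n] by (simp add: top_pair_def)
    then show ?case using Suc unfolding residual_Suc by (simp add: bker_deflate ksym_deflate)
  qed (use W in simp)
  then show ?thesis using tp by simp
qed

lemmas bker_residual = residual_top_pair[THEN conjunct1]
lemmas ksym_residual = residual_top_pair[THEN conjunct2, THEN conjunct1]
lemmas tp_residual = residual_top_pair[THEN conjunct2, THEN conjunct2]

lemma bfun_eigf: "bfun (eigf W n)" using tp_residual[of n] by (simp add: top_pair_def)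
lemma app_residual_eigf: "app (residual W n) (eigf W n) x = eigv W n * eigf W n x"
  using tp_residual[of n] by (simp add: top_pair_def)
lemma eigf_normalised: "eigv W n \<noteq> 0 \<Longrightarrow> ip (eigf W n) (eigf W n) = 1"
  using tp_residual[of n] by (simp add: top_pair_def)
lemma eigf_zero: "eigv W n = 0 \<Longrightarrow> eigf W n = (\<lambda>_. 0)"
  using tp_residual[of n] by (simp add: top_pair_def)

lemma ktr_residual: "ktr (kpow (residual W n) m) = ktr (kpow W m) - (\<Sum>i<n. eigv W i ^ Suc m)"
proof (induction n)
  case (Suc n)
  show ?case unfolding residual_Suc ktr_deflate[OF bker_residual ksym_residual tp_residual] Suc by simp
qed simp

lemma app_residual: "bfun g \<Longrightarrow> app (residual W n) g x = app W g x - (\<Sum>i<n. eigv W i * eigf W i x * ip (eigf W i) g)"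
proof (induction n)
  case (Suc n)
  show ?case unfolding residual_Suc app_deflate[OF bker_residual bfun_eigf Suc(2)] Suc(1)[OF Suc(2)] by simp
qed simp

lemma app_residual_earlier: "i < n \<Longrightarrow> app (residual W n) (eigf W i) x = 0"
proof (induction n arbitrary: x)
  case (Suc n)
  have e: "app (residual W (Suc n)) (eigf W i) x = app (residual W n) (eigf W i) x - eigv W n * eigf W n x * ip (eigf W n) (eigf W i)"
    unfolding residual_Suc by (rule app_deflate[OF bker_residual bfun_eigf bfun_eigf])
  show ?case
  proof (cases "i = n")
    case True
    show ?thesis unfolding e unfolding True app_residual_eigf
      using eigf_normalised[of n] by (cases "eigv W n = 0") auto
  next
    case False
    then have "i < n" using Suc by simp
    then have z: "\<And>x. app (residual W n) (eigf W i) x = 0" by (rule Suc.IH)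
    have "eigv W n * ip (eigf W n) (eigf W i) = ip (app (residual W n) (eigf W n)) (eigf W i)"
      unfolding ip_def app_residual_eigf by (simp add: mult.assoc)
    also have "\<dots> = 0"
      unfolding app_selfadjoint[OF bker_residual ksym_residual bfun_eigf bfun_eigf] by (simp add: ip_def z)
    finally show ?thesis unfolding e z by auto
  qed
qed simp

lemma eigf_orthogonal: "i \<noteq> j \<Longrightarrow> ip (eigf W i) (eigf W j) = 0"
proof -
  have lt: "ip (eigf W j) (eigf W i) = 0" if "i < j" for i j
  proof (cases "eigv W j = 0")
    case False
    have "eigv W j * ip (eigf W j) (eigf W i) = ip (app (residual W j) (eigf W j)) (eigf W i)"
      unfolding ip_def app_residual_eigf by (simp add: mult.assoc)
    also have "\<dots> = 0"
      unfolding app_selfadjoint[OF bker_residual ksym_residual bfun_eigf bfun_eigf]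
      by (simp add: ip_def app_residual_earlier[OF that])
    finally show ?thesis using False by simp
  qed (simp add: eigf_zero ip_def)
  have sym: "ip f g = ip g f" for f g unfolding ip_def by (simp add: mult.commute)
  show "i \<noteq> j \<Longrightarrow> ip (eigf W i) (eigf W j) = 0"
    using lt[of i j] lt[of j i] sym by (metis linorder_neq_iff)
qed

lemma app_eigf: "app W (eigf W n) x = eigv W n * eigf W n x"
  using app_residual[OF bfun_eigf, of n n x] app_residual_eigf[of n x]
  by (simp add: eigf_orthogonal)

lemma hs_residual: "hs (residual W n) (residual W n) = hs W W - (\<Sum>i<n. (eigv W i)\<^sup>2)"
  using ktr_residual[of n 1] hs_kpow[OF bker_residual ksym_residual, of n 0 0] hs_kpow[OF W, of 0 0]
  by (simp add: numeral_2_eq_2)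

lemma hs_residual_le: "hs (residual W n) (residual W n) \<le> hs W W"
  unfolding hs_residual by (simp add: sum_nonneg)

lemma summable_eigv_sq: "summable (\<lambda>i. (eigv W i)\<^sup>2)"
proof (rule bounded_imp_summable[where B="hs W W"])
  show "(\<Sum>k\<le>n. (eigv W k)\<^sup>2) \<le> hs W W" for n
    using hs_residual[of "Suc n"] hs_nonneg[of "residual W (Suc n)"] by (simp add: lessThan_Suc_atMost)
qed simp

text \<open>
  The eigenvalues tend to \<open>0\<close> because their squares are summable, and the defining bound of a top pair
  transfers this to the residuals.
\<close>

lemma hs_residual_sq_tendsto: "(\<lambda>n. hs (kpow (residual W n) 1) (kpow (residual W n) 1)) \<longlonglongrightarrow> 0"
proof (rule tendsto_sandwich[OF _ _ tendsto_const])
  show "(\<lambda>n. (eigv W n)\<^sup>2 * hs W W) \<longlonglongrightarrow> 0"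
    using tendsto_mult_right[OF summable_LIMSEQ_zero[OF summable_eigv_sq], of "hs W W"] by simp
  show "\<forall>\<^sub>F n in sequentially. hs (kpow (residual W n) 1) (kpow (residual W n) 1) \<le> (eigv W n)\<^sup>2 * hs W W"
  proof (intro always_eventually allI)
    fix n
    have "hs (kpow (residual W n) 1) (kpow (residual W n) 1) \<le> (eigv W n)\<^sup>2 * hs (residual W n) (residual W n)"
      using tp_residual[of n] by (simp add: top_pair_def)
    also have "\<dots> \<le> (eigv W n)\<^sup>2 * hs W W" by (intro mult_left_mono hs_residual_le) simp
    finally show "hs (kpow (residual W n) 1) (kpow (residual W n) 1) \<le> (eigv W n)\<^sup>2 * hs W W" .
  qed
qed (simp add: hs_nonneg)

text \<open>
  For \<open>m \<ge> 2\<close> the power \<open>m + 1\<close> contains the square of the residual as a factor, so Cauchy--Schwarz reduces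
  the claim to \<open>hs_residual_sq_tendsto\<close>.
\<close>

lemma ktr_residual_tendsto: assumes "m \<ge> 2" shows "(\<lambda>n. ktr (kpow (residual W n) m)) \<longlonglongrightarrow> 0"
proof (rule Lim_null_comparison)
  define C where "C = sqrt (hs W W ^ Suc (m - 2))"
  show "(\<lambda>n. sqrt (hs (kpow (residual W n) 1) (kpow (residual W n) 1)) * C) \<longlonglongrightarrow> 0"
    using tendsto_mult_right[OF tendsto_real_sqrt[OF hs_residual_sq_tendsto], of C] by simp
  show "\<forall>\<^sub>F n in sequentially. norm (ktr (kpow (residual W n) m)) \<le> sqrt (hs (kpow (residual W n) 1) (kpow (residual W n) 1)) * C"
  proof (intro always_eventually allI)
    fix n
    let ?K = "residual W n"
    have "ktr (kpow ?K m) = hs (kpow ?K 1) (kpow ?K (m - 2))"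
      unfolding hs_kpow[OF bker_residual ksym_residual] using assms by (simp add: numeral_2_eq_2 Suc_diff_Suc del: kpow.simps)
    then have "(ktr (kpow ?K m))\<^sup>2 \<le> hs (kpow ?K 1) (kpow ?K 1) * hs (kpow ?K (m - 2)) (kpow ?K (m - 2))"
      using hs_cauchy_schwarz[OF bker_kpow[OF bker_residual] bker_kpow[OF bker_residual]] by metis
    also have "\<dots> \<le> hs (kpow ?K 1) (kpow ?K 1) * (hs W W ^ Suc (m - 2))"
      by (intro mult_left_mono order_trans[OF hs_kpow_le[OF bker_residual]] power_mono hs_residual_le hs_nonneg)
    finally show "norm (ktr (kpow ?K m)) \<le> sqrt (hs (kpow ?K 1) (kpow ?K 1)) * C"
      unfolding C_def real_sqrt_mult[symmetric] by (simp add: real_le_rsqrt del: kpow.simps)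
  qed
qed

lemma eigv_power_sums: assumes "m \<ge> 2" shows "(\<lambda>i. eigv W i ^ Suc m) sums ktr (kpow W m)"
proof -
  have "(\<lambda>n. ktr (kpow W m) - ktr (kpow (residual W n) m)) \<longlonglongrightarrow> ktr (kpow W m) - 0"
    by (intro tendsto_diff tendsto_const ktr_residual_tendsto assms)
  then show ?thesis unfolding sums_def ktr_residual by simp
qed

lemma ip_app_residual_tendsto: assumes h: "bfun h"
  shows "(\<lambda>n. ip (app (residual W n) h) (app (residual W n) h)) \<longlonglongrightarrow> 0"
proof (rule tendsto_sandwich[OF _ _ tendsto_const])
  show "(\<lambda>n. sqrt (hs (kpow (residual W n) 1) (kpow (residual W n) 1)) * ip h h) \<longlonglongrightarrow> 0"
    using tendsto_mult_right[OF tendsto_real_sqrt[OF hs_residual_sq_tendsto], of "ip h h"] by simp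
  show "\<forall>\<^sub>F n in sequentially. ip (app (residual W n) h) (app (residual W n) h)
      \<le> sqrt (hs (kpow (residual W n) 1) (kpow (residual W n) 1)) * ip h h"
    by (intro always_eventually allI ip_app_app_le[OF bker_residual ksym_residual h])
qed (simp add: ip_nonneg)

lemma ip_residual_tendsto: assumes g: "bfun g" and h: "bfun h"
  shows "(\<lambda>n. ip g (app (residual W n) h)) \<longlonglongrightarrow> 0"
proof (rule Lim_null_comparison)
  show "(\<lambda>n. sqrt (ip g g * ip (app (residual W n) h) (app (residual W n) h))) \<longlonglongrightarrow> 0"
    using tendsto_real_sqrt[OF tendsto_mult_left[OF ip_app_residual_tendsto[OF h], of "ip g g"]] by simp
  show "\<forall>\<^sub>F n in sequentially. norm (ip g (app (residual W n) h)) \<le> sqrt (ip g g * ip (app (residual W n) h) (app (residual W n) h))"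
    by (intro always_eventually allI)
       (simp add: real_le_rsqrt ip_cauchy_schwarz[OF g bfun_app[OF bker_residual h]])
qed

text \<open>
  Eigenfunctions for different eigenvalues are orthogonal, so \<open>g\<close> is orthogonal to every \<open>eigf W i\<close>. Each
  residual therefore maps \<open>g\<close> to \<open>l * g\<close>, whereas the residuals tend to \<open>0\<close> on every bounded function.
\<close>

lemma eigf_complete:
  assumes g: "bfun g" "\<And>x. app W g x = l * g x" "l \<noteq> 0" and o: "\<And>i. eigv W i = l \<Longrightarrow> ip (eigf W i) g = 0"
  shows "ip g g = 0"
proof -
  have o': "ip (eigf W i) g = 0" for i
  proof (cases "eigv W i = l")
    case False
    have "eigv W i * ip (eigf W i) g = ip (app W (eigf W i)) g" unfolding ip_def app_eigf by (simp add: mult.assoc)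
    also have "\<dots> = l * ip (eigf W i) g"
      unfolding app_selfadjoint[OF W bfun_eigf g(1)] by (simp add: ip_def g(2) mult.left_commute)
    finally show ?thesis using False by simp
  qed (rule o)
  have "app (residual W n) g x = l * g x" for n x
    using app_residual[OF g(1), of n x] by (simp add: o' g(2))
  then have "ip (app (residual W n) g) (app (residual W n) g) = l\<^sup>2 * ip g g" for n
    unfolding ip_def by (simp add: power2_eq_square mult_ac)
  then have "l\<^sup>2 * ip g g = 0"
    using ip_app_residual_tendsto[OF g(1)] by (simp add: LIMSEQ_const_iff)
  then show ?thesis using g(3) by simp
qed

text \<open>
  The residual annihilates the eigenfunctions that have been split off.
\<close>

lemma hs_residual_self: "hs (residual W n) (residual W n) = hs (residual W n) W"
proof -
  have "hs (residual W n) (residual W m) = hs (residual W n) W" if "m \<le> n" for m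
    using that
  proof (induction m)
    case (Suc m)
    have t: "bker (tensor (eigf W m) (eigf W m))" by (intro bker_tensor bfun_eigf)
    have i: "bker (\<lambda>x y. residual W n x y * residual W m x y)"
      "bker (\<lambda>x y. residual W n x y * tensor (eigf W m) (eigf W m) x y)" by (intro bker_mult bker_residual t)+
    have "hs (residual W n) (residual W (Suc m)) =
      dint (\<lambda>x y. residual W n x y * residual W m x y - eigv W m * (residual W n x y * tensor (eigf W m) (eigf W m) x y))"
      unfolding hs_def residual_Suc deflate_def tensor_def by (simp add: algebra_simps)
    also have "\<dots> = hs (residual W n) (residual W m) - eigv W m * hs (residual W n) (tensor (eigf W m) (eigf W m))"
      using dint_diff[OF i(1) bker_cmult[OF i(2), of "eigv W m"]] unfolding dint_cmult hs_def .
    also have "hs (residual W n) (tensor (eigf W m) (eigf W m)) = 0"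
      unfolding hs_tensor[OF bker_residual bfun_eigf bfun_eigf]
      using Suc(2) by (simp add: app_residual_earlier ip_def)
    finally show ?case using Suc by simp
  qed simp
  then show ?thesis by simp
qed

text \<open>
  The Hilbert--Schmidt norm of the residual equals its product with \<open>W\<close>. Replacing \<open>W\<close> there by a kernel of
  finite rank leaves finitely many terms \<open>ip (g i) (app (residual W n) (h i))\<close>, which tend to \<open>0\<close>.
\<close>

lemma eigv_sq_sums: assumes "separably_approximable W"
  shows "(\<lambda>i. (eigv W i)\<^sup>2) sums hs W W"
proof -
  have "(\<lambda>n. hs (residual W n) (residual W n)) \<longlonglongrightarrow> 0"
  proof (rule LIMSEQ_I)
    fix e :: real assume e: "0 < e"
    define C where "C = sqrt (hs W W) + 1"
    have C: "0 < C" unfolding C_def using hs_nonneg[of W] by (simp add: add_nonneg_pos)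
    have "0 < (e / (2 * C))\<^sup>2" using e C by simp
    from assms[unfolded separably_approximable_def, rule_format, OF this]
    obtain S g h where S0: "finite (S::nat set)" "\<forall>i\<in>S. bfun (g i) \<and> bfun (h i)"
      and ap: "hs (\<lambda>x y. W x y - (\<Sum>i\<in>S. tensor (g i) (h i) x y)) (\<lambda>x y. W x y - (\<Sum>i\<in>S. tensor (g i) (h i) x y)) < (e / (2 * C))\<^sup>2"
      by (elim exE conjE)
    have S: "finite S" "\<And>i. i \<in> S \<Longrightarrow> bfun (g i)" "\<And>i. i \<in> S \<Longrightarrow> bfun (h i)" using S0 by auto
    define D where "D x y = W x y - (\<Sum>i\<in>S. tensor (g i) (h i) x y)" for x y
    have bD: "bker D" unfolding D_def by (intro bker_diff W bker_sum bker_tensor S)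
    have split: "hs K W = hs K D + (\<Sum>i\<in>S. ip (g i) (app K (h i)))" if K: "bker K" for K
    proof -
      have sm: "dint (\<lambda>x y. \<Sum>i\<in>T. K x y * tensor (g i) (h i) x y) = (\<Sum>i\<in>T. hs K (tensor (g i) (h i)))"
        if "finite T" "T \<subseteq> S" for T using that
      proof (induction T rule: finite_induct)
        case (insert i T)
        then have iS: "i \<in> S" and TS: "T \<subseteq> S" by auto
        have "bker (\<lambda>x y. K x y * tensor (g i) (h i) x y)" by (intro bker_mult K bker_tensor S iS)
        moreover have "bker (\<lambda>x y. \<Sum>i\<in>T. K x y * tensor (g i) (h i) x y)"
          by (intro bker_sum bker_mult K bker_tensor S) (use TS in auto)
        ultimately show ?case
          using dint_add insert.IH[OF TS] insert.hyps by (simp add: hs_def)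
      qed (simp add: dint_def)
      have "hs K W = dint (\<lambda>x y. K x y * D x y + (\<Sum>i\<in>S. K x y * tensor (g i) (h i) x y))"
        unfolding hs_def D_def sum_distrib_left[symmetric] by (simp add: algebra_simps)
      also have "\<dots> = hs K D + (\<Sum>i\<in>S. hs K (tensor (g i) (h i)))"
        using dint_add[OF bker_mult[OF K bD] bker_sum[of S "\<lambda>i x y. K x y * tensor (g i) (h i) x y", OF bker_mult[OF K bker_tensor[OF S(2) S(3)]]]]
          sm[OF S(1) subset_refl] by (simp add: hs_def)
      also have "(\<Sum>i\<in>S. hs K (tensor (g i) (h i))) = (\<Sum>i\<in>S. ip (g i) (app K (h i)))"
        by (intro sum.cong refl hs_tensor K S)
      finally show ?thesis .
    qed
    have lim: "(\<lambda>n. \<Sum>i\<in>S. ip (g i) (app (residual W n) (h i))) \<longlonglongrightarrow> 0"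
      using tendsto_sum[of S "\<lambda>i n. ip (g i) (app (residual W n) (h i))" "\<lambda>_. 0" sequentially] ip_residual_tendsto S by auto
    have "0 < e / 2" using e by simp
    from LIMSEQ_D[OF lim this]
    obtain N where N: "\<And>n. n \<ge> N \<Longrightarrow> \<bar>\<Sum>i\<in>S. ip (g i) (app (residual W n) (h i))\<bar> < e / 2"
      unfolding diff_zero real_norm_def by auto
    show "\<exists>N. \<forall>n\<ge>N. norm (hs (residual W n) (residual W n) - 0) < e"
    proof (intro exI[of _ N] allI impI)
      fix n assume n: "N \<le> n"
      have "(hs (residual W n) D)\<^sup>2 \<le> hs (residual W n) (residual W n) * hs D D"
        by (intro hs_cauchy_schwarz bker_residual bD)
      also have "\<dots> \<le> C\<^sup>2 * (e / (2 * C))\<^sup>2"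
      proof (intro mult_mono)
        show "hs (residual W n) (residual W n) \<le> C\<^sup>2"
        proof -
          have "C\<^sup>2 = hs W W + 1 + 2 * sqrt (hs W W)" unfolding C_def power2_sum using hs_nonneg[of W] by simp
          moreover have "0 \<le> sqrt (hs W W)" using hs_nonneg[of W] by simp
          ultimately show ?thesis using hs_residual_le[of n] by linarith
        qed
        show "hs D D \<le> (e / (2 * C))\<^sup>2" using ap unfolding D_def by simp
      qed (auto simp: hs_nonneg)
      also have "\<dots> = (e / 2)\<^sup>2" using C by (simp add: power_divide power_mult_distrib)
      finally have "\<bar>hs (residual W n) D\<bar> \<le> e / 2" using e by (metis abs_le_square_iff abs_of_pos half_gt_zero)
      then show "norm (hs (residual W n) (residual W n) - 0) < e"
        unfolding hs_residual_self split[OF bker_residual] using N[OF n] by simp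
    qed
  qed
  then have "(\<lambda>n. hs W W - hs (residual W n) (residual W n)) \<longlonglongrightarrow> hs W W - 0"
    by (intro tendsto_diff tendsto_const)
  then show ?thesis unfolding sums_def hs_residual by simp
qed

end
end

section \<open>The cut norm and traces of powers\<close>

context kernel_space begin

text \<open>
  The cut norm in its form as operator norm from \<open>L\<^sup>\<infinity>\<close> to \<open>L\<^sup>1\<close>.
\<close>

definition cut_bounded :: "('a \<Rightarrow> 'a \<Rightarrow> real) \<Rightarrow> real \<Rightarrow> bool" where
  "cut_bounded D e \<longleftrightarrow> (\<forall>u v. bfun u \<and> bfun v \<and> (\<forall>x. \<bar>u x\<bar> \<le> 1) \<and> (\<forall>x. \<bar>v x\<bar> \<le> 1) \<longrightarrow> \<bar>ip u (app D v)\<bar> \<le> e)"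

lemma ip_cmult_left: "ip (\<lambda>x. c * f x) g = c * ip f g" unfolding ip_def by (simp add: mult.assoc)
lemma ip_cmult_right: "ip f (\<lambda>x. c * g x) = c * ip f g" unfolding ip_def by (simp add: mult.left_commute)

lemma cut_bounded_scaled:
  assumes D: "cut_bounded D e" and u: "bfun u" "\<And>x. \<bar>u x\<bar> \<le> a" and v: "bfun v" "\<And>x. \<bar>v x\<bar> \<le> b"
    and ab: "0 < a" "0 < b"
  shows "\<bar>ip u (app D v)\<bar> \<le> a * b * e"
proof -
  define u' where "u' x = (1 / a) * u x" for x
  define v' where "v' x = (1 / b) * v x" for x
  have "\<bar>ip u' (app D v')\<bar> \<le> e"
  proof (rule D[unfolded cut_bounded_def, rule_format], intro conjI allI)
    show "bfun u'" "bfun v'" unfolding u'_def v'_def by (intro bfun_cmult u v)+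
    show "\<bar>u' x\<bar> \<le> 1" for x using u(2)[of x] ab by (simp add: u'_def abs_mult)
    show "\<bar>v' x\<bar> \<le> 1" for x using v(2)[of x] ab by (simp add: v'_def abs_mult)
  qed
  also have "ip u' (app D v') = (1 / (a * b)) * ip u (app D v)"
  proof -
    have "app D v' = (\<lambda>x. (1 / b) * app D v x)" unfolding v'_def by (intro ext app_cmult)
    then show ?thesis unfolding u'_def by (simp only: ip_cmult_left ip_cmult_right) simp
  qed
  finally show ?thesis using ab by (simp add: abs_mult field_simps)
qed

lemma kcomp_abs_le: assumes "bker K" "bker L" "\<And>x y. \<bar>K x y\<bar> \<le> a" "\<And>x y. \<bar>L x y\<bar> \<le> b"
  shows "\<bar>kcomp K L x y\<bar> \<le> a * b"
  unfolding kcomp_def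
proof (intro integral_abs_le bfun_mult bker_row[OF assms(1)] bker_col[OF assms(2)])
  show "\<bar>K x z * L z y\<bar> \<le> a * b" for z
    by (simp only: abs_mult) (intro mult_mono' assms abs_ge_zero)
qed

lemma kpow_abs_le: assumes "bker K" "\<And>x y. \<bar>K x y\<bar> \<le> C" shows "\<bar>kpow K n x y\<bar> \<le> C ^ Suc n"
proof (induction n arbitrary: x y)
  case (Suc n)
  show ?case using kcomp_abs_le[OF assms(1) bker_kpow[OF assms(1)] assms(2) Suc] by simp
qed (use assms in simp)

lemma app_abs_le': assumes "bker K" "bfun f" "\<And>x y. \<bar>K x y\<bar> \<le> a" "\<And>x. \<bar>f x\<bar> \<le> b"
  shows "\<bar>app K f x\<bar> \<le> a * b"
  unfolding app_def
proof (intro integral_abs_le bfun_mult bker_row[OF assms(1)] assms(2))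
  show "\<bar>K x z * f z\<bar> \<le> a * b" for z
    by (simp only: abs_mult) (intro mult_mono' assms abs_ge_zero)
qed

lemma ip_add_right: assumes "bfun f" "bfun g" "bfun h" shows "ip f (\<lambda>x. g x + h x) = ip f g + ip f h"
  unfolding ip_def distrib_left
  by (intro Bochner_Integration.integral_add bfun_integrable bfun_mult assms)

lemma app_diff_left: assumes "bker K" "bker L" "bfun f"
  shows "app (\<lambda>x y. K x y - L x y) f x = app K f x - app L f x"
  unfolding app_def left_diff_distrib
  by (intro Bochner_Integration.integral_diff bfun_integrable bfun_mult bker_row[OF assms(1)] bker_row[OF assms(2)] assms(3))

text \<open>
  Telescoping: \<open>K\<^bsup>n+2\<^esup> - W\<^bsup>n+2\<^esup> = K (K\<^bsup>n+1\<^esup> - W\<^bsup>n+1\<^esup>) + (K - W) W\<^bsup>n+1\<^esup>\<close>. The outer factor \<open>K\<close> is moved to the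
  test function by symmetry, and bounded kernels map bounded functions to bounded functions.
\<close>

lemma cut_bounded_kpow:
  assumes K: "bker K" "ksym K" "\<And>x y. \<bar>K x y\<bar> \<le> C" and W: "bker W" "\<And>x y. \<bar>W x y\<bar> \<le> C"
    and D: "cut_bounded (\<lambda>x y. K x y - W x y) e" and C: "1 \<le> C"
  shows "cut_bounded (\<lambda>x y. kpow K n x y - kpow W n x y) (real (Suc n) * C ^ n * e)"
proof (induction n)
  case (Suc n)
  let ?E = "\<lambda>x y. kpow K n x y - kpow W n x y" and ?D = "\<lambda>x y. K x y - W x y"
  have bE: "bker ?E" by (intro bker_diff bker_kpow K W)
  have bD: "bker ?D" by (intro bker_diff K W)
  show ?case unfolding cut_bounded_def
  proof (intro allI impI, elim conjE)
    fix u v assume u: "bfun u" "\<forall>x. \<bar>u x\<bar> \<le> 1" and v: "bfun v" "\<forall>x. \<bar>v x\<bar> \<le> 1"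
    have Wv: "bfun (app (kpow W n) v)" by (intro bfun_app bker_kpow W v)
    have split: "app (\<lambda>x y. kpow K (Suc n) x y - kpow W (Suc n) x y) v
      = (\<lambda>x. app K (app ?E v) x + app ?D (app (kpow W n) v) x)"
    proof
      fix x
      have kE: "app K (app ?E v) x = app K (app (kpow K n) v) x - app K (app (kpow W n) v) x"
      proof -
        have "app ?E v = (\<lambda>x. app (kpow K n) v x + (-1) * app (kpow W n) v x)"
          by (intro ext) (simp add: app_diff_left bker_kpow K W v)
        then have "app K (app ?E v) x = app K (app (kpow K n) v) x + app K (\<lambda>x. (-1) * app (kpow W n) v x) x"
          using app_add[OF K(1) bfun_app[OF bker_kpow[OF K(1)] v(1)] bfun_cmult[OF Wv, of "-1"]] by simp
        then show ?thesis unfolding app_cmult by simp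
      qed
      have "app (\<lambda>x y. kpow K (Suc n) x y - kpow W (Suc n) x y) v x
        = app (kpow K (Suc n)) v x - app (kpow W (Suc n)) v x"
        by (intro app_diff_left bker_kpow K W v)
      also have "\<dots> = app K (app (kpow K n) v) x - app W (app (kpow W n) v) x"
        by (simp add: app_kcomp bker_kpow K W v)
      also have "\<dots> = app K (app ?E v) x + app ?D (app (kpow W n) v) x"
        unfolding kE using app_diff_left[OF K(1) W(1) Wv, of x] by simp
      finally show "app (\<lambda>x y. kpow K (Suc n) x y - kpow W (Suc n) x y) v x
        = app K (app ?E v) x + app ?D (app (kpow W n) v) x" .
    qed
    have Ev: "bfun (app ?E v)" by (intro bfun_app bE v)
    have 1: "\<bar>ip u (app K (app ?E v))\<bar> \<le> C * 1 * (real (Suc n) * C ^ n * e)"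
      unfolding app_selfadjoint[OF K(1,2) u(1) Ev, symmetric]
    proof (rule cut_bounded_scaled[OF Suc])
      show "\<bar>app K u x\<bar> \<le> C" for x using app_abs_le'[OF K(1) u(1) K(3) u(2)[rule_format]] by simp
    qed (use v C in \<open>auto intro: bfun_app K u\<close>)
    have 2: "\<bar>ip u (app ?D (app (kpow W n) v))\<bar> \<le> 1 * C ^ Suc n * e"
    proof (rule cut_bounded_scaled[OF D])
      show "\<bar>app (kpow W n) v x\<bar> \<le> C ^ Suc n" for x
        using app_abs_le'[OF bker_kpow[OF W(1)] v(1) kpow_abs_le[OF W(1,2)] v(2)[rule_format]] by simp
    qed (use u C Wv in auto)
    have "ip u (app (\<lambda>x y. kpow K (Suc n) x y - kpow W (Suc n) x y) v)
      = ip u (app K (app ?E v)) + ip u (app ?D (app (kpow W n) v))"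
      unfolding split by (intro ip_add_right u bfun_app K bE v bD bker_kpow W)
    then have "\<bar>ip u (app (\<lambda>x y. kpow K (Suc n) x y - kpow W (Suc n) x y) v)\<bar>
      \<le> C * 1 * (real (Suc n) * C ^ n * e) + 1 * C ^ Suc n * e"
      using 1 2 by linarith
    also have "\<dots> = real (Suc (Suc n)) * C ^ Suc n * e" by (simp add: algebra_simps)
    finally show "\<bar>ip u (app (\<lambda>x y. kpow K (Suc n) x y - kpow W (Suc n) x y) v)\<bar> \<le> real (Suc (Suc n)) * C ^ Suc n * e" .
  qed
qed (use D in simp)

lemma ktr_commute: assumes "bker K" "bker L" shows "ktr (kcomp K L) = ktr (kcomp L K)"
proof -
  have "ktr (kcomp K L) = (\<integral>z. \<integral>x. K x z * L z x \<partial>M \<partial>M)"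
    unfolding ktr_def kcomp_def by (intro integral_swap bker_mult bker_swap[OF assms(2)] assms)
  then show ?thesis unfolding ktr_def kcomp_def by (simp add: mult.commute)
qed

lemma ktr_diff: "bker K \<Longrightarrow> bker L \<Longrightarrow> ktr (\<lambda>x y. K x y - L x y) = ktr K - ktr L"
  unfolding ktr_def by (intro Bochner_Integration.integral_diff bfun_integrable bker_diag)

text \<open>
  Each diagonal entry is the bilinear form of \<open>E\<close> at a row of \<open>K\<close> and a column of \<open>L\<close>.
\<close>

lemma ktr_sandwich_le:
  assumes "bker K" "bker E" "bker L" "\<And>x y. \<bar>K x y\<bar> \<le> a" "\<And>x y. \<bar>L x y\<bar> \<le> b" "cut_bounded E e" "0 < a" "0 < b"
  shows "\<bar>ktr (kcomp K (kcomp E L))\<bar> \<le> a * b * e"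
proof -
  have "\<bar>\<integral>x. kcomp K (kcomp E L) x x \<partial>M\<bar> \<le> a * b * e"
  proof (rule integral_abs_le)
    show "bfun (\<lambda>x. kcomp K (kcomp E L) x x)" by (intro bker_diag[OF bker_kcomp] bker_kcomp assms)
    show "\<bar>kcomp K (kcomp E L) x x\<bar> \<le> a * b * e" for x
      using cut_bounded_scaled[OF assms(6) bker_row[OF assms(1)] assms(4) bker_col[OF assms(3)] assms(5,7,8)]
      unfolding kcomp_eq_app[of K] ip_def app_def kcomp_def .
  qed
  then show ?thesis unfolding ktr_def .
qed

text \<open>
  The difference telescopes into three traces. In a product of at least three factors, cyclicity of the trace
  brings a bounded kernel to each side of the factor that is small in the cut norm. The square of a kernel leaves
  no room for this, and its trace is not continuous in the cut norm.
\<close>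

lemma ktr_kpow_diff_le:
  assumes K: "bker K" "ksym K" "\<And>x y. \<bar>K x y\<bar> \<le> C" and W: "bker W" "\<And>x y. \<bar>W x y\<bar> \<le> C"
    and D: "cut_bounded (\<lambda>x y. K x y - W x y) e" and C: "1 \<le> C"
  shows "\<bar>ktr (kpow K (n + 2)) - ktr (kpow W (n + 2))\<bar> \<le> real (n + 3) * C ^ (n + 2) * e"
proof -
  let ?E = "\<lambda>x y. kpow K n x y - kpow W n x y" and ?D = "\<lambda>x y. K x y - W x y"
  have bE: "bker ?E" by (intro bker_diff bker_kpow K W)
  have bD: "bker ?D" by (intro bker_diff K W)
  note b = bker_kcomp bker_kpow K(1) W(1) bE bD
  have C0: "0 < C" using C by simp
  have s: "kpow L (n + 2) = kcomp L (kcomp (kpow L n) L)" if "bker L" for L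
    using kpow_add[OF that, of n 0] by simp
  have 1: "\<bar>ktr (kcomp K (kcomp ?E K))\<bar> \<le> C * C * (real (Suc n) * C ^ n * e)"
    by (intro ktr_sandwich_le K bE cut_bounded_kpow W D C C0)
  have 2: "\<bar>ktr (kcomp K (kcomp ?D (kpow W n)))\<bar> \<le> C * C ^ Suc n * e"
    by (intro ktr_sandwich_le b K(3) kpow_abs_le W(2) D zero_less_power C0)
  have 3: "\<bar>ktr (kcomp (kpow W n) (kcomp ?D W))\<bar> \<le> C ^ Suc n * C * e"
    by (intro ktr_sandwich_le b kpow_abs_le W(2) D zero_less_power C0)
  have e1: "ktr (kcomp K (kcomp ?E K)) = ktr (kcomp K (kcomp (kpow K n) K)) - ktr (kcomp K (kcomp (kpow W n) K))"
  proof -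
    have "kcomp ?E K = (\<lambda>x y. kcomp (kpow K n) K x y - kcomp (kpow W n) K x y)"
      by (intro ext kcomp_diff_left b)
    then have "kcomp K (kcomp ?E K) = (\<lambda>x y. kcomp K (kcomp (kpow K n) K) x y - kcomp K (kcomp (kpow W n) K) x y)"
      by (auto intro!: ext kcomp_diff_right b)
    then show ?thesis by (simp add: ktr_diff b)
  qed
  have e2: "ktr (kcomp K (kcomp ?D (kpow W n))) = ktr (kcomp K (kcomp (kpow W n) K)) - ktr (kcomp W (kcomp (kpow W n) K))"
  proof -
    have "ktr (kcomp K (kcomp ?D (kpow W n))) = ktr (kcomp ?D (kcomp (kpow W n) K))"
      by (subst ktr_commute) (simp_all add: b kcomp_assoc)
    also have "kcomp ?D (kcomp (kpow W n) K) = (\<lambda>x y. kcomp K (kcomp (kpow W n) K) x y - kcomp W (kcomp (kpow W n) K) x y)"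
      by (intro ext kcomp_diff_left b)
    finally show ?thesis by (simp add: ktr_diff b)
  qed
  have e3: "ktr (kcomp (kpow W n) (kcomp ?D W)) = ktr (kcomp W (kcomp (kpow W n) K)) - ktr (kcomp W (kcomp (kpow W n) W))"
  proof -
    have "ktr (kcomp (kpow W n) (kcomp ?D W)) = ktr (kcomp (kcomp (kpow W n) ?D) W)"
      by (simp add: b kcomp_assoc)
    also have "\<dots> = ktr (kcomp W (kcomp (kpow W n) ?D))" by (rule ktr_commute) (intro b)+
    also have "kcomp (kpow W n) ?D = (\<lambda>x y. kcomp (kpow W n) K x y - kcomp (kpow W n) W x y)"
      by (intro ext kcomp_diff_right b)
    also have "kcomp W (\<lambda>x y. kcomp (kpow W n) K x y - kcomp (kpow W n) W x y)
      = (\<lambda>x y. kcomp W (kcomp (kpow W n) K) x y - kcomp W (kcomp (kpow W n) W) x y)"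
      by (intro ext kcomp_diff_right b)
    finally show ?thesis by (simp add: ktr_diff b)
  qed
  have "\<bar>ktr (kpow K (n + 2)) - ktr (kpow W (n + 2))\<bar>
    \<le> C * C * (real (Suc n) * C ^ n * e) + C * C ^ Suc n * e + C ^ Suc n * C * e"
    unfolding s[OF K(1)] s[OF W(1)] using 1 2 3 e1 e2 e3 by linarith
  also have "\<dots> = real (n + 3) * C ^ (n + 2) * e" by (simp add: algebra_simps power2_eq_square)
  finally show ?thesis .
qed

lemma ktr_kpow_tendsto:
  assumes K: "\<And>n. bker (K n)" "\<And>n. ksym (K n)" "\<And>n x y. \<bar>K n x y\<bar> \<le> C" and W: "bker W" "\<And>x y. \<bar>W x y\<bar> \<le> C"
    and D: "\<And>e. 0 < e \<Longrightarrow> \<forall>\<^sub>F n in sequentially. cut_bounded (\<lambda>x y. K n x y - W x y) e" and m: "2 \<le> m"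
  shows "(\<lambda>n. ktr (kpow (K n) m)) \<longlonglongrightarrow> ktr (kpow W m)"
proof (rule LIMSEQ_I)
  fix r :: real assume r: "0 < r"
  define B where "B = max C 1"
  define c where "c = real (m + 1) * B ^ m"
  have B: "1 \<le> B" unfolding B_def by simp
  have c: "0 < c" unfolding c_def using B by simp
  have "0 < r / (2 * c)" using r c by simp
  from D[OF this] obtain N where N: "\<And>n. n \<ge> N \<Longrightarrow> cut_bounded (\<lambda>x y. K n x y - W x y) (r / (2 * c))"
    unfolding eventually_sequentially by auto
  show "\<exists>N. \<forall>n\<ge>N. norm (ktr (kpow (K n) m) - ktr (kpow W m)) < r"
  proof (intro exI[of _ N] allI impI)
    fix n assume n: "N \<le> n"
    have KB: "\<bar>K n x y\<bar> \<le> B" for x y using K(3)[of n x y] unfolding B_def by simp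
    have WB: "\<bar>W x y\<bar> \<le> B" for x y using W(2)[of x y] unfolding B_def by simp
    have "\<bar>ktr (kpow (K n) (m - 2 + 2)) - ktr (kpow W (m - 2 + 2))\<bar> \<le> real (m - 2 + 3) * B ^ (m - 2 + 2) * (r / (2 * c))"
      by (rule ktr_kpow_diff_le[OF K(1,2) KB W(1) WB N[OF n] B])
    moreover have "m - 2 + 2 = m" "m - 2 + 3 = m + 1" using m by auto
    ultimately have "\<bar>ktr (kpow (K n) m) - ktr (kpow W m)\<bar> \<le> c * (r / (2 * c))" unfolding c_def by (simp only:)
    also have "\<dots> < r" using c r by simp
    finally show "norm (ktr (kpow (K n) m) - ktr (kpow W m)) < r" by simp
  qed
qed

end

section \<open>Lebesgue measure on the unit interval and Borel versions of graphons\<close>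

text \<open>
  A density on the whole line, rather than a restriction to the interval, so that the underlying space is the
  whole type.
\<close>

definition U :: "real measure" where "U = density lborel (indicator {0..1})"

lemma space_U [simp]: "space U = UNIV" by (simp add: U_def)
lemma sets_U [simp, measurable_cong]: "sets U = sets borel" by (simp add: U_def)

lemma prob_space_U: "prob_space U"
proof
  show "emeasure U (space U) = 1"
    unfolding U_def by (subst emeasure_density) (auto simp: nn_integral_indicator)
qed

interpretation U: kernel_space U
  by (intro kernel_space.intro kernel_space_axioms.intro prob_space_U) simp

lemma AE_U: "(AE x in U. P x) \<longleftrightarrow> (AE x in lborel. x \<in> {0..1} \<longrightarrow> P x)"
  unfolding U_def by (subst AE_density) (auto simp: indicator_def)

lemma AE_lebesgue_on_iff:
  assumes "S \<in> sets borel"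
  shows "(AE x in lebesgue_on S. P x) \<longleftrightarrow> (AE x in lborel. x \<in> S \<longrightarrow> P x)"
proof -
  have "S \<in> sets lebesgue" using assms by (simp add: sets_completionI_sets)
  then show ?thesis by (subst AE_restrict_space_iff) (auto simp: AE_completion_iff)
qed

lemma AE_U_lebesgue: "(AE x in lebesgue_on {0..1}. P x) \<longleftrightarrow> (AE x in U. P x)"
  by (simp add: AE_lebesgue_on_iff AE_U)

lemma UU_eq: "U \<Otimes>\<^sub>M U = density lborel (indicator ({0..1} \<times> {0..1}))"
proof -
  have "sigma_finite_measure U" by unfold_locales
  then have "U \<Otimes>\<^sub>M U = density (lborel \<Otimes>\<^sub>M lborel) (\<lambda>(x, y). indicator {0..1} x * indicator {0..1} y)"
    unfolding U_def by (intro pair_measure_density lborel.sigma_finite_measure_axioms) auto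
  also have "(\<lambda>(x, y). indicator {0..1::real} x * indicator {0..1::real} y :: ennreal) = indicator ({0..1} \<times> {0..1})"
    by (auto simp: indicator_def fun_eq_iff)
  finally show ?thesis by (simp add: lborel_prod)
qed

lemma sq_borel: "{0..1::real} \<times> {0..1::real} \<in> sets borel"
  by (intro borel_closed closed_Times) auto

lemma AE_UU: "(AE p in U \<Otimes>\<^sub>M U. P p) \<longleftrightarrow> (AE p in lborel. p \<in> {0..1} \<times> {0..1} \<longrightarrow> P p)"
  unfolding UU_eq using sq_borel by (subst AE_density) (auto simp: indicator_def)

lemma measurable_completion_AE:
  assumes g: "g \<in> borel_measurable M" and ae: "AE x in M. f x = g x"
  shows "f \<in> borel_measurable (completion M)"
proof (rule measurableI)
  fix S :: "'b set" assume S: "S \<in> sets borel"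
  show "f -` S \<inter> space (completion M) \<in> sets (completion M)"
  proof (rule completion.in_sets_AE)
    show "AE x in completion M. x \<in> g -` S \<inter> space M \<longleftrightarrow> x \<in> f -` S \<inter> space (completion M)"
      using AE_completion[OF ae] by eventually_elim auto
    show "g -` S \<inter> space M \<in> sets (completion M)"
      using measurable_sets[OF g S] by (rule sets_completionI_sets)
  qed simp
qed simp

lemma indicator_AE:
  fixes f g :: "'a::euclidean_space \<Rightarrow> real"
  assumes "AE x in lborel. x \<in> S \<longrightarrow> f x = g x"
  shows "AE x in lborel. indicator S x *\<^sub>R f x = indicator S x *\<^sub>R g x"
  using assms by eventually_elim (auto simp: indicator_def)

lemma lebesgue_on_measurable:
  fixes f g :: "'a::euclidean_space \<Rightarrow> real"
  assumes S: "S \<in> sets borel" and g: "g \<in> borel_measurable borel" and ae: "AE x in lborel. x \<in> S \<longrightarrow> f x = g x"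
  shows "(\<lambda>x. indicator S x *\<^sub>R f x) \<in> borel_measurable lebesgue" "f \<in> borel_measurable (lebesgue_on S)"
proof -
  show 1: "(\<lambda>x. indicator S x *\<^sub>R f x) \<in> borel_measurable lebesgue"
    by (rule measurable_completion_AE[OF _ indicator_AE[OF ae]]) (use S g in measurable)
  have "S \<in> sets lebesgue" using S by (simp add: sets_completionI_sets)
  then show "f \<in> borel_measurable (lebesgue_on S)"
    using 1 by (simp add: borel_measurable_restrict_space_iff)
qed

lemma integral_lebesgue_on:
  fixes f g :: "'a::euclidean_space \<Rightarrow> real"
  assumes S: "S \<in> sets borel" and g: "g \<in> borel_measurable borel" and ae: "AE x in lborel. x \<in> S \<longrightarrow> f x = g x"
  shows "integral\<^sup>L (lebesgue_on S) f = integral\<^sup>L (density lborel (indicator S)) g"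
proof -
  have S': "S \<in> sets lebesgue" using S by (simp add: sets_completionI_sets)
  have gm: "(\<lambda>x. indicator S x *\<^sub>R g x) \<in> borel_measurable lborel" using S g by measurable
  have "integral\<^sup>L (lebesgue_on S) f = integral\<^sup>L lebesgue (\<lambda>x. indicator S x *\<^sub>R f x)"
    using S' by (subst integral_restrict_space) auto
  also have "\<dots> = integral\<^sup>L lebesgue (\<lambda>x. indicator S x *\<^sub>R g x)"
    by (intro integral_cong_AE lebesgue_on_measurable[OF assms] measurable_completion[OF gm])
      (use indicator_AE[OF ae] in \<open>simp add: AE_completion_iff\<close>)
  also have "\<dots> = integral\<^sup>L lborel (\<lambda>x. indicator S x *\<^sub>R g x)"
    by (rule integral_completion[OF gm])
  also have "\<dots> = integral\<^sup>L (density lborel (\<lambda>x. ennreal (indicator S x))) g"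
    using S g by (subst integral_density) auto
  also have "(\<lambda>x. ennreal (indicator S x)) = indicator S" by (auto simp: indicator_def)
  finally show ?thesis .
qed

lemma integrable_lebesgue_on:
  fixes f g :: "'a::euclidean_space \<Rightarrow> real"
  assumes S: "S \<in> sets borel" and g: "g \<in> borel_measurable borel" and ae: "AE x in lborel. x \<in> S \<longrightarrow> f x = g x"
  shows "integrable (lebesgue_on S) f \<longleftrightarrow> integrable (density lborel (indicator S)) g"
proof -
  have S': "S \<in> sets lebesgue" using S by (simp add: sets_completionI_sets)
  have gm: "(\<lambda>x. indicator S x *\<^sub>R g x) \<in> borel_measurable lborel" using S g by measurable
  have "integrable (lebesgue_on S) f \<longleftrightarrow> integrable lebesgue (\<lambda>x. indicator S x *\<^sub>R f x)"
    using S' by (subst integrable_restrict_space) auto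
  also have "\<dots> \<longleftrightarrow> integrable lebesgue (\<lambda>x. indicator S x *\<^sub>R g x)"
    by (intro integrable_cong_AE lebesgue_on_measurable[OF assms] measurable_completion[OF gm])
      (use indicator_AE[OF ae] in \<open>simp add: AE_completion_iff\<close>)
  also have "\<dots> \<longleftrightarrow> integrable lborel (\<lambda>x. indicator S x *\<^sub>R g x)"
    by (rule integrable_completion[OF gm])
  also have "\<dots> \<longleftrightarrow> integrable (density lborel (\<lambda>x. ennreal (indicator S x))) g"
    using S g by (subst integrable_density) auto
  also have "(\<lambda>x. ennreal (indicator S x)) = indicator S" by (auto simp: indicator_def)
  finally show ?thesis .
qed

lemma integral_lebesgue_on_U:
  fixes g :: "real \<Rightarrow> real"
  assumes "g \<in> borel_measurable borel" "AE x in U. f x = g x"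
  shows "integral\<^sup>L (lebesgue_on {0..1}) f = integral\<^sup>L U g"
  unfolding U_def using assms by (intro integral_lebesgue_on) (auto simp: AE_U)

lemma integrable_lebesgue_on_U:
  fixes g :: "real \<Rightarrow> real"
  assumes "g \<in> borel_measurable borel" "AE x in U. f x = g x"
  shows "integrable (lebesgue_on {0..1}) f \<longleftrightarrow> integrable U g"
  unfolding U_def using assms by (intro integrable_lebesgue_on) (auto simp: AE_U)

lemma measurable_lebesgue_on_U:
  fixes g :: "real \<Rightarrow> real"
  assumes "g \<in> borel_measurable borel" "AE x in U. f x = g x"
  shows "f \<in> borel_measurable (lebesgue_on {0..1})"
  using assms by (intro lebesgue_on_measurable(2)) (auto simp: AE_U)

lemma borel_version_U:
  fixes f :: "real \<Rightarrow> real"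
  assumes "f \<in> borel_measurable (lebesgue_on {0..1})"
  obtains g where "g \<in> borel_measurable borel" "AE x in U. f x = g x"
proof -
  have "(\<lambda>x. indicator {0..1} x *\<^sub>R f x) \<in> borel_measurable lebesgue"
    using assms by (simp add: borel_measurable_restrict_space_iff)
  from completion_ex_borel_measurable_real[OF this]
  obtain g where "g \<in> borel_measurable lborel" "AE x in lborel. indicator {0..1} x *\<^sub>R f x = g x" by blast
  then show thesis by (intro that[of g]) (auto simp: AE_U elim!: eventually_mono)
qed

lemma integral_lebesgue_on_UU:
  fixes g :: "real \<times> real \<Rightarrow> real"
  assumes "g \<in> borel_measurable borel" "AE p in U \<Otimes>\<^sub>M U. f p = g p"
  shows "integral\<^sup>L (lebesgue_on ({0..1} \<times> {0..1})) f = integral\<^sup>L (U \<Otimes>\<^sub>M U) g"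
  unfolding UU_eq using assms by (intro integral_lebesgue_on sq_borel) (auto simp: AE_UU)

lemma dint_eq_integral: assumes "U.bker K" shows "integral\<^sup>L (U \<Otimes>\<^sub>M U) (case_prod K) = U.dint K"
proof -
  have "integral\<^sup>L (U \<Otimes>\<^sub>M U) (case_prod K) = (\<integral>x. \<integral>y. case_prod K (x, y) \<partial>U \<partial>U)"
    by (rule U.MM.integral_fst'[OF U.bker_integrable[OF assms], symmetric])
  then show ?thesis by (simp add: U.dint_def)
qed

lemma measurable_UU: "f \<in> borel_measurable (U \<Otimes>\<^sub>M U) \<longleftrightarrow> f \<in> borel_measurable (borel :: (real \<times> real) measure)"
proof -
  have "sets (U \<Otimes>\<^sub>M U) = sets (borel :: (real \<times> real) measure)"
    unfolding UU_eq by simp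
  then show ?thesis by (metis measurable_cong_sets)
qed

text \<open>
  A graphon is Lebesgue measurable on the square and arbitrary outside, and it may be changed on a null set: a
  Borel version is cut off at \<open>0\<close> and \<open>1\<close> and then averaged with its transpose.
\<close>

lemma graphon_borel_version:
  assumes W: "graphon W"
  obtains V where "U.bker V" "U.ksym V" "\<And>x y. 0 \<le> V x y" "\<And>x y. V x y \<le> 1"
    "AE p in U \<Otimes>\<^sub>M U. W (fst p) (snd p) = V (fst p) (snd p)"
proof -
  have W1: "\<And>x y. x \<in> {0..1} \<Longrightarrow> y \<in> {0..1} \<Longrightarrow> W x y = W y x \<and> 0 \<le> W x y \<and> W x y \<le> 1"
    and Wm: "(\<lambda>(x, y). W x y) \<in> borel_measurable (lebesgue_on ({0..1} \<times> {0..1}))"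
    using W by (auto simp: graphon_def)
  have sq: "{0..1::real} \<times> {0..1::real} \<in> sets lebesgue" using sq_borel by (simp add: sets_completionI_sets)
  have "(\<lambda>p. indicator ({0..1} \<times> {0..1}) p *\<^sub>R (case p of (x, y) \<Rightarrow> W x y)) \<in> borel_measurable lebesgue"
    using Wm sq by (simp add: borel_measurable_restrict_space_iff)
  from completion_ex_borel_measurable_real[OF this]
  obtain g where g: "g \<in> borel_measurable lborel"
    and ae: "AE p in lborel. indicator ({0..1} \<times> {0..1}) p *\<^sub>R (case p of (x, y) \<Rightarrow> W x y) = g p" by blast
  define c where "c x y = max 0 (min 1 (g (x, y)))" for x y
  define V where "V x y = (c x y + c y x) / 2" for x y
  have c: "0 \<le> c x y" "c x y \<le> 1" for x y by (auto simp: c_def)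
  have gm: "g \<in> borel_measurable (U \<Otimes>\<^sub>M U)" using g by (simp add: measurable_UU)
  have cm: "case_prod c \<in> borel_measurable (U \<Otimes>\<^sub>M U)"
    unfolding c_def split_beta' using gm by simp
  have bc: "U.bker c" by (rule U.bkerI[OF cm, of 1]) (use c in simp)
  have ae1: "AE p in U \<Otimes>\<^sub>M U. W (fst p) (snd p) = c (fst p) (snd p)"
    unfolding AE_UU using ae
  proof eventually_elim
    case (elim p)
    then show ?case using W1[of "fst p" "snd p"] by (auto simp: c_def split_beta split: split_indicator_asm)
  qed
  have ae2: "AE p in U \<Otimes>\<^sub>M U. W (snd p) (fst p) = c (snd p) (fst p)"
  proof -
    have "AE p in distr (U \<Otimes>\<^sub>M U) (U \<Otimes>\<^sub>M U) (\<lambda>(x, y). (y, x)). W (fst p) (snd p) = c (fst p) (snd p)"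
      unfolding U.MM.distr_pair_swap[symmetric] by (rule ae1)
    then have "AE p in U \<Otimes>\<^sub>M U. (\<lambda>q. W (fst q) (snd q) = c (fst q) (snd q)) ((\<lambda>(x, y). (y, x)) p)"
      by (rule AE_distrD[rotated]) simp
    then show ?thesis by (simp add: split_beta)
  qed
  have sqae: "AE p in U \<Otimes>\<^sub>M U. p \<in> {0..1} \<times> {0..1}" unfolding AE_UU by simp
  show thesis
  proof (rule that[of V])
    show "U.bker V" unfolding V_def by (intro U.bker_divide U.bker_add bc U.bker_swap[OF bc])
    show "U.ksym V" by (simp add: V_def U.ksym_def add.commute)
    show "0 \<le> V x y" "V x y \<le> 1" for x y using c[of x y] c[of y x] by (auto simp: V_def)
    show "AE p in U \<Otimes>\<^sub>M U. W (fst p) (snd p) = V (fst p) (snd p)"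
      using ae1 ae2 sqae
    proof eventually_elim
      case (elim p)
      then show ?case using W1[of "fst p" "snd p"] by (auto simp: V_def)
    qed
  qed
qed

text \<open>
  The index of the cell \<open>((i - 1) / N, i / N]\<close> that contains a point of \<open>(0, 1]\<close>, forced into \<open>{1..N}\<close> for
  all other points.
\<close>

definition idx :: "nat \<Rightarrow> real \<Rightarrow> nat" where
  "idx N x = max 1 (min N (nat \<lceil>real N * x\<rceil>))"

lemma idx_range: "N \<ge> 1 \<Longrightarrow> idx N x \<in> {1..N}" by (auto simp: idx_def)

lemma idx_eq_iff:
  assumes "N \<ge> 1" "0 < x" "x \<le> 1" "i \<in> {1..N}"
  shows "idx N x = i \<longleftrightarrow> (real i - 1) / real N < x \<and> x \<le> real i / real N"
proof -
  have N: "0 < real N" using assms by simp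
  have "0 < real N * x" using N assms by simp
  then have c1: "1 \<le> \<lceil>real N * x\<rceil>" by (simp add: less_ceiling_iff)
  have "real N * x \<le> real N" using N assms by simp
  then have c2: "\<lceil>real N * x\<rceil> \<le> int N" by (simp add: ceiling_le_iff)
  have "idx N x = nat \<lceil>real N * x\<rceil>" using c1 c2 unfolding idx_def by linarith
  then have "idx N x = i \<longleftrightarrow> \<lceil>real N * x\<rceil> = int i" using c1 by auto
  also have "\<dots> \<longleftrightarrow> real i - 1 < real N * x \<and> real N * x \<le> real i"
    by (auto simp: ceiling_eq_iff)
  also have "\<dots> \<longleftrightarrow> (real i - 1) / real N < x \<and> x \<le> real i / real N"
    using N by (simp add: field_simps)
  finally show ?thesis .
qed

lemma idx_measurable [measurable]: "idx N \<in> measurable borel (count_space UNIV)"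
  unfolding idx_def[abs_def] by measurable

lemma AE_U_pos: "AE x in U. 0 < x \<and> x \<le> 1"
proof -
  have "AE x in lborel. x \<noteq> (0::real)" by (rule AE_lborel_singleton)
  then show ?thesis unfolding AE_U by eventually_elim auto
qed

lemma integral_idx:
  fixes g :: "nat \<Rightarrow> real"
  assumes N: "N \<ge> 1"
  shows "(\<integral>x. g (idx N x) \<partial>U) = (\<Sum>i=1..N. g i) / real N"
proof -
  let ?I = "\<lambda>i. {(real i - 1) / real N<..real i / real N}"
  have m: "measure U (?I i) = 1 / real N" if "i \<in> {1..N}" for i
  proof -
    have "0 \<le> (real i - 1) / real N" "real i / real N \<le> 1" using that N by auto
    then have "{0..1} \<inter> ?I i = ?I i" by auto
    moreover have "emeasure U (?I i) = emeasure lborel ({0..1} \<inter> ?I i)"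
      unfolding U_def by (subst emeasure_density) (auto simp: indicator_inter_arith[symmetric] mult.commute nn_integral_indicator)
    ultimately have "emeasure U (?I i) = ennreal (1 / real N)"
      using N by (simp add: emeasure_lborel_Ioc divide_right_mono diff_divide_distrib[symmetric])
    then show ?thesis by (simp add: measure_def)
  qed
  have "(\<integral>x. g (idx N x) \<partial>U) = (\<integral>x. (\<Sum>i=1..N. g i * indicator (?I i) x) \<partial>U)"
  proof (rule integral_cong_AE)
    show "AE x in U. g (idx N x) = (\<Sum>i=1..N. g i * indicator (?I i) x)"
      using AE_U_pos
    proof eventually_elim
      case (elim x)
      have "(\<Sum>i=1..N. g i * indicator (?I i) x) = (\<Sum>i=1..N. if i = idx N x then g i else 0)"
        using idx_eq_iff[OF N, of x] elim by (intro sum.cong refl) (auto simp: indicator_def)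
      also have "\<dots> = g (idx N x)" using idx_range[OF N, of x] by simp
      finally show ?case ..
    qed
  qed measurable
  also have "\<dots> = (\<Sum>i=1..N. g i * measure U (?I i))"
    by (subst Bochner_Integration.integral_sum) (auto simp: U.emeasure_eq_measure)
  also have "\<dots> = (\<Sum>i=1..N. g i) / real N" by (simp add: m sum_divide_distrib)
  finally show ?thesis .
qed

section \<open>Riemann integrability and step kernels\<close>

definition cell :: "nat \<Rightarrow> nat \<Rightarrow> real set" where
  "cell N i = {(real i - 1) / real N..real i / real N}"

lemma cell_end: assumes "N \<ge> 1" "i \<in> {1..N}" shows "real i / real N \<in> cell N i"
  using assms by (auto simp: cell_def divide_right_mono)

lemma cell_subset: assumes "N \<ge> 1" "i \<in> {1..N}" shows "cell N i \<subseteq> {0..1}"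
proof -
  have "0 \<le> (real i - 1) / real N" "real i / real N \<le> 1" using assms by auto
  then show ?thesis by (auto simp: cell_def)
qed

lemma cell_dist: assumes "N \<ge> 1" "x \<in> cell N i" "y \<in> cell N i" shows "dist x y \<le> 1 / real N"
proof -
  have "real i / real N - (real i - 1) / real N = 1 / real N" by (simp add: diff_divide_distrib[symmetric])
  then show ?thesis using assms unfolding cell_def dist_real_def by auto
qed

lemma cell_inj: assumes "N \<ge> 1" "cell N i = cell N j" shows "i = j"
proof -
  have ne: "(real i - 1) / real N \<le> real i / real N" by (simp add: divide_right_mono)
  then have "real i / real N = real j / real N" using assms(2) unfolding cell_def by (simp add: Icc_eq_Icc)
  then show ?thesis using assms by simp
qed

lemma cell_interior_disjoint:
  assumes "N \<ge> 1" "i \<noteq> j" shows "interior (cell N i) \<inter> interior (cell N j) = {}"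
proof -
  have "False" if x: "(real i - 1) / real N < x" "x < real i / real N" "(real j - 1) / real N < x" "x < real j / real N" for x
  proof -
    have "real i - 1 < x * real N" "x * real N < real i" "real j - 1 < x * real N" "x * real N < real j"
      using x assms by (simp_all add: field_simps)
    then have "real i - 1 < real j" "real j - 1 < real i" by linarith+
    then show False using assms(2) by linarith
  qed
  note F = this
  show ?thesis
  proof (rule equals0I)
    fix x assume "x \<in> interior (cell N i) \<inter> interior (cell N j)"
    then show False using F[of x] by (simp add: cell_def)
  qed
qed

lemma cell_cover: assumes "N \<ge> 1" shows "(\<Union>i\<in>{1..N}. cell N i) = {0..1}"
proof
  show "(\<Union>i\<in>{1..N}. cell N i) \<subseteq> {0..1}" using cell_subset[OF assms] by blast
  show "{0..1} \<subseteq> (\<Union>i\<in>{1..N}. cell N i)"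
  proof
    fix x :: real assume x: "x \<in> {0..1}"
    show "x \<in> (\<Union>i\<in>{1..N}. cell N i)"
    proof (cases "x = 0")
      case True
      have "x \<in> cell N 1" using True by (simp add: cell_def)
      then show ?thesis using assms by auto
    next
      case False
      then have "(real (idx N x) - 1) / real N < x \<and> x \<le> real (idx N x) / real N"
        using idx_eq_iff[OF assms, of x "idx N x"] idx_range[OF assms] x by simp
      then have "x \<in> cell N (idx N x)" by (simp add: cell_def)
      then show ?thesis using idx_range[OF assms] by blast
    qed
  qed
qed

lemma emeasure_cell: assumes "N \<ge> 1" shows "emeasure lborel (cell N i) = ennreal (1 / real N)"
proof -
  have "real i / real N - (real i - 1) / real N = 1 / real N" by (simp add: diff_divide_distrib[symmetric])
  then show ?thesis unfolding cell_def by (simp add: divide_right_mono)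
qed

lemma measure_cell: assumes "N \<ge> 1" shows "measure lborel (cell N i) = 1 / real N"
  using emeasure_cell[OF assms] by (simp add: measure_def)

lemma measure_cell_times: assumes "N \<ge> 1" shows "measure lborel (cell N i \<times> cell N j) = 1 / (real N)\<^sup>2"
proof -
  have m: "cell N i \<in> sets lborel" for i by (simp add: cell_def)
  have "emeasure lborel (cell N i \<times> cell N j) = emeasure (lborel \<Otimes>\<^sub>M lborel) (cell N i \<times> cell N j)"
    by (simp add: lborel_prod)
  also have "\<dots> = ennreal (1 / real N) * ennreal (1 / real N)"
    by (subst lborel.emeasure_pair_measure_Times[OF m m]) (simp add: emeasure_cell[OF assms])
  also have "\<dots> = ennreal (1 / (real N)\<^sup>2)" by (simp add: ennreal_mult[symmetric] power2_eq_square)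
  finally show ?thesis by (simp add: measure_def)
qed

text \<open>
  A constant gauge is respected by the uniform partition with right end points as tags.
\<close>

lemma riemann_sum_tendsto:
  assumes "riemann_integrable f 0 (1::real)"
  obtains I where "(\<lambda>N. (\<Sum>i=1..N. f (real i / real N)) / real N) \<longlonglongrightarrow> I" "(f has_integral I) {0..1}"
proof -
  from assms obtain I where I: "\<And>e. e > 0 \<Longrightarrow> \<exists>d>0. \<forall>D. D tagged_division_of cbox 0 1 \<and> (\<lambda>x. ball x d) fine D \<longrightarrow>
        \<bar>(\<Sum>(x, K)\<in>D. measure lborel K * f x) - I\<bar> < e"
    unfolding riemann_integrable_def by blast
  have "(f has_integral I) (cbox 0 1)"
    unfolding has_integral
  proof (intro allI impI)
    fix e :: real assume "e > 0"
    from I[OF this] obtain d where d: "d > 0" "\<And>D. D tagged_division_of cbox 0 1 \<Longrightarrow> (\<lambda>x. ball x d) fine D \<Longrightarrow>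
        \<bar>(\<Sum>(x, K)\<in>D. measure lborel K * f x) - I\<bar> < e" by blast
    show "\<exists>\<gamma>. gauge \<gamma> \<and> (\<forall>\<D>. \<D> tagged_division_of cbox 0 1 \<and> \<gamma> fine \<D> \<longrightarrow>
        norm ((\<Sum>(x, k)\<in>\<D>. measure lborel k *\<^sub>R f x) - I) < e)"
      using d by (intro exI[of _ "\<lambda>x. ball x d"]) (simp add: gauge_ball)
  qed
  moreover have "(\<lambda>N. (\<Sum>i=1..N. f (real i / real N)) / real N) \<longlonglongrightarrow> I"
  proof (rule LIMSEQ_I)
    fix e :: real assume "e > 0"
    from I[OF this] obtain d where d: "d > 0" "\<And>D. D tagged_division_of cbox 0 1 \<Longrightarrow> (\<lambda>x. ball x d) fine D \<Longrightarrow>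
        \<bar>(\<Sum>(x, K)\<in>D. measure lborel K * f x) - I\<bar> < e" by blast
    obtain N0 where N0: "1 / real N0 < d" "N0 \<ge> 1"
      using reals_Archimedean[OF d(1)] by (metis One_nat_def Suc_leI inverse_eq_divide zero_less_Suc)
    show "\<exists>no. \<forall>N\<ge>no. norm ((\<Sum>i=1..N. f (real i / real N)) / real N - I) < e"
    proof (intro exI[of _ N0] allI impI)
      fix N assume "N \<ge> N0"
      then have N: "N \<ge> 1" and Nd: "1 / real N < d"
        using N0 frac_le[of 1 1 "real N0" "real N"] by auto
      define D where "D = (\<lambda>i. (real i / real N, cell N i)) ` {1..N}"
      have "D tagged_division_of cbox 0 1"
        unfolding tagged_division_of
      proof (intro conjI allI impI)
        show "finite D" by (simp add: D_def)
        show "x \<in> K" "K \<subseteq> cbox 0 1" "\<exists>a b. K = cbox a b" if xK: "(x, K) \<in> D" for x K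
        proof -
          obtain i where i: "i \<in> {1..N}" "x = real i / real N" "K = cell N i" using xK unfolding D_def by blast
          show "x \<in> K" "K \<subseteq> cbox 0 1" using cell_end[OF N i(1)] cell_subset[OF N i(1)] i by auto
          have "K = cbox ((real i - 1) / real N) (real i / real N)" using i by (simp add: cell_def)
          then show "\<exists>a b. K = cbox a b" by blast
        qed
        show "interior K1 \<inter> interior K2 = {}" if h: "(x1, K1) \<in> D \<and> (x2, K2) \<in> D \<and> (x1, K1) \<noteq> (x2, K2)" for x1 K1 x2 K2
        proof -
          obtain i where 1: "x1 = real i / real N" "K1 = cell N i" using h unfolding D_def by auto
          obtain j where 2: "x2 = real j / real N" "K2 = cell N j" using h unfolding D_def by auto
          have "i \<noteq> j" using h 1 2 by auto
          then show ?thesis unfolding 1 2 by (rule cell_interior_disjoint[OF N])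
        qed
        show "\<Union>{K. \<exists>x. (x, K) \<in> D} = cbox 0 1"
        proof -
          have "\<Union>{K. \<exists>x. (x, K) \<in> D} = (\<Union>i\<in>{1..N}. cell N i)" unfolding D_def by auto
          then show ?thesis unfolding cell_cover[OF N] by simp
        qed
      qed
      moreover have "(\<lambda>x. ball x d) fine D"
        unfolding fine_def
      proof (safe)
        fix x K y assume "(x, K) \<in> D" "y \<in> K"
        then obtain i where i: "i \<in> {1..N}" "x = real i / real N" "y \<in> cell N i" unfolding D_def by blast
        have "dist x y < d" using cell_dist[OF N cell_end[OF N i(1)] i(3)] i(2) Nd by simp
        then show "y \<in> ball x d" by simp
      qed
      ultimately have "\<bar>(\<Sum>(x, K)\<in>D. measure lborel K * f x) - I\<bar> < e" by (rule d(2))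
      moreover have "(\<Sum>(x, K)\<in>D. measure lborel K * f x) = (\<Sum>i=1..N. (1 / real N) * f (real i / real N))"
        unfolding D_def by (subst sum.reindex) (auto simp: inj_on_def measure_cell[OF N] dest: cell_inj[OF N])
      ultimately show "norm ((\<Sum>i=1..N. f (real i / real N)) / real N - I) < e"
        by (simp add: sum_divide_distrib)
    qed
  qed
  ultimately show thesis using that by simp
qed

text \<open>
  Two families of tags for the same fine uniform grid give Riemann sums that are both close to the integral. As
  the tags are chosen freely in each cell, the differences can be given a common sign, so that this bounds the
  average oscillation of \<open>W\<close> over the cells.
\<close>

lemma riemann_oscillation:
  fixes W :: "real \<Rightarrow> real \<Rightarrow> real"
  assumes "riemann_integrable (\<lambda>(x, y). W x y) (0, 0) (1, 1)" and e: "0 < e"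
  obtains N0 where "N0 \<ge> 1" "\<And>N s t. N \<ge> N0 \<Longrightarrow>
    (\<And>i j. i \<in> {1..N} \<Longrightarrow> j \<in> {1..N} \<Longrightarrow> s i j \<in> cell N i \<times> cell N j) \<Longrightarrow>
    (\<And>i j. i \<in> {1..N} \<Longrightarrow> j \<in> {1..N} \<Longrightarrow> t i j \<in> cell N i \<times> cell N j) \<Longrightarrow>
    (\<Sum>i=1..N. \<Sum>j=1..N. case_prod W (s i j) - case_prod W (t i j)) / (real N)\<^sup>2 < e"
proof -
  let ?f = "case_prod W"
  from assms(1) obtain I where I: "\<And>e. e > 0 \<Longrightarrow> \<exists>d>0. \<forall>D. D tagged_division_of cbox (0, 0) (1, 1) \<and> (\<lambda>x. ball x d) fine D \<longrightarrow>
        \<bar>(\<Sum>(x, K)\<in>D. measure lborel K * ?f x) - I\<bar> < e"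
    unfolding riemann_integrable_def by blast
  have "e / 2 > 0" using e by simp
  from I[OF this] obtain d where d: "d > 0" "\<And>D. D tagged_division_of cbox (0, 0) (1, 1) \<Longrightarrow> (\<lambda>x. ball x d) fine D \<Longrightarrow>
        \<bar>(\<Sum>(x, K)\<in>D. measure lborel K * ?f x) - I\<bar> < e / 2" by blast
  have d2: "d / 2 > 0" using d by simp
  obtain N0 where N0: "1 / real N0 < d / 2" "N0 \<ge> 1"
    using reals_Archimedean[OF d2] by (metis One_nat_def Suc_leI inverse_eq_divide zero_less_Suc)
  have key: "\<bar>(\<Sum>i=1..N. \<Sum>j=1..N. ?f (s i j)) / (real N)\<^sup>2 - I\<bar> < e / 2"
    if NN: "N \<ge> N0" and s: "\<And>i j. i \<in> {1..N} \<Longrightarrow> j \<in> {1..N} \<Longrightarrow> s i j \<in> cell N i \<times> cell N j" for N s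
  proof -
    have N: "N \<ge> 1" and Nd: "1 / real N < d / 2"
      using NN N0 frac_le[of 1 1 "real N0" "real N"] by auto
    define D where "D = (\<lambda>(i, j). (s i j, cell N i \<times> cell N j)) ` ({1..N} \<times> {1..N})"
    have ne: "cell N i \<noteq> {}" for i by (simp add: cell_def divide_right_mono)
    have tinj: "i = i' \<and> j = j'" if "cell N i \<times> cell N j = cell N i' \<times> cell N j'" for i j i' j'
      using that ne cell_inj[OF N] by (metis times_eq_iff)
    have "D tagged_division_of cbox (0, 0) (1, 1)"
      unfolding tagged_division_of
    proof (intro conjI allI impI)
      show "finite D" by (simp add: D_def)
      show "x \<in> K" if "(x, K) \<in> D" for x K using that s unfolding D_def by auto
      show "K \<subseteq> cbox (0, 0) (1, 1)" if h: "(x, K) \<in> D" for x K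
      proof -
        obtain i j where i: "i \<in> {1..N}" "j \<in> {1..N}" "K = cell N i \<times> cell N j" using h unfolding D_def by auto
        show ?thesis unfolding cbox_Pair_eq i(3) using cell_subset[OF N i(1)] cell_subset[OF N i(2)]
          by (simp add: Sigma_mono)
      qed
      show "\<exists>a b. K = cbox a b" if "(x, K) \<in> D" for x K
      proof -
        obtain i j where "K = cell N i \<times> cell N j" using \<open>(x, K) \<in> D\<close> unfolding D_def by auto
        then have "K = cbox ((real i - 1) / real N, (real j - 1) / real N) (real i / real N, real j / real N)"
          by (simp add: cell_def cbox_Pair_eq)
        then show ?thesis by blast
      qed
      show "interior K1 \<inter> interior K2 = {}" if h: "(x1, K1) \<in> D \<and> (x2, K2) \<in> D \<and> (x1, K1) \<noteq> (x2, K2)" for x1 K1 x2 K2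
      proof -
        obtain i j where 1: "x1 = s i j" "K1 = cell N i \<times> cell N j" using h unfolding D_def by auto
        obtain i' j' where 2: "x2 = s i' j'" "K2 = cell N i' \<times> cell N j'" using h unfolding D_def by auto
        have "i \<noteq> i' \<or> j \<noteq> j'" using h 1 2 by auto
        then have "interior (cell N i) \<inter> interior (cell N i') = {} \<or> interior (cell N j) \<inter> interior (cell N j') = {}"
          using cell_interior_disjoint[OF N, of i i'] cell_interior_disjoint[OF N, of j j'] by blast
        then show ?thesis unfolding 1 2 interior_Times by blast
      qed
      show "\<Union>{K. \<exists>x. (x, K) \<in> D} = cbox (0, 0) (1, 1)"
      proof -
        have "\<Union>{K. \<exists>x. (x, K) \<in> D} = (\<Union>i\<in>{1..N}. cell N i) \<times> (\<Union>j\<in>{1..N}. cell N j)"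
        proof -
          have "\<Union>{K. \<exists>x. (x, K) \<in> D} = \<Union>(snd ` D)" by force
          also have "snd ` D = (\<lambda>(i, j). cell N i \<times> cell N j) ` ({1..N} \<times> {1..N})"
            unfolding D_def image_image by (simp add: split_beta)
          also have "\<Union>\<dots> = (\<Union>i\<in>{1..N}. cell N i) \<times> (\<Union>j\<in>{1..N}. cell N j)" by auto
          finally show ?thesis .
        qed
        then show ?thesis unfolding cell_cover[OF N] cbox_Pair_eq by simp
      qed
    qed
    moreover have "(\<lambda>x. ball x d) fine D"
      unfolding fine_def
    proof (safe)
      fix x1 x2 K y1 y2 assume "((x1, x2), K) \<in> D" and y: "(y1, y2) \<in> K"
      then obtain i j where ij: "i \<in> {1..N}" "j \<in> {1..N}" "(x1, x2) = s i j" "K = cell N i \<times> cell N j" unfolding D_def by auto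
      then have x: "x1 \<in> cell N i" "x2 \<in> cell N j" using s[of i j] by (metis mem_Sigma_iff)+
      have y': "y1 \<in> cell N i" "y2 \<in> cell N j" using y ij by auto
      have "dist (x1, x2) (y1, y2) \<le> dist x1 y1 + dist x2 y2"
        unfolding dist_Pair_Pair by (intro order_trans[OF sqrt_sum_squares_le_sum]) auto
      also have "\<dots> < d" using cell_dist[OF N x(1) y'(1)] cell_dist[OF N x(2) y'(2)] Nd by linarith
      finally show "(y1, y2) \<in> ball (x1, x2) d" by simp
    qed
    ultimately have "\<bar>(\<Sum>(x, K)\<in>D. measure lborel K * ?f x) - I\<bar> < e / 2" by (rule d(2))
    moreover have "(\<Sum>(x, K)\<in>D. measure lborel K * ?f x) = (\<Sum>(i, j)\<in>{1..N} \<times> {1..N}. (1 / (real N)\<^sup>2) * ?f (s i j))"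
    proof -
      have "inj_on (\<lambda>(i, j). (s i j, cell N i \<times> cell N j)) ({1..N} \<times> {1..N})"
        by (rule inj_onI) (use tinj in \<open>auto\<close>)
      then show ?thesis unfolding D_def
        by (subst sum.reindex) (auto simp: measure_cell_times[OF N] intro!: sum.cong)
    qed
    ultimately show ?thesis
      by (simp add: sum.cartesian_product sum_divide_distrib split_beta)
  qed
  show thesis
  proof (rule that[of N0])
    fix N :: nat and s t :: "nat \<Rightarrow> nat \<Rightarrow> real \<times> real" assume "N \<ge> N0"
      "\<And>i j. i \<in> {1..N} \<Longrightarrow> j \<in> {1..N} \<Longrightarrow> s i j \<in> cell N i \<times> cell N j"
      "\<And>i j. i \<in> {1..N} \<Longrightarrow> j \<in> {1..N} \<Longrightarrow> t i j \<in> cell N i \<times> cell N j"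
    then have "\<bar>(\<Sum>i=1..N. \<Sum>j=1..N. ?f (s i j)) / (real N)\<^sup>2 - I\<bar> < e / 2"
      "\<bar>(\<Sum>i=1..N. \<Sum>j=1..N. ?f (t i j)) / (real N)\<^sup>2 - I\<bar> < e / 2" using key by blast+
    then have "(\<Sum>i=1..N. \<Sum>j=1..N. ?f (s i j)) / (real N)\<^sup>2 - (\<Sum>i=1..N. \<Sum>j=1..N. ?f (t i j)) / (real N)\<^sup>2 < e"
      unfolding abs_less_iff by linarith
    then show "(\<Sum>i=1..N. \<Sum>j=1..N. ?f (s i j) - ?f (t i j)) / (real N)\<^sup>2 < e"
      by (simp add: sum_subtractf diff_divide_distrib)
  qed (rule N0)
qed

definition step_kernel :: "nat \<Rightarrow> (nat \<Rightarrow> nat \<Rightarrow> real) \<Rightarrow> real \<Rightarrow> real \<Rightarrow> real" where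
  "step_kernel N a x y = a (idx N x) (idx N y)"

lemma idx_measurable_U [measurable]: "idx N \<in> measurable U (count_space UNIV)"
  using idx_measurable by (simp add: measurable_cong_sets)

lemma bfun_idx: assumes "N \<ge> 1" shows "U.bfun (\<lambda>x. g (idx N x))"
proof (rule U.bfunI[of _ "\<Sum>i=1..N. \<bar>g i\<bar>"])
  show "\<bar>g (idx N x)\<bar> \<le> (\<Sum>i=1..N. \<bar>g i\<bar>)" for x
    using idx_range[OF assms, of x] by (intro member_le_sum[of _ "{1..N}" "\<lambda>i. \<bar>g i\<bar>"]) auto
qed measurable

lemma step_kernel_expand:
  assumes "N \<ge> 1"
  shows "step_kernel N a x y = (\<Sum>i=1..N. (of_bool (idx N x = i)) * a i (idx N y))"
  using idx_range[OF assms, of x] by (simp add: step_kernel_def of_bool_def if_distrib[of "\<lambda>c. c * _"] cong: if_cong)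

lemma bker_step: assumes "N \<ge> 1" shows "U.bker (step_kernel N a)"
  unfolding step_kernel_expand[OF assms, abs_def]
  by (intro U.bker_sum U.bker_mult U.bker_fst U.bker_snd bfun_idx[OF assms])

lemma dint_step: assumes "N \<ge> 1" shows "U.dint (step_kernel N a) = (\<Sum>i=1..N. \<Sum>j=1..N. a i j) / (real N)\<^sup>2"
  unfolding U.dint_def step_kernel_def integral_idx[OF assms]
    integral_idx[OF assms, of "\<lambda>i. (\<Sum>j=1..N. a i j) / real N"]
  by (simp add: sum_divide_distrib[symmetric] power2_eq_square)

text \<open>
  The deviation of \<open>W\<close> from its value at the corner of a cell is at most the oscillation in that cell, and the
  average oscillation is small by \<open>riemann_oscillation\<close>.
\<close>

lemma step_kernel_L1:
  fixes W :: "real \<Rightarrow> real \<Rightarrow> real"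
  assumes R: "riemann_integrable (\<lambda>(x, y). W x y) (0, 0) (1, 1)"
    and Wb: "\<And>x y. x \<in> {0..1} \<Longrightarrow> y \<in> {0..1} \<Longrightarrow> 0 \<le> W x y \<and> W x y \<le> 1"
    and V: "U.bker V" "AE p in U \<Otimes>\<^sub>M U. W (fst p) (snd p) = V (fst p) (snd p)" and e: "0 < e"
  shows "\<forall>\<^sub>F N in sequentially. U.dint (\<lambda>x y. \<bar>step_kernel N (\<lambda>i j. W (real i / real N) (real j / real N)) x y - V x y\<bar>) < e"
proof -
  have "0 < e / 2" using e by simp
  from riemann_oscillation[OF R this] obtain N0 where N0: "N0 \<ge> 1" and osc: "\<And>N s t. N \<ge> N0 \<Longrightarrow>
    (\<And>i j. i \<in> {1..N} \<Longrightarrow> j \<in> {1..N} \<Longrightarrow> s i j \<in> cell N i \<times> cell N j) \<Longrightarrow>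
    (\<And>i j. i \<in> {1..N} \<Longrightarrow> j \<in> {1..N} \<Longrightarrow> t i j \<in> cell N i \<times> cell N j) \<Longrightarrow>
    (\<Sum>i=1..N. \<Sum>j=1..N. case_prod W (s i j) - case_prod W (t i j)) / (real N)\<^sup>2 < e / 2" by blast
  show ?thesis
  proof (rule eventually_sequentiallyI[of N0])
    fix N assume NN: "N0 \<le> N"
    then have N: "N \<ge> 1" using N0 by simp
    define w where "w i j = W (real i / real N) (real j / real N)" for i j
    \<comment> \<open>A point of the cell at which \<open>W\<close> deviates most, up to \<open>e / 2\<close>, from its value at the corner.\<close>
    define r where "r i j = (SOME p. p \<in> cell N i \<times> cell N j \<and> (\<forall>q\<in>cell N i \<times> cell N j. \<bar>case_prod W q - w i j\<bar> \<le> \<bar>case_prod W p - w i j\<bar> + e / 2))" for i j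
    have r: "r i j \<in> cell N i \<times> cell N j \<and> (\<forall>q\<in>cell N i \<times> cell N j. \<bar>case_prod W q - w i j\<bar> \<le> \<bar>case_prod W (r i j) - w i j\<bar> + e / 2)"
      if ij: "i \<in> {1..N}" "j \<in> {1..N}" for i j
      unfolding r_def
    proof (rule someI_ex)
      let ?C = "cell N i \<times> cell N j" and ?h = "\<lambda>p. \<bar>case_prod W p - w i j\<bar>"
      have ne: "?C \<noteq> {}" using cell_end[OF N] ij by blast
      have b: "?h p \<le> 1" if p: "p \<in> ?C" for p
      proof -
        have "fst p \<in> cell N i" "snd p \<in> cell N j" using p by auto
        then have "fst p \<in> {0..1}" "snd p \<in> {0..1}"
          using cell_subset[OF N ij(1)] cell_subset[OF N ij(2)] by blast+
        moreover have "real i / real N \<in> {0..1}" "real j / real N \<in> {0..1}" using ij N by auto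
        ultimately have "0 \<le> W (fst p) (snd p) \<and> W (fst p) (snd p) \<le> 1" "0 \<le> w i j \<and> w i j \<le> 1"
          using Wb unfolding w_def by blast+
        then show ?thesis by (simp add: split_beta abs_le_iff)
      qed
      have bdd: "bdd_above (?h ` ?C)" using b by (auto simp: bdd_above_def)
      have "Sup (?h ` ?C) - e / 2 < Sup (?h ` ?C)" using e by simp
      then obtain p where p: "p \<in> ?C" "Sup (?h ` ?C) - e / 2 < ?h p"
        using less_cSup_iff[of "?h ` ?C" "Sup (?h ` ?C) - e / 2"] ne bdd by auto
      have "?h q \<le> ?h p + e / 2" if "q \<in> ?C" for q
      proof -
        have "?h q \<le> Sup (?h ` ?C)" by (rule cSUP_upper[OF that bdd])
        then show ?thesis using p(2) by linarith
      qed
      then show "\<exists>p. p \<in> ?C \<and> (\<forall>q\<in>?C. ?h q \<le> ?h p + e / 2)" using p(1) by blast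
    qed
    define c where "c i j = \<bar>case_prod W (r i j) - w i j\<bar>" for i j
    have cl: "U.dint (step_kernel N c) < e / 2"
    proof -
      \<comment> \<open>The two points of each cell are exchanged where needed to make every difference equal to \<open>c i j\<close>.\<close>
      define sw where "sw i j = (w i j \<le> case_prod W (r i j))" for i j
      define en where "en i j = (real i / real N, real j / real N)" for i j
      define s where "s i j = (if sw i j then r i j else en i j)" for i j
      define t where "t i j = (if sw i j then en i j else r i j)" for i j
      have en: "en i j \<in> cell N i \<times> cell N j" if "i \<in> {1..N}" "j \<in> {1..N}" for i j
        using cell_end[OF N] that by (simp add: en_def)
      have "(\<Sum>i=1..N. \<Sum>j=1..N. case_prod W (s i j) - case_prod W (t i j)) / (real N)\<^sup>2 < e / 2"
        by (rule osc[OF NN]) (use r en in \<open>auto simp: s_def t_def\<close>)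
      moreover have "case_prod W (s i j) - case_prod W (t i j) = c i j" for i j
        unfolding s_def t_def c_def sw_def en_def w_def by simp
      ultimately show ?thesis unfolding dint_step[OF N] by simp
    qed
    let ?S = "step_kernel N w"
    have bS: "U.bker (\<lambda>x y. \<bar>?S x y - V x y\<bar>)" by (intro U.bker_abs U.bker_diff bker_step[OF N] V)
    have bc: "U.bker (\<lambda>x y. step_kernel N c x y + e / 2)" by (intro U.bker_add bker_step[OF N] U.bker_const)
    have pos: "AE p in U \<Otimes>\<^sub>M U. 0 < fst p \<and> fst p \<le> 1 \<and> 0 < snd p \<and> snd p \<le> 1"
    proof -
      have 1: "AE x in U. AE y in U. 0 < x \<and> x \<le> 1 \<and> 0 < y \<and> y \<le> 1"
        using AE_U_pos
      proof eventually_elim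
        case (elim x)
        then show ?case using AE_U_pos by simp
      qed
      show ?thesis
      proof (rule U.MM.AE_pair_measure)
        show "{p \<in> space (U \<Otimes>\<^sub>M U). 0 < fst p \<and> fst p \<le> 1 \<and> 0 < snd p \<and> snd p \<le> 1} \<in> sets (U \<Otimes>\<^sub>M U)"
          by measurable
      qed (use 1 in simp)
    qed
    have "U.dint (\<lambda>x y. \<bar>?S x y - V x y\<bar>) = integral\<^sup>L (U \<Otimes>\<^sub>M U) (\<lambda>(x, y). \<bar>?S x y - V x y\<bar>)"
      by (rule dint_eq_integral[symmetric, OF bS])
    also have "\<dots> \<le> integral\<^sup>L (U \<Otimes>\<^sub>M U) (\<lambda>(x, y). step_kernel N c x y + e / 2)"
    proof (rule integral_mono_AE[OF U.bker_integrable[OF bS] U.bker_integrable[OF bc]])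
      show "AE p in U \<Otimes>\<^sub>M U. (case p of (x, y) \<Rightarrow> \<bar>?S x y - V x y\<bar>) \<le> (case p of (x, y) \<Rightarrow> step_kernel N c x y + e / 2)"
        using pos V(2)
      proof eventually_elim
        case (elim p)
        define i where "i = idx N (fst p)"
        define j where "j = idx N (snd p)"
        have ij: "i \<in> {1..N}" "j \<in> {1..N}" unfolding i_def j_def using idx_range[OF N] by auto
        have "fst p \<in> cell N i" "snd p \<in> cell N j"
          using idx_eq_iff[OF N, of "fst p" i] idx_eq_iff[OF N, of "snd p" j] elim ij
          unfolding i_def j_def cell_def by auto
        then have "p \<in> cell N i \<times> cell N j" by (simp add: mem_Times_iff)
        then have "\<bar>case_prod W p - w i j\<bar> \<le> c i j + e / 2" using r[OF ij] unfolding c_def by blast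
        then show ?case using elim by (simp add: split_beta step_kernel_def i_def j_def abs_minus_commute)
      qed
    qed
    also have "\<dots> = U.dint (step_kernel N c) + e / 2"
      unfolding dint_eq_integral[OF bc] using U.prob_space by (subst U.dint_add) (auto simp: bker_step[OF N] U.dint_def)
    also have "\<dots> < e" using cl by simp
    finally show "U.dint (\<lambda>x y. \<bar>step_kernel N (\<lambda>i j. W (real i / real N) (real j / real N)) x y - V x y\<bar>) < e"
      unfolding w_def .
  qed
qed

section \<open>The spectrum of a graphon\<close>

lemma underdetermined_system:
  fixes a :: "'j \<Rightarrow> 'i \<Rightarrow> real"
  assumes "finite E" "finite J" "card E < card J"
  shows "\<exists>c. (\<exists>j\<in>J. c j \<noteq> 0) \<and> (\<forall>i\<in>E. (\<Sum>j\<in>J. c j * a j i) = 0)"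
  using assms
proof (induction E arbitrary: J a rule: finite_induct)
  case empty
  then have "J \<noteq> {}" by auto
  then show ?case by (intro exI[of _ "\<lambda>_. 1"]) auto
next
  case (insert i0 E)
  show ?case
  proof (cases "\<forall>j\<in>J. a j i0 = 0")
    case True
    have "card E < card J" using insert by simp
    from insert.IH[OF insert.prems(1) this, of a]
    obtain c where "\<exists>j\<in>J. c j \<noteq> 0" "\<forall>i\<in>E. (\<Sum>j\<in>J. c j * a j i) = 0" by blast
    then show ?thesis using True by (intro exI[of _ c]) auto
  next
    case False
    then obtain p where p: "p \<in> J" "a p i0 \<noteq> 0" by blast
    let ?J = "J - {p}"
    have "card E < card ?J" using insert p by simp
    from insert.IH[OF _ this, of "\<lambda>j i. a j i - a j i0 / a p i0 * a p i"] insert.prems(1)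
    obtain c where c: "\<exists>j\<in>?J. c j \<noteq> 0" "\<forall>i\<in>E. (\<Sum>j\<in>?J. c j * (a j i - a j i0 / a p i0 * a p i)) = 0" by auto
    define d where "d j = (if j = p then - (\<Sum>j\<in>?J. c j * a j i0) / a p i0 else c j)" for j
    have s: "(\<Sum>j\<in>J. d j * a j i) = (\<Sum>j\<in>?J. c j * (a j i - a j i0 / a p i0 * a p i))" for i
    proof -
      have "(\<Sum>j\<in>J. d j * a j i) = d p * a p i + (\<Sum>j\<in>?J. d j * a j i)"
        using p insert.prems(1) by (simp add: sum.remove)
      also have "(\<Sum>j\<in>?J. d j * a j i) = (\<Sum>j\<in>?J. c j * a j i)" by (intro sum.cong) (auto simp: d_def)
      also have "d p * a p i = - (\<Sum>j\<in>?J. c j * (a j i0 / a p i0 * a p i))"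
        by (simp add: d_def sum_distrib_right sum_divide_distrib sum_negf mult.assoc)
      finally show ?thesis by (simp add: right_diff_distrib sum_subtractf)
    qed
    have "(\<Sum>j\<in>J. d j * a j i0) = 0" unfolding s using p by simp
    moreover have "\<exists>j\<in>J. d j \<noteq> 0" using c(1) by (auto simp: d_def)
    ultimately show ?thesis using c(2) by (intro exI[of _ d]) (simp add: s)
  qed
qed

lemma bij_betw_rank:
  fixes E :: "nat set"
  assumes "finite E"
  shows "bij_betw (\<lambda>i. card {j. j \<le> i \<and> j \<in> E}) E {1..card E}"
proof -
  let ?r = "\<lambda>i. card {j. j \<le> i \<and> j \<in> E}"
  have lt: "?r i < ?r i'" if "i \<in> E" "i' \<in> E" "i < i'" for i i'
    proof (rule psubset_card_mono)
    show "finite {j. j \<le> i' \<and> j \<in> E}" using assms by simp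
    have "i' \<in> {j. j \<le> i' \<and> j \<in> E}" "i' \<notin> {j. j \<le> i \<and> j \<in> E}" using that by auto
    moreover have "{j. j \<le> i \<and> j \<in> E} \<subseteq> {j. j \<le> i' \<and> j \<in> E}" using that by auto
    ultimately show "{j. j \<le> i \<and> j \<in> E} \<subset> {j. j \<le> i' \<and> j \<in> E}" by blast
  qed
  have inj: "inj_on ?r E"
  proof (rule inj_onI)
    fix x y assume "x \<in> E" "y \<in> E" "?r x = ?r y"
    then show "x = y" using lt[of x y] lt[of y x] by (cases rule: linorder_cases[of x y]) auto
  qed
  have "?r ` E \<subseteq> {1..card E}"
  proof
    fix k assume "k \<in> ?r ` E"
    then obtain i where i: "i \<in> E" "k = ?r i" by auto
    have "?r i \<le> card E" using assms by (intro card_mono) auto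
    moreover have "0 < ?r i" using i assms by (auto simp: card_gt_0_iff)
    ultimately show "k \<in> {1..card E}" using i(2) by simp
  qed
  then have "?r ` E = {1..card E}"
    by (intro card_subset_eq) (simp_all add: card_image[OF inj])
  then show ?thesis using inj by (simp add: bij_betw_def)
qed

text \<open>
  The spectral theory is applied to the Borel version \<open>V\<close>, whereas the operator, its norm and its spectrum are
  those of \<open>W\<close>.
\<close>

locale graphon_version =
  fixes W V :: "real \<Rightarrow> real \<Rightarrow> real"
  assumes gr: "graphon W"
    and bV: "U.bker V" and sV: "U.ksym V" and V0: "\<And>x y. 0 \<le> V x y" and V1: "\<And>x y. V x y \<le> 1"
    and ae: "AE p in U \<Otimes>\<^sub>M U. W (fst p) (snd p) = V (fst p) (snd p)"
begin

lemma ae_sections: "AE x in U. AE y in U. W x y = V x y"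
  using U.MM.AE_pair[OF ae] by simp

lemma V_abs: "\<bar>V x y\<bar> \<le> 1" using V0[of x y] V1[of x y] by simp

lemma borel_measurable_app:
  assumes "g \<in> borel_measurable borel"
  shows "U.app V g \<in> borel_measurable borel"
proof -
  have [measurable]: "(\<lambda>p. V (fst p) (snd p)) \<in> borel_measurable (U \<Otimes>\<^sub>M U)"
    by (intro U.bker_measurable_compose[OF bV]) auto
  have [measurable]: "g \<in> borel_measurable U" using assms by simp
  have "(\<lambda>x. \<integral>y. V x y * g y \<partial>U) \<in> borel_measurable U"
    by (rule U.borel_measurable_lebesgue_integral) (simp add: split_beta')
  then show ?thesis unfolding U.app_def[abs_def] by simp
qed

lemma graphon_op_AE:
  assumes g: "g \<in> borel_measurable borel" and h: "AE x in U. h x = g x"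
  shows "AE x in U. graphon_op W h x = U.app V g x"
  using ae_sections
proof eventually_elim
  case (elim x)
  show ?case unfolding graphon_op_def U.app_def
  proof (rule integral_lebesgue_on_U)
    show "(\<lambda>y. V x y * g y) \<in> borel_measurable borel"
      using g U.bfun_measurable[OF U.bker_row[OF bV, of x]] by simp
    show "AE y in U. W x y * h y = V x y * g y" using elim h by eventually_elim simp
  qed
qed

lemma bfun_borel: "U.bfun f \<Longrightarrow> f \<in> borel_measurable borel"
  using U.bfun_measurable[of f] unfolding measurable_cong_sets[OF sets_U refl] .

lemma L2_bfun: assumes "U.bfun f" shows "L2 f"
  unfolding L2_def
proof
  show "f \<in> borel_measurable (lebesgue_on {0..1})"
    by (rule measurable_lebesgue_on_U[OF bfun_borel[OF assms]]) simp
  show "integrable (lebesgue_on {0..1}) (\<lambda>x. (f x)\<^sup>2)"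
    by (subst integrable_lebesgue_on_U[OF bfun_borel[OF U.bfun_power2[OF assms]]])
      (simp_all add: U.bfun_integrable U.bfun_power2 assms)
qed

lemma L2_norm_AE: assumes "U.bfun f" "AE x in U. h x = f x" shows "L2_norm h = sqrt (U.ip f f)"
proof -
  have "(LINT x|lebesgue_on {0..1}. (h x)\<^sup>2) = (\<integral>x. (f x)\<^sup>2 \<partial>U)"
    using assms(2) by (intro integral_lebesgue_on_U bfun_borel U.bfun_power2 assms(1)) (auto elim: eventually_mono)
  then show ?thesis unfolding L2_norm_def U.ip_def by (simp add: power2_eq_square)
qed

lemma eigenspace_bfun: assumes "U.bfun f" "\<And>x. U.app V f x = l * f x" shows "f \<in> eigenspace W l"
  unfolding eigenspace_def AE_U_lebesgue
  using L2_bfun[OF assms(1)] graphon_op_AE[OF bfun_borel[OF assms(1)], of f] assms(2) by simp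

lemma L2_integrable:
  assumes "L2 g" "g1 \<in> borel_measurable borel" "AE x in U. g x = g1 x"
  shows "integrable U g1" "integrable U (\<lambda>x. (g1 x)\<^sup>2)"
proof -
  have "AE x in U. (g x)\<^sup>2 = (g1 x)\<^sup>2" using assms(3) by eventually_elim simp
  then have "integrable (lebesgue_on {0..1}) (\<lambda>x. (g x)\<^sup>2) \<longleftrightarrow> integrable U (\<lambda>x. (g1 x)\<^sup>2)"
    using assms(2) by (intro integrable_lebesgue_on_U) simp_all
  then show sq: "integrable U (\<lambda>x. (g1 x)\<^sup>2)" using assms(1) by (simp add: L2_def)
  show "integrable U g1"
  proof (rule Bochner_Integration.integrable_bound)
    show "integrable U (\<lambda>x. 1 + (g1 x)\<^sup>2)" using sq by simp
    show "g1 \<in> borel_measurable U" using assms(2) by simp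
    have "\<bar>t\<bar> \<le> 1 + t\<^sup>2" for t :: real
    proof -
      have "0 \<le> (\<bar>t\<bar> - 1)\<^sup>2 + \<bar>t\<bar>" by simp
      then show ?thesis by (simp add: power2_diff)
    qed
    then show "AE x in U. norm (g1 x) \<le> norm (1 + (g1 x)\<^sup>2)" by (intro AE_I2) (simp add: abs_of_nonneg)
  qed
qed

text \<open>
  A square-integrable eigenfunction \<open>g\<close> agrees almost everywhere with the image of \<open>g\<close> divided by \<open>l\<close>, which is
  bounded and satisfies the eigenvalue equation at every point.
\<close>

lemma eigenspace_bounded_version:
  assumes g: "g \<in> eigenspace W l" and l: "l \<noteq> 0"
  shows "\<exists>h. U.bfun h \<and> (\<forall>x. U.app V h x = l * h x) \<and> (AE x in U. g x = h x)"
proof -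
  have L: "L2 g" and ev: "AE x in U. graphon_op W g x = l * g x"
    using g unfolding eigenspace_def AE_U_lebesgue by auto
  obtain g1 where g1: "g1 \<in> borel_measurable borel" "AE x in U. g x = g1 x"
    using borel_version_U[of g] L unfolding L2_def by blast
  note int = L2_integrable[OF L g1]
  define h where "h x = U.app V g1 x / l" for x
  have "AE x in U. graphon_op W g x = U.app V g1 x" by (rule graphon_op_AE[OF g1])
  with ev have gh: "AE x in U. g x = h x"
    unfolding h_def by eventually_elim (use l in \<open>auto simp: field_simps\<close>)
  have bh: "U.bfun h"
  proof (rule U.bfunI[of _ "(\<integral>y. \<bar>g1 y\<bar> \<partial>U) / \<bar>l\<bar>"])
    show "h \<in> borel_measurable U" unfolding h_def[abs_def] using borel_measurable_app[OF g1(1)] by simp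
    have "\<bar>U.app V g1 x\<bar> \<le> (\<integral>y. \<bar>g1 y\<bar> \<partial>U)" for x
    proof -
      have "\<bar>U.app V g1 x\<bar> \<le> (\<integral>y. \<bar>V x y * g1 y\<bar> \<partial>U)" unfolding U.app_def by (rule integral_abs_bound)
      also have "\<dots> \<le> (\<integral>y. \<bar>g1 y\<bar> \<partial>U)"
      proof (rule integral_mono')
        show "integrable U (\<lambda>y. \<bar>g1 y\<bar>)" using int by simp
        show "\<bar>V x y * g1 y\<bar> \<le> \<bar>g1 y\<bar>" for y
          using mult_right_mono[OF V_abs, of "\<bar>g1 y\<bar>" x y] by (simp add: abs_mult)
      qed simp
      finally show ?thesis .
    qed
    then show "\<bar>h x\<bar> \<le> (\<integral>y. \<bar>g1 y\<bar> \<partial>U) / \<bar>l\<bar>" for x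
      unfolding h_def by (simp add: divide_right_mono)
  qed
  have "U.app V h x = l * h x" for x
  proof -
    have "U.app V h x = U.app V g1 x" unfolding U.app_def
    proof (rule integral_cong_AE)
      show "AE y in U. V x y * h y = V x y * g1 y" using gh g1(2) by eventually_elim simp
      have "(\<lambda>y. V x y) \<in> borel_measurable U" by (rule U.bfun_measurable[OF U.bker_row[OF bV]])
      then show "(\<lambda>y. V x y * h y) \<in> borel_measurable U" "(\<lambda>y. V x y * g1 y) \<in> borel_measurable U"
        using g1(1) bfun_borel[OF bh] by simp_all
    qed
    then show ?thesis using l by (simp add: h_def)
  qed
  then show ?thesis using bh gh by blast
qed

abbreviation "lam \<equiv> U.eigv V"
abbreviation "ef \<equiv> U.eigf V"

lemmas lam_sq_summable = U.summable_eigv_sq[OF bV sV]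

lemma finite_eigv: assumes "l \<noteq> 0" shows "finite {i. lam i = l}"
proof -
  have "(\<lambda>i. (lam i)\<^sup>2) \<longlonglongrightarrow> 0" by (rule summable_LIMSEQ_zero[OF lam_sq_summable])
  moreover have "0 < l\<^sup>2" using assms by simp
  ultimately have "\<forall>\<^sub>F i in sequentially. (lam i)\<^sup>2 < l\<^sup>2" by (rule order_tendstoD)
  then obtain N where N: "\<And>i. i \<ge> N \<Longrightarrow> (lam i)\<^sup>2 < l\<^sup>2" unfolding eventually_sequentially by blast
  have "{i. lam i = l} \<subseteq> {..<N}"
  proof
    fix i assume "i \<in> {i. lam i = l}"
    then have "\<not> N \<le> i" using N[of i] by auto
    then show "i \<in> {..<N}" by simp
  qed
  then show ?thesis by (rule finite_subset) simp
qed

lemma ip_sum_left: assumes "\<And>i. i \<in> S \<Longrightarrow> U.bfun (f i)" "U.bfun g"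
  shows "U.ip (\<lambda>x. \<Sum>i\<in>S. c i * f i x) g = (\<Sum>i\<in>S. c i * U.ip (f i) g)"
proof -
  have "U.ip (\<lambda>x. \<Sum>i\<in>S. c i * f i x) g = (\<integral>x. (\<Sum>i\<in>S. c i * (f i x * g x)) \<partial>U)"
    unfolding U.ip_def by (simp add: sum_distrib_right mult.assoc)
  also have "\<dots> = (\<Sum>i\<in>S. \<integral>x. c i * (f i x * g x) \<partial>U)"
    by (intro Bochner_Integration.integral_sum U.bfun_integrable U.bfun_cmult U.bfun_mult assms)
  finally show ?thesis unfolding U.ip_def by simp
qed

text \<open>
  The functions \<open>ef i\<close> with \<open>lam i = l\<close> are orthonormal, which gives enough independent eigenfunctions. A larger
  independent family would have a non-trivial linear combination orthogonal to all of them, and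
  \<open>eigf_complete\<close> forces it to vanish.
\<close>

lemma Spec_iff: "(l, k) \<in> Spec W \<longleftrightarrow> l \<noteq> 0 \<and> 1 \<le> k \<and> k \<le> card {i. lam i = l}"
proof (cases "l \<noteq> 0 \<and> 1 \<le> k")
  case True
  let ?E = "{i. lam i = l}"
  have l: "l \<noteq> 0" using True by simp
  have fin: "finite ?E" by (rule finite_eigv[OF l])
  have "(\<exists>f. (\<forall>i<k. f i \<in> eigenspace W l) \<and> L2_independent k f) \<longleftrightarrow> k \<le> card ?E"
  proof
    assume k: "k \<le> card ?E"
    obtain e where e: "bij_betw e {0..<card ?E} ?E" using ex_bij_betw_nat_finite[OF fin] by blast
    have eE: "lam (e i) = l" if "i < k" for i
      using bij_betwE[OF e] that k by auto
    have einj: "e i = e j \<Longrightarrow> i = j" if "i < k" "j < k" for i j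
      using bij_betw_imp_inj_on[OF e] that k by (auto simp: inj_on_def)
    have "L2_independent k (\<lambda>i. ef (e i))"
      unfolding L2_independent_def AE_U_lebesgue
    proof (intro allI impI)
      fix c :: "nat \<Rightarrow> real" and j assume z: "AE x in U. (\<Sum>i<k. c i * ef (e i) x) = 0" and j: "j < k"
      have b: "U.bfun (\<lambda>x. \<Sum>i<k. c i * ef (e i) x)" by (intro U.bfun_sum U.bfun_cmult U.bfun_eigf[OF bV sV])
      have "U.ip (\<lambda>x. \<Sum>i<k. c i * ef (e i) x) (ef (e j)) = U.ip (\<lambda>x. 0) (ef (e j))"
        unfolding U.ip_def
        by (intro integral_cong_AE U.bfun_measurable U.bfun_mult b U.bfun_eigf[OF bV sV] U.bfun_const)
           (use z in \<open>auto elim: eventually_mono\<close>)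
      then have "(\<Sum>i<k. c i * U.ip (ef (e i)) (ef (e j))) = 0"
        by (subst (asm) ip_sum_left) (simp_all add: U.bfun_eigf[OF bV sV] U.ip_def)
      moreover have "(\<Sum>i<k. c i * U.ip (ef (e i)) (ef (e j))) = (\<Sum>i<k. if i = j then c j else 0)"
      proof (intro sum.cong refl)
        fix i assume "i \<in> {..<k}"
        then show "c i * U.ip (ef (e i)) (ef (e j)) = (if i = j then c j else 0)"
          using U.eigf_orthogonal[OF bV sV, of "e i" "e j"] U.eigf_normalised[OF bV sV, of "e j"] eE[OF j] l einj[of i j] j
          by (cases "i = j") auto
      qed
      ultimately show "c j = 0" using j by simp
    qed
    moreover have "\<forall>i<k. ef (e i) \<in> eigenspace W l"
      using eigenspace_bfun[OF U.bfun_eigf[OF bV sV] U.app_eigf[OF bV sV]] eE by metis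
    ultimately show "\<exists>f. (\<forall>i<k. f i \<in> eigenspace W l) \<and> L2_independent k f" by (intro exI[of _ "\<lambda>i. ef (e i)"]) simp
  next
    assume "\<exists>f. (\<forall>i<k. f i \<in> eigenspace W l) \<and> L2_independent k f"
    then obtain f where f: "\<And>i. i < k \<Longrightarrow> f i \<in> eigenspace W l" and ind: "L2_independent k f" by blast
    show "k \<le> card ?E"
    proof (rule ccontr)
      assume "\<not> k \<le> card ?E"
      then have ck: "card ?E < card {..<k}" by simp
      have "\<forall>i. \<exists>h. i < k \<longrightarrow> U.bfun h \<and> (\<forall>x. U.app V h x = l * h x) \<and> (AE x in U. f i x = h x)"
        using eigenspace_bounded_version[OF f l] by blast
      then obtain h where h: "\<And>i. i < k \<Longrightarrow> U.bfun (h i)" "\<And>i x. i < k \<Longrightarrow> U.app V (h i) x = l * h i x"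
        "\<And>i. i < k \<Longrightarrow> AE x in U. f i x = h i x" by metis
      obtain c where c: "\<exists>j\<in>{..<k}. c j \<noteq> 0" "\<forall>i\<in>?E. (\<Sum>j\<in>{..<k}. c j * U.ip (h j) (ef i)) = 0"
        using underdetermined_system[OF fin _ ck, of "\<lambda>j i. U.ip (h j) (ef i)"] by blast
      define G where "G x = (\<Sum>j<k. c j * h j x)" for x
      have bG: "U.bfun G" unfolding G_def by (intro U.bfun_sum U.bfun_cmult h) simp
      have "U.app V G x = l * G x" for x
      proof -
        have "U.app V G x = U.ip G (\<lambda>y. V x y)" unfolding U.app_def U.ip_def by (simp add: mult.commute)
        also have "\<dots> = (\<Sum>j<k. c j * U.ip (h j) (\<lambda>y. V x y))"
          unfolding G_def by (intro ip_sum_left U.bker_row[OF bV] h) simp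
        also have "\<dots> = (\<Sum>j<k. c j * (l * h j x))"
          using h(2) unfolding U.app_def U.ip_def by (intro sum.cong refl) (simp add: mult.commute)
        also have "\<dots> = l * G x" unfolding G_def by (simp add: sum_distrib_left mult.left_commute)
        finally show ?thesis .
      qed
      moreover have "U.ip (ef i) G = 0" if "lam i = l" for i
      proof -
        have "U.ip (ef i) G = U.ip G (ef i)" unfolding U.ip_def by (simp add: mult.commute)
        also have "\<dots> = (\<Sum>j<k. c j * U.ip (h j) (ef i))"
          unfolding G_def by (intro ip_sum_left U.bfun_eigf[OF bV sV] h) simp
        also have "\<dots> = 0" using c(2) that by simp
        finally show ?thesis .
      qed
      ultimately have "U.ip G G = 0" using U.eigf_complete[OF bV sV bG _ l] by blast
      then have "AE x in U. G x = 0" by (rule U.ip_zero_AE[OF bG])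
      moreover have "AE x in U. \<forall>j\<in>{..<k}. f j x = h j x" using h(3) by (intro AE_finite_allI) auto
      ultimately have "AE x in U. (\<Sum>j<k. c j * f j x) = 0"
        unfolding G_def by eventually_elim simp
      then have "\<forall>j<k. c j = 0" using ind unfolding L2_independent_def AE_U_lebesgue by blast
      then show False using c(1) by auto
    qed
  qed
  then show ?thesis using True by (auto simp: Spec_def)
qed (auto simp: Spec_def)

text \<open>
  The second component is the rank of \<open>i\<close> among the indices with the same eigenvalue.
\<close>

definition spec_pair :: "nat \<Rightarrow> real \<times> nat" where
  "spec_pair i = (lam i, card {j. j \<le> i \<and> j \<in> {j. lam j = lam i}})"

lemma bij_betw_spec_pair: "bij_betw spec_pair {i. lam i \<noteq> 0} (Spec W)"
proof -
  have rk: "bij_betw (\<lambda>i. card {j. j \<le> i \<and> j \<in> {j. lam j = l}}) {j. lam j = l} {1..card {j. lam j = l}}" if "l \<noteq> 0" for l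
    by (rule bij_betw_rank[OF finite_eigv[OF that]])
  show ?thesis
  proof (rule bij_betwI')
    fix x y assume xy: "x \<in> {i. lam i \<noteq> 0}" "y \<in> {i. lam i \<noteq> 0}"
    show "spec_pair x = spec_pair y \<longleftrightarrow> x = y"
      using bij_betw_imp_inj_on[OF rk[of "lam x"]] xy unfolding spec_pair_def inj_on_def by auto
  next
    fix x assume x: "x \<in> {i. lam i \<noteq> 0}"
    then show "spec_pair x \<in> Spec W"
      using bij_betwE[OF rk[of "lam x"]] unfolding spec_pair_def Spec_iff by auto
  next
    fix p assume p: "p \<in> Spec W"
    obtain l k where lk: "p = (l, k)" by fastforce
    have h: "l \<noteq> 0" "k \<in> {1..card {j. lam j = l}}" using p unfolding lk Spec_iff by auto
    then obtain i where "lam i = l" "k = card {j. j \<le> i \<and> j \<in> {j. lam j = l}}"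
      using rk[OF h(1)] unfolding bij_betw_def by blast
    then show "\<exists>x\<in>{i. lam i \<noteq> 0}. p = spec_pair x" using h lk unfolding spec_pair_def by auto
  qed
qed

text \<open>
  The set whose supremum is the operator norm is bounded, so that the supremum is an upper bound.
\<close>

lemma L2_norm_graphon_op_le:
  assumes f: "L2 f" "L2_norm f \<le> 1" shows "L2_norm (graphon_op W f) \<le> 1"
proof -
  obtain g where g: "g \<in> borel_measurable borel" "AE x in U. f x = g x"
    using borel_version_U[of f] f unfolding L2_def by blast
  note int = L2_integrable[OF f(1) g]
  have "(LINT x|lebesgue_on {0..1}. (f x)\<^sup>2) = (\<integral>x. (g x)\<^sup>2 \<partial>U)"
    using g by (intro integral_lebesgue_on_U) (auto elim: eventually_mono)
  then have g2: "(\<integral>x. (g x)\<^sup>2 \<partial>U) \<le> 1" using f(2) unfolding L2_norm_def by simp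
  have "(\<integral>x. \<bar>g x\<bar> \<partial>U) \<le> (\<integral>x. (1 + (g x)\<^sup>2) / 2 \<partial>U)"
  proof (rule integral_mono)
    have "\<bar>t\<bar> \<le> (1 + t\<^sup>2) / 2" for t :: real
    proof -
      have "0 \<le> (\<bar>t\<bar> - 1)\<^sup>2" by simp
      then show ?thesis by (simp add: power2_diff)
    qed
    then show "\<bar>g x\<bar> \<le> (1 + (g x)\<^sup>2) / 2" for x .
  qed (use int in auto)
  also have "\<dots> = (1 + (\<integral>x. (g x)\<^sup>2 \<partial>U)) / 2" using int U.prob_space by simp
  finally have g1: "(\<integral>x. \<bar>g x\<bar> \<partial>U) \<le> 1" using g2 by simp
  have app: "\<bar>U.app V g x\<bar> \<le> 1" for x
  proof -
    have "\<bar>U.app V g x\<bar> \<le> (\<integral>y. \<bar>V x y * g y\<bar> \<partial>U)" unfolding U.app_def by (rule integral_abs_bound)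
    also have "\<dots> \<le> (\<integral>y. \<bar>g y\<bar> \<partial>U)"
    proof (rule integral_mono')
      show "integrable U (\<lambda>y. \<bar>g y\<bar>)" using int by simp
      show "\<bar>V x y * g y\<bar> \<le> \<bar>g y\<bar>" for y
        using mult_right_mono[OF V_abs, of "\<bar>g y\<bar>" x y] by (simp add: abs_mult)
    qed simp
    finally show ?thesis using g1 by linarith
  qed
  have b: "U.bfun (U.app V g)" using app borel_measurable_app[OF g(1)] by (intro U.bfunI[of _ 1]) simp_all
  have "L2_norm (graphon_op W f) = sqrt (U.ip (U.app V g) (U.app V g))"
    by (rule L2_norm_AE[OF b graphon_op_AE[OF g]])
  also have "U.ip (U.app V g) (U.app V g) \<le> 1"
  proof -
    have "\<bar>U.app V g x * U.app V g x\<bar> \<le> 1 * 1" for x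
      by (simp only: abs_mult) (intro mult_mono' app abs_ge_zero)
    then have "\<bar>U.ip (U.app V g) (U.app V g)\<bar> \<le> 1 * 1"
      unfolding U.ip_def by (intro U.integral_abs_le U.bfun_mult b)
    then show ?thesis by simp
  qed
  finally show ?thesis by simp
qed

lemma eigv_le_op_norm: "\<bar>lam i\<bar> \<le> graphon_op_norm W"
proof -
  have bdd: "bdd_above ((\<lambda>f. L2_norm (graphon_op W f)) ` {f. L2 f \<and> L2_norm f \<le> 1})"
    using L2_norm_graphon_op_le by (auto simp: bdd_above_def)
  have upper: "L2_norm (graphon_op W f) \<le> graphon_op_norm W" if "L2 f" "L2_norm f \<le> 1" for f
    unfolding graphon_op_norm_def by (rule cSUP_upper[OF _ bdd]) (use that in simp)
  have b: "U.bfun (ef i)" by (rule U.bfun_eigf[OF bV sV])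
  have ap: "U.app V (ef i) = (\<lambda>x. lam i * ef i x)" using U.app_eigf[OF bV sV] by blast
  have "L2_norm (graphon_op W (ef i)) = sqrt (U.ip (\<lambda>x. lam i * ef i x) (\<lambda>x. lam i * ef i x))"
    using graphon_op_AE[OF bfun_borel[OF b], of "ef i"] by (intro L2_norm_AE U.bfun_cmult b) (simp add: ap)
  also have "\<dots> = \<bar>lam i\<bar> * sqrt (U.ip (ef i) (ef i))"
    by (simp add: U.ip_cmult_left U.ip_cmult_right real_sqrt_mult[symmetric] mult.assoc[symmetric])
      (simp add: real_sqrt_mult)
  finally have n: "L2_norm (graphon_op W (ef i)) = \<bar>lam i\<bar> * sqrt (U.ip (ef i) (ef i))" .
  have n1: "L2_norm (ef i) = sqrt (U.ip (ef i) (ef i))" by (rule L2_norm_AE[OF b]) simp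
  show ?thesis
  proof (cases "lam i = 0")
    case True
    have "U.ip (ef i) (ef i) = 0" using U.eigf_zero[OF bV sV True] by (simp add: U.ip_def)
    then have "0 \<le> graphon_op_norm W" using upper[OF L2_bfun[OF b]] n n1 by simp
    then show ?thesis using True by simp
  next
    case False
    then have "U.ip (ef i) (ef i) = 1" by (rule U.eigf_normalised[OF bV sV])
    then show ?thesis using upper[OF L2_bfun[OF b]] n n1 by simp
  qed
qed

text \<open>
  A step kernel has finite rank. Closeness in \<open>L\<^sup>1\<close> suffices, since the difference is at most \<open>1\<close> in absolute
  value and thus dominates its square.
\<close>

lemma separably_approximable:
  assumes R: "riemann_integrable (\<lambda>(x, y). W x y) (0, 0) (1, 1)"
  shows "U.separably_approximable V"
  unfolding U.separably_approximable_def
proof (intro allI impI)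
  fix e :: real assume e: "0 < e"
  have Wb: "0 \<le> W x y \<and> W x y \<le> 1" if "x \<in> {0..1}" "y \<in> {0..1}" for x y
    using gr that by (auto simp: graphon_def)
  from step_kernel_L1[OF R Wb bV ae e] obtain N0
    where "\<And>N. N \<ge> N0 \<Longrightarrow> U.dint (\<lambda>x y. \<bar>step_kernel N (\<lambda>i j. W (real i / real N) (real j / real N)) x y - V x y\<bar>) < e"
    unfolding eventually_sequentially by blast
  then obtain N where N: "N \<ge> 1" and d: "U.dint (\<lambda>x y. \<bar>step_kernel N (\<lambda>i j. W (real i / real N) (real j / real N)) x y - V x y\<bar>) < e"
    by (meson max.cobounded1 max.cobounded2)
  define a where "a i j = W (real i / real N) (real j / real N)" for i j
  let ?S = "step_kernel N a"
  have bD: "U.bker (\<lambda>x y. V x y - ?S x y)" by (intro U.bker_diff bV bker_step[OF N])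
  have dle: "\<bar>V x y - ?S x y\<bar> \<le> 1" for x y
  proof -
    have "real (idx N x) / real N \<in> {0..1}" "real (idx N y) / real N \<in> {0..1}" using idx_range[OF N] by (auto simp: divide_le_eq)
    then have "0 \<le> ?S x y \<and> ?S x y \<le> 1" unfolding step_kernel_def a_def by (rule Wb)
    then show ?thesis using V0[of x y] V1[of x y] by (simp add: abs_le_iff)
  qed
  have "U.hs (\<lambda>x y. V x y - ?S x y) (\<lambda>x y. V x y - ?S x y) \<le> U.dint (\<lambda>x y. \<bar>V x y - ?S x y\<bar>)"
    unfolding U.hs_def
  proof (intro U.dint_mono U.bker_mult U.bker_abs bD)
    show "(V x y - ?S x y) * (V x y - ?S x y) \<le> \<bar>V x y - ?S x y\<bar>" for x y
      using mult_right_mono[OF dle, of "\<bar>V x y - ?S x y\<bar>" x y] by (simp add: abs_mult[symmetric])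
  qed
  also have "\<dots> < e" using d unfolding a_def[abs_def] by (simp add: abs_minus_commute)
  finally have hs: "U.hs (\<lambda>x y. V x y - ?S x y) (\<lambda>x y. V x y - ?S x y) < e" .
  show "\<exists>(S::nat set) g h. finite S \<and> (\<forall>i\<in>S. U.bfun (g i) \<and> U.bfun (h i)) \<and>
     U.hs (\<lambda>x y. V x y - (\<Sum>i\<in>S. U.tensor (g i) (h i) x y)) (\<lambda>x y. V x y - (\<Sum>i\<in>S. U.tensor (g i) (h i) x y)) < e"
  proof (intro exI conjI)
    show "finite {1..N}" by simp
    show "\<forall>i\<in>{1..N}. U.bfun (\<lambda>x. of_bool (idx N x = i)) \<and> U.bfun (\<lambda>y. a i (idx N y))"
      by (auto intro: bfun_idx[OF N])
    show "U.hs (\<lambda>x y. V x y - (\<Sum>i\<in>{1..N}. U.tensor (\<lambda>x. of_bool (idx N x = i)) (\<lambda>y. a i (idx N y)) x y))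
      (\<lambda>x y. V x y - (\<Sum>i\<in>{1..N}. U.tensor (\<lambda>x. of_bool (idx N x = i)) (\<lambda>y. a i (idx N y)) x y)) < e"
      using hs unfolding U.tensor_def step_kernel_expand[OF N] .
  qed
qed

end

section \<open>Power sums of matrix eigenvalues as kernel traces\<close>

definition mtr :: "'a::comm_ring_1 mat \<Rightarrow> 'a" where
  "mtr B = (\<Sum>i<dim_row B. B $$ (i, i))"

lemma mat_mult_entry:
  assumes "A \<in> carrier_mat n m" "B \<in> carrier_mat m k" "i < n" "j < k"
  shows "(A * B) $$ (i, j) = (\<Sum>l<m. A $$ (i, l) * B $$ (l, j))"
  using assms by (simp add: scalar_prod_def lessThan_atLeast0)

lemma mtr_commute:
  assumes A: "A \<in> carrier_mat n n" and B: "B \<in> carrier_mat n n"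
  shows "mtr (A * B) = mtr (B * A)"
proof -
  have "mtr (A * B) = (\<Sum>i<n. \<Sum>l<n. A $$ (i, l) * B $$ (l, i))"
    using A B unfolding mtr_def by (simp add: mat_mult_entry[OF A B] del: index_mult_mat(1))
  also have "\<dots> = (\<Sum>l<n. \<Sum>i<n. B $$ (l, i) * A $$ (i, l))" by (subst sum.swap) (simp add: mult.commute)
  also have "\<dots> = mtr (B * A)"
    using A B unfolding mtr_def by (simp add: mat_mult_entry[OF B A] del: index_mult_mat(1))
  finally show ?thesis .
qed

lemma upper_triangular_pow:
  assumes T: "T \<in> carrier_mat n n" "upper_triangular T"
  shows "upper_triangular (T ^\<^sub>m k) \<and> (\<forall>i<n. (T ^\<^sub>m k) $$ (i, i) = (T $$ (i, i)) ^ k)"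
proof (induction k)
  case 0
  show ?case using T by (auto simp: upper_triangular_def)
next
  case (Suc k)
  have Tk: "T ^\<^sub>m k \<in> carrier_mat n n" using T by simp
  have z: "(T ^\<^sub>m k) $$ (i, l) * T $$ (l, j) = 0" if "i < n" "l < n" "j < n" "j \<le> i" "l \<noteq> i \<or> j \<noteq> i" for i j l
  proof (cases "l < i")
    case True
    then show ?thesis using Suc that Tk unfolding upper_triangular_def by auto
  next
    case False
    then have "j < l" using that by auto
    then show ?thesis using T that unfolding upper_triangular_def by auto
  qed
  have e: "(T ^\<^sub>m Suc k) $$ (i, j) = (\<Sum>l<n. (T ^\<^sub>m k) $$ (i, l) * T $$ (l, j))" if "i < n" "j < n" for i j
    using mat_mult_entry[OF Tk T(1) that] by simp
  have "upper_triangular (T ^\<^sub>m Suc k)"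
    unfolding upper_triangular_def
  proof (intro allI impI)
    fix i j assume "i < dim_row (T ^\<^sub>m Suc k)" "j < i"
    then have ij: "i < n" "j < n" "j < i" using T by auto
    show "(T ^\<^sub>m Suc k) $$ (i, j) = 0" unfolding e[OF ij(1,2)]
      using ij by (intro sum.neutral ballI z) auto
  qed
  moreover have "(T ^\<^sub>m Suc k) $$ (i, i) = (T $$ (i, i)) ^ Suc k" if i: "i < n" for i
  proof -
    have "(T ^\<^sub>m Suc k) $$ (i, i) = (\<Sum>l<n. if l = i then (T ^\<^sub>m k) $$ (i, i) * T $$ (i, i) else 0)"
      unfolding e[OF i i] using i by (intro sum.cong refl) (auto intro: z)
    also have "\<dots> = (T ^\<^sub>m k) $$ (i, i) * T $$ (i, i)" using i by simp
    finally show ?thesis using Suc i by (simp add: power_commutes)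
  qed
  ultimately show ?case by blast
qed

text \<open>
  Schur triangularisation reduces the trace of a power to the powers of the diagonal entries.
\<close>

lemma mtr_pow:
  fixes B :: "real mat"
  assumes B: "B \<in> carrier_mat n n" and cp: "char_poly B = (\<Prod>b\<leftarrow>bs. [:- b, 1:])"
  shows "mtr (B ^\<^sub>m k) = (\<Sum>b\<leftarrow>bs. b ^ k)"
proof -
  obtain T P Q where "schur_decomposition B bs = (T, P, Q)" by (cases "schur_decomposition B bs") auto
  from schur_decomposition[OF B cp this]
  have w: "similar_mat_wit B T P Q" and ut: "upper_triangular T" and d: "diag_mat T = bs" by auto
  from similar_mat_witD2[OF B w] have c: "T \<in> carrier_mat n n" "P \<in> carrier_mat n n" "Q \<in> carrier_mat n n" "Q * P = 1\<^sub>m n" by auto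
  have Tk: "T ^\<^sub>m k \<in> carrier_mat n n" using c by simp
  have "mtr (B ^\<^sub>m k) = mtr (P * (T ^\<^sub>m k * Q))"
    unfolding similar_mat_wit_pow_id[OF w] using assoc_mult_mat[OF c(2) Tk c(3)] by simp
  also have "\<dots> = mtr (T ^\<^sub>m k * Q * P)" using mtr_commute[OF c(2) mult_carrier_mat[OF Tk c(3)]] by simp
  also have "T ^\<^sub>m k * Q * P = T ^\<^sub>m k" using assoc_mult_mat[OF Tk c(3,2)] c(4) right_mult_one_mat[OF Tk] by simp
  also have "mtr (T ^\<^sub>m k) = (\<Sum>i<n. (T $$ (i, i)) ^ k)"
    unfolding mtr_def using upper_triangular_pow[OF c(1) ut, of k] Tk by (intro sum.cong) auto
  also have "\<dots> = (\<Sum>b\<leftarrow>diag_mat T. b ^ k)"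
    using c(1) by (simp add: diag_mat_def o_def sum_list_distinct_conv_sum_set lessThan_atLeast0)
  finally show ?thesis unfolding d .
qed

text \<open>
  Over the complex numbers the characteristic polynomial splits. For an eigenvector \<open>v\<close> with eigenvalue \<open>a\<close> the
  Hermitian form \<open>q\<close> of \<open>B\<close> at \<open>v\<close> is real and equals \<open>a\<close> times the squared norm of \<open>v\<close>, so \<open>a\<close> is real.
\<close>

lemma symmetric_char_poly_splits:
  fixes B :: "real mat"
  assumes B: "B \<in> carrier_mat n n" and sym: "\<And>i j. i < n \<Longrightarrow> j < n \<Longrightarrow> B $$ (i, j) = B $$ (j, i)"
  obtains bs where "char_poly B = (\<Prod>b\<leftarrow>bs. [:- b, 1:])" "length bs = n"
proof -
  define C where "C = map_mat complex_of_real B"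
  have C: "C \<in> carrier_mat n n" using B by (simp add: C_def)
  obtain as where as: "char_poly C = (\<Prod>a\<leftarrow>as. [:- a, 1:])" "length as = n" using char_poly_factorized[OF C] by blast
  have re: "Im a = 0" if "a \<in> set as" for a
  proof -
    have "poly (char_poly C) a = 0" unfolding as poly_prod_list using that by (auto simp: prod_list_zero_iff)
    then have "eigenvalue C a" using eigenvalue_root_char_poly[OF C] by simp
    then obtain v where v: "v \<in> carrier_vec n" "v \<noteq> 0\<^sub>v n" "C *\<^sub>v v = a \<cdot>\<^sub>v v"
      unfolding eigenvalue_def eigenvector_def using C by auto
    have row: "(\<Sum>j<n. complex_of_real (B $$ (i, j)) * v $ j) = a * v $ i" if "i < n" for i
    proof -
      have "(C *\<^sub>v v) $ i = (\<Sum>j<n. complex_of_real (B $$ (i, j)) * v $ j)"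
        using that v(1) B unfolding C_def by (simp add: scalar_prod_def lessThan_atLeast0)
      then show ?thesis using v that by simp
    qed
    define S where "S = (\<Sum>i<n. (cmod (v $ i))\<^sup>2)"
    define q where "q = (\<Sum>i<n. \<Sum>j<n. cnj (v $ i) * (complex_of_real (B $$ (i, j)) * v $ j))"
    have q1: "q = a * complex_of_real S"
    proof -
      have "q = (\<Sum>i<n. cnj (v $ i) * (a * v $ i))" unfolding q_def
        by (intro sum.cong refl) (simp add: row sum_distrib_left[symmetric])
      also have "\<dots> = (\<Sum>i<n. a * complex_of_real ((cmod (v $ i))\<^sup>2))"
        unfolding complex_norm_square by (simp add: mult_ac)
      also have "\<dots> = a * complex_of_real S" unfolding S_def of_real_sum by (rule sum_distrib_left[symmetric])
      finally show ?thesis .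
    qed
    have "cnj q = (\<Sum>i<n. \<Sum>j<n. v $ i * (complex_of_real (B $$ (i, j)) * cnj (v $ j)))"
      unfolding q_def by simp
    also have "\<dots> = (\<Sum>j<n. \<Sum>i<n. v $ i * (complex_of_real (B $$ (i, j)) * cnj (v $ j)))" by (rule sum.swap)
    also have "\<dots> = q" unfolding q_def by (intro sum.cong refl) (use sym in \<open>simp add: mult_ac\<close>)
    finally have "cnj q = q" .
    from arg_cong[OF this, of Im] have "Im q = 0" by simp
    then have "Im a * S = 0" unfolding q1 by simp
    moreover have "S > 0"
    proof -
      obtain i where i: "i < n" "v $ i \<noteq> 0" using v(1,2) by (metis carrier_vecD eq_vecI index_zero_vec(1) index_zero_vec(2))
      have "(cmod (v $ i))\<^sup>2 \<le> S" unfolding S_def by (rule member_le_sum) (use i in auto)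
      from less_le_trans[OF _ this] show ?thesis using i by simp
    qed
    ultimately show ?thesis by simp
  qed
  define bs where "bs = map Re as"
  have "poly (char_poly B) x = poly (\<Prod>b\<leftarrow>bs. [:- b, 1:]) x" for x
  proof -
    have "complex_of_real (poly (char_poly B) x) = poly (char_poly C) (complex_of_real x)"
      unfolding C_def of_real_hom.char_poly_hom[OF B] by simp
    also have "\<dots> = (\<Prod>a\<leftarrow>as. complex_of_real x - a)" unfolding as poly_prod_list by (simp add: o_def)
    also have "\<dots> = (\<Prod>a\<leftarrow>as. complex_of_real (x - Re a))"
      by (intro arg_cong[where f=prod_list] map_cong refl) (use re in \<open>simp add: complex_eq_iff\<close>)
    also have "\<dots> = complex_of_real (\<Prod>a\<leftarrow>as. x - Re a)" by (induction as) auto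
    also have "\<dots> = complex_of_real (poly (\<Prod>b\<leftarrow>bs. [:- b, 1:]) x)"
      unfolding poly_prod_list bs_def by (simp add: o_def)
    finally show ?thesis by (simp only: of_real_eq_iff)
  qed
  then have "char_poly B = (\<Prod>b\<leftarrow>bs. [:- b, 1:])" by (intro poly_eqI_degree poly_eq_poly_eq_iff[THEN iffD1] ext)
  then show thesis by (rule that) (simp add: bs_def as(2))
qed

lemma proots_linear_factors: "proots (\<Prod>b\<leftarrow>bs. [:- b, 1:]) = mset (bs :: real list)"
proof (induction bs)
  case (Cons b bs)
  have "(\<Prod>b\<leftarrow>bs. [:- b, 1:]) \<noteq> 0" by (auto simp: prod_list_zero_iff)
  then have "proots ([:- b, 1:] * (\<Prod>b\<leftarrow>bs. [:- b, 1:])) = {#b#} + mset bs"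
    by (subst proots_mult) (simp_all add: Cons)
  then show ?case by simp
qed simp

lemma sum_eigval:
  fixes B :: "real mat"
  assumes cp: "char_poly B = (\<Prod>b\<leftarrow>bs. [:- b, 1:])" "length bs = n"
  shows "(\<Sum>i=1..n. F (eigval B i)) = (\<Sum>b\<leftarrow>bs. F b)"
proof -
  define L where "L = rev (sorted_list_of_multiset (proots (char_poly B)))"
  have "proots (char_poly B) = mset bs"
    unfolding cp(1) by (rule proots_linear_factors)
  then have m: "mset L = mset bs" by (simp add: L_def)
  then have len: "length L = n" using cp(2) by (metis size_mset)
  have e: "eigval B i = L ! (i - 1)" for i unfolding eigval_def L_def ..
  have "(\<Sum>i=1..n. F (eigval B i)) = (\<Sum>i<n. F (L ! i))"
    unfolding e One_nat_def sum.atLeast1_atMost_eq by simp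
  also have "\<dots> = (\<Sum>b\<leftarrow>L. F b)" using len by (simp add: sum_list_sum_nth lessThan_atLeast0)
  also have "\<dots> = (\<Sum>b\<leftarrow>bs. F b)" using m by (metis mset_map sum_mset_sum_list)
  finally show "(\<Sum>i=1..n. F (eigval B i)) = (\<Sum>b\<leftarrow>bs. F b)" .
qed

text \<open>
  Composition of step kernels is matrix multiplication; the factor \<open>N\<close> compensates for the measure \<open>1 / N\<close> of a
  cell.
\<close>

lemma kpow_step:
  fixes B :: "real mat"
  assumes N: "N \<ge> 1" and B: "B \<in> carrier_mat N N"
  shows "U.kpow (step_kernel N (\<lambda>i j. real N * B $$ (i - 1, j - 1))) m x y
    = real N * (B ^\<^sub>m Suc m) $$ (idx N x - 1, idx N y - 1)"
proof (induction m arbitrary: x y)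
  case 0
  show ?case using B by (simp add: step_kernel_def)
next
  case (Suc m)
  let ?K = "step_kernel N (\<lambda>i j. real N * B $$ (i - 1, j - 1))"
  have r: "idx N z - 1 < N" for z using idx_range[OF N, of z] N by auto
  have Bm: "B ^\<^sub>m Suc m \<in> carrier_mat N N" using B by (intro pow_carrier_mat)
  have "U.kpow ?K (Suc m) x y = U.kcomp (U.kpow ?K m) (U.kpow ?K 0) x y"
    unfolding U.kpow_add[OF bker_step[OF N]] by simp
  also have "\<dots> = (\<integral>z. (\<lambda>i. real N * (B ^\<^sub>m Suc m) $$ (idx N x - 1, i - 1) * (real N * B $$ (i - 1, idx N y - 1))) (idx N z) \<partial>U)"
    unfolding U.kcomp_def Suc by (simp add: step_kernel_def)
  also have "\<dots> = (\<Sum>i=1..N. real N * (B ^\<^sub>m Suc m) $$ (idx N x - 1, i - 1) * (real N * B $$ (i - 1, idx N y - 1))) / real N"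
    by (rule integral_idx[OF N])
  also have "\<dots> = (\<Sum>l<N. real N * ((B ^\<^sub>m Suc m) $$ (idx N x - 1, l) * B $$ (l, idx N y - 1)))"
    unfolding One_nat_def sum.atLeast1_atMost_eq sum_divide_distrib
    using N by (intro sum.cong refl) simp
  also have "\<dots> = real N * (B ^\<^sub>m Suc (Suc m)) $$ (idx N x - 1, idx N y - 1)"
    using mat_mult_entry[OF Bm B r r, of x y] by (simp add: sum_distrib_left)
  finally show ?case .
qed

lemma eigval_power_sum:
  fixes B :: "real mat"
  assumes N: "N \<ge> 1" and B: "B \<in> carrier_mat N N" and sym: "\<And>i j. i < N \<Longrightarrow> j < N \<Longrightarrow> B $$ (i, j) = B $$ (j, i)"
  shows "(\<Sum>i=1..N. eigval B i ^ Suc m) = U.ktr (U.kpow (step_kernel N (\<lambda>i j. real N * B $$ (i - 1, j - 1))) m)"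
proof -
  obtain bs where bs: "char_poly B = (\<Prod>b\<leftarrow>bs. [:- b, 1:])" "length bs = N"
    using symmetric_char_poly_splits[OF B sym] by blast
  have "(\<Sum>i=1..N. eigval B i ^ Suc m) = mtr (B ^\<^sub>m Suc m)"
    unfolding mtr_pow[OF B bs(1)] by (rule sum_eigval[OF bs, of "\<lambda>b. b ^ Suc m"])
  also have "\<dots> = (\<Sum>i=1..N. real N * (B ^\<^sub>m Suc m) $$ (i - 1, i - 1)) / real N"
    unfolding One_nat_def sum.atLeast1_atMost_eq mtr_def using N B by (simp add: sum_distrib_left[symmetric] del: pow_mat.simps)
  also have "\<dots> = U.ktr (U.kpow (step_kernel N (\<lambda>i j. real N * B $$ (i - 1, j - 1))) m)"
    unfolding U.ktr_def kpow_step[OF N B] by (rule integral_idx[OF N, symmetric])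
  finally show ?thesis .
qed

section \<open>Concentration of the adjacency matrix\<close>

definition upper_pairs :: "nat \<Rightarrow> (nat \<times> nat) set" where
  "upper_pairs N = {(i, j). 1 \<le> i \<and> i \<le> j \<and> j \<le> N}"

lemma upper_pairs_subset: "upper_pairs N \<subseteq> {1..N} \<times> {1..N}" by (auto simp: upper_pairs_def)
lemma finite_upper_pairs [simp]: "finite (upper_pairs N)" by (rule finite_subset[OF upper_pairs_subset]) simp
lemma card_upper_pairs: "card (upper_pairs N) \<le> N\<^sup>2"
  using card_mono[OF _ upper_pairs_subset, of N] by (simp add: power2_eq_square)

text \<open>
  The entries of the adjacency matrix are independent on and above the diagonal only, so double sums are folded.
\<close>

lemma sum_symmetric_pairs:
  fixes d f :: "nat \<Rightarrow> nat \<Rightarrow> real"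
  assumes sym: "\<And>i j. i \<in> {1..N} \<Longrightarrow> j \<in> {1..N} \<Longrightarrow> d i j = d j i"
  shows "(\<Sum>i=1..N. \<Sum>j=1..N. d i j * f i j)
    = (\<Sum>p\<in>upper_pairs N. (if fst p = snd p then f (fst p) (snd p) else f (fst p) (snd p) + f (snd p) (fst p)) * d (fst p) (snd p))"
proof -
  let ?S = "{(i, j). 1 \<le> i \<and> i < j \<and> j \<le> N}" and ?L = "{(i, j). 1 \<le> j \<and> j < i \<and> i \<le> N}"
    and ?D = "{(i, j). 1 \<le> i \<and> i = j \<and> j \<le> N}"
  let ?g = "\<lambda>p. d (fst p) (snd p) * f (fst p) (snd p)"
  have fin: "finite ?S" "finite ?L" "finite ?D"
    by (rule finite_subset[of _ "{1..N} \<times> {1..N}"]; auto)+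
  have u: "upper_pairs N = ?S \<union> ?D" "?S \<inter> ?D = {}" by (auto simp: upper_pairs_def)
  have "(\<Sum>i=1..N. \<Sum>j=1..N. d i j * f i j) = (\<Sum>p\<in>{1..N} \<times> {1..N}. ?g p)"
    by (simp add: sum.cartesian_product split_beta)
  also have "{1..N} \<times> {1..N} = ?S \<union> ?D \<union> ?L" by auto
  also have "(\<Sum>p\<in>?S \<union> ?D \<union> ?L. ?g p) = (\<Sum>p\<in>?S. ?g p) + (\<Sum>p\<in>?D. ?g p) + (\<Sum>p\<in>?L. ?g p)"
    using fin by (subst sum.union_disjoint; (subst sum.union_disjoint)?) auto
  also have "(\<Sum>p\<in>?L. ?g p) = (\<Sum>p\<in>?S. d (fst p) (snd p) * f (snd p) (fst p))"
    by (rule sum.reindex_bij_witness[of _ prod.swap prod.swap]) (auto simp: sym)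
  finally have "(\<Sum>i=1..N. \<Sum>j=1..N. d i j * f i j) =
    (\<Sum>p\<in>?S. d (fst p) (snd p) * (f (fst p) (snd p) + f (snd p) (fst p))) + (\<Sum>p\<in>?D. ?g p)"
    by (simp add: distrib_left sum.distrib)
  also have "\<dots> = (\<Sum>p\<in>?S. (if fst p = snd p then f (fst p) (snd p) else f (fst p) (snd p) + f (snd p) (fst p)) * d (fst p) (snd p))
    + (\<Sum>p\<in>?D. (if fst p = snd p then f (fst p) (snd p) else f (fst p) (snd p) + f (snd p) (fst p)) * d (fst p) (snd p))"
    by (intro arg_cong2[where f="(+)"] sum.cong refl) auto
  also have "\<dots> = (\<Sum>p\<in>upper_pairs N. (if fst p = snd p then f (fst p) (snd p) else f (fst p) (snd p) + f (snd p) (fst p)) * d (fst p) (snd p))"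
    unfolding u(1) using fin u(2) by (subst sum.union_disjoint) auto
  finally show ?thesis .
qed

text \<open>
  Folding a double sum with signs as coefficients produces coefficients of absolute value at most \<open>2\<close>, hence
  summands with values in an interval of length \<open>4\<close>.
\<close>

lemma hoeffding_random_graph:
  assumes M: "prob_space M" and rg: "random_graph M N t W A"
    and t: "0 < t" "t < 1" and W: "\<And>x y. x \<in> {0..1} \<Longrightarrow> y \<in> {0..1} \<Longrightarrow> 0 \<le> W x y \<and> W x y \<le> 1"
    and I: "I \<subseteq> upper_pairs N" "I \<noteq> {}" and c: "\<And>p. p \<in> I \<Longrightarrow> \<bar>c p\<bar> \<le> 2" and e: "0 \<le> e"
  shows "measure M {\<omega>\<in>space M. \<bar>\<Sum>p\<in>I. c p * (of_bool (A (fst p) (snd p) \<omega>) - t * W (real (fst p) / real N) (real (snd p) / real N))\<bar> \<ge> e}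
    \<le> 2 * exp (- e\<^sup>2 / (8 * real (card I)))"
    "{\<omega>\<in>space M. \<bar>\<Sum>p\<in>I. c p * (of_bool (A (fst p) (snd p) \<omega>) - t * W (real (fst p) / real N) (real (snd p) / real N))\<bar> \<ge> e} \<in> sets M"
proof -
  interpret prob_space M by (rule M)
  define q where "q p = t * W (real (fst p) / real N) (real (snd p) / real N)" for p :: "nat \<times> nat"
  define X where "X p \<omega> = c p * of_bool (A (fst p) (snd p) \<omega>)" for p \<omega>
  have ind: "indep_vars (\<lambda>_. count_space UNIV) (\<lambda>(i, j). A i j) (upper_pairs N)"
    using rg unfolding random_graph_def upper_pairs_def by simp
  have A: "distr M (count_space UNIV) (A (fst p) (snd p)) = measure_pmf (bernoulli_pmf (q p))" if "p \<in> upper_pairs N" for p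
    using rg that unfolding random_graph_def upper_pairs_def q_def by (auto simp: case_prod_beta)
  have Am: "A (fst p) (snd p) \<in> measurable M (count_space UNIV)" if "p \<in> upper_pairs N" for p
    using ind that unfolding indep_vars_def by (auto simp: case_prod_beta)
  have q01: "0 \<le> q p \<and> q p \<le> 1" if "p \<in> upper_pairs N" for p
  proof -
    have "real (fst p) / real N \<in> {0..1}" "real (snd p) / real N \<in> {0..1}"
      using that by (auto simp: upper_pairs_def divide_le_eq)
    from W[OF this] show ?thesis unfolding q_def using t mult_le_one[of t] by auto
  qed
  have finI: "finite I" by (rule finite_subset[OF I(1)]) simp
  have indX: "indep_vars (\<lambda>_. borel) X I"
  proof -
    have "indep_vars (\<lambda>_. borel) (\<lambda>p \<omega>. (\<lambda>b. c p * of_bool b) ((\<lambda>(i, j). A i j) p \<omega>)) I"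
      by (rule indep_vars_compose2[OF indep_vars_subset[OF ind I(1)]]) simp
    then show ?thesis unfolding X_def[abs_def] by (simp add: case_prod_beta)
  qed
  have Xm: "X p \<in> borel_measurable M" if "p \<in> I" for p
    using indX that unfolding indep_vars_def by auto
  have ex: "expectation (X p) = c p * q p" if p: "p \<in> I" for p
  proof -
    have pu: "p \<in> upper_pairs N" using p I by blast
    have "expectation (X p) = (\<integral>b. c p * of_bool b \<partial>distr M (count_space UNIV) (A (fst p) (snd p)))"
      unfolding X_def by (rule integral_distr[OF Am[OF pu], symmetric]) simp
    also have "\<dots> = c p * q p" unfolding A[OF pu] using q01[OF pu] by simp
    finally show ?thesis .
  qed
  have H: "Hoeffding_ineq M I X (\<lambda>_. -2) (\<lambda>_. 2)"
  proof unfold_locales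
    show "AE x in M. X i x \<in> {- 2..2}" if "i \<in> I" for i
      using c[OF that] by (intro AE_I2) (auto simp: X_def)
  qed (use finI indX in auto)
  have "0 < card I" using I finI by (simp add: card_gt_0_iff)
  then have pos: "(\<Sum>i\<in>I. (2 - (- 2 :: real))\<^sup>2) > 0" by simp
  have s: "(\<Sum>p\<in>I. X p \<omega>) - (\<Sum>p\<in>I. expectation (X p)) = (\<Sum>p\<in>I. c p * (of_bool (A (fst p) (snd p) \<omega>) - q p))" for \<omega>
    by (simp add: sum_subtractf[symmetric] ex X_def right_diff_distrib)
  have "prob {\<omega>\<in>space M. \<bar>(\<Sum>p\<in>I. X p \<omega>) - (\<Sum>p\<in>I. expectation (X p))\<bar> \<ge> e} \<le> 2 * exp (-2 * e\<^sup>2 / (\<Sum>i\<in>I. (2 - (- 2 :: real))\<^sup>2))"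
    by (rule Hoeffding_ineq.Hoeffding_ineq_abs_ge[OF H e pos])
  also have "-2 * e\<^sup>2 / (\<Sum>i\<in>I. (2 - (- 2 :: real))\<^sup>2) = - e\<^sup>2 / (8 * real (card I))" by simp
  finally show "prob {\<omega>\<in>space M. \<bar>\<Sum>p\<in>I. c p * (of_bool (A (fst p) (snd p) \<omega>) - t * W (real (fst p) / real N) (real (snd p) / real N))\<bar> \<ge> e}
    \<le> 2 * exp (- e\<^sup>2 / (8 * real (card I)))" unfolding s q_def[symmetric] .
  have [measurable]: "(\<lambda>\<omega>. (\<Sum>p\<in>I. X p \<omega>) - (\<Sum>p\<in>I. expectation (X p))) \<in> borel_measurable M"
    using Xm by (intro borel_measurable_diff borel_measurable_sum) auto
  have "{\<omega>\<in>space M. \<bar>(\<Sum>p\<in>I. X p \<omega>) - (\<Sum>p\<in>I. expectation (X p))\<bar> \<ge> e} \<in> sets M" by measurable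
  then show "{\<omega>\<in>space M. \<bar>\<Sum>p\<in>I. c p * (of_bool (A (fst p) (snd p) \<omega>) - t * W (real (fst p) / real N) (real (snd p) / real N))\<bar> \<ge> e} \<in> sets M"
    unfolding s q_def[symmetric] .
qed

text \<open>
  Extensional functions, so that there are exactly \<open>2 ^ N\<close> of them.
\<close>

definition signs :: "nat \<Rightarrow> (nat \<Rightarrow> real) set" where
  "signs N = {1..N} \<rightarrow>\<^sub>E {-1, 1}"

lemma signs_value: assumes "s \<in> signs N" "i \<in> {1..N}" shows "s i = -1 \<or> s i = 1"
  using PiE_mem[OF assms[unfolded signs_def]] by simp

lemma finite_signs [simp]: "finite (signs N)" unfolding signs_def by (intro finite_PiE) auto
lemma card_signs: "card (signs N) = 2 ^ N" unfolding signs_def by (simp add: card_PiE numeral_2_eq_2)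

lemma summable_exp_square: assumes "0 < c" shows "summable (\<lambda>N. 4 ^ N * (2 * exp (- c * (real N)\<^sup>2)))"
proof (rule summable_comparison_test_ev)
  show "summable (\<lambda>N. 2 * (1 / 2) ^ N :: real)" by (intro summable_mult summable_geometric) simp
  obtain N0 where N0: "ln 8 / c \<le> real N0" using real_arch_simple by blast
  show "\<forall>\<^sub>F N in sequentially. norm (4 ^ N * (2 * exp (- c * (real N)\<^sup>2))) \<le> 2 * (1 / 2) ^ N"
  proof (rule eventually_sequentiallyI[of N0])
    fix N assume "N0 \<le> N"
    then have "ln 8 / c \<le> real N" using N0 by linarith
    then have "ln 8 \<le> c * real N" using assms by (simp add: field_simps)
    then have "exp (- (c * real N)) \<le> exp (- ln 8)" by simp
    also have "\<dots> = 1 / 8" by (simp add: exp_minus)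
    finally have le: "exp (- (c * real N)) \<le> 1 / 8" .
    have "exp (- c * (real N)\<^sup>2) = exp (real N * (- (c * real N)))" by (simp add: power2_eq_square mult_ac)
    also have "\<dots> = exp (- (c * real N)) ^ N" by (rule exp_of_nat_mult)
    also have "\<dots> \<le> (1 / 8) ^ N" by (intro power_mono le) simp
    finally have "4 ^ N * (2 * exp (- c * (real N)\<^sup>2)) \<le> 4 ^ N * (2 * (1 / 8) ^ N)" by (intro mult_left_mono) auto
    also have "\<dots> = 2 * (4 * (1 / 8)) ^ N" by (simp only: power_mult_distrib mult_ac)
    finally show "norm (4 ^ N * (2 * exp (- c * (real N)\<^sup>2))) \<le> 2 * (1 / 2) ^ N" by simp
  qed
qed

lemma summable_exp_linear: assumes "0 < c" shows "summable (\<lambda>N. 2 * exp (- c * real N))"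
proof -
  have "exp (- c * real N) = exp (- c) ^ N" for N by (simp add: exp_of_nat_mult[symmetric] mult.commute)
  then show ?thesis using assms by (auto intro!: summable_mult summable_geometric)
qed

definition centred :: "nat \<Rightarrow> real \<Rightarrow> (real \<Rightarrow> real \<Rightarrow> real) \<Rightarrow> (nat \<Rightarrow> nat \<Rightarrow> 'w \<Rightarrow> bool) \<Rightarrow> 'w \<Rightarrow> nat \<Rightarrow> nat \<Rightarrow> real" where
  "centred N t W A \<omega> i j = of_bool (A i j \<omega>) - t * W (real i / real N) (real j / real N)"

text \<open>
  There are \<open>4 ^ N\<close> pairs of sign vectors, and each fails with a probability of order \<open>exp (- c N\<^sup>2)\<close>, so the union
  bound is summable and the Borel--Cantelli lemma applies. The diagonal is a single event with probability of order
  \<open>exp (- c N)\<close>.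
\<close>

lemma random_graph_concentration:
  fixes A :: "nat \<Rightarrow> nat \<Rightarrow> nat \<Rightarrow> 'w \<Rightarrow> bool"
  assumes M: "prob_space M" and rg: "\<And>N. N \<ge> 1 \<Longrightarrow> random_graph M N (t N) W (A N)"
    and t: "\<And>N. N \<ge> 1 \<Longrightarrow> 0 < t N \<and> t N < 1" and W: "graphon W" and \<delta>: "0 < \<delta>"
  shows "AE \<omega> in M. \<forall>\<^sub>F N in sequentially.
     (\<forall>s\<in>signs N. \<forall>u\<in>signs N. \<bar>\<Sum>i=1..N. \<Sum>j=1..N. centred N (t N) W (A N) \<omega> i j * (s i * u j)\<bar> < \<delta> * (real N)\<^sup>2) \<and>
     \<bar>\<Sum>i=1..N. centred N (t N) W (A N) \<omega> i i\<bar> < \<delta> * real N"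
proof -
  interpret prob_space M by (rule M)
  have W1: "W x y = W y x" "0 \<le> W x y \<and> W x y \<le> 1" if "x \<in> {0..1}" "y \<in> {0..1}" for x y
    using W that by (auto simp: graphon_def)
  \<comment> \<open>The coefficients after folding the double sum onto the pairs with \<open>i \<le> j\<close>.\<close>
  define c where "c s u p = (if fst p = snd p then s (fst p) * u (snd p) else s (fst p) * u (snd p) + s (snd p) * u (fst p))"
    for s u :: "nat \<Rightarrow> real" and p :: "nat \<times> nat"
  have c2: "\<bar>c s u p\<bar> \<le> 2" if "p \<in> upper_pairs N" "s \<in> signs N" "u \<in> signs N" for p s u N
  proof -
    have m: "fst p \<in> {1..N}" "snd p \<in> {1..N}" using that(1) by (auto simp: upper_pairs_def)
    show ?thesis
      using signs_value[OF that(2) m(1)] signs_value[OF that(2) m(2)] signs_value[OF that(3) m(1)] signs_value[OF that(3) m(2)]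
      unfolding c_def by auto
  qed
  define S where "S N I f \<omega> = (\<Sum>p\<in>I. f p * (of_bool (A N (fst p) (snd p) \<omega>) - t N * W (real (fst p) / real N) (real (snd p) / real N)))"
    for N and I :: "(nat \<times> nat) set" and f :: "nat \<times> nat \<Rightarrow> real" and \<omega>
  define bad where "bad N s u = {\<omega> \<in> space M. \<bar>S N (upper_pairs N) (c s u) \<omega>\<bar> \<ge> \<delta> * (real N)\<^sup>2}" for N s u
  define diag where "diag N = (\<lambda>i. (i, i)) ` {1..N}" for N :: nat
  define bad1 where "bad1 N = (if N = 0 then {} else (\<Union>(s, u)\<in>signs N \<times> signs N. bad N s u))" for N
  define bad2 where "bad2 N = (if N = 0 then {} else {\<omega> \<in> space M. \<bar>S N (diag N) (\<lambda>_. 1) \<omega>\<bar> \<ge> \<delta> * real N})" for N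
  have bad: "bad N s u \<in> events" "prob (bad N s u) \<le> 2 * exp (- (\<delta>\<^sup>2 / 8) * (real N)\<^sup>2)"
    if N: "N \<ge> 1" and su: "s \<in> signs N" "u \<in> signs N" for N s u
  proof -
    have "(1, 1) \<in> upper_pairs N" using N by (simp add: upper_pairs_def)
    then have ne: "upper_pairs N \<noteq> {}" by blast
    have d: "0 \<le> \<delta> * (real N)\<^sup>2" using \<delta> by simp
    note h = hoeffding_random_graph[OF M rg[OF N] t[OF N, THEN conjunct1] t[OF N, THEN conjunct2] W1(2) subset_refl ne c2[OF _ su] d]
    show "bad N s u \<in> events" unfolding bad_def S_def by (rule h(2))
    have "prob (bad N s u) \<le> 2 * exp (- (\<delta> * (real N)\<^sup>2)\<^sup>2 / (8 * real (card (upper_pairs N))))"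
      unfolding bad_def S_def by (rule h(1))
    also have "\<dots> \<le> 2 * exp (- (\<delta>\<^sup>2 / 8) * (real N)\<^sup>2)"
    proof -
      have c0: "0 < card (upper_pairs N)" using ne by (simp add: card_gt_0_iff)
      have cle: "real (card (upper_pairs N)) \<le> (real N)\<^sup>2" using card_upper_pairs[of N] by (metis of_nat_le_iff of_nat_power)
      have "(\<delta>\<^sup>2 / 8) * (real N)\<^sup>2 = (\<delta> * (real N)\<^sup>2)\<^sup>2 / (8 * (real N)\<^sup>2)" using N by (simp add: power2_eq_square)
      also have "\<dots> \<le> (\<delta> * (real N)\<^sup>2)\<^sup>2 / (8 * real (card (upper_pairs N)))"
        using c0 cle N by (intro divide_left_mono mult_left_mono) auto
      finally show ?thesis by simp
    qed
    finally show "prob (bad N s u) \<le> 2 * exp (- (\<delta>\<^sup>2 / 8) * (real N)\<^sup>2)" .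
  qed
  have bad1: "bad1 N \<in> events" "prob (bad1 N) \<le> 4 ^ N * (2 * exp (- (\<delta>\<^sup>2 / 8) * (real N)\<^sup>2))" for N
  proof -
    show ev: "bad1 N \<in> events" unfolding bad1_def using bad(1)[of N] by (auto intro!: sets.finite_UN)
    show "prob (bad1 N) \<le> 4 ^ N * (2 * exp (- (\<delta>\<^sup>2 / 8) * (real N)\<^sup>2))"
    proof (cases "N = 0")
      case False
      then have N: "N \<ge> 1" by simp
      have "prob (bad1 N) \<le> (\<Sum>p\<in>signs N \<times> signs N. prob (case p of (s, u) \<Rightarrow> bad N s u))"
        unfolding bad1_def using False bad(1)[OF N] by (auto intro!: finite_measure_subadditive_finite)
      also have "\<dots> \<le> (\<Sum>p\<in>signs N \<times> signs N. 2 * exp (- (\<delta>\<^sup>2 / 8) * (real N)\<^sup>2))"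
        using bad(2)[OF N] by (intro sum_mono) auto
      also have "\<dots> = 4 ^ N * (2 * exp (- (\<delta>\<^sup>2 / 8) * (real N)\<^sup>2))"
        by (simp add: card_cartesian_product card_signs power_mult_distrib[symmetric])
      finally show ?thesis .
    qed (simp add: bad1_def)
  qed
  have bad2: "bad2 N \<in> events" "prob (bad2 N) \<le> 2 * exp (- (\<delta>\<^sup>2 / 8) * real N)" for N
  proof -
    have "bad2 N \<in> events \<and> prob (bad2 N) \<le> 2 * exp (- (\<delta>\<^sup>2 / 8) * real N)"
    proof (cases "N = 0")
      case False
      then have N: "N \<ge> 1" by simp
      have dg: "diag N \<subseteq> upper_pairs N" "diag N \<noteq> {}" using N by (auto simp: diag_def upper_pairs_def)
      have cd: "card (diag N) = N" unfolding diag_def by (subst card_image) (auto simp: inj_on_def)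
      have d: "0 \<le> \<delta> * real N" using \<delta> by simp
      have one: "\<bar>(\<lambda>_. 1) p\<bar> \<le> (2::real)" if "p \<in> diag N" for p :: "nat \<times> nat" by simp
      note h = hoeffding_random_graph[OF M rg[OF N] t[OF N, THEN conjunct1] t[OF N, THEN conjunct2] W1(2) dg one d]
      have 1: "bad2 N \<in> events" unfolding bad2_def S_def if_not_P[OF False] by (rule h(2))
      have "prob (bad2 N) \<le> 2 * exp (- (\<delta> * real N)\<^sup>2 / (8 * real (card (diag N))))"
        unfolding bad2_def S_def if_not_P[OF False] by (rule h(1))
      also have "- (\<delta> * real N)\<^sup>2 / (8 * real (card (diag N))) = - (\<delta>\<^sup>2 / 8) * real N"
        unfolding cd using N by (simp add: power2_eq_square)
      finally show ?thesis using 1 by simp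
    qed (simp add: bad2_def)
    then show "bad2 N \<in> events" "prob (bad2 N) \<le> 2 * exp (- (\<delta>\<^sup>2 / 8) * real N)" by auto
  qed
  have d8: "0 < \<delta>\<^sup>2 / 8" using \<delta> by simp
  have s1: "summable (\<lambda>N. prob (bad1 N))"
    by (rule summable_comparison_test'[OF summable_exp_square[OF d8], of 0]) (use bad1 in simp)
  have s2: "summable (\<lambda>N. prob (bad2 N))"
    by (rule summable_comparison_test'[OF summable_exp_linear[OF d8], of 0]) (use bad2 in simp)
  have "AE \<omega> in M. \<forall>\<^sub>F N in sequentially. \<omega> \<in> space M - bad1 N"
    by (rule borel_cantelli_AE1[OF bad1(1) _ s1]) (simp add: emeasure_eq_measure)
  moreover have "AE \<omega> in M. \<forall>\<^sub>F N in sequentially. \<omega> \<in> space M - bad2 N"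
    by (rule borel_cantelli_AE1[OF bad2(1) _ s2]) (simp add: emeasure_eq_measure)
  ultimately show ?thesis
  proof eventually_elim
    case (elim \<omega>)
    show ?case using elim(1,2) eventually_ge_at_top[of 1]
    proof eventually_elim
      case (elim N)
      then have N: "N \<ge> 1" and \<omega>: "\<omega> \<in> space M" by auto
      have symA: "A N i j \<omega> = A N j i \<omega>" if "i \<in> {1..N}" "j \<in> {1..N}" for i j
        using rg[OF N] that \<omega> unfolding random_graph_def by blast
      have sym: "centred N (t N) W (A N) \<omega> i j = centred N (t N) W (A N) \<omega> j i" if "i \<in> {1..N}" "j \<in> {1..N}" for i j
      proof -
        have "real i / real N \<in> {0..1}" "real j / real N \<in> {0..1}" using that by (auto simp: divide_le_eq)
        from W1(1)[OF this] show ?thesis unfolding centred_def symA[OF that] by (simp only:)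
      qed
      have "\<bar>\<Sum>i=1..N. \<Sum>j=1..N. centred N (t N) W (A N) \<omega> i j * (s i * u j)\<bar> < \<delta> * (real N)\<^sup>2"
        if su: "s \<in> signs N" "u \<in> signs N" for s u
      proof -
        have "\<omega> \<notin> bad N s u" using elim(1) N su unfolding bad1_def by auto
        then have "\<bar>S N (upper_pairs N) (c s u) \<omega>\<bar> < \<delta> * (real N)\<^sup>2" using \<omega> unfolding bad_def by auto
        moreover have "S N (upper_pairs N) (c s u) \<omega> = (\<Sum>i=1..N. \<Sum>j=1..N. centred N (t N) W (A N) \<omega> i j * (s i * u j))"
          using sum_symmetric_pairs[where d="centred N (t N) W (A N) \<omega>" and f="\<lambda>i j. s i * u j", OF sym]
          unfolding S_def c_def centred_def by (rule HOL.sym)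
        ultimately show ?thesis by simp
      qed
      moreover have "\<bar>\<Sum>i=1..N. centred N (t N) W (A N) \<omega> i i\<bar> < \<delta> * real N"
      proof -
        have "\<bar>S N (diag N) (\<lambda>_. 1) \<omega>\<bar> < \<delta> * real N" using elim(2) N unfolding bad2_def by auto
        moreover have "S N (diag N) (\<lambda>_. 1) \<omega> = (\<Sum>i=1..N. centred N (t N) W (A N) \<omega> i i)"
          unfolding S_def diag_def centred_def by (subst sum.reindex) (auto simp: inj_on_def)
        ultimately show ?thesis by simp
      qed
      ultimately show ?case by blast
    qed
  qed
qed

section \<open>The characteristic function of a squared normal variable\<close>

lemma exp_neg_square_tendsto:
  assumes "0 < Re a"
  shows "((\<lambda>u::real. exp (- a * of_real (u\<^sup>2))) \<longlongrightarrow> (0::complex)) at_top"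
proof (rule Lim_null_comparison)
  show "\<forall>\<^sub>F u in at_top. norm (exp (- a * of_real (u\<^sup>2))) \<le> exp (- Re a * u\<^sup>2)" by (simp add: norm_exp_eq_Re)
  have "filterlim (\<lambda>u::real. u ^ 2) at_top at_top" by (rule filterlim_pow_at_top[OF _ filterlim_ident]) simp
  then have "filterlim (\<lambda>u::real. - Re a * u\<^sup>2) at_bot at_top"
    using assms by (intro filterlim_tendsto_neg_mult_at_bot[OF tendsto_const]) auto
  then show "((\<lambda>u::real. exp (- Re a * u\<^sup>2)) \<longlongrightarrow> 0) at_top" by (rule filterlim_compose[OF exp_at_bot])
qed

lemma rayleigh_real:
  assumes r: "0 < r"
  shows "integrable lborel (\<lambda>u::real. indicator {0<..} u * (u * exp (- r * u\<^sup>2)))"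
    "(\<integral>u. indicator {0<..} u * (u * exp (- r * u\<^sup>2)) \<partial>lborel) = 1 / (2 * r)"
proof -
  let ?F = "\<lambda>u::real. - exp (- r * u\<^sup>2) / (2 * r)" and ?f = "\<lambda>u::real. u * exp (- r * u\<^sup>2)"
  have D: "DERIV ?F x :> ?f x" for x
    using r by (auto intro!: derivative_eq_intros)
  have A: "((?F \<circ> real_of_ereal) \<longlongrightarrow> - 1 / (2 * r)) (at_right 0)"
    unfolding zero_ereal_def ereal_tendsto_simps
  proof -
    have "(?F \<longlongrightarrow> ?F 0) (at_right 0)" by (intro tendsto_intros) (use r in auto)
    then show "(?F \<longlongrightarrow> - 1 / (2 * r)) (at_right 0)" by simp
  qed
  have B: "((?F \<circ> real_of_ereal) \<longlongrightarrow> 0) (at_left \<infinity>)"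
    unfolding ereal_tendsto_simps
  proof -
    have "((\<lambda>u. exp (- complex_of_real r * of_real (u\<^sup>2))) \<longlongrightarrow> 0) at_top"
      by (rule exp_neg_square_tendsto) (use r in simp)
    from tendsto_Re[OF this] have "((\<lambda>u. exp (- r * u\<^sup>2)) \<longlongrightarrow> 0) at_top"
      by (simp add: Re_exp)
    from tendsto_divide[OF tendsto_minus[OF this] tendsto_const, of "2 * r"]
    show "(?F \<longlongrightarrow> 0) at_top" using r by simp
  qed
  note h = interval_integral_FTC_nonneg[of 0 \<infinity> ?F ?f, OF _ D _ _ A B]
  have e: "einterval 0 \<infinity> = {0<..}" by (auto simp: einterval_def zero_ereal_def)
  have "set_integrable lborel (einterval 0 \<infinity>) ?f" by (rule h(1)) (auto simp: zero_ereal_def intro!: continuous_intros)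
  then show "integrable lborel (\<lambda>u::real. indicator {0<..} u * (u * exp (- r * u\<^sup>2)))"
    unfolding e set_integrable_def by simp
  have "(LBINT x=0..\<infinity>. ?f x) = 0 - (- 1 / (2 * r))" by (rule h(2)) (auto simp: zero_ereal_def intro!: continuous_intros)
  then show "(\<integral>u. indicator {0<..} u * (u * exp (- r * u\<^sup>2)) \<partial>lborel) = 1 / (2 * r)"
    unfolding interval_lebesgue_integral_def set_lebesgue_integral_def e by simp
qed

lemma rayleigh_complex:
  fixes a :: complex
  assumes r: "0 < Re a"
  shows "integrable lborel (\<lambda>u::real. indicator {0<..} u *\<^sub>R (of_real u * exp (- a * of_real (u\<^sup>2))))"
    "(\<integral>u. indicator {0<..} u *\<^sub>R (of_real u * exp (- a * of_real (u\<^sup>2))) \<partial>lborel) = 1 / (2 * a)"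
proof -
  let ?F = "\<lambda>u::real. - exp (- a * of_real (u\<^sup>2)) / (2 * a)" and ?f = "\<lambda>u::real. of_real u * exp (- a * of_real (u\<^sup>2))"
  have a0: "a \<noteq> 0" using r by auto
  show int: "integrable lborel (\<lambda>u::real. indicator {0<..} u *\<^sub>R ?f u)"
  proof (rule Bochner_Integration.integrable_bound[OF rayleigh_real(1)[OF r]])
    show "AE u in lborel. norm (indicator {0<..} u *\<^sub>R ?f u) \<le> norm (indicator {0<..} u * (u * exp (- Re a * u\<^sup>2)))"
      by (intro AE_I2) (auto simp: norm_mult norm_exp_eq_Re indicator_def)
  qed measurable
  have e: "einterval 0 \<infinity> = {0<..}" by (auto simp: einterval_def zero_ereal_def)
  have D: "(?F has_vector_derivative ?f x) (at x)" for x
  proof -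
    have "((\<lambda>z::complex. - exp (- a * z\<^sup>2) / (2 * a)) has_field_derivative (of_real x * exp (- a * (of_real x)\<^sup>2))) (at (of_real x))"
      using a0 by (auto intro!: derivative_eq_intros)
    from has_vector_derivative_real_field[OF this] show ?thesis by simp
  qed
  have "(LBINT x=0..\<infinity>. ?f x) = 0 - (- 1 / (2 * a))"
  proof (rule interval_integral_FTC_integrable[where F="?F"])
    show "set_integrable lborel (einterval 0 \<infinity>) ?f" using int unfolding e set_integrable_def .
    show "((?F \<circ> real_of_ereal) \<longlongrightarrow> - 1 / (2 * a)) (at_right 0)"
      unfolding zero_ereal_def ereal_tendsto_simps
    proof -
      have "(?F \<longlongrightarrow> ?F 0) (at_right 0)" by (intro tendsto_intros) (use a0 in auto)
      then show "(?F \<longlongrightarrow> - 1 / (2 * a)) (at_right 0)" by simp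
    qed
    show "((?F \<circ> real_of_ereal) \<longlongrightarrow> 0) (at_left \<infinity>)"
      unfolding ereal_tendsto_simps
      using tendsto_divide[OF tendsto_minus[OF exp_neg_square_tendsto[OF r]] tendsto_const, of "2 * a"] a0 by simp
    show "(?F has_vector_derivative ?f x) (at x)" for x by (rule D)
    show "isCont ?f x" for x by (intro continuous_intros)
  qed simp
  then show "(\<integral>u. indicator {0<..} u *\<^sub>R ?f u \<partial>lborel) = 1 / (2 * a)"
    unfolding interval_lebesgue_integral_def set_lebesgue_integral_def e by simp
qed

lemma integral_inverse_one_plus_square:
  "integrable lborel (\<lambda>s::real. indicator {0<..} s * (1 / (1 + s\<^sup>2)))"
  "(\<integral>s. indicator {0<..} s * (1 / (1 + s\<^sup>2)) \<partial>lborel) = pi / 2"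
proof -
  have e: "einterval 0 \<infinity> = {0<..}" by (auto simp: einterval_def zero_ereal_def)
  show "integrable lborel (\<lambda>s::real. indicator {0<..} s * (1 / (1 + s\<^sup>2)))"
    using integrable_I0i_1_div_plus_square
    unfolding interval_lebesgue_integrable_def set_integrable_def e by simp
  show "(\<integral>s. indicator {0<..} s * (1 / (1 + s\<^sup>2)) \<partial>lborel) = pi / 2"
    using LBINT_I0i_1_div_plus_square
    unfolding interval_lebesgue_integral_def set_lebesgue_integral_def e by simp
qed

lemma exp_half_square_integrable: "integrable lborel (\<lambda>u::real. exp (- (1 / 2) * u\<^sup>2))"
proof -
  have "integrable lborel (\<lambda>u. sqrt (2 * pi) * std_normal_density u)" by simp
  then show ?thesis by (simp add: std_normal_density_def)
qed

text \<open>
  The square of the half-line integral is a double integral over \<open>(u, v)\<close>. The substitution \<open>v = u s\<close> turns the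
  integrand into \<open>u exp (- c (1 + s\<^sup>2) u\<^sup>2)\<close>, which is elementary in \<open>u\<close> and leaves \<open>1 / (2 c (1 + s\<^sup>2))\<close>. This
  determines the integral for complex \<open>c\<close> up to its sign.
\<close>

lemma complex_gaussian_square:
  fixes c :: complex
  assumes c: "Re c = 1 / 2"
  shows "(\<integral>u. exp (- c * of_real (u\<^sup>2)) \<partial>lborel)\<^sup>2 = of_real pi / c"
proof -
  define g where "g u = exp (- c * of_real (u\<^sup>2))" for u :: real
  have c0: "c \<noteq> 0" using c by auto
  have gm [measurable]: "g \<in> borel_measurable borel" unfolding g_def[abs_def] by measurable
  have gi: "integrable lborel g"
    by (rule Bochner_Integration.integrable_bound[OF exp_half_square_integrable])
       (auto simp: g_def[abs_def] norm_exp_eq_Re c)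
  define h where "h u = indicator {0<..} u *\<^sub>R g u" for u :: real
  have hi: "integrable lborel h" unfolding h_def[abs_def]
    by (rule Bochner_Integration.integrable_bound[OF gi]) (auto simp: indicator_def)
  define J where "J = (\<integral>u. h u \<partial>lborel)"
  have ref: "(\<integral>u. h (- u) \<partial>lborel) = J"
    using lborel_integral_real_affine[of "-1" h 0] unfolding J_def by simp
  have hi': "integrable lborel (\<lambda>u. h (- u))"
    using lborel_integrable_real_affine[OF hi, of "-1" 0] by simp
  have "(\<integral>u. g u \<partial>lborel) = (\<integral>u. h u + h (- u) \<partial>lborel)"
  proof (rule integral_cong_AE)
    have "AE x in lborel. x \<noteq> (0::real)" by (rule AE_lborel_singleton)
    then show "AE x in lborel. g x = h x + h (- x)"
      by eventually_elim (auto simp: h_def g_def indicator_def)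
  qed (auto simp: h_def[abs_def])
  also have "\<dots> = 2 * J" using hi hi' ref unfolding J_def by simp
  finally have IJ: "(\<integral>u. g u \<partial>lborel) = 2 * J" .
  define k where "k s u = (indicator {0<..} u * indicator {0<..} s) *\<^sub>R (of_real u * exp (- (c * of_real (1 + s\<^sup>2)) * of_real (u\<^sup>2)))" for s u :: real
  have inner: "h u * J = (\<integral>s. k s u \<partial>lborel)" for u
  proof (cases "0 < u")
    case True
    have "J = \<bar>u\<bar> *\<^sub>R (\<integral>s. h (0 + u * s) \<partial>lborel)" unfolding J_def by (rule lborel_integral_real_affine) (use True in simp)
    then have "h u * J = (\<integral>s. (h u * of_real u) * h (u * s) \<partial>lborel)"
      using True by (simp add: scaleR_conv_of_real)
    also have "\<dots> = (\<integral>s. k s u \<partial>lborel)"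
    proof (intro Bochner_Integration.integral_cong refl)
      fix s
      show "(h u * of_real u) * h (u * s) = k s u"
        using True unfolding h_def k_def g_def
        by (auto simp: indicator_def zero_less_mult_iff exp_add[symmetric] power_mult_distrib algebra_simps)
    qed
    finally show ?thesis .
  qed (simp add: h_def k_def)
  have km: "(\<lambda>(s, u). k s u) \<in> borel_measurable (lborel \<Otimes>\<^sub>M lborel)"
    unfolding k_def by measurable
  have re: "0 < Re (c * of_real (1 + s\<^sup>2))" for s :: real using c by (simp add: add_pos_nonneg)
  have kint: "integrable lborel (k s)" for s
  proof -
    have "k s = (\<lambda>u. indicator {0<..} s *\<^sub>R (indicator {0<..} u *\<^sub>R (of_real u * exp (- (c * of_real (1 + s\<^sup>2)) * of_real (u\<^sup>2)))))"
      by (auto simp: k_def)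
    then show ?thesis by (simp only:) (intro integrable_scaleR_right rayleigh_complex(1) re)
  qed
  have kval: "(\<integral>u. k s u \<partial>lborel) = (1 / (2 * c)) * of_real (indicator {0<..} s * (1 / (1 + s\<^sup>2)))" for s
  proof -
    have "(\<integral>u. k s u \<partial>lborel) = (\<integral>u. indicator {0<..} s *\<^sub>R (indicator {0<..} u *\<^sub>R (of_real u * exp (- (c * of_real (1 + s\<^sup>2)) * of_real (u\<^sup>2)))) \<partial>lborel)"
      by (intro Bochner_Integration.integral_cong) (auto simp: k_def)
    also have "\<dots> = indicator {0<..} s *\<^sub>R (1 / (2 * (c * of_real (1 + s\<^sup>2))))"
      using rayleigh_complex[OF re[of s]] by (simp only: integral_scaleR_right)
    finally show ?thesis by (simp add: scaleR_conv_of_real)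
  qed
  have knorm: "(\<integral>u. norm (k s u) \<partial>lborel) = indicator {0<..} s * (1 / (1 + s\<^sup>2))" for s
  proof -
    have pos: "0 < (1 + s\<^sup>2) / 2" by (simp add: add_pos_nonneg)
    have "(\<integral>u. norm (k s u) \<partial>lborel) = (\<integral>u. indicator {0<..} s * (indicator {0<..} u * (u * exp (- ((1 + s\<^sup>2) / 2) * u\<^sup>2))) \<partial>lborel)"
      by (intro Bochner_Integration.integral_cong refl)
        (auto simp: k_def norm_mult norm_exp_eq_Re indicator_def c)
    also have "\<dots> = indicator {0<..} s * (1 / (2 * ((1 + s\<^sup>2) / 2)))"
      unfolding integral_mult_right_zero rayleigh_real(2)[OF pos] ..
    also have "2 * ((1 + s\<^sup>2) / 2) = 1 + s\<^sup>2" by simp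
    finally show ?thesis .
  qed
  have kk: "integrable (lborel \<Otimes>\<^sub>M lborel) (\<lambda>(s, u). k s u)"
  proof (rule lborel_pair.Fubini_integrable[OF km])
    show "integrable lborel (\<lambda>s. \<integral>u. norm (case (s, u) of (s, u) \<Rightarrow> k s u) \<partial>lborel)"
      using integral_inverse_one_plus_square(1) by (simp add: knorm)
    show "AE s in lborel. integrable lborel (\<lambda>u. case (s, u) of (s, u) \<Rightarrow> k s u)"
      using kint by simp
  qed
  have "J * J = (\<integral>u. h u * J \<partial>lborel)" using hi unfolding J_def by simp
  also have "\<dots> = (\<integral>u. \<integral>s. k s u \<partial>lborel \<partial>lborel)" by (simp add: inner)
  also have "\<dots> = (\<integral>s. \<integral>u. k s u \<partial>lborel \<partial>lborel)" by (rule lborel_pair.Fubini_integral[OF kk])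
  also have "\<dots> = (1 / (2 * c)) * of_real (\<integral>s. indicator {0<..} s * (1 / (1 + s\<^sup>2)) \<partial>lborel)"
    unfolding kval by (simp only: integral_mult_right_zero integral_complex_of_real)
  also have "\<dots> = (1 / (2 * c)) * (of_real pi / 2)" unfolding integral_inverse_one_plus_square(2) by simp
  finally have JJ: "J * J = (1 / (2 * c)) * (of_real pi / 2)" .
  have "(\<integral>u. g u \<partial>lborel)\<^sup>2 = 4 * (J * J)" unfolding IJ by (simp add: power2_eq_square)
  then show ?thesis unfolding JJ g_def by simp
qed

text \<open>Logarithm of the characteristic function of \<open>(Z\<^sup>2 - 1) / 2\<close> for a standard normal \<open>Z\<close>.\<close>

definition chi_log :: "real \<Rightarrow> complex" where
  "chi_log y = - (\<i> * of_real y) / 2 - Ln (1 - \<i> * of_real y) / 2"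

lemma chi_log_arg: "Re (1 - \<i> * of_real y) = 1" by simp

lemma chi_log_nonpos: "1 - \<i> * of_real y \<notin> \<real>\<^sub>\<le>\<^sub>0"
  using chi_log_arg[of y] by (auto simp: complex_nonpos_Reals_iff)

lemma continuous_chi_log: "continuous_on UNIV chi_log"
  unfolding chi_log_def[abs_def] using chi_log_nonpos by (intro continuous_intros) auto

lemma chi_log_0 [simp]: "chi_log 0 = 0" by (simp add: chi_log_def)

text \<open>
  By \<open>complex_gaussian_square\<close> the quotient \<open>R\<close> of the two sides satisfies \<open>R\<^sup>2 = 1\<close>. It is continuous on the line,
  hence constant, and it equals \<open>1\<close> at the origin.
\<close>

lemma normal_square_char:
  "(\<integral>u. exp (\<i> * of_real (x * ((u\<^sup>2 - 1) / 2))) \<partial>std_normal_distribution) = exp (chi_log x)"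
proof -
  interpret sn: prob_space std_normal_distribution
    by (rule prob_space_normal_density) simp
  define \<mu> where "\<mu> = distr std_normal_distribution borel (\<lambda>u. (u\<^sup>2 - 1) / 2)"
  interpret mu: real_distribution \<mu>
    unfolding \<mu>_def by (intro sn.real_distribution_distr) simp
  have chr: "char \<mu> x = (\<integral>u. exp (\<i> * of_real (x * ((u\<^sup>2 - 1) / 2))) \<partial>std_normal_distribution)" for x
    unfolding \<mu>_def char_def by (subst integral_distr) auto
  have sq: "(char \<mu> x)\<^sup>2 = exp (- \<i> * of_real x) / (1 - \<i> * of_real x)" for x
  proof -
    define c where "c = (1 - \<i> * of_real x) / 2"
    have "char \<mu> x = (\<integral>u. std_normal_density u *\<^sub>R exp (\<i> * of_real (x * ((u\<^sup>2 - 1) / 2))) \<partial>lborel)"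
      unfolding chr by (subst integral_density) auto
    also have "\<dots> = (\<integral>u. (exp (- \<i> * of_real x / 2) / of_real (sqrt (2 * pi))) * exp (- c * of_real (u\<^sup>2)) \<partial>lborel)"
    proof (intro Bochner_Integration.integral_cong refl)
      fix u :: real
      have "std_normal_density u *\<^sub>R exp (\<i> * of_real (x * ((u\<^sup>2 - 1) / 2)))
        = (exp (of_real (- u\<^sup>2 / 2)) * exp (\<i> * of_real (x * ((u\<^sup>2 - 1) / 2)))) / of_real (sqrt (2 * pi))"
        unfolding std_normal_density_def scaleR_conv_of_real exp_of_real by simp
      also have "exp (of_real (- u\<^sup>2 / 2)) * exp (\<i> * of_real (x * ((u\<^sup>2 - 1) / 2))) = exp (- \<i> * of_real x / 2) * exp (- c * of_real (u\<^sup>2))"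
        unfolding exp_add[symmetric] c_def by (rule arg_cong[where f=exp]) (simp add: field_simps)
      finally show "std_normal_density u *\<^sub>R exp (\<i> * of_real (x * ((u\<^sup>2 - 1) / 2)))
        = (exp (- \<i> * of_real x / 2) / of_real (sqrt (2 * pi))) * exp (- c * of_real (u\<^sup>2))" by simp
    qed
    also have "\<dots> = (exp (- \<i> * of_real x / 2) / of_real (sqrt (2 * pi))) * (\<integral>u. exp (- c * of_real (u\<^sup>2)) \<partial>lborel)"
      by simp
    finally have "(char \<mu> x)\<^sup>2 = (exp (- \<i> * of_real x / 2))\<^sup>2 / (of_real (sqrt (2 * pi)))\<^sup>2 * (of_real pi / c)"
      using complex_gaussian_square[of c] by (simp add: power_mult_distrib power_divide c_def)
    also have "(exp (- \<i> * of_real x / 2))\<^sup>2 = exp (- \<i> * of_real x)" by (simp add: exp_double[symmetric])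
    also have "(complex_of_real (sqrt (2 * pi)))\<^sup>2 = 2 * of_real pi"
      by (simp add: of_real_power[symmetric] del: of_real_power)
    finally show ?thesis unfolding c_def by simp
  qed
  define R where "R x = char \<mu> x * exp (- chi_log x)" for x
  have R2: "(R x)\<^sup>2 = 1" for x
  proof -
    have nz: "1 - \<i> * complex_of_real x \<noteq> 0" using chi_log_arg[of x] by auto
    have "(exp (- chi_log x))\<^sup>2 = exp (\<i> * of_real x + Ln (1 - \<i> * of_real x))"
      unfolding chi_log_def by (simp add: exp_double[symmetric] algebra_simps)
    also have "\<dots> = exp (\<i> * of_real x) * (1 - \<i> * of_real x)" using nz by (simp add: exp_add exp_Ln)
    finally have "(exp (- chi_log x))\<^sup>2 = exp (\<i> * of_real x) * (1 - \<i> * of_real x)" .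
    then show ?thesis unfolding R_def power_mult_distrib sq
      using nz by (simp add: exp_minus)
  qed
  have "continuous_on UNIV R"
    unfolding R_def using continuous_chi_log mu.isCont_char
    by (intro continuous_intros) (auto intro: continuous_at_imp_continuous_on)
  then have "connected (range R)" by (rule connected_continuous_image) simp
  moreover have "range R \<subseteq> {1, -1}" using R2 by (auto simp: power2_eq_1_iff)
  then have "finite (range R)" by (rule finite_subset) simp
  ultimately obtain a where a: "range R = {a}" using connected_finite_iff_sing by (metis UNIV_not_empty image_is_empty)
  have "R 0 = 1" unfolding R_def using mu.char_zero by simp
  then have "R x = 1" using a by (metis rangeI singletonD)
  then have "char \<mu> x = exp (chi_log x)" unfolding R_def by (simp add: exp_minus field_simps)
  then show ?thesis unfolding chr .
qed

lemma Ln_approx_quadratic: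
  fixes z :: complex
  assumes "norm z \<le> 1 / 2"
  shows "norm (Ln (1 + z) - z + z\<^sup>2 / 2) \<le> 8 * norm z ^ 3"
proof -
  define f where "f i w = (if i = 0 then Ln (1 + w) else if i = 1 then inverse (1 + w) else if i = 2 then - (inverse (1 + w))\<^sup>2
    else 2 * (inverse (1 + w)) ^ 3)" for i :: nat and w :: complex
  let ?S = "cball 0 (1 / 2) :: complex set"
  have pos: "1 / 2 \<le> Re (1 + w)" if "w \<in> ?S" for w
    using abs_Re_le_cmod[of w] that by simp
  have nz: "1 + w \<noteq> 0" if "w \<in> ?S" for w
  proof
    assume "1 + w = 0"
    then have "Re (1 + w) = 0" by (simp only: zero_complex.sel)
    then show False using pos[OF that] by linarith
  qed
  have np: "1 + w \<notin> \<real>\<^sub>\<le>\<^sub>0" if "w \<in> ?S" for w using pos[OF that] by (auto simp: complex_nonpos_Reals_iff)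
  have "norm (f 0 z - (\<Sum>i\<le>2. f i 0 * (z - 0) ^ i / fact i)) \<le> 16 * norm (z - 0) ^ Suc 2 / fact 2"
  proof (rule complex_Taylor[where S="?S"])
    show "(f i has_field_derivative f (Suc i) x) (at x within ?S)" if x: "x \<in> ?S" and i: "i \<le> 2" for i x
    proof -
      consider "i = 0" | "i = 1" | "i = 2" using i by linarith
      then show ?thesis
      proof cases
        case 1
        have "((\<lambda>w. Ln (1 + w)) has_field_derivative inverse (1 + x)) (at x within ?S)"
          using np[OF x] by (auto intro!: derivative_eq_intros)
        then show ?thesis unfolding 1 by (simp add: f_def[abs_def])
      next
        case 2
        have "((\<lambda>w. inverse (1 + w)) has_field_derivative - (inverse (1 + x))\<^sup>2) (at x within ?S)"
          using nz[OF x] by (auto intro!: derivative_eq_intros simp: power2_eq_square)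
        then show ?thesis unfolding 2 by (simp add: f_def[abs_def] numeral_2_eq_2)
      next
        case 3
        have "((\<lambda>w. - (inverse (1 + w))\<^sup>2) has_field_derivative 2 * (inverse (1 + x)) ^ 3) (at x within ?S)"
          using nz[OF x] by (auto intro!: derivative_eq_intros simp: power2_eq_square power3_eq_cube)
        then show ?thesis unfolding 3 by (simp add: f_def[abs_def])
      qed
    qed
    show "norm (f (Suc 2) x) \<le> 16" if x: "x \<in> ?S" for x
    proof -
      have "1 / 2 \<le> norm (1 + x)" using pos[OF x] complex_Re_le_cmod[of "1 + x"] by linarith
      then have "inverse (norm (1 + x)) \<le> inverse (1 / 2)" by (intro le_imp_inverse_le) auto
      then have "inverse (norm (1 + x)) ^ 3 \<le> 2 ^ 3" by (intro power_mono) auto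
      then show ?thesis by (simp add: f_def norm_mult norm_power norm_inverse)
    qed
  qed (use assms in auto)
  then show ?thesis by (simp add: f_def numeral_2_eq_2 power3_eq_cube algebra_simps)
qed

lemma chi_log_approx: assumes "\<bar>y\<bar> \<le> 1 / 2" shows "norm (chi_log y + of_real (y\<^sup>2 / 4)) \<le> 4 * \<bar>y\<bar> ^ 3"
proof -
  define z where "z = - (\<i> * complex_of_real y)"
  have nz: "norm z = \<bar>y\<bar>" by (simp add: z_def norm_mult)
  have "chi_log y + of_real (y\<^sup>2 / 4) = - (Ln (1 + z) - z + z\<^sup>2 / 2) / 2"
    unfolding chi_log_def z_def by (simp add: power_mult_distrib field_simps)
  then have "norm (chi_log y + of_real (y\<^sup>2 / 4)) = norm (Ln (1 + z) - z + z\<^sup>2 / 2) / 2"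
    by (simp only: norm_divide norm_minus_cancel) simp
  also have "\<dots> \<le> 8 * norm z ^ 3 / 2" using Ln_approx_quadratic[of z] assms nz by simp
  finally show ?thesis unfolding nz by simp
qed

section \<open>Convergence of spectral sums\<close>

text \<open>
  The constant term of a Weierstrass approximation is small because \<open>h 0 = 0\<close>, and may be dropped.
\<close>

lemma polynomial_approx_vanishing_at_0:
  fixes h :: "real \<Rightarrow> real"
  assumes h: "continuous_on {-b..b} h" "h 0 = 0" and b: "0 \<le> b" and e: "0 < e"
  obtains n and a :: "nat \<Rightarrow> real" where "\<And>x. x \<in> {-b..b} \<Longrightarrow> \<bar>h x - (\<Sum>i<n. a i * x ^ Suc i)\<bar> < e"
proof -
  have "0 < e / 2" using e by simp
  from Stone_Weierstrass_real_polynomial_function[OF compact_Icc h(1) this]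
  obtain g where g: "real_polynomial_function g" "\<And>x. x \<in> {-b..b} \<Longrightarrow> \<bar>h x - g x\<bar> < e / 2" by blast
  obtain a n where gn: "g = (\<lambda>x. \<Sum>i\<le>n. a i * x ^ i)"
    using g(1) real_polynomial_function_iff_sum by blast
  have g0: "g x = a 0 + (\<Sum>i<n. a (Suc i) * x ^ Suc i)" for x
    unfolding gn by (subst sum.atMost_shift) simp
  have "\<bar>h 0 - g 0\<bar> < e / 2" by (rule g(2)) (use b in simp)
  then have a0: "\<bar>a 0\<bar> < e / 2" unfolding g0 h(2) by simp
  show thesis
  proof (rule that[of "\<lambda>i. a (Suc i)" n])
    fix x assume "x \<in> {-b..b}"
    from g(2)[OF this] show "\<bar>h x - (\<Sum>i<n. a (Suc i) * x ^ Suc i)\<bar> < e"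
      using a0 unfolding g0 abs_less_iff by linarith
  qed
qed

text \<open>
  The rows \<open>L N\<close> are the eigenvalues of matrices and \<open>lam\<close> those of the limit operator. The limit \<open>s\<close> of the sums of
  squares may exceed the sum of the squares of \<open>lam\<close>.
\<close>

locale spectral_limit =
  fixes L :: "nat \<Rightarrow> nat \<Rightarrow> real" and lam :: "nat \<Rightarrow> real" and b s :: real
  assumes power_lim: "\<And>m. m \<ge> 3 \<Longrightarrow> (\<lambda>N. \<Sum>i=1..N. L N i ^ m) \<longlonglongrightarrow> (\<Sum>j. lam j ^ m)"
    and sq_lim: "(\<lambda>N. \<Sum>i=1..N. (L N i)\<^sup>2) \<longlonglongrightarrow> s"
    and lam_sq: "summable (\<lambda>j. (lam j)\<^sup>2)"
    and lam_less: "\<exists>r<b. \<forall>j. \<bar>lam j\<bar> \<le> r"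
begin

lemma lam_le: "\<bar>lam j\<bar> \<le> b" using lam_less by (meson less_imp_le order_trans)
lemma b_pos: "0 < b" using lam_less by (meson abs_ge_zero le_less_trans order_trans)

lemma summable_lam_sq_mult:
  assumes "\<And>j. \<bar>g j\<bar> \<le> B"
  shows "summable (\<lambda>j. (lam j)\<^sup>2 * g j)"
proof (rule summable_comparison_test')
  show "summable (\<lambda>j. (lam j)\<^sup>2 * B)" by (intro summable_mult2 lam_sq)
  show "norm ((lam n)\<^sup>2 * g n) \<le> (lam n)\<^sup>2 * B" for n using assms[of n] by (simp add: abs_mult mult_left_mono)
qed

lemma suminf_lam_sq_le:
  assumes "\<And>j. \<bar>g j\<bar> \<le> B"
  shows "\<bar>\<Sum>j. (lam j)\<^sup>2 * g j\<bar> \<le> (\<Sum>j. (lam j)\<^sup>2) * B"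
proof -
  have le: "\<bar>(lam j)\<^sup>2 * g j\<bar> \<le> (lam j)\<^sup>2 * B" for j using assms[of j] by (simp add: abs_mult mult_left_mono)
  have s1: "summable (\<lambda>j. \<bar>(lam j)\<^sup>2 * g j\<bar>)"
    by (rule summable_comparison_test'[OF summable_mult2[OF lam_sq, of B], of 0]) (use le in simp)
  have "\<bar>\<Sum>j. (lam j)\<^sup>2 * g j\<bar> \<le> (\<Sum>j. \<bar>(lam j)\<^sup>2 * g j\<bar>)" by (rule summable_rabs[OF s1])
  also have "\<dots> \<le> (\<Sum>j. (lam j)\<^sup>2 * B)" by (rule suminf_le[OF le s1 summable_mult2[OF lam_sq]])
  finally show ?thesis by (simp add: suminf_mult2[OF lam_sq])
qed

lemma power_summable: assumes "m \<ge> 2" shows "summable (\<lambda>j. lam j ^ m)"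
proof -
  have "\<bar>lam j ^ (m - 2)\<bar> \<le> b ^ (m - 2)" for j unfolding power_abs by (intro power_mono lam_le) simp
  then have "summable (\<lambda>j. (lam j)\<^sup>2 * lam j ^ (m - 2))" by (rule summable_lam_sq_mult)
  moreover have "(lam j)\<^sup>2 * lam j ^ (m - 2) = lam j ^ m" for j
    using assms by (simp only: power_add[symmetric] le_add_diff_inverse)
  ultimately show ?thesis by simp
qed

text \<open>
  For large even exponents \<open>k + 2\<close>, the limiting power sum is at most \<open>r ^ k\<close> times the sum of squares and thus below
  \<open>b ^ (k + 2)\<close>, while each \<open>\<bar>L N i\<bar> ^ (k + 2)\<close> is bounded by the power sum of its row.
\<close>

lemma eventually_bounded: "\<forall>\<^sub>F N in sequentially. \<forall>i\<in>{1..N}. \<bar>L N i\<bar> \<le> b"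
proof -
  obtain r where r: "r < b" "\<And>j. \<bar>lam j\<bar> \<le> r" using lam_less by blast
  have r0: "0 \<le> r" using r(2)[of 0] by linarith
  let ?T = "\<Sum>j. (lam j)\<^sup>2"
  have "(\<lambda>k. (r / b) ^ k) \<longlonglongrightarrow> 0" using r r0 by (intro LIMSEQ_realpow_zero) auto
  from tendsto_mult_left[OF this, of "?T"] have "(\<lambda>k. ?T * (r / b) ^ k) \<longlonglongrightarrow> 0" by simp
  moreover have "0 < b\<^sup>2" using b_pos by simp
  ultimately have "\<forall>\<^sub>F k in sequentially. ?T * (r / b) ^ k < b\<^sup>2" by (rule order_tendstoD)
  then obtain K where K: "\<And>k. k \<ge> K \<Longrightarrow> ?T * (r / b) ^ k < b\<^sup>2" unfolding eventually_sequentially by auto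
  \<comment> \<open>An even exponent, so that all summands of the power sum are non-negative.\<close>
  define k where "k = 2 * (K + 1)"
  have ek: "even (k + 2)" "k + 2 \<ge> 3" unfolding k_def by auto
  have "(\<Sum>j. lam j ^ (k + 2)) = (\<Sum>j. (lam j)\<^sup>2 * lam j ^ k)" by (simp add: power_add[symmetric] add.commute)
  also have "\<dots> \<le> \<bar>\<Sum>j. (lam j)\<^sup>2 * lam j ^ k\<bar>" by simp
  also have "\<dots> \<le> ?T * r ^ k" by (rule suminf_lam_sq_le) (simp add: power_abs power_mono r)
  also have "\<dots> < b ^ (k + 2)"
  proof -
    have "?T * (r / b) ^ k * b ^ k < b\<^sup>2 * b ^ k" using K[of k] b_pos by (intro mult_strict_right_mono) (auto simp: k_def)
    then show ?thesis using b_pos by (simp add: power_divide power_add power2_eq_square mult_ac)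
  qed
  finally have "(\<Sum>j. lam j ^ (k + 2)) < b ^ (k + 2)" .
  from order_tendstoD(2)[OF power_lim[OF ek(2)] this]
  show ?thesis
  proof eventually_elim
    case (elim N)
    show ?case
    proof
      fix i assume i: "i \<in> {1..N}"
      have "L N i ^ (k + 2) \<le> (\<Sum>i=1..N. L N i ^ (k + 2))"
      proof (rule member_le_sum[OF i])
        show "0 \<le> L N x ^ (k + 2)" for x by (rule zero_le_even_power[OF ek(1)])
      qed simp
      then have "\<bar>L N i\<bar> ^ (k + 2) < b ^ (k + 2)" using elim ek by (simp add: power_even_abs del: power_Suc add_2_eq_Suc')
      then show "\<bar>L N i\<bar> \<le> b" using b_pos by (meson less_imp_le power_less_imp_less_base)
    qed
  qed
qed

text \<open>
  If \<open>h\<close> is replaced by a polynomial without constant term, only powers with exponent at least \<open>3\<close> occur, and these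
  converge. The error is bounded by a small multiple of the sums of squares, which stay bounded.
\<close>

lemma real_spectral_sum_tendsto:
  fixes h :: "real \<Rightarrow> real"
  assumes h: "continuous_on {-b..b} h" "h 0 = 0"
  shows "(\<lambda>N. \<Sum>i=1..N. (L N i)\<^sup>2 * h (L N i)) \<longlonglongrightarrow> (\<Sum>j. (lam j)\<^sup>2 * h (lam j))"
proof (rule LIMSEQ_I)
  fix e :: real assume e: "0 < e"
  let ?T = "\<Sum>j. (lam j)\<^sup>2"
  have T0: "0 \<le> ?T" by (intro suminf_nonneg lam_sq) simp
  have s0: "0 \<le> s" by (rule LIMSEQ_le_const[OF sq_lim], rule exI[of _ 0]) (simp add: sum_nonneg)
  define C where "C = s + 1 + ?T"
  have C: "0 < C" unfolding C_def using T0 s0 by linarith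
  define d where "d = e / (2 * C)"
  have d: "0 < d" unfolding d_def using e C by simp
  obtain n a where p: "\<And>x. x \<in> {-b..b} \<Longrightarrow> \<bar>h x - (\<Sum>i<n. a i * x ^ Suc i)\<bar> < d"
    using polynomial_approx_vanishing_at_0[OF h less_imp_le[OF b_pos] d] by blast
  define q where "q x = (\<Sum>i<n. a i * x ^ Suc i)" for x
  have sq: "x\<^sup>2 * q x = (\<Sum>k<n. a k * x ^ (k + 3))" for x
    unfolding q_def sum_distrib_left by (intro sum.cong refl) (simp add: power2_eq_square power3_eq_cube power_add mult_ac)
  have "(\<lambda>N. \<Sum>k<n. a k * (\<Sum>i=1..N. L N i ^ (k + 3))) \<longlonglongrightarrow> (\<Sum>k<n. a k * (\<Sum>j. lam j ^ (k + 3)))"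
    by (intro tendsto_sum tendsto_mult_left power_lim) simp
  moreover have "(\<Sum>k<n. a k * (\<Sum>i=1..N. L N i ^ (k + 3))) = (\<Sum>i=1..N. (L N i)\<^sup>2 * q (L N i))" for N
    unfolding sq sum_distrib_left by (rule sum.swap)
  moreover have "(\<Sum>k<n. a k * (\<Sum>j. lam j ^ (k + 3))) = (\<Sum>j. (lam j)\<^sup>2 * q (lam j))"
  proof -
    have ps: "summable (\<lambda>j. lam j ^ (k + 3))" for k by (rule power_summable) simp
    have "(\<Sum>j. (lam j)\<^sup>2 * q (lam j)) = (\<Sum>k<n. \<Sum>j. a k * lam j ^ (k + 3))"
      unfolding sq by (rule suminf_sum) (intro summable_mult ps)
    also have "\<dots> = (\<Sum>k<n. a k * (\<Sum>j. lam j ^ (k + 3)))"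
      by (intro sum.cong refl suminf_mult ps)
    finally show ?thesis by simp
  qed
  ultimately have qlim: "(\<lambda>N. \<Sum>i=1..N. (L N i)\<^sup>2 * q (L N i)) \<longlonglongrightarrow> (\<Sum>j. (lam j)\<^sup>2 * q (lam j))" by simp
  have "0 < e / 2" using e by simp
  from LIMSEQ_D[OF qlim this] obtain N1 where N1: "\<And>N. N \<ge> N1 \<Longrightarrow>
    \<bar>(\<Sum>i=1..N. (L N i)\<^sup>2 * q (L N i)) - (\<Sum>j. (lam j)\<^sup>2 * q (lam j))\<bar> < e / 2" by auto
  obtain N2 where N2: "\<And>N. N \<ge> N2 \<Longrightarrow> (\<Sum>i=1..N. (L N i)\<^sup>2) < s + 1"
    using order_tendstoD(2)[OF sq_lim, of "s + 1"] unfolding eventually_sequentially by auto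
  obtain N3 where N3: "\<And>N i. N \<ge> N3 \<Longrightarrow> i \<in> {1..N} \<Longrightarrow> \<bar>L N i\<bar> \<le> b"
    using eventually_bounded unfolding eventually_sequentially by blast
  define g where "g x = h x - q x" for x
  have g: "\<bar>g x\<bar> \<le> d" if "\<bar>x\<bar> \<le> b" for x
  proof -
    have "x \<in> {-b..b}" using that by auto
    from p[OF this] show ?thesis unfolding g_def q_def by (rule less_imp_le)
  qed
  have lamq: "summable (\<lambda>j. (lam j)\<^sup>2 * q (lam j))"
    unfolding sq by (intro summable_sum summable_mult power_summable) simp
  have lamg: "summable (\<lambda>j. (lam j)\<^sup>2 * g (lam j))" by (rule summable_lam_sq_mult) (rule g[OF lam_le])
  have hl: "(\<Sum>j. (lam j)\<^sup>2 * h (lam j)) = (\<Sum>j. (lam j)\<^sup>2 * q (lam j)) + (\<Sum>j. (lam j)\<^sup>2 * g (lam j))"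
    unfolding suminf_add[OF lamq lamg] by (simp add: g_def algebra_simps)
  have gl: "\<bar>\<Sum>j. (lam j)\<^sup>2 * g (lam j)\<bar> \<le> ?T * d" by (rule suminf_lam_sq_le) (rule g[OF lam_le])
  show "\<exists>N0. \<forall>N\<ge>N0. norm ((\<Sum>i=1..N. (L N i)\<^sup>2 * h (L N i)) - (\<Sum>j. (lam j)\<^sup>2 * h (lam j))) < e"
  proof (intro exI[of _ "max N1 (max N2 N3)"] allI impI)
    fix N assume "max N1 (max N2 N3) \<le> N"
    then have N: "N1 \<le> N" "N2 \<le> N" "N3 \<le> N" by auto
    have "\<bar>\<Sum>i=1..N. (L N i)\<^sup>2 * g (L N i)\<bar> \<le> (\<Sum>i=1..N. (L N i)\<^sup>2 * d)"
      by (rule order_trans[OF sum_abs]) (intro sum_mono, auto simp: abs_mult intro!: mult_left_mono g N3[OF N(3)])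
    also have "\<dots> = (\<Sum>i=1..N. (L N i)\<^sup>2) * d" by (rule sum_distrib_right[symmetric])
    also have "\<dots> \<le> (s + 1) * d" using N2[OF N(2)] d by (intro mult_right_mono) auto
    finally have g1: "\<bar>\<Sum>i=1..N. (L N i)\<^sup>2 * g (L N i)\<bar> \<le> (s + 1) * d" .
    have hN: "(\<Sum>i=1..N. (L N i)\<^sup>2 * h (L N i)) = (\<Sum>i=1..N. (L N i)\<^sup>2 * q (L N i)) + (\<Sum>i=1..N. (L N i)\<^sup>2 * g (L N i))"
      unfolding sum.distrib[symmetric] by (simp add: g_def algebra_simps)
    have "(s + 1) * d + ?T * d = C * d" unfolding C_def by (simp add: algebra_simps)
    also have "\<dots> = e / 2" unfolding d_def using C by simp
    finally have cd: "(s + 1) * d + ?T * d = e / 2" .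
    have tri: "\<bar>(x + y) - (x' + y')\<bar> < e" if "\<bar>x - x'\<bar> < e / 2" "\<bar>y\<bar> \<le> u" "\<bar>y'\<bar> \<le> v" "u + v = e / 2" for x y x' y' u v :: real
      using that unfolding abs_less_iff abs_le_iff by linarith
    show "norm ((\<Sum>i=1..N. (L N i)\<^sup>2 * h (L N i)) - (\<Sum>j. (lam j)\<^sup>2 * h (lam j))) < e"
      unfolding hN hl real_norm_def by (rule tri[OF N1[OF N(1)] g1 gl cd])
  qed
qed

lemma continuous_bounded:
  fixes h :: "real \<Rightarrow> 'a::real_normed_vector"
  assumes "continuous_on {-b..b} h"
  obtains B where "\<And>j. norm (h (lam j)) \<le> B"
proof -
  have "bounded (h ` {-b..b})" by (rule compact_imp_bounded[OF compact_continuous_image[OF assms compact_Icc]])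
  then obtain B where "\<forall>x\<in>{-b..b}. norm (h x) \<le> B" unfolding bounded_iff by blast
  moreover have "lam j \<in> {-b..b}" for j using lam_le[of j] by (simp add: abs_le_iff)
  ultimately show thesis using that by blast
qed

lemma complex_spectral_sum:
  fixes h :: "real \<Rightarrow> complex"
  assumes h: "continuous_on {-b..b} h" "h 0 = 0"
  shows "(\<lambda>N. \<Sum>i=1..N. of_real ((L N i)\<^sup>2) * h (L N i)) \<longlonglongrightarrow> (\<Sum>j. of_real ((lam j)\<^sup>2) * h (lam j))"
proof -
  obtain B where B: "\<And>j. norm (h (lam j)) \<le> B" using continuous_bounded[OF h(1)] by blast
  have sm: "summable (\<lambda>j. of_real ((lam j)\<^sup>2) * h (lam j))"
  proof (rule summable_comparison_test')
    show "summable (\<lambda>j. (lam j)\<^sup>2 * B)" by (intro summable_mult2 lam_sq)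
    show "norm (of_real ((lam n)\<^sup>2) * h (lam n)) \<le> (lam n)\<^sup>2 * B" for n
      using B[of n] by (simp add: norm_mult norm_power mult_left_mono)
  qed
  have re: "(\<lambda>N. \<Sum>i=1..N. (L N i)\<^sup>2 * Re (h (L N i))) \<longlonglongrightarrow> (\<Sum>j. (lam j)\<^sup>2 * Re (h (lam j)))"
    by (rule real_spectral_sum_tendsto) (use h in \<open>auto intro!: continuous_intros\<close>)
  have im: "(\<lambda>N. \<Sum>i=1..N. (L N i)\<^sup>2 * Im (h (L N i))) \<longlonglongrightarrow> (\<Sum>j. (lam j)\<^sup>2 * Im (h (lam j)))"
    by (rule real_spectral_sum_tendsto) (use h in \<open>auto intro!: continuous_intros\<close>)
  show "(\<lambda>N. \<Sum>i=1..N. of_real ((L N i)\<^sup>2) * h (L N i)) \<longlonglongrightarrow> (\<Sum>j. of_real ((lam j)\<^sup>2) * h (lam j))"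
    unfolding tendsto_complex_iff
    using re im by (simp add: Re_suminf[OF sm] Im_suminf[OF sm] del: of_real_power)
qed

end

text \<open>
  The remainder of \<open>chi_log y\<close> after its quadratic term \<open>- y\<^sup>2 / 4\<close>, divided by \<open>y\<^sup>2\<close>. At \<open>0\<close> division by zero yields
  \<open>0\<close>, which is also the limit there.
\<close>

definition chi_rest :: "real \<Rightarrow> complex" where
  "chi_rest y = (chi_log y + of_real (y\<^sup>2 / 4)) / of_real (y\<^sup>2)"

lemma continuous_chi_rest: "continuous_on UNIV chi_rest"
proof -
  have "isCont chi_rest y" for y
  proof (cases "y = 0")
    case False
    have "isCont chi_log y" using continuous_chi_log by (simp add: continuous_on_eq_continuous_at)
    then show ?thesis unfolding chi_rest_def[abs_def] using False by (intro continuous_intros) auto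
  next
    case True
    have "(chi_rest \<longlongrightarrow> 0) (at 0)"
    proof (rule Lim_null_comparison)
      show "((\<lambda>y::real. 4 * \<bar>y\<bar>) \<longlongrightarrow> 0) (at 0)"
        by (rule tendsto_eq_intros refl)+ simp
      have "\<forall>\<^sub>F y in at 0. \<bar>y - 0\<bar> < (1 / 2 :: real)"
        unfolding eventually_at by (auto simp: dist_real_def intro!: exI[of _ "1/2"])
      then show "\<forall>\<^sub>F y in at 0. norm (chi_rest y) \<le> 4 * \<bar>y\<bar>"
      proof eventually_elim
        case (elim y)
        have "norm (chi_rest y) = norm (chi_log y + of_real (y\<^sup>2 / 4)) / y\<^sup>2"
          unfolding chi_rest_def norm_divide by (simp add: norm_power)
        also have "\<dots> \<le> (4 * \<bar>y\<bar> ^ 3) / y\<^sup>2"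
          using chi_log_approx[of y] elim by (intro divide_right_mono) auto
        also have "\<dots> \<le> 4 * \<bar>y\<bar>"
          by (cases "y = 0") (auto simp: power3_eq_cube power2_eq_square field_simps abs_if)
        finally show ?case .
      qed
    qed
    moreover have "chi_rest 0 = 0" by (simp add: chi_rest_def)
    ultimately show ?thesis unfolding True continuous_at by simp
  qed
  then show ?thesis by (simp add: continuous_at_imp_continuous_on)
qed

text \<open>
  Up to the factor \<open>l\<^sup>2\<close>, this is the contribution of an eigenvalue \<open>l\<close> to the logarithm of the characteristic function
  of the estimator after removal of \<open>- t\<^sup>2 l\<^sup>2 / 4\<close>; see \<open>rest_fun_eq\<close>. The factor is taken out of each term separately
  to exhibit a function that is continuous and vanishes at \<open>0\<close>.
\<close>

definition rest_fun :: "real \<Rightarrow> real \<Rightarrow> real \<Rightarrow> complex" where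
  "rest_fun \<beta> t l = of_real (t\<^sup>2 / (1 - \<beta> * l)\<^sup>2) * chi_rest (t * (l / (1 - \<beta> * l)))
     - of_real (t\<^sup>2 / 4 * (1 / (1 - \<beta> * l)\<^sup>2 - 1)) + \<i> * of_real (t * \<beta>\<^sup>2 * l / (2 * (1 - \<beta> * l)))"

lemma rest_fun_0 [simp]: "rest_fun \<beta> t 0 = 0" by (simp add: rest_fun_def chi_rest_def)

lemma rest_fun_eq:
  assumes "1 - \<beta> * l \<noteq> 0"
  shows "of_real (l\<^sup>2) * rest_fun \<beta> t l
    = chi_log (t * (l / (1 - \<beta> * l))) + \<i> * of_real (t * (\<beta>\<^sup>2 / 2 * (l ^ 3 / (1 - \<beta> * l)))) + of_real (t\<^sup>2 / 4 * l\<^sup>2)"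
proof -
  define q where "q = 1 - \<beta> * l"
  have q: "q \<noteq> 0" using assms by (simp add: q_def)
  have 1: "of_real (l\<^sup>2) * (of_real (t\<^sup>2 / q\<^sup>2) * chi_rest (t * (l / q))) = chi_log (t * (l / q)) + of_real ((t * (l / q))\<^sup>2 / 4)"
  proof (cases "t * l = 0")
    case True
    then show ?thesis by (auto simp: chi_rest_def)
  next
    case False
    have "l\<^sup>2 * (t\<^sup>2 / q\<^sup>2) = (t * (l / q))\<^sup>2" by (simp add: power_mult_distrib power_divide)
    then have "of_real (l\<^sup>2) * (of_real (t\<^sup>2 / q\<^sup>2) * chi_rest (t * (l / q))) = of_real ((t * (l / q))\<^sup>2) * chi_rest (t * (l / q))"
      by (metis (no_types, opaque_lifting) mult.assoc of_real_mult)
    moreover have "(t * (l / q))\<^sup>2 \<noteq> 0" using False q by auto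
    then have "complex_of_real ((t * (l / q))\<^sup>2) \<noteq> 0" by (simp only: of_real_eq_0_iff not_False_eq_True)
    ultimately show ?thesis unfolding chi_rest_def by simp
  qed
  have 2: "l\<^sup>2 * (t\<^sup>2 / 4 * (1 / q\<^sup>2 - 1)) = (t * (l / q))\<^sup>2 / 4 - t\<^sup>2 / 4 * l\<^sup>2"
    using q by (simp add: power_mult_distrib power_divide field_simps)
  have 3: "l\<^sup>2 * (t * \<beta>\<^sup>2 * l / (2 * q)) = t * (\<beta>\<^sup>2 / 2 * (l ^ 3 / q))"
    by (simp add: power3_eq_cube power2_eq_square)
  have "of_real (l\<^sup>2) * rest_fun \<beta> t l = of_real (l\<^sup>2) * (of_real (t\<^sup>2 / q\<^sup>2) * chi_rest (t * (l / q)))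
    - of_real (l\<^sup>2 * (t\<^sup>2 / 4 * (1 / q\<^sup>2 - 1))) + \<i> * of_real (l\<^sup>2 * (t * \<beta>\<^sup>2 * l / (2 * q)))"
    unfolding rest_fun_def q_def[symmetric] of_real_mult by (simp only: right_diff_distrib distrib_left mult.left_commute)
  also have "\<dots> = chi_log (t * (l / q)) + \<i> * of_real (t * (\<beta>\<^sup>2 / 2 * (l ^ 3 / q))) + of_real (t\<^sup>2 / 4 * l\<^sup>2)"
    unfolding 1 2 3 by simp
  finally show ?thesis unfolding q_def .
qed

lemma continuous_rest_fun:
  assumes \<beta>: "0 < \<beta>" "b * \<beta> < 1"
  shows "continuous_on {-b..b} (rest_fun \<beta> t)"
proof -
  have q: "1 - \<beta> * l \<noteq> 0" if "l \<in> {-b..b}" for l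
  proof -
    have "\<beta> * l \<le> \<beta> * b" using that \<beta> by (intro mult_left_mono) auto
    moreover have "\<beta> * b < 1" using \<beta>(2) by (simp add: mult.commute)
    ultimately show ?thesis by linarith
  qed
  have "continuous_on {-b..b} (\<lambda>l. chi_rest (t * (l / (1 - \<beta> * l))))"
    by (rule continuous_on_compose2[OF continuous_chi_rest]) (use q in \<open>auto intro!: continuous_intros\<close>)
  then show ?thesis unfolding rest_fun_def[abs_def] using q by (intro continuous_intros) auto
qed

section \<open>The conditional law of the estimator\<close>

text \<open>
  The part of the estimator that the adjacency matrix \<open>a\<close> determines.
\<close>

definition U_fixed :: "real \<Rightarrow> nat \<Rightarrow> real \<Rightarrow> real mat \<Rightarrow> real" where
  "U_fixed \<beta> N t a =
     \<beta> / (2 * (real N)\<^sup>2 * t\<^sup>2) * (\<Sum>(i, j)\<in>{(i, j). i \<in> {1..N} \<and> j \<in> {1..N} \<and> i \<noteq> j}. a $$ (i - 1, j - 1))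
      + 1 / (2 * real N * t) * (\<Sum>i=1..N. a $$ (i - 1, i - 1))
      + \<beta>\<^sup>2 / 2 * (\<Sum>i=1..N. eigval ((1 / (real N * t)) \<cdot>\<^sub>m a) i ^ 3 / (1 - \<beta> * eigval ((1 / (real N * t)) \<cdot>\<^sub>m a) i))"

definition coef :: "real \<Rightarrow> nat \<Rightarrow> real \<Rightarrow> real mat \<Rightarrow> nat \<Rightarrow> real" where
  "coef \<beta> N t a i = eigval ((1 / (real N * t)) \<cdot>\<^sub>m a) i / (1 - \<beta> * eigval ((1 / (real N * t)) \<cdot>\<^sub>m a) i)"

lemma U_hat_eq:
  assumes N: "N \<ge> 1"
  shows "U_hat \<beta> N t A \<eta> \<omega> = U_fixed \<beta> N t (adjacency_mat N A \<omega>)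
    + 1 / 2 * (\<Sum>i=1..N. coef \<beta> N t (adjacency_mat N A \<omega>) i * ((\<eta> i \<omega>)\<^sup>2 - 1))"
proof -
  have e: "of_bool (A i j \<omega>) = adjacency_mat N A \<omega> $$ (i - 1, j - 1)" if "i \<in> {1..N}" "j \<in> {1..N}" for i j
  proof -
    have "i - 1 < N" "j - 1 < N" using that by auto
    then show ?thesis using that unfolding adjacency_mat_def by simp
  qed
  have "(\<Sum>(i, j)\<in>{(i, j). i \<in> {1..N} \<and> j \<in> {1..N} \<and> i \<noteq> j}. of_bool (A i j \<omega>))
    = (\<Sum>(i, j)\<in>{(i, j). i \<in> {1..N} \<and> j \<in> {1..N} \<and> i \<noteq> j}. adjacency_mat N A \<omega> $$ (i - 1, j - 1))"
    by (intro sum.cong refl) (use e in \<open>auto simp del: One_nat_def\<close>)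
  moreover have "(\<Sum>i=1..N. of_bool (A i i \<omega>)) = (\<Sum>i=1..N. adjacency_mat N A \<omega> $$ (i - 1, i - 1))"
    by (intro sum.cong refl e) auto
  ultimately show ?thesis unfolding U_hat_def U_fixed_def coef_def Let_def by (simp only:)
qed

lemma adjacency_finite_range: "finite (adjacency_mat N A ` S)"
proof -
  have "adjacency_mat N A ` S \<subseteq> (\<lambda>f. mat N N f) ` (({0..<N} \<times> {0..<N}) \<rightarrow>\<^sub>E {0, 1 :: real})"
  proof
    fix a assume "a \<in> adjacency_mat N A ` S"
    then obtain \<omega> where a: "a = adjacency_mat N A \<omega>" by auto
    let ?f = "restrict (\<lambda>(i, j). of_bool (A (Suc i) (Suc j) \<omega>) :: real) ({0..<N} \<times> {0..<N})"
    have "a = mat N N ?f" unfolding a adjacency_mat_def by (intro eq_matI) auto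
    moreover have "?f \<in> ({0..<N} \<times> {0..<N}) \<rightarrow>\<^sub>E {0, 1 :: real}" by auto
    ultimately show "a \<in> (\<lambda>f. mat N N f) ` (({0..<N} \<times> {0..<N}) \<rightarrow>\<^sub>E {0, 1 :: real})" by blast
  qed
  then show ?thesis by (rule finite_subset) (intro finite_imageI finite_PiE, auto)
qed

lemma char_normal_quadratic:
  assumes M: "prob_space M" and \<eta>: "distributed M lborel Z std_normal_density"
  shows "char (distr M borel (\<lambda>\<omega>. 1 / 2 * (c * ((Z \<omega>)\<^sup>2 - 1)))) t = exp (chi_log (t * c))"
proof -
  have Zm [measurable]: "Z \<in> borel_measurable M" using \<eta> by (simp add: distributed_def)
  have d: "distr M lborel Z = std_normal_distribution" using \<eta> by (simp add: distributed_def)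
  have "char (distr M borel (\<lambda>\<omega>. 1 / 2 * (c * ((Z \<omega>)\<^sup>2 - 1)))) t
    = (\<integral>\<omega>. (\<lambda>u. exp (\<i> * of_real ((t * c) * ((u\<^sup>2 - 1) / 2)))) (Z \<omega>) \<partial>M)"
    unfolding char_def by (subst integral_distr) (auto intro!: Bochner_Integration.integral_cong arg_cong[where f=exp])
  also have "\<dots> = (\<integral>u. exp (\<i> * of_real ((t * c) * ((u\<^sup>2 - 1) / 2))) \<partial>distr M lborel Z)"
    by (rule integral_distr[symmetric]) auto
  also have "\<dots> = exp (chi_log (t * c))" unfolding d by (rule normal_square_char)
  finally show ?thesis .
qed

lemma distr_add_const_char:
  assumes M: "prob_space M" and X [measurable]: "X \<in> borel_measurable M"
  shows "char (distr M borel (\<lambda>\<omega>. c + X \<omega>)) t = exp (\<i> * of_real (t * c)) * char (distr M borel X) t"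
proof -
  interpret prob_space M by (rule M)
  have "char (distr M borel (\<lambda>\<omega>. c + X \<omega>)) t = (\<integral>\<omega>. exp (\<i> * of_real (t * c)) * exp (\<i> * of_real (t * X \<omega>)) \<partial>M)"
    unfolding char_def by (subst integral_distr) (auto simp: exp_add[symmetric] algebra_simps)
  also have "\<dots> = exp (\<i> * of_real (t * c)) * (\<integral>\<omega>. exp (\<i> * of_real (t * X \<omega>)) \<partial>M)" by simp
  also have "(\<integral>\<omega>. exp (\<i> * of_real (t * X \<omega>)) \<partial>M) = char (distr M borel X) t"
    unfolding char_def by (subst integral_distr) auto
  finally show ?thesis .
qed

lemma char_quadratic_form:
  assumes M: "prob_space M" and iid: "iid_std_normal M \<eta> {1..}"
  shows "char (distr M borel (\<lambda>\<omega>. c0 + 1 / 2 * (\<Sum>i=1..N. c i * ((\<eta> i \<omega>)\<^sup>2 - 1)))) t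
    = exp (\<i> * of_real (t * c0)) * (\<Prod>i=1..N. exp (chi_log (t * c i)))"
proof -
  interpret prob_space M by (rule M)
  have ind: "indep_vars (\<lambda>_. borel) \<eta> {1..}" and n: "\<And>i. i \<ge> 1 \<Longrightarrow> distributed M lborel (\<eta> i) std_normal_density"
    using iid by (auto simp: iid_std_normal_def)
  have \<eta>m: "\<eta> i \<in> borel_measurable M" if "i \<ge> 1" for i using n[OF that] by (simp add: distributed_def)
  define X where "X i \<omega> = 1 / 2 * (c i * ((\<eta> i \<omega>)\<^sup>2 - 1))" for i \<omega>
  have indX: "indep_vars (\<lambda>_. borel) X {1..N}"
  proof -
    have "indep_vars (\<lambda>_. borel) (\<lambda>i \<omega>. (\<lambda>u. 1 / 2 * (c i * (u\<^sup>2 - 1))) (\<eta> i \<omega>)) {1..N}"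
      by (rule indep_vars_compose2[OF indep_vars_subset[OF ind]]) auto
    then show ?thesis unfolding X_def .
  qed
  have Xm: "(\<lambda>\<omega>. \<Sum>i=1..N. X i \<omega>) \<in> borel_measurable M"
    unfolding X_def using \<eta>m by (intro borel_measurable_sum) auto
  have "(\<lambda>\<omega>. c0 + 1 / 2 * (\<Sum>i=1..N. c i * ((\<eta> i \<omega>)\<^sup>2 - 1))) = (\<lambda>\<omega>. c0 + (\<Sum>i=1..N. X i \<omega>))"
    unfolding X_def by (simp add: sum_distrib_left)
  then have "char (distr M borel (\<lambda>\<omega>. c0 + 1 / 2 * (\<Sum>i=1..N. c i * ((\<eta> i \<omega>)\<^sup>2 - 1)))) t
    = exp (\<i> * of_real (t * c0)) * char (distr M borel (\<lambda>\<omega>. \<Sum>i=1..N. X i \<omega>)) t"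
    using distr_add_const_char[OF M Xm] by simp
  also have "char (distr M borel (\<lambda>\<omega>. \<Sum>i=1..N. X i \<omega>)) t = (\<Prod>i=1..N. char (distr M borel (X i)) t)"
    by (rule char_distr_sum[OF indX])
  also have "\<dots> = (\<Prod>i=1..N. exp (chi_log (t * c i)))"
    unfolding X_def by (intro prod.cong refl char_normal_quadratic M n) simp
  finally show ?thesis .
qed

text \<open>
  By independence, conditioning on the value of the adjacency matrix fixes the matrix in the formula for the
  estimator and leaves the law of the normal variables unchanged.
\<close>

lemma cond_distr_eq:
  assumes M: "prob_space M" and N: "N \<ge> 1"
    and ie: "indep_elements M (count_space UNIV) (adjacency_mat N A) (\<Pi>\<^sub>M i\<in>{1..}. borel) (\<lambda>\<omega>. \<lambda>i\<in>{1..}. \<eta> i \<omega>)"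
    and pos: "0 < measure M {\<omega>' \<in> space M. adjacency_mat N A \<omega>' = a}"
    and \<omega>: "adjacency_mat N A \<omega> = a"
  shows "cond_distr M (U_hat \<beta> N t A \<eta>) (adjacency_mat N A) \<omega>
    = distr M borel (\<lambda>\<omega>'. U_fixed \<beta> N t a + 1 / 2 * (\<Sum>i=1..N. coef \<beta> N t a i * ((\<eta> i \<omega>')\<^sup>2 - 1)))"
proof -
  interpret prob_space M by (rule M)
  let ?Y = "adjacency_mat N A"
  define E where "E = {\<omega>' \<in> space M. ?Y \<omega>' = a}"
  define Q where "Q b f = U_fixed \<beta> N t b + 1 / 2 * (\<Sum>i=1..N. coef \<beta> N t b i * ((f i)\<^sup>2 - 1))" for b and f :: "nat \<Rightarrow> real"
  define H where "H \<omega>' = (\<lambda>i\<in>{1..}. \<eta> i \<omega>')" for \<omega>'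
  have Ym: "?Y \<in> measurable M (count_space UNIV)" and Hm: "H \<in> measurable M (\<Pi>\<^sub>M i\<in>{1::nat..}. borel)"
    and ind: "indep_set {?Y -` B \<inter> space M | B. B \<in> sets (count_space UNIV)} {H -` C \<inter> space M | C. C \<in> sets (\<Pi>\<^sub>M i\<in>{1::nat..}. borel)}"
    using ie unfolding indep_elements_def H_def by auto
  have Ev: "E \<in> events" unfolding E_def using measurable_sets[OF Ym, of "{a}"] by (simp add: vimage_def Int_def conj_commute)
  have Qm: "Q b \<in> borel_measurable (\<Pi>\<^sub>M i\<in>{1::nat..}. borel)" for b
    unfolding Q_def[abs_def] by (intro borel_measurable_add borel_measurable_times borel_measurable_sum borel_measurable_diff borel_measurable_power measurable_component_singleton borel_measurable_const) auto
  have QH: "Q b (H \<omega>') = U_fixed \<beta> N t b + 1 / 2 * (\<Sum>i=1..N. coef \<beta> N t b i * ((\<eta> i \<omega>')\<^sup>2 - 1))" for b \<omega>'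
    unfolding Q_def H_def by simp
  have Xa: "(\<lambda>\<omega>'. Q b (H \<omega>')) \<in> borel_measurable M" for b
    using measurable_compose[OF Hm Qm] .
  have U: "U_hat \<beta> N t A \<eta> \<omega>' = Q (?Y \<omega>') (H \<omega>')" for \<omega>'
    unfolding QH by (rule U_hat_eq[OF N])
  have Um: "U_hat \<beta> N t A \<eta> \<in> borel_measurable M"
  proof -
    have fin: "finite (?Y ` space M)" by (rule adjacency_finite_range)
    have "(\<lambda>\<omega>'. \<Sum>b\<in>?Y ` space M. indicator {\<omega>' \<in> space M. ?Y \<omega>' = b} \<omega>' * Q b (H \<omega>')) \<in> borel_measurable M"
    proof (intro borel_measurable_sum borel_measurable_times Xa borel_measurable_indicator)
      show "{\<omega>' \<in> space M. ?Y \<omega>' = b} \<in> events" for b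
        using measurable_sets[OF Ym, of "{b}"] by (simp add: vimage_def Int_def conj_commute)
    qed
    moreover have "U_hat \<beta> N t A \<eta> \<omega>' = (\<Sum>b\<in>?Y ` space M. indicator {\<omega>' \<in> space M. ?Y \<omega>' = b} \<omega>' * Q b (H \<omega>'))" if "\<omega>' \<in> space M" for \<omega>'
    proof -
      have "(\<Sum>b\<in>?Y ` space M. indicator {\<omega>' \<in> space M. ?Y \<omega>' = b} \<omega>' * Q b (H \<omega>')) = (\<Sum>b\<in>?Y ` space M. if b = ?Y \<omega>' then Q b (H \<omega>') else 0)"
        using that by (intro sum.cong refl) (auto simp: indicator_def)
      then show ?thesis unfolding U using fin that by simp
    qed
    ultimately show ?thesis by (subst measurable_cong) auto
  qed
  have posE: "0 < emeasure M E" using pos unfolding E_def by (simp add: emeasure_eq_measure)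
  have "distr (uniform_measure M E) borel (U_hat \<beta> N t A \<eta>) = distr M borel (\<lambda>\<omega>'. Q a (H \<omega>'))"
  proof (rule measure_eqI)
    fix B assume "B \<in> sets (distr (uniform_measure M E) borel (U_hat \<beta> N t A \<eta>))"
    then have B: "B \<in> sets borel" by simp
    define F where "F = (\<lambda>\<omega>'. Q a (H \<omega>')) -` B \<inter> space M"
    have F: "F \<in> events" unfolding F_def using measurable_sets[OF Xa B] .
    have EF: "prob (E \<inter> F) = prob E * prob F"
    proof (rule indep_setD[OF ind])
      show "E \<in> {?Y -` B \<inter> space M | B. B \<in> sets (count_space UNIV)}"
        by (intro CollectI exI[of _ "{a}"]) (auto simp: E_def)
      have "Q a -` B \<inter> space (\<Pi>\<^sub>M i\<in>{1::nat..}. borel) \<in> sets (\<Pi>\<^sub>M i\<in>{1::nat..}. borel)" by (rule measurable_sets[OF Qm B])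
      moreover have "F = H -` (Q a -` B \<inter> space (\<Pi>\<^sub>M i\<in>{1::nat..}. borel)) \<inter> space M"
        unfolding F_def using measurable_space[OF Hm] by auto
      ultimately show "F \<in> {H -` C \<inter> space M | C. C \<in> sets (\<Pi>\<^sub>M i\<in>{1::nat..}. borel)}" by blast
    qed
    have "emeasure (distr (uniform_measure M E) borel (U_hat \<beta> N t A \<eta>)) B = emeasure (uniform_measure M E) (U_hat \<beta> N t A \<eta> -` B \<inter> space M)"
      using Um B by (subst emeasure_distr) (auto simp: measurable_def)
    also have "\<dots> = emeasure M (E \<inter> (U_hat \<beta> N t A \<eta> -` B \<inter> space M)) / emeasure M E"
      using Ev measurable_sets[OF Um B] by (rule emeasure_uniform_measure)
    also have "E \<inter> (U_hat \<beta> N t A \<eta> -` B \<inter> space M) = E \<inter> F"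
      unfolding E_def F_def by (auto simp: U)
    also have "emeasure M (E \<inter> F) / emeasure M E = emeasure M F"
    proof -
      have p: "0 < prob E" using pos unfolding E_def .
      then show ?thesis unfolding emeasure_eq_measure EF by (simp add: divide_ennreal)
    qed
    also have "\<dots> = emeasure (distr M borel (\<lambda>\<omega>'. Q a (H \<omega>'))) B"
      unfolding F_def using Xa B by (subst emeasure_distr) auto
    finally show "emeasure (distr (uniform_measure M E) borel (U_hat \<beta> N t A \<eta>)) B = emeasure (distr M borel (\<lambda>\<omega>'. Q a (H \<omega>'))) B" .
  qed simp
  then show ?thesis unfolding cond_distr_def \<omega> E_def QH .
qed

lemma AE_pos_event:
  assumes M: "prob_space M" and Ym: "Y \<in> measurable M (count_space UNIV)" and fin: "finite (Y ` space M)"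
  shows "AE \<omega> in M. 0 < measure M {\<omega>' \<in> space M. Y \<omega>' = Y \<omega>}"
proof -
  interpret prob_space M by (rule M)
  have ev: "{\<omega>' \<in> space M. Y \<omega>' = b} \<in> events" for b
    using measurable_sets[OF Ym, of "{b}"] by (simp add: vimage_def Int_def conj_commute)
  have "AE \<omega> in M. \<forall>b\<in>{b \<in> Y ` space M. prob {\<omega>' \<in> space M. Y \<omega>' = b} = 0}. \<omega> \<notin> {\<omega>' \<in> space M. Y \<omega>' = b}"
  proof (rule AE_finite_allI)
    fix b assume "b \<in> {b \<in> Y ` space M. prob {\<omega>' \<in> space M. Y \<omega>' = b} = 0}"
    then have "{\<omega>' \<in> space M. Y \<omega>' = b} \<in> null_sets M" using ev by (auto simp: null_sets_def emeasure_eq_measure)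
    then show "AE \<omega> in M. \<omega> \<notin> {\<omega>' \<in> space M. Y \<omega>' = b}" by (rule AE_not_in)
  qed (use fin in simp)
  then show ?thesis
  proof (rule AE_mp, intro AE_I2 impI)
    fix \<omega> assume \<omega>: "\<omega> \<in> space M" and h: "\<forall>b\<in>{b \<in> Y ` space M. prob {\<omega>' \<in> space M. Y \<omega>' = b} = 0}. \<omega> \<notin> {\<omega>' \<in> space M. Y \<omega>' = b}"
    then have "prob {\<omega>' \<in> space M. Y \<omega>' = Y \<omega>} \<noteq> 0" by auto
    then show "0 < prob {\<omega>' \<in> space M. Y \<omega>' = Y \<omega>}" by (simp add: zero_less_measure_iff)
  qed
qed

section \<open>Series of square-integrable random variables\<close>

lemma summable_on_tail:
  fixes m :: "'i \<Rightarrow> real"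
  assumes m: "m summable_on I" "\<And>i. i \<in> I \<Longrightarrow> 0 \<le> m i" and e: "0 < e"
  shows "\<exists>F. finite F \<and> F \<subseteq> I \<and> (\<forall>G. finite G \<longrightarrow> G \<subseteq> I \<longrightarrow> G \<inter> F = {} \<longrightarrow> sum m G < e)"
proof -
  have "(sum m \<longlongrightarrow> infsum m I) (finite_subsets_at_top I)"
    using has_sum_infsum[OF m(1)] by (simp add: has_sum_def)
  from order_tendstoD(1)[OF this, of "infsum m I - e"] e
  obtain F where F: "finite F" "F \<subseteq> I" "infsum m I - e < sum m F"
    unfolding eventually_finite_subsets_at_top by auto
  show ?thesis
  proof (intro exI[of _ F] conjI F(1,2) allI impI)
    fix G assume G: "finite G" "G \<subseteq> I" "G \<inter> F = {}"
    have "sum m G + sum m F = sum m (G \<union> F)" using G F by (simp add: sum.union_disjoint)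
    also have "\<dots> \<le> infsum m I"
      by (rule finite_sum_le_infsum[OF m(1)]) (use G F m(2) in auto)
    finally show "sum m G < e" using F(3) by linarith
  qed
qed

context prob_space begin

lemma integral_abs_le_sq:
  assumes "X \<in> borel_measurable M" "integrable M (\<lambda>x. (X x)\<^sup>2)" "0 < e"
  shows "integrable M (X :: 'a \<Rightarrow> real)" "(\<integral>x. \<bar>X x\<bar> \<partial>M) \<le> e + (\<integral>x. (X x)\<^sup>2 \<partial>M) / e"
proof -
  have le: "\<bar>y\<bar> \<le> e + y\<^sup>2 / e" for y :: real
  proof -
    have "0 \<le> (\<bar>y\<bar> - e)\<^sup>2 + e * \<bar>y\<bar>" using assms(3) by simp
    then have "e * \<bar>y\<bar> \<le> e\<^sup>2 + y\<^sup>2" by (simp add: power2_diff mult.commute)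
    then show ?thesis using assms(3) by (simp add: field_simps power2_eq_square)
  qed
  have i: "integrable M (\<lambda>x. e + (X x)\<^sup>2 / e)" using assms by simp
  show X: "integrable M X"
    by (rule Bochner_Integration.integrable_bound[OF i assms(1)]) (use le assms(3) in \<open>auto simp: abs_of_nonneg\<close>)
  have "(\<integral>x. \<bar>X x\<bar> \<partial>M) \<le> (\<integral>x. e + (X x)\<^sup>2 / e \<partial>M)"
    by (intro integral_mono integrable_abs X i le)
  also have "\<dots> = e + (\<integral>x. (X x)\<^sup>2 \<partial>M) / e" using assms prob_space by simp
  finally show "(\<integral>x. \<bar>X x\<bar> \<partial>M) \<le> e + (\<integral>x. (X x)\<^sup>2 \<partial>M) / e" .
qed

text \<open>
  The mixed moments vanish by independence.
\<close>

lemma indep_centred_second_moment: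
  fixes Y :: "'i \<Rightarrow> 'a \<Rightarrow> real"
  assumes ind: "indep_vars (\<lambda>_. borel) Y I"
    and Y: "\<And>i. i \<in> I \<Longrightarrow> integrable M (\<lambda>x. (Y i x)\<^sup>2)" "\<And>i. i \<in> I \<Longrightarrow> expectation (Y i) = 0"
    and F: "finite F" "F \<subseteq> I"
  shows "integrable M (\<lambda>x. (\<Sum>i\<in>F. Y i x)\<^sup>2)" "expectation (\<lambda>x. \<Sum>i\<in>F. Y i x) = 0"
    "expectation (\<lambda>x. (\<Sum>i\<in>F. Y i x)\<^sup>2) = (\<Sum>i\<in>F. expectation (\<lambda>x. (Y i x)\<^sup>2))"
proof -
  have m: "Y i \<in> borel_measurable M" if "i \<in> I" for i using ind that by (auto simp: indep_vars_def)
  have iY: "integrable M (Y i)" if "i \<in> I" for i by (rule integral_abs_le_sq(1)[OF m[OF that] Y(1)[OF that], of 1]) simp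
  have "integrable M (\<lambda>x. (\<Sum>i\<in>F. Y i x)\<^sup>2) \<and> expectation (\<lambda>x. \<Sum>i\<in>F. Y i x) = 0 \<and>
    expectation (\<lambda>x. (\<Sum>i\<in>F. Y i x)\<^sup>2) = (\<Sum>i\<in>F. expectation (\<lambda>x. (Y i x)\<^sup>2))"
    using F
  proof (induction F rule: finite_induct)
    case (insert p F)
    then have p: "p \<in> I" and FI: "F \<subseteq> I" by auto
    note IH = insert.IH[OF FI]
    let ?T = "\<lambda>x. \<Sum>i\<in>F. Y i x"
    have iv: "indep_var borel (Y p) borel ?T"
      by (rule indep_vars_sum[OF insert.hyps indep_vars_subset[OF ind insert.prems]])
    have iT: "integrable M ?T" using iY FI by (intro Bochner_Integration.integrable_sum) auto
    have pT: "integrable M (\<lambda>x. Y p x * ?T x)" "expectation (\<lambda>x. Y p x * ?T x) = 0"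
      using indep_var_integrable[OF iv iY[OF p] iT] indep_var_lebesgue_integral[OF iv iY[OF p] iT] Y(2)[OF p] by auto
    have sq: "(\<lambda>x. (\<Sum>i\<in>insert p F. Y i x)\<^sup>2) = (\<lambda>x. (Y p x)\<^sup>2 + (2 * (Y p x * ?T x) + (?T x)\<^sup>2))"
      using insert.hyps by (auto simp: power2_sum algebra_simps)
    show ?case unfolding sq using insert.hyps IH pT Y[OF p] iY[OF p] iT by simp
  qed simp
  then show "integrable M (\<lambda>x. (\<Sum>i\<in>F. Y i x)\<^sup>2)" "expectation (\<lambda>x. \<Sum>i\<in>F. Y i x) = 0"
    "expectation (\<lambda>x. (\<Sum>i\<in>F. Y i x)\<^sup>2) = (\<Sum>i\<in>F. expectation (\<lambda>x. (Y i x)\<^sup>2))" by auto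
qed

text \<open>
  Here \<open>m\<close> bounds the means and \<open>v\<close> the variances of the summands. By the hypothesis on second moments the finite
  partial sums are a Cauchy net in \<open>L\<^sup>2\<close>. The limit is taken along an almost surely convergent subsequence of an exhausting
  sequence of index sets, and Fatou's lemma shows that the whole net converges to it.
\<close>

lemma L2_sum_exists:
  fixes X :: "'i \<Rightarrow> 'a \<Rightarrow> real"
  assumes Xm: "\<And>i. i \<in> I \<Longrightarrow> X i \<in> borel_measurable M"
    and m: "m summable_on I" "\<And>i. i \<in> I \<Longrightarrow> 0 \<le> m i"
    and v: "v summable_on I" "\<And>i. i \<in> I \<Longrightarrow> 0 \<le> v i"
    and int: "\<And>F. finite F \<Longrightarrow> F \<subseteq> I \<Longrightarrow> integrable M (\<lambda>x. (\<Sum>i\<in>F. X i x)\<^sup>2)"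
    and le: "\<And>F. finite F \<Longrightarrow> F \<subseteq> I \<Longrightarrow> expectation (\<lambda>x. (\<Sum>i\<in>F. X i x)\<^sup>2) \<le> (sum m F)\<^sup>2 + sum v F"
  shows "\<exists>S. has_L2_sum M X I S"
proof -
  define T where "T F x = (\<Sum>i\<in>F. X i x)" for F x
  have Tm: "T F \<in> borel_measurable M" if "F \<subseteq> I" for F
    unfolding T_def using Xm that by (intro borel_measurable_sum) auto
  have tail: "\<exists>F. finite F \<and> F \<subseteq> I \<and> (\<forall>G. finite G \<and> G \<subseteq> I \<and> G \<inter> F = {} \<longrightarrow> expectation (\<lambda>x. (T G x)\<^sup>2) \<le> (1/4) ^ k)" for k
  proof -
    have h: "0 < (1 / 2) ^ (k + 1) / (1::real)" "0 < (1 / 4) ^ k / (2::real)" by auto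
    obtain F1 where F1: "finite F1" "F1 \<subseteq> I" "\<And>G. finite G \<Longrightarrow> G \<subseteq> I \<Longrightarrow> G \<inter> F1 = {} \<Longrightarrow> sum m G < (1 / 2) ^ (k + 1) / 1"
      using summable_on_tail[of m I, OF m(1) _ h(1)] m(2) by (metis (no_types, lifting))
    obtain F2 where F2: "finite F2" "F2 \<subseteq> I" "\<And>G. finite G \<Longrightarrow> G \<subseteq> I \<Longrightarrow> G \<inter> F2 = {} \<Longrightarrow> sum v G < (1 / 4) ^ k / 2"
      using summable_on_tail[of v I, OF v(1) _ h(2)] v(2) by (metis (no_types, lifting))
    have "expectation (\<lambda>x. (T G x)\<^sup>2) \<le> (1/4) ^ k" if G: "finite G" "G \<subseteq> I" "G \<inter> (F1 \<union> F2) = {}" for G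
    proof -
      have d: "G \<inter> F1 = {}" "G \<inter> F2 = {}" using G(3) by auto
      have "sum m G \<le> (1 / 2) ^ (k + 1)" using less_imp_le[OF F1(3)[OF G(1,2) d(1)]] by simp
      moreover have "0 \<le> sum m G" using m(2) G by (intro sum_nonneg) auto
      ultimately have "(sum m G)\<^sup>2 \<le> ((1 / 2) ^ (k + 1))\<^sup>2" by (intro power_mono)
      also have "\<dots> = (1 / 4) ^ (k + 1)" by (simp add: power_mult[symmetric] power2_eq_square power_mult_distrib[symmetric])
      finally have "(sum m G)\<^sup>2 \<le> (1 / 4) ^ k / 4" by simp
      moreover have "sum v G < (1 / 4) ^ k / 2" by (rule F2(3)[OF G(1,2) d(2)])
      ultimately have "(sum m G)\<^sup>2 + sum v G \<le> (1 / 4) ^ k" using zero_less_power[of "1/4 :: real" k] by linarith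
      then show ?thesis using le[OF G(1,2)] unfolding T_def by linarith
    qed
    note K = this
    show ?thesis
    proof (intro exI[of _ "F1 \<union> F2"] conjI allI impI)
      show "finite (F1 \<union> F2)" "F1 \<union> F2 \<subseteq> I" using F1(1,2) F2(1,2) by auto
      show "expectation (\<lambda>x. (T G x)\<^sup>2) \<le> (1/4) ^ k" if "finite G \<and> G \<subseteq> I \<and> G \<inter> (F1 \<union> F2) = {}" for G
        using that by (elim conjE) (rule K)
    qed
  qed
  then have tail': "\<forall>k. \<exists>F. finite F \<and> F \<subseteq> I \<and> (\<forall>G. finite G \<and> G \<subseteq> I \<and> G \<inter> F = {} \<longrightarrow> expectation (\<lambda>x. (T G x)\<^sup>2) \<le> (1/4) ^ k)"
    by (rule allI)
  from choice[OF tail'] obtain F0 where F0': "\<forall>k. finite (F0 k) \<and> F0 k \<subseteq> I \<and>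
    (\<forall>G. finite G \<and> G \<subseteq> I \<and> G \<inter> F0 k = {} \<longrightarrow> expectation (\<lambda>x. (T G x)\<^sup>2) \<le> (1/4) ^ k)" by (elim exE)
  have F0: "\<And>k. finite (F0 k)" "\<And>k. F0 k \<subseteq> I"
    "\<And>k G. finite G \<Longrightarrow> G \<subseteq> I \<Longrightarrow> G \<inter> F0 k = {} \<Longrightarrow> expectation (\<lambda>x. (T G x)\<^sup>2) \<le> (1/4) ^ k"
    using F0' by blast+
  define F where "F k = (\<Union>i\<le>k. F0 i)" for k
  have F: "finite (F k)" "F k \<subseteq> I" "F0 k \<subseteq> F k" for k unfolding F_def using F0 by auto
  have Fmono: "F i \<subseteq> F j" if "i \<le> j" for i j unfolding F_def using that by fastforce
  have diff: "T G x - T G' x = T (G - G') x - T (G' - G) x" if "finite G" "finite G'" for G G' x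
  proof -
    have "T G x = T (G \<inter> G') x + T (G - G') x" unfolding T_def by (rule sum.Int_Diff[OF that(1)])
    moreover have "T G' x = T (G' \<inter> G) x + T (G' - G) x" unfolding T_def by (rule sum.Int_Diff[OF that(2)])
    moreover have "G' \<inter> G = G \<inter> G'" by (rule Int_commute)
    ultimately show ?thesis by simp
  qed
  have dsq: "integrable M (\<lambda>x. (T G x - T G' x)\<^sup>2)" "expectation (\<lambda>x. (T G x - T G' x)\<^sup>2) \<le> 4 * (1/4) ^ k"
    if G: "finite G" "G \<subseteq> I" "F0 k \<subseteq> G" "finite G'" "G' \<subseteq> I" "F0 k \<subseteq> G'" for G G' k
  proof -
    let ?A = "G - G'" and ?B = "G' - G"
    have iA: "integrable M (\<lambda>x. (T ?A x)\<^sup>2)" and iB: "integrable M (\<lambda>x. (T ?B x)\<^sup>2)"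
      unfolding T_def using G by (auto intro!: int)
    have i: "integrable M (\<lambda>x. 2 * (T ?A x)\<^sup>2 + 2 * (T ?B x)\<^sup>2)" using iA iB by simp
    have sqle: "(a - b)\<^sup>2 \<le> 2 * a\<^sup>2 + 2 * b\<^sup>2" for a b :: real
    proof -
      have "0 \<le> (a + b)\<^sup>2" by simp
      then show ?thesis by (simp add: power2_sum power2_diff)
    qed
    have mm: "(\<lambda>x. (T G x - T G' x)\<^sup>2) \<in> borel_measurable M" using Tm[OF G(2)] Tm[OF G(5)] by simp
    show id: "integrable M (\<lambda>x. (T G x - T G' x)\<^sup>2)"
      by (rule Bochner_Integration.integrable_bound[OF i mm]) (auto simp: diff[OF G(1,4)] sqle)
    have "expectation (\<lambda>x. (T G x - T G' x)\<^sup>2) \<le> expectation (\<lambda>x. 2 * (T ?A x)\<^sup>2 + 2 * (T ?B x)\<^sup>2)"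
      by (intro integral_mono id i) (simp add: diff[OF G(1,4)] sqle)
    also have "\<dots> = 2 * expectation (\<lambda>x. (T ?A x)\<^sup>2) + 2 * expectation (\<lambda>x. (T ?B x)\<^sup>2)" using iA iB by simp
    also have "\<dots> \<le> 2 * (1/4) ^ k + 2 * (1/4) ^ k"
      using F0(3)[of ?A k] F0(3)[of ?B k] G by (intro add_mono mult_left_mono) auto
    finally show "expectation (\<lambda>x. (T G x - T G' x)\<^sup>2) \<le> 4 * (1/4) ^ k" by simp
  qed
  have F0F: "F0 k \<subseteq> F j" if "k \<le> j" for k j using F(3)[of k] Fmono[OF that] by blast
  have small: "\<exists>k. C * (1/4) ^ k < e" if e: "0 < e" and C: "0 < C" for e C :: real
  proof -
    obtain k where "(1/4 :: real) ^ k < e / C" using real_arch_pow_inv[of "e / C" "1/4"] e C by auto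
    then show ?thesis using C by (intro exI[of _ k]) (simp add: field_simps)
  qed
  have cauchy: "\<exists>N. \<forall>i\<ge>N. \<forall>j\<ge>N. (\<integral>x. norm (T (F i) x - T (F j) x) \<partial>M) < e" if e: "0 < e" for e
  proof -
    have "0 < (e / 2)\<^sup>2 / 2" using e by simp
    from small[OF this, of 4] obtain k where k: "4 * (1/4 :: real) ^ k < (e / 2)\<^sup>2 / 2" by auto
    have "(\<integral>x. norm (T (F i) x - T (F j) x) \<partial>M) < e" if ij: "k \<le> i" "k \<le> j" for i j
    proof -
      note d = dsq[OF F(1,2) F0F[OF ij(1)] F(1,2) F0F[OF ij(2)]]
      have "(\<integral>x. \<bar>T (F i) x - T (F j) x\<bar> \<partial>M) \<le> e / 2 + expectation (\<lambda>x. (T (F i) x - T (F j) x)\<^sup>2) / (e / 2)"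
        by (rule integral_abs_le_sq(2)) (use d(1) Tm[OF F(2)] e in auto)
      also have "\<dots> \<le> e / 2 + ((e / 2)\<^sup>2 / 2) / (e / 2)"
        using d(2) k e by (intro add_left_mono divide_right_mono) auto
      also have "\<dots> < e" using e by (simp add: power2_eq_square)
      finally show ?thesis by simp
    qed
    then show ?thesis by blast
  qed
  have iT: "integrable M (T (F i))" for i
    by (rule integral_abs_le_sq(1)[OF Tm[OF F(2)], of i 1]) (use int[OF F(1,2)] in \<open>auto simp: T_def\<close>)
  obtain r where r: "strict_mono r" "AE x in M. Cauchy (\<lambda>i. T (F (r i)) x)"
    using cauchy_L1_AE_cauchy_subseq[of M "\<lambda>i. T (F i)", OF iT cauchy] by metis
  define S where "S x = lim (\<lambda>i. T (F (r i)) x)" for x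
  have Sm: "S \<in> borel_measurable M" unfolding S_def[abs_def]
    by (rule borel_measurable_lim_metric) (rule Tm[OF F(2)])
  have Slim: "AE x in M. (\<lambda>i. T (F (r i)) x) \<longlonglongrightarrow> S x"
    using r(2) by eventually_elim (auto simp: S_def Cauchy_convergent_iff convergent_LIMSEQ_iff)
  have fatou: "(\<integral>\<^sup>+x. ennreal ((T G x - S x)\<^sup>2) \<partial>M) \<le> ennreal (4 * (1/4) ^ k)" if G: "finite G" "G \<subseteq> I" "F k \<subseteq> G" for G k
  proof -
    have "(\<integral>\<^sup>+x. ennreal ((T G x - S x)\<^sup>2) \<partial>M) = (\<integral>\<^sup>+x. liminf (\<lambda>n. ennreal ((T G x - T (F (r n)) x)\<^sup>2)) \<partial>M)"
    proof (rule nn_integral_cong_AE)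
      show "AE x in M. ennreal ((T G x - S x)\<^sup>2) = liminf (\<lambda>n. ennreal ((T G x - T (F (r n)) x)\<^sup>2))"
        using Slim
      proof eventually_elim
        case (elim x)
        have "(\<lambda>n. ennreal ((T G x - T (F (r n)) x)\<^sup>2)) \<longlonglongrightarrow> ennreal ((T G x - S x)\<^sup>2)"
          by (intro tendsto_ennrealI tendsto_power tendsto_diff tendsto_const elim)
        from lim_imp_Liminf[OF trivial_limit_sequentially this] show ?case by (rule sym)
      qed
    qed
    also have "\<dots> \<le> liminf (\<lambda>n. \<integral>\<^sup>+x. ennreal ((T G x - T (F (r n)) x)\<^sup>2) \<partial>M)"
      using Tm[OF G(2)] Tm[OF F(2)] by (intro nn_integral_liminf) auto
    also have "\<dots> \<le> ennreal (4 * (1/4) ^ k)"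
    proof (rule Liminf_le)
      show "\<forall>\<^sub>F n in sequentially. (\<integral>\<^sup>+x. ennreal ((T G x - T (F (r n)) x)\<^sup>2) \<partial>M) \<le> ennreal (4 * (1/4) ^ k)"
      proof (rule eventually_sequentiallyI[of k])
        fix n assume "k \<le> n"
        then have "k \<le> r n" using strict_mono_imp_increasing[OF r(1), of n] by linarith
        then have d: "F0 k \<subseteq> F (r n)" by (rule F0F)
        have g: "F0 k \<subseteq> G" using F(3)[of k] G(3) by blast
        show "(\<integral>\<^sup>+x. ennreal ((T G x - T (F (r n)) x)\<^sup>2) \<partial>M) \<le> ennreal (4 * (1/4) ^ k)"
          using dsq[OF G(1,2) g F(1,2) d] by (subst nn_integral_eq_integral) (auto intro!: ennreal_leI)
      qed
    qed simp
    finally show ?thesis .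
  qed
  have "has_L2_sum M X I S"
    unfolding has_L2_sum_def T_def[symmetric]
  proof (intro conjI Sm order_tendstoI)
    fix a :: ennreal assume "a < 0" then show "\<forall>\<^sub>F G in finite_subsets_at_top I. a < (\<integral>\<^sup>+x. ennreal ((T G x - S x)\<^sup>2) \<partial>M)" by simp
  next
    fix a :: ennreal assume a: "0 < a"
    obtain c where c: "0 < c" "c < a" using dense[OF a] by blast
    then have "c < \<top>" using order_less_le_trans[OF c(2) top_greatest] by simp
    then obtain b where cb: "c = ennreal b" "0 \<le> b" by (cases c) auto
    have b: "0 < b" "ennreal b < a" using c cb by (auto simp: ennreal_less_zero_iff)
    obtain k where k: "4 * (1/4 :: real) ^ k < b" using small[OF b(1), of 4] by auto
    have "(\<integral>\<^sup>+x. ennreal ((T G x - S x)\<^sup>2) \<partial>M) < a" if "finite G" "F k \<subseteq> G" "G \<subseteq> I" for G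
    proof -
      have "(\<integral>\<^sup>+x. ennreal ((T G x - S x)\<^sup>2) \<partial>M) \<le> ennreal (4 * (1/4) ^ k)" by (rule fatou) (use that in auto)
      also have "\<dots> \<le> ennreal b" using k by (intro ennreal_leI) simp
      finally show ?thesis using b(2) by (rule le_less_trans)
    qed
    note K = this
    show "\<forall>\<^sub>F G in finite_subsets_at_top I. (\<integral>\<^sup>+x. ennreal ((T G x - S x)\<^sup>2) \<partial>M) < a"
      unfolding eventually_finite_subsets_at_top
    proof (intro exI[of _ "F k"] conjI allI impI F(1,2))
      fix G assume "finite G \<and> F k \<subseteq> G \<and> G \<subseteq> I"
      then show "(\<integral>\<^sup>+x. ennreal ((T G x - S x)\<^sup>2) \<partial>M) < a" by (elim conjE) (rule K)
    qed
  qed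
  then show ?thesis by blast
qed

lemma norm_iexp_diff_le: "norm (exp (\<i> * complex_of_real a) - exp (\<i> * complex_of_real b)) \<le> \<bar>a - b\<bar>"
proof -
  have "exp (\<i> * complex_of_real a) = exp (\<i> * complex_of_real b) * exp (\<i> * complex_of_real (a - b))"
    unfolding exp_add[symmetric] by (simp add: algebra_simps)
  then have "exp (\<i> * complex_of_real a) - exp (\<i> * complex_of_real b) = exp (\<i> * complex_of_real b) * (exp (\<i> * complex_of_real (a - b)) - 1)"
    by (simp add: right_diff_distrib)
  then have "norm (exp (\<i> * complex_of_real a) - exp (\<i> * complex_of_real b)) = norm (exp (\<i> * complex_of_real (a - b)) - 1)"
    by (simp add: norm_mult)
  also have "\<dots> \<le> \<bar>a - b\<bar>" using iexp_approx1[of "a - b" 0] by simp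
  finally show ?thesis .
qed

lemma char_L2_limit:
  assumes Vm: "\<And>n. V n \<in> borel_measurable M" and Wm: "W \<in> borel_measurable M"
    and lim: "(\<lambda>n. \<integral>\<^sup>+x. ennreal ((V n x - W x)\<^sup>2) \<partial>M) \<longlonglongrightarrow> 0"
  shows "(\<lambda>n. char (distr M borel (\<lambda>x. c + d * V n x)) t) \<longlonglongrightarrow> char (distr M borel (\<lambda>x. c + d * W x)) t"
proof (rule LIMSEQ_I)
  fix e :: real assume e: "0 < e"
  define K where "K = (t * d)\<^sup>2 / (e / 2) + 1"
  have K: "0 < K" unfolding K_def using e by (intro add_nonneg_pos) auto
  have "0 < ennreal (e / (2 * K))" using e K by simp
  from order_tendstoD(2)[OF lim this] obtain N where N: "\<And>n. n \<ge> N \<Longrightarrow> (\<integral>\<^sup>+x. ennreal ((V n x - W x)\<^sup>2) \<partial>M) < ennreal (e / (2 * K))"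
    unfolding eventually_sequentially by blast
  show "\<exists>N. \<forall>n\<ge>N. norm (char (distr M borel (\<lambda>x. c + d * V n x)) t - char (distr M borel (\<lambda>x. c + d * W x)) t) < e"
  proof (intro exI[of _ N] allI impI)
    fix n assume n: "N \<le> n"
    define D where "D x = V n x - W x" for x
    have Dm: "D \<in> borel_measurable M" unfolding D_def using Vm Wm by simp
    have nf: "(\<integral>\<^sup>+x. ennreal ((D x)\<^sup>2) \<partial>M) < ennreal (e / (2 * K))" using N[OF n] unfolding D_def .
    have Di: "integrable M (\<lambda>x. (D x)\<^sup>2)"
      using Dm less_trans[OF nf ennreal_less_top] by (intro integrableI_bounded) auto
    have Dv: "expectation (\<lambda>x. (D x)\<^sup>2) < e / (2 * K)"
      using nf nn_integral_eq_integral[OF Di] e K by (simp add: ennreal_less_iff)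
    let ?E = "\<lambda>y. exp (\<i> * complex_of_real (t * (c + d * y)))"
    have chr: "char (distr M borel (\<lambda>x. c + d * f x)) t = expectation (\<lambda>x. ?E (f x))" "integrable M (\<lambda>x. ?E (f x))"
      if [measurable]: "f \<in> borel_measurable M" for f
    proof -
      show "char (distr M borel (\<lambda>x. c + d * f x)) t = expectation (\<lambda>x. ?E (f x))"
        unfolding char_def by (subst integral_distr) auto
      show "integrable M (\<lambda>x. ?E (f x))" by (rule integrable_const_bound[of _ 1]) auto
    qed
    have "norm (char (distr M borel (\<lambda>x. c + d * V n x)) t - char (distr M borel (\<lambda>x. c + d * W x)) t)
      = norm (expectation (\<lambda>x. ?E (V n x) - ?E (W x)))"
      using chr[OF Vm] chr[OF Wm] by simp
    also have "\<dots> \<le> expectation (\<lambda>x. norm (?E (V n x) - ?E (W x)))" by (rule integral_norm_bound)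
    also have "\<dots> \<le> expectation (\<lambda>x. \<bar>(t * d) * D x\<bar>)"
    proof (rule integral_mono)
      show "integrable M (\<lambda>x. norm (?E (V n x) - ?E (W x)))" using chr(2)[OF Vm] chr(2)[OF Wm] by simp
      show "integrable M (\<lambda>x. \<bar>(t * d) * D x\<bar>)"
        using integral_abs_le_sq(1)[OF Dm Di, of 1] by simp
      show "norm (?E (V n x) - ?E (W x)) \<le> \<bar>(t * d) * D x\<bar>" for x
        using norm_iexp_diff_le[of "t * (c + d * V n x)" "t * (c + d * W x)"] by (simp add: D_def algebra_simps)
    qed
    also have "\<dots> \<le> e / 2 + expectation (\<lambda>x. ((t * d) * D x)\<^sup>2) / (e / 2)"
      by (rule integral_abs_le_sq(2)) (use Dm Di e in \<open>auto simp: power_mult_distrib\<close>)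
    also have "expectation (\<lambda>x. ((t * d) * D x)\<^sup>2) / (e / 2) = (K - 1) * expectation (\<lambda>x. (D x)\<^sup>2)"
      unfolding K_def by (simp add: power_mult_distrib)
    also have "\<dots> \<le> K * expectation (\<lambda>x. (D x)\<^sup>2)" by (intro mult_right_mono) auto
    also have "\<dots> < K * (e / (2 * K))" using Dv K by (intro mult_strict_left_mono)
    also have "e / 2 + K * (e / (2 * K)) = e" using K by simp
    finally show "norm (char (distr M borel (\<lambda>x. c + d * V n x)) t - char (distr M borel (\<lambda>x. c + d * W x)) t) < e" by simp
  qed
qed

end

lemma std_normal_moments:
  assumes M: "prob_space M" and Z: "distributed M lborel Z std_normal_density"
  shows "integrable M (\<lambda>x. ((Z x)\<^sup>2 - 1)\<^sup>2)" "(\<integral>x. (Z x)\<^sup>2 - 1 \<partial>M) = 0" "(\<integral>x. ((Z x)\<^sup>2 - 1)\<^sup>2 \<partial>M) = 2"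
proof -
  interpret prob_space M by (rule M)
  have i2: "integrable lborel (\<lambda>u. std_normal_density u * u\<^sup>2)" "(\<integral>u. std_normal_density u * u\<^sup>2 \<partial>lborel) = 1"
    using std_normal_moment_even[of 1] by (auto simp: has_bochner_integral_iff fact_numeral)
  have i4: "integrable lborel (\<lambda>u. std_normal_density u * u ^ 4)" "(\<integral>u. std_normal_density u * u ^ 4 \<partial>lborel) = 3"
    using std_normal_moment_even[of 2] by (auto simp: has_bochner_integral_iff fact_numeral)
  have i0: "integrable lborel std_normal_density" "(\<integral>u. std_normal_density u \<partial>lborel) = 1" by auto
  have p: "std_normal_density u * (u\<^sup>2 - 1)\<^sup>2 = std_normal_density u * u ^ 4 - 2 * (std_normal_density u * u\<^sup>2) + std_normal_density u" for u
    by (simp add: power2_eq_square power4_eq_xxxx algebra_simps)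
  have p1: "std_normal_density u * (u\<^sup>2 - 1) = std_normal_density u * u\<^sup>2 - std_normal_density u" for u
    by (simp add: algebra_simps)
  have "integrable lborel (\<lambda>u. std_normal_density u * (u\<^sup>2 - 1)\<^sup>2)" unfolding p using i0 i2 i4 by simp
  then show "integrable M (\<lambda>x. ((Z x)\<^sup>2 - 1)\<^sup>2)"
    by (subst distributed_integrable[OF Z, of "\<lambda>u. (u\<^sup>2 - 1)\<^sup>2", symmetric]) auto
  have "(\<integral>x. (Z x)\<^sup>2 - 1 \<partial>M) = (\<integral>u. std_normal_density u * (u\<^sup>2 - 1) \<partial>lborel)"
    by (rule distributed_integral[OF Z, of "\<lambda>u. u\<^sup>2 - 1", symmetric]) auto
  also have "\<dots> = 0" unfolding p1 using i0 i2 by simp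
  finally show "(\<integral>x. (Z x)\<^sup>2 - 1 \<partial>M) = 0" .
  have "(\<integral>x. ((Z x)\<^sup>2 - 1)\<^sup>2 \<partial>M) = (\<integral>u. std_normal_density u * (u\<^sup>2 - 1)\<^sup>2 \<partial>lborel)"
    by (rule distributed_integral[OF Z, of "\<lambda>u. (u\<^sup>2 - 1)\<^sup>2", symmetric]) auto
  also have "\<dots> = 2" unfolding p using i0 i2 i4 by simp
  finally show "(\<integral>x. ((Z x)\<^sup>2 - 1)\<^sup>2 \<partial>M) = 2" .
qed

section \<open>The characteristic function of the limit\<close>

text \<open>
  Logarithm of the characteristic function of the summand of the limit that belongs to the eigenvalue \<open>l\<close>.
\<close>

definition term_log :: "real \<Rightarrow> real \<Rightarrow> real \<Rightarrow> complex" where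
  "term_log \<beta> t l = \<i> * of_real (t * (\<beta> * l\<^sup>2 / (2 * (1 - \<beta> * l)))) + chi_log (t * (l / (1 - \<beta> * l)))"

lemma term_log_eq:
  assumes "1 - \<beta> * l \<noteq> 0"
  shows "term_log \<beta> t l = of_real (l\<^sup>2) * rest_fun \<beta> t l + (\<i> * of_real (t * \<beta> / 2) - of_real (t\<^sup>2 / 4)) * of_real (l\<^sup>2)"
proof -
  define q where "q = 1 - \<beta> * l"
  have q: "q \<noteq> 0" using assms by (simp add: q_def)
  have "\<beta> * l\<^sup>2 / (2 * q) = \<beta>\<^sup>2 / 2 * (l ^ 3 / q) + \<beta> / 2 * l\<^sup>2"
  proof -
    have "\<beta> * l\<^sup>2 / (2 * q) = (\<beta> * l\<^sup>2 * (\<beta> * l + q)) / (2 * q)" unfolding q_def by simp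
    also have "\<dots> = \<beta>\<^sup>2 / 2 * (l ^ 3 / q) + \<beta> / 2 * l\<^sup>2"
      using q by (simp add: field_simps power2_eq_square power3_eq_cube)
    finally show ?thesis .
  qed
  then have 1: "t * (\<beta> * l\<^sup>2 / (2 * q)) = t * (\<beta>\<^sup>2 / 2 * (l ^ 3 / q)) + t * \<beta> / 2 * l\<^sup>2" by (simp add: distrib_left)
  have "term_log \<beta> t l = \<i> * of_real (t * (\<beta>\<^sup>2 / 2 * (l ^ 3 / q))) + \<i> * of_real (t * \<beta> / 2 * l\<^sup>2) + chi_log (t * (l / q))"
    unfolding term_log_def q_def[symmetric] 1 of_real_add by (simp only: distrib_left)
  then show ?thesis
    unfolding rest_fun_eq[OF assms] q_def[symmetric] by (simp add: algebra_simps)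
qed

lemma char_std_normal_scaled:
  assumes M: "prob_space M" and Z: "distributed M lborel Z std_normal_density"
  shows "char (distr M borel (\<lambda>\<omega>. s * Z \<omega>)) t = exp (of_real (- (s\<^sup>2 * t\<^sup>2) / 2))"
proof -
  have [measurable]: "Z \<in> borel_measurable M" using Z by (simp add: distributed_def)
  have d: "distr M lborel Z = std_normal_distribution" using Z by (simp add: distributed_def)
  have "char (distr M borel (\<lambda>\<omega>. s * Z \<omega>)) t = (\<integral>\<omega>. (\<lambda>u. exp (\<i> * of_real ((t * s) * u))) (Z \<omega>) \<partial>M)"
    unfolding char_def by (subst integral_distr) (auto simp: mult.assoc)
  also have "\<dots> = (\<integral>u. exp (\<i> * of_real ((t * s) * u)) \<partial>distr M lborel Z)"
    by (rule integral_distr[symmetric]) auto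
  also have "\<dots> = char std_normal_distribution (t * s)" unfolding d char_def ..
  also have "\<dots> = exp (of_real (- (s\<^sup>2 * t\<^sup>2) / 2))"
    unfolding char_std_normal_distribution exp_of_real by (simp add: power_mult_distrib mult.commute)
  finally show ?thesis .
qed

lemma (in prob_space) indep_vars_reindex:
  assumes f: "inj_on f I" and X: "indep_vars M' X (f ` I)"
  shows "indep_vars (\<lambda>i. M' (f i)) (\<lambda>i. X (f i)) I"
  unfolding indep_vars_def2 indep_sets_def
proof (intro conjI ballI allI impI)
  fix i assume i: "i \<in> I"
  show m: "X (f i) \<in> M \<rightarrow>\<^sub>M M' (f i)" using X i by (auto simp: indep_vars_def2)
  show "{X (f i) -` A \<inter> space M |A. A \<in> sets (M' (f i))} \<subseteq> events" using measurable_sets[OF m] by blast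
next
  fix J A assume J: "J \<subseteq> I" "J \<noteq> {}" "finite J" and A: "A \<in> (\<Pi> i\<in>J. {X (f i) -` A \<inter> space M |A. A \<in> sets (M' (f i))})"
  have fJ: "inj_on f J" using f J(1) by (rule inj_on_subset)
  define B where "B k = A (inv_into J f k)" for k
  have B: "B (f j) = A j" if "j \<in> J" for j using fJ that by (simp add: B_def inv_into_f_f)
  have "prob (\<Inter>k\<in>f ` J. B k) = (\<Prod>k\<in>f ` J. prob (B k))"
    using X unfolding indep_vars_def2
    by (intro indep_setsD[where I="f ` I" and F="\<lambda>i. {X i -` A \<inter> space M |A. A \<in> sets (M' i)}"]) (use J A B in auto)
  then show "prob (\<Inter>j\<in>J. A j) = (\<Prod>j\<in>J. prob (A j))"
    using B by (simp add: prod.reindex[OF fJ] INT_extend_simps cong: INF_cong_simp prod.cong)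
qed

context graphon_version begin

lemma lam_q_pos:
  assumes \<beta>: "0 < \<beta>" "\<beta> < 1 / graphon_op_norm W"
  shows "0 < graphon_op_norm W" "0 < 1 - \<beta> * graphon_op_norm W" "1 - \<beta> * graphon_op_norm W \<le> 1 - \<beta> * lam j"
proof -
  have "0 < 1 / graphon_op_norm W" using \<beta> by linarith
  then show n: "0 < graphon_op_norm W" by simp
  show "0 < 1 - \<beta> * graphon_op_norm W" using \<beta>(2) n by (simp add: field_simps)
  have "lam j \<le> graphon_op_norm W" using eigv_le_op_norm[of j] by linarith
  then show "1 - \<beta> * graphon_op_norm W \<le> 1 - \<beta> * lam j" using \<beta>(1) by simp
qed

lemma Spec_cases: assumes "p \<in> Spec W" obtains j where "lam j \<noteq> 0" "p = spec_pair j" "fst p = lam j"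
proof -
  obtain j where "j \<in> {i. lam i \<noteq> 0}" "p = spec_pair j"
    using bij_betw_spec_pair assms unfolding bij_betw_def by blast
  then show thesis using that[of j] by (simp add: spec_pair_def)
qed

lemma summable_on_Spec:
  assumes "\<And>j. norm (f (lam j)) \<le> C * (lam j)\<^sup>2"
  shows "(\<lambda>p. f (fst p) :: real) summable_on Spec W"
proof -
  have "summable (\<lambda>j. norm (f (lam j)))"
    by (rule summable_comparison_test'[OF summable_mult[OF lam_sq_summable, of C], of 0]) (use assms in simp)
  then have "(\<lambda>j. f (lam j)) summable_on UNIV" by (rule norm_summable_imp_summable_on)
  then have "(\<lambda>j. f (lam j)) summable_on {i. lam i \<noteq> 0}" by (rule summable_on_subset_banach) simp
  then have "(\<lambda>j. f (fst (spec_pair j))) summable_on {i. lam i \<noteq> 0}" by (simp add: spec_pair_def)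
  then show ?thesis using summable_on_reindex_bij_betw[OF bij_betw_spec_pair, of "\<lambda>p. f (fst p)"] by simp
qed

lemma spec_limit_filter:
  "filterlim (\<lambda>n. spec_pair ` ({..<n} \<inter> {i. lam i \<noteq> 0})) (finite_subsets_at_top (Spec W)) sequentially"
  unfolding filterlim_finite_subsets_at_top
proof (intro allI impI)
  fix X assume X: "finite X \<and> X \<subseteq> Spec W"
  then obtain Y where Y: "Y \<subseteq> {i. lam i \<noteq> 0}" "finite Y" "X = spec_pair ` Y"
    using bij_betw_spec_pair unfolding bij_betw_def by (metis finite_subset_image)
  obtain N where N: "\<forall>i\<in>Y. i < N" using Y(2) finite_nat_set_iff_bounded by blast
  show "\<forall>\<^sub>F n in sequentially. finite (spec_pair ` ({..<n} \<inter> {i. lam i \<noteq> 0})) \<and>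
      X \<subseteq> spec_pair ` ({..<n} \<inter> {i. lam i \<noteq> 0}) \<and> spec_pair ` ({..<n} \<inter> {i. lam i \<noteq> 0}) \<subseteq> Spec W"
  proof (rule eventually_sequentiallyI[of N], intro conjI)
    fix n assume "N \<le> n"
    then have "Y \<subseteq> {..<n} \<inter> {i. lam i \<noteq> 0}" using N Y(1) by auto
    then show "X \<subseteq> spec_pair ` ({..<n} \<inter> {i. lam i \<noteq> 0})" unfolding Y(3) by (rule image_mono)
    show "spec_pair ` ({..<n} \<inter> {i. lam i \<noteq> 0}) \<subseteq> Spec W"
      using bij_betw_spec_pair unfolding bij_betw_def by blast
  qed simp
qed

text \<open>
  The series is the mean-square limit of the partial sums over the first \<open>n\<close> eigenvalues in the enumeration
  \<open>spec_pair\<close>. These are sums of independent variables, and together with \<open>Z0\<close> their characteristic function is a product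
  of explicit factors.
\<close>

lemma U_lim_char:
  fixes \<beta> \<theta> t :: real and P :: "'v measure" and Z0 :: "'v \<Rightarrow> real" and Z :: "real \<times> nat \<Rightarrow> 'v \<Rightarrow> real"
  assumes \<beta>: "0 < \<beta>" "\<beta> < 1 / graphon_op_norm W" and P: "prob_space P"
    and iid: "iid_std_normal P (\<lambda>s. case s of None \<Rightarrow> Z0 | Some p \<Rightarrow> Z p) (insert None (Some ` Spec W))"
  defines "\<sigma> \<equiv> sigma_W W \<theta>"
    and "D \<equiv> (LINT x|lebesgue_on {0..1}. W x x)"
  shows "U_lim W \<beta> \<theta> P Z0 Z \<in> borel_measurable P"
    "char (distr P borel (U_lim W \<beta> \<theta> P Z0 Z)) t =
      exp (\<i> * of_real (t * (\<beta> * \<sigma>\<^sup>2 + 1 / 2 * D)) + of_real (- (\<sigma>\<^sup>2 * t\<^sup>2) / 2)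
        + ((\<Sum>j. of_real ((lam j)\<^sup>2) * rest_fun \<beta> t (lam j)) + (\<i> * of_real (t * \<beta> / 2) - of_real (t\<^sup>2 / 4)) * of_real (\<Sum>j. (lam j)\<^sup>2)))"
proof -
  interpret P: prob_space P by (rule P)
  define \<delta> where "\<delta> = 1 - \<beta> * graphon_op_norm W"
  have \<delta>: "0 < \<delta>" and q: "\<delta> \<le> 1 - \<beta> * lam j" for j using lam_q_pos[OF \<beta>] unfolding \<delta>_def by auto
  have ind: "P.indep_vars (\<lambda>_. borel) (\<lambda>s. case s of None \<Rightarrow> Z0 | Some p \<Rightarrow> Z p) (insert None (Some ` Spec W))"
    using iid by (simp add: iid_std_normal_def)
  have Z0: "distributed P lborel Z0 std_normal_density" using iid by (auto simp: iid_std_normal_def)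
  have Z: "distributed P lborel (Z p) std_normal_density" if "p \<in> Spec W" for p
    using iid that by (auto simp: iid_std_normal_def)
  have Z0m: "Z0 \<in> borel_measurable P" using Z0 by (simp add: distributed_def)
  have Zm: "Z p \<in> borel_measurable P" if "p \<in> Spec W" for p using Z[OF that] by (simp add: distributed_def)
  define \<mu> where "\<mu> l = l / (1 - \<beta> * l)" for l
  define m where "m l = \<beta> * l\<^sup>2 / (1 - \<beta> * l)" for l
  define X where "X = (\<lambda>(l, k) \<omega>. l * ((Z (l, k) \<omega>)\<^sup>2 / (1 - \<beta> * l) - 1))"
  have distrib_q: "l * (z / r - 1) = (l * z - l * r) / r" if "r \<noteq> 0" for l z r :: real
    using that by (simp add: field_simps)
  \<comment> \<open>The mean \<open>m l\<close> is of order \<open>l\<^sup>2\<close> and hence summable, although \<open>l\<close> need not be.\<close>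
  have Xeq: "X p \<omega> = m (fst p) + \<mu> (fst p) * ((Z p \<omega>)\<^sup>2 - 1)" if p: "p \<in> Spec W" for p \<omega>
  proof -
    obtain j where j: "fst p = lam j" using Spec_cases[OF p] by blast
    have q0: "1 - \<beta> * fst p \<noteq> 0" using q[of j] \<delta> unfolding j by linarith
    have "X p \<omega> = fst p * ((Z p \<omega>)\<^sup>2 / (1 - \<beta> * fst p) - 1)" unfolding X_def by (simp add: split_beta)
    also have "\<dots> = (fst p * (Z p \<omega>)\<^sup>2 - fst p * (1 - \<beta> * fst p)) / (1 - \<beta> * fst p)"
      by (rule distrib_q) (rule q0)
    also have "\<dots> = m (fst p) + \<mu> (fst p) * ((Z p \<omega>)\<^sup>2 - 1)"
      unfolding m_def \<mu>_def times_divide_eq_left add_divide_distrib[symmetric]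
      by (simp add: algebra_simps power2_eq_square)
    finally show ?thesis .
  qed
  have Xm: "X p \<in> borel_measurable P" if "p \<in> Spec W" for p
  proof -
    have "X p = (\<lambda>\<omega>. m (fst p) + \<mu> (fst p) * ((Z p \<omega>)\<^sup>2 - 1))" using Xeq[OF that] by blast
    then show ?thesis using Zm[OF that] by simp
  qed
  have m0: "0 \<le> m (fst p)" if p: "p \<in> Spec W" for p
  proof -
    obtain j where j: "fst p = lam j" using Spec_cases[OF p] by blast
    show ?thesis unfolding j m_def using q[of j] \<delta> \<beta> by (intro divide_nonneg_nonneg mult_nonneg_nonneg) auto
  qed
  have ms: "(\<lambda>p. m (fst p)) summable_on Spec W"
  proof (rule summable_on_Spec[where C="\<beta> / \<delta>"])
    fix j
    have "norm (m (lam j)) = \<beta> * (lam j)\<^sup>2 / (1 - \<beta> * lam j)"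
      unfolding m_def using q[of j] \<delta> \<beta> by (simp add: abs_mult)
    also have "\<dots> \<le> \<beta> * (lam j)\<^sup>2 / \<delta>" using q[of j] \<delta> \<beta> by (intro divide_left_mono) auto
    finally show "norm (m (lam j)) \<le> \<beta> / \<delta> * (lam j)\<^sup>2" by simp
  qed
  have vs: "(\<lambda>p. 2 * (\<mu> (fst p))\<^sup>2) summable_on Spec W"
  proof (rule summable_on_Spec[where C="2 / \<delta>\<^sup>2"])
    fix j
    have "norm (2 * (\<mu> (lam j))\<^sup>2) = 2 * (lam j)\<^sup>2 / (1 - \<beta> * lam j)\<^sup>2" by (simp add: \<mu>_def power_divide)
    also have "\<dots> \<le> 2 * (lam j)\<^sup>2 / \<delta>\<^sup>2" using q[of j] \<delta> by (intro divide_left_mono power_mono) auto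
    finally show "norm (2 * (\<mu> (lam j))\<^sup>2) \<le> 2 / \<delta>\<^sup>2 * (lam j)\<^sup>2" by simp
  qed
  define Y where "Y p \<omega> = \<mu> (fst p) * ((Z p \<omega>)\<^sup>2 - 1)" for p \<omega>
  have indZ: "P.indep_vars (\<lambda>_. borel) Z (Spec W)"
  proof -
    have "P.indep_vars (\<lambda>_. borel) (\<lambda>s. case s of None \<Rightarrow> Z0 | Some p \<Rightarrow> Z p) (Some ` Spec W)"
      by (rule P.indep_vars_subset[OF ind]) auto
    then show ?thesis using P.indep_vars_reindex[of Some "Spec W" "\<lambda>_. borel" "\<lambda>s. case s of None \<Rightarrow> Z0 | Some p \<Rightarrow> Z p"]
      by simp
  qed
  have indY: "P.indep_vars (\<lambda>_. borel) Y (Spec W)"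
  proof -
    have "P.indep_vars (\<lambda>_. borel) (\<lambda>p \<omega>. (\<lambda>u. \<mu> (fst p) * (u\<^sup>2 - 1)) (Z p \<omega>)) (Spec W)"
      by (rule P.indep_vars_compose2[OF indZ]) auto
    then show ?thesis unfolding Y_def .
  qed
  have Y2: "integrable P (\<lambda>\<omega>. (Y p \<omega>)\<^sup>2)" "P.expectation (Y p) = 0" "P.expectation (\<lambda>\<omega>. (Y p \<omega>)\<^sup>2) = 2 * (\<mu> (fst p))\<^sup>2"
    if "p \<in> Spec W" for p
    using std_normal_moments[OF P Z[OF that]] unfolding Y_def[abs_def] by (simp_all add: power_mult_distrib mult.commute)
  have sumX: "(\<Sum>p\<in>F. X p \<omega>) = (\<Sum>p\<in>F. m (fst p)) + (\<Sum>p\<in>F. Y p \<omega>)" if "F \<subseteq> Spec W" for F \<omega>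
    unfolding sum.distrib[symmetric] Y_def using that by (intro sum.cong refl Xeq) auto
  have "\<exists>S. has_L2_sum P X (Spec W) S"
  proof (rule P.L2_sum_exists[OF Xm ms m0 vs])
    fix F assume F: "finite F" "F \<subseteq> Spec W"
    have mom: "integrable P (\<lambda>\<omega>. (\<Sum>p\<in>F. Y p \<omega>)\<^sup>2)" "P.expectation (\<lambda>\<omega>. \<Sum>p\<in>F. Y p \<omega>) = 0"
      "P.expectation (\<lambda>\<omega>. (\<Sum>p\<in>F. Y p \<omega>)\<^sup>2) = (\<Sum>p\<in>F. P.expectation (\<lambda>\<omega>. (Y p \<omega>)\<^sup>2))"
      by (rule P.indep_centred_second_moment[OF indY Y2(1) Y2(2) F]; assumption)+
    have iY: "integrable P (\<lambda>\<omega>. \<Sum>p\<in>F. Y p \<omega>)"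
    proof (rule P.integral_abs_le_sq(1)[where e=1])
      show "(\<lambda>\<omega>. \<Sum>p\<in>F. Y p \<omega>) \<in> borel_measurable P"
        unfolding Y_def using Zm F by (intro borel_measurable_sum) auto
    qed (use mom in simp_all)
    have e: "(\<lambda>\<omega>. (\<Sum>p\<in>F. X p \<omega>)\<^sup>2) = (\<lambda>\<omega>. (\<Sum>p\<in>F. m (fst p))\<^sup>2 + (2 * (\<Sum>p\<in>F. m (fst p)) * (\<Sum>p\<in>F. Y p \<omega>) + (\<Sum>p\<in>F. Y p \<omega>)\<^sup>2))"
      unfolding sumX[OF F(2)] by (simp add: power2_sum ac_simps)
    show "integrable P (\<lambda>\<omega>. (\<Sum>p\<in>F. X p \<omega>)\<^sup>2)" unfolding e using iY mom(1) by simp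
    have "P.expectation (\<lambda>\<omega>. (\<Sum>p\<in>F. X p \<omega>)\<^sup>2) = (\<Sum>p\<in>F. m (fst p))\<^sup>2 + (\<Sum>p\<in>F. P.expectation (\<lambda>\<omega>. (Y p \<omega>)\<^sup>2))"
      unfolding e using iY mom P.prob_space by simp
    also have "(\<Sum>p\<in>F. P.expectation (\<lambda>\<omega>. (Y p \<omega>)\<^sup>2)) = (\<Sum>p\<in>F. 2 * (\<mu> (fst p))\<^sup>2)"
      using Y2(3) F(2) by (intro sum.cong refl) auto
    finally show "P.expectation (\<lambda>\<omega>. (\<Sum>p\<in>F. X p \<omega>)\<^sup>2) \<le> (\<Sum>p\<in>F. m (fst p))\<^sup>2 + (\<Sum>p\<in>F. 2 * (\<mu> (fst p))\<^sup>2)" by simp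
  qed (use vs in simp_all)
  then have hS: "has_L2_sum P X (Spec W) (L2_sum P X (Spec W))" unfolding L2_sum_def by (rule someI_ex)
  define S where "S = L2_sum P X (Spec W)"
  have Sm: "S \<in> borel_measurable P" and Slim: "((\<lambda>F. \<integral>\<^sup>+\<omega>. ennreal (((\<Sum>i\<in>F. X i \<omega>) - S \<omega>)\<^sup>2) \<partial>P) \<longlongrightarrow> 0) (finite_subsets_at_top (Spec W))"
    using hS unfolding has_L2_sum_def S_def by auto
  define c0 where "c0 = \<beta> * \<sigma>\<^sup>2 + 1 / 2 * D"
  have Ueq: "U_lim W \<beta> \<theta> P Z0 Z = (\<lambda>\<omega>. c0 + 1 * (\<sigma> * Z0 \<omega> + 1 / 2 * S \<omega>))"
    unfolding U_lim_def S_def X_def \<sigma>_def D_def c0_def by (simp add: fun_eq_iff)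
  show "U_lim W \<beta> \<theta> P Z0 Z \<in> borel_measurable P" unfolding Ueq using Z0m Sm by simp
  define F where "F n = spec_pair ` ({..<n} \<inter> {i. lam i \<noteq> 0})" for n
  have FS: "finite (F n)" "F n \<subseteq> Spec W" for n
    using bij_betw_spec_pair unfolding F_def bij_betw_def by auto
  define V where "V n \<omega> = \<sigma> * Z0 \<omega> + 1 / 2 * (\<Sum>p\<in>F n. X p \<omega>)" for n \<omega>
  have Vm: "V n \<in> borel_measurable P" for n
    unfolding V_def using Z0m Xm FS(2)[of n] by (intro borel_measurable_add borel_measurable_times borel_measurable_sum borel_measurable_const) auto
  have lim: "(\<lambda>n. \<integral>\<^sup>+\<omega>. ennreal ((V n \<omega> - (\<sigma> * Z0 \<omega> + 1 / 2 * S \<omega>))\<^sup>2) \<partial>P) \<longlonglongrightarrow> 0"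
  proof (rule tendsto_sandwich[OF _ _ tendsto_const])
    show "(\<lambda>n. \<integral>\<^sup>+\<omega>. ennreal (((\<Sum>i\<in>F n. X i \<omega>) - S \<omega>)\<^sup>2) \<partial>P) \<longlonglongrightarrow> 0"
      using filterlim_compose[OF Slim spec_limit_filter] unfolding F_def .
    have le: "(V n \<omega> - (\<sigma> * Z0 \<omega> + 1 / 2 * S \<omega>))\<^sup>2 \<le> ((\<Sum>i\<in>F n. X i \<omega>) - S \<omega>)\<^sup>2" for n \<omega>
    proof -
      have "V n \<omega> - (\<sigma> * Z0 \<omega> + 1 / 2 * S \<omega>) = 1 / 2 * ((\<Sum>i\<in>F n. X i \<omega>) - S \<omega>)" unfolding V_def by (simp add: algebra_simps)
      then have "(V n \<omega> - (\<sigma> * Z0 \<omega> + 1 / 2 * S \<omega>))\<^sup>2 = 1 / 4 * ((\<Sum>i\<in>F n. X i \<omega>) - S \<omega>)\<^sup>2"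
        by (simp only: power_mult_distrib) (simp add: power2_eq_square)
      then show ?thesis using zero_le_power2[of "(\<Sum>i\<in>F n. X i \<omega>) - S \<omega>"] by linarith
    qed
    show "\<forall>\<^sub>F n in sequentially. (\<integral>\<^sup>+\<omega>. ennreal ((V n \<omega> - (\<sigma> * Z0 \<omega> + 1 / 2 * S \<omega>))\<^sup>2) \<partial>P) \<le> (\<integral>\<^sup>+\<omega>. ennreal (((\<Sum>i\<in>F n. X i \<omega>) - S \<omega>)\<^sup>2) \<partial>P)"
      by (intro always_eventually allI nn_integral_mono ennreal_leI le)
  qed simp
  have conv: "(\<lambda>n. char (distr P borel (\<lambda>\<omega>. c0 + 1 * V n \<omega>)) t) \<longlonglongrightarrow> char (distr P borel (U_lim W \<beta> \<theta> P Z0 Z)) t"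
    unfolding Ueq using Z0m Sm by (intro P.char_L2_limit[OF Vm _ lim]) simp
  have chV: "char (distr P borel (\<lambda>\<omega>. c0 + 1 * V n \<omega>)) t
    = exp (\<i> * of_real (t * c0)) * (exp (of_real (- (\<sigma>\<^sup>2 * t\<^sup>2) / 2)) * exp (\<Sum>j<n. term_log \<beta> t (lam j)))" for n
  proof -
    \<comment> \<open>The Gaussian term and the terms of the partial sum as one independent family.\<close>
    define Q where "Q s \<omega> = (case s of None \<Rightarrow> \<sigma> * Z0 \<omega> | Some p \<Rightarrow> 1 / 2 * (m (fst p) + \<mu> (fst p) * ((Z p \<omega>)\<^sup>2 - 1)))" for s \<omega>
    define g where "g s u = (case s of None \<Rightarrow> \<sigma> * u | Some p \<Rightarrow> 1 / 2 * (m (fst p) + \<mu> (fst p) * (u\<^sup>2 - 1)))" for s :: "(real \<times> nat) option" and u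
    have indQ: "P.indep_vars (\<lambda>_. borel) Q (insert None (Some ` F n))"
    proof -
      have "insert None (Some ` F n) \<subseteq> insert None (Some ` Spec W)" using FS(2) by blast
      note sub = P.indep_vars_subset[OF ind this]
      have "P.indep_vars (\<lambda>_. borel) (\<lambda>s \<omega>. g s ((case s of None \<Rightarrow> Z0 | Some p \<Rightarrow> Z p) \<omega>)) (insert None (Some ` F n))"
        by (rule P.indep_vars_compose2[OF sub]) (auto simp: g_def[abs_def] split: option.split)
      moreover have "(\<lambda>s \<omega>. g s ((case s of None \<Rightarrow> Z0 | Some p \<Rightarrow> Z p) \<omega>)) = Q"
        unfolding g_def Q_def by (auto simp: fun_eq_iff split: option.split)
      ultimately show ?thesis by simp
    qed
    have VQ: "V n = (\<lambda>\<omega>. \<Sum>s\<in>insert None (Some ` F n). Q s \<omega>)"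
    proof
      fix \<omega>
      have "(\<Sum>s\<in>insert None (Some ` F n). Q s \<omega>) = Q None \<omega> + (\<Sum>s\<in>Some ` F n. Q s \<omega>)"
        using FS(1) by (subst sum.insert) auto
      also have "(\<Sum>s\<in>Some ` F n. Q s \<omega>) = (\<Sum>p\<in>F n. Q (Some p) \<omega>)" by (subst sum.reindex) auto
      also have "\<dots> = 1 / 2 * (\<Sum>p\<in>F n. X p \<omega>)"
        unfolding sum_distrib_left
      proof (intro sum.cong refl)
        fix p assume "p \<in> F n"
        then have "p \<in> Spec W" using FS(2) by blast
        then show "Q (Some p) \<omega> = 1 / 2 * X p \<omega>" by (simp add: Q_def Xeq)
      qed
      finally show "V n \<omega> = (\<Sum>s\<in>insert None (Some ` F n). Q s \<omega>)" unfolding V_def by (simp add: Q_def)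
    qed
    have "char (distr P borel (\<lambda>\<omega>. c0 + 1 * V n \<omega>)) t = exp (\<i> * of_real (t * c0)) * char (distr P borel (V n)) t"
      using distr_add_const_char[OF P Vm] by simp
    also have "char (distr P borel (V n)) t = (\<Prod>s\<in>insert None (Some ` F n). char (distr P borel (Q s)) t)"
      unfolding VQ by (rule P.char_distr_sum[OF indQ])
    also have "\<dots> = char (distr P borel (Q None)) t * (\<Prod>p\<in>F n. char (distr P borel (Q (Some p))) t)"
      using FS(1) by (subst prod.insert) (auto simp: prod.reindex)
    also have "char (distr P borel (Q None)) t = exp (of_real (- (\<sigma>\<^sup>2 * t\<^sup>2) / 2))"
      using char_std_normal_scaled[OF P Z0] by (simp add: Q_def[abs_def])
    also have "(\<Prod>p\<in>F n. char (distr P borel (Q (Some p))) t) = (\<Prod>p\<in>F n. exp (term_log \<beta> t (fst p)))"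
    proof (intro prod.cong refl)
      fix p assume "p \<in> F n"
      then have p: "p \<in> Spec W" using FS(2) by blast
      have mm: "(\<lambda>\<omega>. 1 / 2 * (\<mu> (fst p) * ((Z p \<omega>)\<^sup>2 - 1))) \<in> borel_measurable P" using Zm[OF p] by simp
      have "Q (Some p) = (\<lambda>\<omega>. m (fst p) / 2 + 1 / 2 * (\<mu> (fst p) * ((Z p \<omega>)\<^sup>2 - 1)))"
        unfolding Q_def by (simp add: fun_eq_iff distrib_left add_divide_distrib)
      then have "char (distr P borel (Q (Some p))) t = exp (\<i> * of_real (t * (m (fst p) / 2))) * exp (chi_log (t * \<mu> (fst p)))"
        using distr_add_const_char[OF P mm] char_normal_quadratic[OF P Z[OF p]] by simp
      then show "char (distr P borel (Q (Some p))) t = exp (term_log \<beta> t (fst p))"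
        unfolding term_log_def exp_add m_def \<mu>_def by (simp add: mult.commute)
    qed
    also have "\<dots> = (\<Prod>j\<in>{..<n} \<inter> {i. lam i \<noteq> 0}. exp (term_log \<beta> t (lam j)))"
    proof -
      have "inj_on spec_pair ({..<n} \<inter> {i. lam i \<noteq> 0})"
        using bij_betw_imp_inj_on[OF bij_betw_spec_pair] by (rule inj_on_subset) auto
      then show ?thesis unfolding F_def by (subst prod.reindex) (auto simp: spec_pair_def)
    qed
    also have "\<dots> = (\<Prod>j<n. exp (term_log \<beta> t (lam j)))"
      by (rule prod.mono_neutral_left) (auto simp: term_log_def)
    also have "\<dots> = exp (\<Sum>j<n. term_log \<beta> t (lam j))" by (simp add: exp_sum)
    finally show ?thesis .
  qed
  let ?H = "\<Sum>j. of_real ((lam j)\<^sup>2) * rest_fun \<beta> t (lam j)"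
  define b where "b = (graphon_op_norm W + 1 / \<beta>) / 2"
  have nb: "graphon_op_norm W < b" "b < 1 / \<beta>"
  proof -
    have "graphon_op_norm W < 1 / \<beta>" using \<beta> lam_q_pos(1)[OF \<beta>] by (simp add: field_simps)
    then show "graphon_op_norm W < b" "b < 1 / \<beta>" unfolding b_def by auto
  qed
  have rs: "summable (\<lambda>j. of_real ((lam j)\<^sup>2) * rest_fun \<beta> t (lam j))"
  proof -
    have cont: "continuous_on {-b..b} (rest_fun \<beta> t)"
      using \<beta> nb by (intro continuous_rest_fun) (auto simp: field_simps)
    have "bounded (rest_fun \<beta> t ` {-b..b})" by (rule compact_imp_bounded[OF compact_continuous_image[OF cont compact_Icc]])
    then obtain B where B: "\<forall>x\<in>{-b..b}. norm (rest_fun \<beta> t x) \<le> B" unfolding bounded_iff by blast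
    have lb: "lam j \<in> {-b..b}" for j using eigv_le_op_norm[of j] nb by (auto simp: abs_le_iff)
    show ?thesis
    proof (rule summable_comparison_test'[OF summable_mult2[OF lam_sq_summable, of B], of 0])
      show "norm (of_real ((lam j)\<^sup>2) * rest_fun \<beta> t (lam j)) \<le> (lam j)\<^sup>2 * B" for j
        using B lb[of j] by (simp add: norm_mult norm_power mult_left_mono)
    qed
  qed
  have "(\<lambda>n. \<Sum>j<n. term_log \<beta> t (lam j)) \<longlonglongrightarrow> ?H + (\<i> * of_real (t * \<beta> / 2) - of_real (t\<^sup>2 / 4)) * of_real (\<Sum>j. (lam j)\<^sup>2)"
  proof -
    have q0: "1 - \<beta> * lam j \<noteq> 0" for j using q[of j] \<delta> by linarith
    have "(\<lambda>j. of_real ((lam j)\<^sup>2) * rest_fun \<beta> t (lam j)) sums ?H" by (rule summable_sums[OF rs])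
    moreover have "(\<lambda>j. (\<i> * of_real (t * \<beta> / 2) - of_real (t\<^sup>2 / 4)) * of_real ((lam j)\<^sup>2)) sums
      ((\<i> * of_real (t * \<beta> / 2) - of_real (t\<^sup>2 / 4)) * of_real (\<Sum>j. (lam j)\<^sup>2))"
      by (rule sums_mult[OF sums_of_real[OF summable_sums[OF lam_sq_summable]]])
    ultimately have "(\<lambda>j. term_log \<beta> t (lam j)) sums (?H + (\<i> * of_real (t * \<beta> / 2) - of_real (t\<^sup>2 / 4)) * of_real (\<Sum>j. (lam j)\<^sup>2))"
      unfolding term_log_eq[OF q0] by (rule sums_add)
    then show ?thesis unfolding sums_def .
  qed
  then have "(\<lambda>n. exp (\<i> * of_real (t * c0)) * (exp (of_real (- (\<sigma>\<^sup>2 * t\<^sup>2) / 2)) * exp (\<Sum>j<n. term_log \<beta> t (lam j))))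
    \<longlonglongrightarrow> exp (\<i> * of_real (t * c0)) * (exp (of_real (- (\<sigma>\<^sup>2 * t\<^sup>2) / 2)) * exp (?H + (\<i> * of_real (t * \<beta> / 2) - of_real (t\<^sup>2 / 4)) * of_real (\<Sum>j. (lam j)\<^sup>2)))"
    by (intro tendsto_mult_left tendsto_exp)
  from LIMSEQ_unique[OF conv[unfolded chV] this]
  show "char (distr P borel (U_lim W \<beta> \<theta> P Z0 Z)) t =
      exp (\<i> * of_real (t * (\<beta> * \<sigma>\<^sup>2 + 1 / 2 * D)) + of_real (- (\<sigma>\<^sup>2 * t\<^sup>2) / 2)
        + (?H + (\<i> * of_real (t * \<beta> / 2) - of_real (t\<^sup>2 / 4)) * of_real (\<Sum>j. (lam j)\<^sup>2)))"
    unfolding c0_def by (simp only: exp_add mult.assoc)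
qed

end

section \<open>Spectra of concentrated graphs\<close>

text \<open>
  A linear form on a cube is maximal at a vertex.
\<close>

lemma linear_form_signs:
  fixes c x :: "nat \<Rightarrow> real"
  assumes b: "\<And>s. s \<in> signs N \<Longrightarrow> \<bar>\<Sum>i=1..N. c i * s i\<bar> \<le> r" and x: "\<And>i. i \<in> {1..N} \<Longrightarrow> \<bar>x i\<bar> \<le> 1"
  shows "\<bar>\<Sum>i=1..N. c i * x i\<bar> \<le> r"
proof -
  \<comment> \<open>The vertex with the signs of the coefficients.\<close>
  define s where "s = (\<lambda>i\<in>{1..N}. if c i < 0 then - 1 else 1 :: real)"
  have "s \<in> signs N" unfolding signs_def s_def by auto
  from b[OF this] have r: "(\<Sum>i=1..N. c i * s i) \<le> r" by linarith
  have "\<bar>\<Sum>i=1..N. c i * x i\<bar> \<le> (\<Sum>i=1..N. \<bar>c i * x i\<bar>)" by (rule sum_abs)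
  also have "\<dots> \<le> (\<Sum>i=1..N. c i * s i)"
  proof (rule sum_mono)
    fix i assume i: "i \<in> {1..N}"
    have "\<bar>c i * x i\<bar> \<le> \<bar>c i\<bar> * 1" unfolding abs_mult using x[OF i] by (intro mult_left_mono) auto
    also have "\<dots> = c i * s i" using i by (simp add: s_def)
    finally show "\<bar>c i * x i\<bar> \<le> c i * s i" .
  qed
  finally show ?thesis using r by linarith
qed

lemma bilinear_form_signs:
  fixes a :: "nat \<Rightarrow> nat \<Rightarrow> real"
  assumes b: "\<And>s u. s \<in> signs N \<Longrightarrow> u \<in> signs N \<Longrightarrow> \<bar>\<Sum>i=1..N. \<Sum>j=1..N. a i j * (s i * u j)\<bar> \<le> r"
    and x: "\<And>i. i \<in> {1..N} \<Longrightarrow> \<bar>x i\<bar> \<le> 1" and y: "\<And>i. i \<in> {1..N} \<Longrightarrow> \<bar>y i\<bar> \<le> 1"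
  shows "\<bar>\<Sum>i=1..N. \<Sum>j=1..N. a i j * (x i * y j)\<bar> \<le> r"
proof -
  have row: "(\<Sum>i=1..N. \<Sum>j=1..N. a i j * (s i * u j)) = (\<Sum>i=1..N. (\<Sum>j=1..N. a i j * u j) * s i)" for s u :: "nat \<Rightarrow> real"
    by (simp add: sum_distrib_right mult.assoc mult.commute[of "s _"])
  have col: "(\<Sum>i=1..N. \<Sum>j=1..N. a i j * (s i * u j)) = (\<Sum>j=1..N. (\<Sum>i=1..N. a i j * s i) * u j)" for s u :: "nat \<Rightarrow> real"
    by (subst sum.swap) (simp add: sum_distrib_right mult.assoc)
  have "\<bar>\<Sum>i=1..N. \<Sum>j=1..N. a i j * (x i * u j)\<bar> \<le> r" if u: "u \<in> signs N" for u
    unfolding row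
  proof (rule linear_form_signs[OF _ x])
    show "\<bar>\<Sum>i=1..N. (\<Sum>j=1..N. a i j * u j) * s i\<bar> \<le> r" if "s \<in> signs N" for s using b[OF that u] unfolding row .
  qed
  then show ?thesis unfolding col by (rule linear_form_signs[OF _ y])
qed

context kernel_space begin

lemma ip_app_eq_dint: "ip u (app D v) = dint (\<lambda>x y. u x * (D x y * v y))"
  unfolding ip_def app_def dint_def by simp

lemma cut_bounded_add:
  assumes D: "bker D" "cut_bounded D e" and E: "bker E" "cut_bounded E f"
  shows "cut_bounded (\<lambda>x y. D x y + E x y) (e + f)"
  unfolding cut_bounded_def
proof (intro allI impI)
  fix u v assume uv: "bfun u \<and> bfun v \<and> (\<forall>x. \<bar>u x\<bar> \<le> 1) \<and> (\<forall>x. \<bar>v x\<bar> \<le> 1)"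
  have "ip u (app (\<lambda>x y. D x y + E x y) v) = ip u (app D v) + ip u (app E v)"
    unfolding ip_app_eq_dint distrib_left distrib_right
    by (intro dint_add bker_mult bker_fst bker_snd D E) (use uv in auto)
  moreover have "\<bar>ip u (app D v)\<bar> \<le> e" "\<bar>ip u (app E v)\<bar> \<le> f"
    using D(2) E(2) uv unfolding cut_bounded_def by blast+
  ultimately show "\<bar>ip u (app (\<lambda>x y. D x y + E x y) v)\<bar> \<le> e + f" by linarith
qed

lemma cut_bounded_cmult:
  assumes "cut_bounded D e" "0 \<le> c"
  shows "cut_bounded (\<lambda>x y. c * D x y) (c * e)"
  unfolding cut_bounded_def
proof (intro allI impI)
  fix u v assume uv: "bfun u \<and> bfun v \<and> (\<forall>x. \<bar>u x\<bar> \<le> 1) \<and> (\<forall>x. \<bar>v x\<bar> \<le> 1)"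
  have "ip u (app (\<lambda>x y. c * D x y) v) = c * ip u (app D v)"
    unfolding ip_app_eq_dint dint_cmult[symmetric] by (simp add: ac_simps)
  moreover have "\<bar>ip u (app D v)\<bar> \<le> e" using assms(1) uv unfolding cut_bounded_def by blast
  ultimately show "\<bar>ip u (app (\<lambda>x y. c * D x y) v)\<bar> \<le> c * e" using assms(2) by (simp add: abs_mult mult_left_mono)
qed

lemma cut_bounded_L1:
  assumes D: "bker D" "dint (\<lambda>x y. \<bar>D x y\<bar>) \<le> e"
  shows "cut_bounded D e"
  unfolding cut_bounded_def
proof (intro allI impI)
  fix u v assume uv: "bfun u \<and> bfun v \<and> (\<forall>x. \<bar>u x\<bar> \<le> 1) \<and> (\<forall>x. \<bar>v x\<bar> \<le> 1)"
  define P where "P x y = u x * (D x y * v y)" for x y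
  have P: "bker P" unfolding P_def by (intro bker_mult bker_fst bker_snd D) (use uv in auto)
  have le: "\<bar>P x y\<bar> \<le> \<bar>D x y\<bar>" for x y
  proof -
    have "\<bar>P x y\<bar> = \<bar>u x\<bar> * (\<bar>D x y\<bar> * \<bar>v y\<bar>)" by (simp add: P_def abs_mult)
    also have "\<dots> \<le> 1 * (\<bar>D x y\<bar> * 1)" using uv by (intro mult_mono) auto
    finally show ?thesis by simp
  qed
  have "dint P \<le> dint (\<lambda>x y. \<bar>D x y\<bar>)"
    by (intro dint_mono P bker_abs D) (use le in \<open>simp add: abs_le_iff\<close>)
  moreover have "dint (\<lambda>x y. (- 1) * P x y) \<le> dint (\<lambda>x y. \<bar>D x y\<bar>)"
    by (intro dint_mono bker_cmult P bker_abs D) (use le in \<open>simp add: abs_le_iff\<close>)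
  ultimately have "\<bar>dint P\<bar> \<le> e" using D(2) unfolding dint_cmult by linarith
  then show "\<bar>ip u (app D v)\<bar> \<le> e" unfolding ip_app_eq_dint P_def .
qed

lemma cut_bounded_dint:
  assumes "cut_bounded D e"
  shows "\<bar>dint D\<bar> \<le> e"
proof -
  have "\<bar>ip (\<lambda>_. 1) (app D (\<lambda>_. 1))\<bar> \<le> e" by (rule assms[unfolded cut_bounded_def, rule_format]) simp
  then show ?thesis unfolding ip_app_eq_dint by simp
qed

end

lemma integral_idx_mult:
  assumes N: "N \<ge> 1" and u: "U.bfun u"
  shows "(\<integral>x. u x * g (idx N x) \<partial>U) = (\<Sum>i=1..N. g i * (\<integral>x. of_bool (idx N x = i) * u x \<partial>U))"
proof -
  have "(\<integral>x. u x * g (idx N x) \<partial>U) = (\<integral>x. (\<Sum>i=1..N. g i * (of_bool (idx N x = i) * u x)) \<partial>U)"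
  proof (rule Bochner_Integration.integral_cong)
    fix x
    have "(\<Sum>i=1..N. g i * (of_bool (idx N x = i) * u x)) = (\<Sum>i=1..N. if i = idx N x then g i * u x else 0)"
      by (intro sum.cong) auto
    also have "\<dots> = u x * g (idx N x)" using idx_range[OF N, of x] by simp
    finally show "u x * g (idx N x) = (\<Sum>i=1..N. g i * (of_bool (idx N x = i) * u x))" ..
  qed simp
  also have "\<dots> = (\<Sum>i=1..N. g i * (\<integral>x. of_bool (idx N x = i) * u x \<partial>U))"
    by (subst Bochner_Integration.integral_sum)
      (auto intro!: U.bfun_integrable U.bfun_mult u bfun_idx[OF N, of "\<lambda>k. of_bool (k = _)"])
  finally show ?thesis .
qed

lemma integral_cell_le:
  assumes N: "N \<ge> 1" and u: "U.bfun u" "\<And>x. \<bar>u x\<bar> \<le> 1" and i: "i \<in> {1..N}"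
  shows "\<bar>real N * (\<integral>x. of_bool (idx N x = i) * u x \<partial>U)\<bar> \<le> 1"
proof -
  have b: "U.bfun (\<lambda>x. of_bool (idx N x = i))" using bfun_idx[OF N, of "\<lambda>k. of_bool (k = i)"] .
  have "\<bar>\<integral>x. of_bool (idx N x = i) * u x \<partial>U\<bar> \<le> (\<integral>x. \<bar>of_bool (idx N x = i) * u x\<bar> \<partial>U)"
    by (rule integral_abs_bound)
  also have "\<dots> \<le> (\<integral>x. of_bool (idx N x = i) \<partial>U)"
    by (intro integral_mono U.bfun_integrable U.bfun_abs U.bfun_mult b u(1)) (use u(2) in \<open>auto simp: abs_mult\<close>)
  also have "\<dots> = 1 / real N"
    using i by (subst integral_idx[OF N, of "\<lambda>k. of_bool (k = i)"]) (simp add: of_bool_def)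
  finally show ?thesis using N by (simp add: abs_mult field_simps)
qed

text \<open>
  The bilinear form of a step kernel depends on the test functions through their cell averages only, and these are
  vectors in the cube \<open>[-1, 1]\<^sup>N\<close>.
\<close>

lemma cut_bounded_step:
  assumes N: "N \<ge> 1"
    and b: "\<And>s u. s \<in> signs N \<Longrightarrow> u \<in> signs N \<Longrightarrow> \<bar>\<Sum>i=1..N. \<Sum>j=1..N. a i j * (s i * u j)\<bar> \<le> r * (real N)\<^sup>2"
  shows "U.cut_bounded (step_kernel N a) r"
  unfolding U.cut_bounded_def
proof (intro allI impI)
  fix u v assume uv: "U.bfun u \<and> U.bfun v \<and> (\<forall>x. \<bar>u x\<bar> \<le> 1) \<and> (\<forall>x. \<bar>v x\<bar> \<le> 1)"
  define c where "c w i = (\<integral>x. of_bool (idx N x = i) * w x \<partial>U)" for w :: "real \<Rightarrow> real" and i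
  have "U.app (step_kernel N a) v x = (\<Sum>j=1..N. a (idx N x) j * c v j)" for x
    unfolding U.app_def step_kernel_def c_def using integral_idx_mult[OF N, of v "a (idx N x)"] uv by (simp add: mult.commute)
  then have "U.ip u (U.app (step_kernel N a) v) = (\<Sum>i=1..N. (\<Sum>j=1..N. a i j * c v j) * c u i)"
    unfolding U.ip_def using integral_idx_mult[OF N, of u "\<lambda>i. \<Sum>j=1..N. a i j * c v j"] uv by (simp add: c_def)
  then have "(real N)\<^sup>2 * U.ip u (U.app (step_kernel N a) v) = (\<Sum>i=1..N. \<Sum>j=1..N. (real N)\<^sup>2 * (a i j * c v j * c u i))"
    by (simp only: sum_distrib_left sum_distrib_right)
  also have "\<dots> = (\<Sum>i=1..N. \<Sum>j=1..N. a i j * ((real N * c u i) * (real N * c v j)))"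
    by (intro sum.cong refl) (simp add: power2_eq_square)
  finally have "(real N)\<^sup>2 * U.ip u (U.app (step_kernel N a) v) = (\<Sum>i=1..N. \<Sum>j=1..N. a i j * ((real N * c u i) * (real N * c v j)))" .
  moreover have "\<bar>\<Sum>i=1..N. \<Sum>j=1..N. a i j * ((real N * c u i) * (real N * c v j))\<bar> \<le> r * (real N)\<^sup>2"
  proof (rule bilinear_form_signs[of N a, OF b])
    show "\<bar>real N * c u i\<bar> \<le> 1" "\<bar>real N * c v i\<bar> \<le> 1" if "i \<in> {1..N}" for i
      unfolding c_def using uv by (auto intro!: integral_cell_le[OF N _ _ that])
  qed
  ultimately have "\<bar>(real N)\<^sup>2 * U.ip u (U.app (step_kernel N a) v)\<bar> \<le> r * (real N)\<^sup>2" by simp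
  then have "(real N)\<^sup>2 * \<bar>U.ip u (U.app (step_kernel N a) v)\<bar> \<le> (real N)\<^sup>2 * r"
    by (simp only: abs_mult abs_power2 mult.commute)
  then show "\<bar>U.ip u (U.app (step_kernel N a) v)\<bar> \<le> r" using N by simp
qed

text \<open>
  A single outcome \<open>\<omega>\<close> outside the exceptional null set: all statements about it are deterministic.
\<close>

locale concentrated_graphs = graphon_version W V for W V +
  fixes A :: "nat \<Rightarrow> nat \<Rightarrow> nat \<Rightarrow> 'w \<Rightarrow> bool" and \<omega> :: 'w and \<theta>N :: "nat \<Rightarrow> real" and \<theta> :: real
  assumes R: "riemann_integrable (\<lambda>(x, y). W x y) (0, 0) (1, 1)"
    and RD: "riemann_integrable (\<lambda>x. W x x) 0 1"
    and \<theta>N: "\<And>N. N \<ge> 1 \<Longrightarrow> 0 < \<theta>N N" and lim: "\<theta>N \<longlonglongrightarrow> \<theta>" and \<theta>: "0 < \<theta>" "\<theta> \<le> 1"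
    and sym: "\<And>N i j. N \<ge> 1 \<Longrightarrow> i \<in> {1..N} \<Longrightarrow> j \<in> {1..N} \<Longrightarrow> A N i j \<omega> = A N j i \<omega>"
    and conc: "\<And>\<delta>. 0 < \<delta> \<Longrightarrow> \<forall>\<^sub>F N in sequentially.
     (\<forall>s\<in>signs N. \<forall>u\<in>signs N. \<bar>\<Sum>i=1..N. \<Sum>j=1..N. centred N (\<theta>N N) W (A N) \<omega> i j * (s i * u j)\<bar> < \<delta> * (real N)\<^sup>2) \<and>
     \<bar>\<Sum>i=1..N. centred N (\<theta>N N) W (A N) \<omega> i i\<bar> < \<delta> * real N"
begin

definition K :: "nat \<Rightarrow> real \<Rightarrow> real \<Rightarrow> real" where
  "K N = step_kernel N (\<lambda>i j. of_bool (A N i j \<omega>) / \<theta>N N)"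

definition L :: "nat \<Rightarrow> nat \<Rightarrow> real" where
  "L N i = eigval ((1 / (real N * \<theta>N N)) \<cdot>\<^sub>m adjacency_mat N (A N) \<omega>) i"

lemma bker_K: "N \<ge> 1 \<Longrightarrow> U.bker (K N)" unfolding K_def by (rule bker_step)

lemma ksym_K: assumes "N \<ge> 1" shows "U.ksym (K N)"
  unfolding U.ksym_def K_def step_kernel_def using sym[OF assms idx_range[OF assms] idx_range[OF assms]] by simp

lemma eventually_good: "\<forall>\<^sub>F N in sequentially. 1 \<le> N \<and> \<theta> / 2 < \<theta>N N"
  using \<theta> by (intro eventually_conj eventually_ge_at_top order_tendstoD(1)[OF lim]) auto

text \<open>
  The difference consists of the centred adjacency matrix, divided by \<open>\<theta>N N\<close>, and of the discretisation error of \<open>W\<close>.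
\<close>

lemma eventually_cut_bounded:
  assumes e: "0 < e"
  shows "\<forall>\<^sub>F N in sequentially. U.cut_bounded (\<lambda>x y. K N x y - V x y) e"
proof -
  have "0 < e * \<theta> / 4" "0 < e / 2" using e \<theta> by auto
  have L1: "\<forall>\<^sub>F N in sequentially. U.dint (\<lambda>x y. \<bar>step_kernel N (\<lambda>i j. W (real i / real N) (real j / real N)) x y - V x y\<bar>) < e / 2"
    by (rule step_kernel_L1[OF R _ bV ae \<open>0 < e / 2\<close>]) (use gr in \<open>simp add: graphon_def\<close>)
  show ?thesis
    using conc[OF \<open>0 < e * \<theta> / 4\<close>] L1 eventually_good
  proof eventually_elim
    case (elim N)
    then have N: "N \<ge> 1" and t: "\<theta> / 2 < \<theta>N N" "0 < \<theta>N N" using \<theta>N by auto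
    let ?w = "step_kernel N (\<lambda>i j. W (real i / real N) (real j / real N))"
    have c: "U.cut_bounded (step_kernel N (centred N (\<theta>N N) W (A N) \<omega>)) (e * \<theta> / 4)"
      by (rule cut_bounded_step[OF N]) (use elim(1) in \<open>auto intro: less_imp_le\<close>)
    have "U.cut_bounded (\<lambda>x y. (1 / \<theta>N N) * step_kernel N (centred N (\<theta>N N) W (A N) \<omega>) x y + (?w x y - V x y))
      ((1 / \<theta>N N) * (e * \<theta> / 4) + e / 2)"
      by (intro U.cut_bounded_add U.cut_bounded_cmult U.cut_bounded_L1 U.bker_cmult U.bker_diff bker_step N bV c)
        (use elim(2) t in auto)
    moreover have "(\<lambda>x y. (1 / \<theta>N N) * step_kernel N (centred N (\<theta>N N) W (A N) \<omega>) x y + (?w x y - V x y)) = (\<lambda>x y. K N x y - V x y)"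
      using t unfolding K_def step_kernel_def centred_def by (simp add: fun_eq_iff diff_divide_distrib)
    moreover have "(1 / \<theta>N N) * (e * \<theta> / 4) + e / 2 \<le> e" using t e by (simp add: field_simps)
    ultimately have "U.cut_bounded (\<lambda>x y. K N x y - V x y) ((1 / \<theta>N N) * (e * \<theta> / 4) + e / 2)"
      "(1 / \<theta>N N) * (e * \<theta> / 4) + e / 2 \<le> e" by (simp_all only:)
    then show ?case unfolding U.cut_bounded_def by (meson order_trans)
  qed
qed

lemma dint_K_tendsto: "(\<lambda>N. U.dint (K N)) \<longlonglongrightarrow> U.dint V"
proof (rule LIMSEQ_I, rule eventually_sequentially[THEN iffD1, simplified])
  fix r :: real assume "0 < r"
  then have "0 < r / 2" by simp
  show "\<forall>\<^sub>F N in sequentially. norm (U.dint (K N) - U.dint V) < r"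
    using eventually_cut_bounded[OF \<open>0 < r / 2\<close>] eventually_good
  proof eventually_elim
    case (elim N)
    have "\<bar>U.dint (\<lambda>x y. K N x y - V x y)\<bar> \<le> r / 2" by (rule U.cut_bounded_dint[OF elim(1)])
    then show ?case using \<open>0 < r\<close> elim(2) by (simp add: U.dint_diff[OF bker_K bV])
  qed
qed

lemma eigval_power_sum_K: assumes N: "N \<ge> 1" shows "(\<Sum>i=1..N. L N i ^ Suc m) = U.ktr (U.kpow (K N) m)"
proof -
  let ?B = "(1 / (real N * \<theta>N N)) \<cdot>\<^sub>m adjacency_mat N (A N) \<omega>"
  have ent: "?B $$ (i, j) = 1 / (real N * \<theta>N N) * of_bool (A N (Suc i) (Suc j) \<omega>)" if "i < N" "j < N" for i j
    using that by (simp add: adjacency_mat_def)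
  have "(\<Sum>i=1..N. eigval ?B i ^ Suc m) = U.ktr (U.kpow (step_kernel N (\<lambda>i j. real N * ?B $$ (i - 1, j - 1))) m)"
  proof (rule eigval_power_sum[OF N])
    show "?B \<in> carrier_mat N N" by (simp add: adjacency_mat_def)
    show "?B $$ (i, j) = ?B $$ (j, i)" if "i < N" "j < N" for i j
      using that sym[OF N, of "Suc i" "Suc j"] by (simp add: ent)
  qed
  moreover have "step_kernel N (\<lambda>i j. real N * ?B $$ (i - 1, j - 1)) = K N"
  proof (intro ext)
    fix x y
    have "idx N x - 1 < N" "idx N y - 1 < N" "Suc (idx N x - 1) = idx N x" "Suc (idx N y - 1) = idx N y"
      using idx_range[OF N, of x] idx_range[OF N, of y] by auto
    then show "step_kernel N (\<lambda>i j. real N * ?B $$ (i - 1, j - 1)) x y = K N x y"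
      unfolding step_kernel_def K_def using N by (simp only: ent) simp
  qed
  ultimately show ?thesis unfolding L_def by simp
qed

text \<open>
  The sequence is shifted because the bound \<open>2 / \<theta>\<close> for the kernels holds for large \<open>N\<close> only.
\<close>

lemma power_sum_tendsto:
  assumes m: "m \<ge> 3"
  shows "(\<lambda>N. \<Sum>i=1..N. L N i ^ m) \<longlonglongrightarrow> (\<Sum>j. lam j ^ m)"
proof -
  obtain k where k: "m = Suc k" "2 \<le> k" using m by (cases m) auto
  obtain N0 where N0: "\<And>N. N \<ge> N0 \<Longrightarrow> 1 \<le> N \<and> \<theta> / 2 < \<theta>N N"
    using eventually_good unfolding eventually_sequentially by blast
  have g: "1 \<le> n + N0" "\<theta> / 2 < \<theta>N (n + N0)" for n using N0[of "n + N0"] by auto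
  have "(\<lambda>n. U.ktr (U.kpow (K (n + N0)) k)) \<longlonglongrightarrow> U.ktr (U.kpow V k)"
  proof (rule U.ktr_kpow_tendsto[where C="2 / \<theta>", OF bker_K[OF g(1)] ksym_K[OF g(1)] _ bV _ _ k(2)])
    show "\<bar>K (n + N0) x y\<bar> \<le> 2 / \<theta>" for n x y
    proof -
      have "\<bar>K (n + N0) x y\<bar> \<le> 1 / \<theta>N (n + N0)"
        unfolding K_def step_kernel_def using \<theta>N[OF g(1)[of n]] by (simp add: divide_right_mono)
      also have "\<dots> \<le> 2 / \<theta>" using g(2)[of n] \<theta> by (simp add: field_simps)
      finally show ?thesis .
    qed
    have "1 \<le> 2 / \<theta>" using \<theta> by simp
    then show "\<bar>V x y\<bar> \<le> 2 / \<theta>" for x y using V_abs[of x y] by linarith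
    show "\<forall>\<^sub>F n in sequentially. U.cut_bounded (\<lambda>x y. K (n + N0) x y - V x y) e" if "0 < e" for e
      using eventually_cut_bounded[OF that] by (rule eventually_compose_filterlim) (rule filterlim_add_const_nat_at_top)
  qed
  then have "(\<lambda>n. \<Sum>i=1..n + N0. L (n + N0) i ^ m) \<longlonglongrightarrow> U.ktr (U.kpow V k)"
    unfolding k(1) eigval_power_sum_K[OF g(1)] .
  then have "(\<lambda>N. \<Sum>i=1..N. L N i ^ m) \<longlonglongrightarrow> U.ktr (U.kpow V k)" by (rule LIMSEQ_offset)
  moreover have "U.ktr (U.kpow V k) = (\<Sum>j. lam j ^ m)"
    unfolding k(1) using U.eigv_power_sums[OF bV sV k(2)] by (simp add: sums_iff)
  ultimately show ?thesis by simp
qed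

lemma dint_K: assumes "N \<ge> 1" shows "U.dint (K N) = (\<Sum>i=1..N. \<Sum>j=1..N. of_bool (A N i j \<omega>)) / ((real N)\<^sup>2 * \<theta>N N)"
  unfolding K_def dint_step[OF assms] by (simp add: sum_divide_distrib[symmetric] mult.commute)

text \<open>
  Entries \<open>0\<close> and \<open>1\<close> are equal to their squares, so the sum of the squared eigenvalues is a normalised edge count.
\<close>

lemma square_sum_K: assumes N: "N \<ge> 1" shows "(\<Sum>i=1..N. (L N i)\<^sup>2) = U.dint (K N) / \<theta>N N"
proof -
  have "(\<Sum>i=1..N. (L N i)\<^sup>2) = U.ktr (U.kpow (K N) 1)"
    using eigval_power_sum_K[OF N, of 1] by (simp add: numeral_2_eq_2)
  also have "\<dots> = U.hs (K N) (K N)" using U.hs_eq_ktr[OF ksym_K[OF N], of "K N"] by simp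
  also have "\<dots> = U.dint (\<lambda>x y. (1 / \<theta>N N) * K N x y)"
    unfolding U.hs_def K_def step_kernel_def by (rule arg_cong[where f=U.dint]) (auto simp: fun_eq_iff)
  finally show ?thesis unfolding U.dint_cmult by simp
qed

lemma square_sum_tendsto: "(\<lambda>N. \<Sum>i=1..N. (L N i)\<^sup>2) \<longlonglongrightarrow> U.dint V / \<theta>"
proof (rule Lim_transform_eventually)
  show "(\<lambda>N. U.dint (K N) / \<theta>N N) \<longlonglongrightarrow> U.dint V / \<theta>"
    using \<theta> by (intro tendsto_divide dint_K_tendsto lim) auto
  show "\<forall>\<^sub>F N in sequentially. U.dint (K N) / \<theta>N N = (\<Sum>i=1..N. (L N i)\<^sup>2)"
    using eventually_good by eventually_elim (rule square_sum_K[symmetric], simp)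
qed

lemma spectral_limit:
  assumes "graphon_op_norm W < b"
  shows "spectral_limit L lam b (U.dint V / \<theta>)"
  using assms eigv_le_op_norm
  by (intro spectral_limit.intro power_sum_tendsto square_sum_tendsto lam_sq_summable) blast+

lemma diagonal_tendsto:
  "(\<lambda>N. (\<Sum>i=1..N. of_bool (A N i i \<omega>)) / (real N * \<theta>N N)) \<longlonglongrightarrow> (LINT x|lebesgue_on {0..1}. W x x)"
proof -
  obtain I where I: "(\<lambda>N. (\<Sum>i=1..N. W (real i / real N) (real i / real N)) / real N) \<longlonglongrightarrow> I"
    and hI: "((\<lambda>x. W x x) has_integral I) {0..1}"
    using riemann_sum_tendsto[OF RD] by blast
  have "integrable (lebesgue_on {0..1}) (\<lambda>x. W x x)"
  proof -
    have "(\<lambda>x. W x x) absolutely_integrable_on {0..1}"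
      using hI gr by (intro nonnegative_absolutely_integrable_1) (auto simp: graphon_def integrable_on_def)
    then show ?thesis by (simp add: integrable_restrict_space set_integrable_def)
  qed
  then have "((\<lambda>x. W x x) has_integral (LINT x|lebesgue_on {0..1}. W x x)) {0..1}"
    by (rule has_integral_integral_lebesgue_on) simp
  then have Ieq: "I = (LINT x|lebesgue_on {0..1}. W x x)" using hI has_integral_unique by blast
  have c: "(\<lambda>N. (\<Sum>i=1..N. centred N (\<theta>N N) W (A N) \<omega> i i) / real N) \<longlonglongrightarrow> 0"
  proof (rule LIMSEQ_I, rule eventually_sequentially[THEN iffD1, simplified])
    fix r :: real assume "0 < r"
    show "\<forall>\<^sub>F N in sequentially. norm ((\<Sum>i=1..N. centred N (\<theta>N N) W (A N) \<omega> i i) / real N - 0) < r"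
      using conc[OF \<open>0 < r\<close>] eventually_good by eventually_elim (auto simp: field_simps)
  qed
  have "(\<lambda>N. (\<Sum>i=1..N. centred N (\<theta>N N) W (A N) \<omega> i i) / real N / \<theta>N N + (\<Sum>i=1..N. W (real i / real N) (real i / real N)) / real N) \<longlonglongrightarrow> 0 / \<theta> + I"
    using \<theta> by (intro tendsto_add tendsto_divide c I lim) auto
  then have "(\<lambda>N. (\<Sum>i=1..N. centred N (\<theta>N N) W (A N) \<omega> i i) / real N / \<theta>N N + (\<Sum>i=1..N. W (real i / real N) (real i / real N)) / real N) \<longlonglongrightarrow> I"
    by simp
  then show ?thesis unfolding Ieq
  proof (rule Lim_transform_eventually)
    show "\<forall>\<^sub>F N in sequentially. (\<Sum>i=1..N. centred N (\<theta>N N) W (A N) \<omega> i i) / real N / \<theta>N N + (\<Sum>i=1..N. W (real i / real N) (real i / real N)) / real N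
      = (\<Sum>i=1..N. of_bool (A N i i \<omega>)) / (real N * \<theta>N N)"
      using eventually_good
    proof eventually_elim
      case (elim N)
      then show ?case using \<theta>N[of N]
        unfolding centred_def sum_subtractf sum_distrib_left[symmetric] by (simp add: field_simps)
    qed
  qed
qed

text \<open>
  At most \<open>N\<close> loops are removed from a sum that is normalised by \<open>N\<^sup>2\<close>.
\<close>

lemma off_diagonal_tendsto:
  "(\<lambda>N. (\<Sum>(i, j)\<in>{(i, j). i \<in> {1..N} \<and> j \<in> {1..N} \<and> i \<noteq> j}. of_bool (A N i j \<omega>)) / ((real N)\<^sup>2 * (\<theta>N N)\<^sup>2)) \<longlonglongrightarrow> U.dint V / \<theta>"
proof -
  let ?d = "\<lambda>N. (\<Sum>i=1..N. of_bool (A N i i \<omega>)) / (real N * \<theta>N N)"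
  have "(\<lambda>N. U.dint (K N) / \<theta>N N - ?d N * (inverse (real N) / \<theta>N N)) \<longlonglongrightarrow> U.dint V / \<theta> - (LINT x|lebesgue_on {0..1}. W x x) * (0 / \<theta>)"
    using \<theta> by (intro tendsto_diff tendsto_mult tendsto_divide dint_K_tendsto diagonal_tendsto lim lim_inverse_n) auto
  then have "(\<lambda>N. U.dint (K N) / \<theta>N N - ?d N * (inverse (real N) / \<theta>N N)) \<longlonglongrightarrow> U.dint V / \<theta>" by simp
  then show ?thesis
  proof (rule Lim_transform_eventually)
    show "\<forall>\<^sub>F N in sequentially. U.dint (K N) / \<theta>N N - ?d N * (inverse (real N) / \<theta>N N)
      = (\<Sum>(i, j)\<in>{(i, j). i \<in> {1..N} \<and> j \<in> {1..N} \<and> i \<noteq> j}. of_bool (A N i j \<omega>)) / ((real N)\<^sup>2 * (\<theta>N N)\<^sup>2)"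
      using eventually_good
    proof eventually_elim
      case (elim N)
      let ?O = "{(i, j). i \<in> {1..N} \<and> j \<in> {1..N} \<and> i \<noteq> j}" and ?D = "(\<lambda>i. (i, i)) ` {1..N}"
      let ?f = "\<lambda>(i, j). of_bool (A N i j \<omega>) :: real"
      have "(\<Sum>i=1..N. \<Sum>j=1..N. ?f (i, j)) = sum ?f ({1..N} \<times> {1..N})"
        unfolding sum.cartesian_product by (rule sum.cong) auto
      also have "{1..N} \<times> {1..N} = ?O \<union> ?D" by auto
      also have "sum ?f (?O \<union> ?D) = sum ?f ?O + sum ?f ?D"
        by (rule sum.union_disjoint) (auto intro: finite_subset[of _ "{1..N} \<times> {1..N}"])
      also have "sum ?f ?D = (\<Sum>i=1..N. of_bool (A N i i \<omega>))" by (subst sum.reindex) (auto simp: inj_on_def)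
      finally have "(\<Sum>i=1..N. \<Sum>j=1..N. of_bool (A N i j \<omega>) :: real) = sum ?f ?O + (\<Sum>i=1..N. of_bool (A N i i \<omega>))" by (simp only: prod.case)
      then have "sum ?f ?O = (\<Sum>i=1..N. \<Sum>j=1..N. of_bool (A N i j \<omega>)) - (\<Sum>i=1..N. of_bool (A N i i \<omega>))" by linarith
      then show ?case unfolding dint_K[OF conjunct1[OF elim]]
        by (simp only: diff_divide_distrib) (simp add: power2_eq_square field_simps)
    qed
  qed
qed

end

section \<open>Convergence of the conditional laws\<close>

context concentrated_graphs begin

text \<open>
  The number \<open>b\<close> lies strictly between the operator norm and \<open>1 / \<beta>\<close>. Eventually all eigenvalues are bounded by \<open>b\<close>, so
  the denominators \<open>1 - \<beta> l\<close> stay away from \<open>0\<close> and the spectral sums converge.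
\<close>

lemma U_fixed_char_tendsto:
  assumes \<beta>: "0 < \<beta>" "\<beta> < 1 / graphon_op_norm W"
  shows "(\<lambda>N. exp (\<i> * of_real (t * U_fixed \<beta> N (\<theta>N N) (adjacency_mat N (A N) \<omega>)))
      * (\<Prod>i=1..N. exp (chi_log (t * coef \<beta> N (\<theta>N N) (adjacency_mat N (A N) \<omega>) i))))
    \<longlonglongrightarrow> exp (\<i> * of_real (t * (\<beta> / 2 * (U.dint V / \<theta>) + 1 / 2 * (LINT x|lebesgue_on {0..1}. W x x)))
      + (\<Sum>j. of_real ((lam j)\<^sup>2) * rest_fun \<beta> t (lam j)) - of_real (t\<^sup>2 / 4) * of_real (U.dint V / \<theta>))"
proof -
  define b where "b = (graphon_op_norm W + 1 / \<beta>) / 2"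
  have n: "0 < graphon_op_norm W" by (rule lam_q_pos(1)[OF \<beta>])
  have b: "graphon_op_norm W < b" "b * \<beta> < 1"
    unfolding b_def using \<beta> n by (auto simp: field_simps)
  interpret spectral_limit L lam b "U.dint V / \<theta>" by (rule spectral_limit[OF b(1)])
  define offd where "offd N = (\<Sum>(i, j)\<in>{(i, j). i \<in> {1..N} \<and> j \<in> {1..N} \<and> i \<noteq> j}. of_bool (A N i j \<omega>) :: real) / ((real N)\<^sup>2 * (\<theta>N N)\<^sup>2)" for N
  define diag where "diag N = (\<Sum>i=1..N. of_bool (A N i i \<omega>) :: real) / (real N * \<theta>N N)" for N
  have cont: "continuous_on {-b..b} (rest_fun \<beta> t)" by (rule continuous_rest_fun[OF \<beta>(1) b(2)])
  have "(\<lambda>N. exp (\<i> * of_real (t * (\<beta> / 2 * offd N + 1 / 2 * diag N))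
      + (\<Sum>i=1..N. of_real ((L N i)\<^sup>2) * rest_fun \<beta> t (L N i)) - of_real (t\<^sup>2 / 4) * of_real (\<Sum>i=1..N. (L N i)\<^sup>2)))
    \<longlonglongrightarrow> exp (\<i> * of_real (t * (\<beta> / 2 * (U.dint V / \<theta>) + 1 / 2 * (LINT x|lebesgue_on {0..1}. W x x)))
      + (\<Sum>j. of_real ((lam j)\<^sup>2) * rest_fun \<beta> t (lam j)) - of_real (t\<^sup>2 / 4) * of_real (U.dint V / \<theta>))"
    by (intro tendsto_intros complex_spectral_sum[OF cont rest_fun_0] sq_lim
        off_diagonal_tendsto[folded offd_def] diagonal_tendsto[folded diag_def])
  then show ?thesis
  proof (rule Lim_transform_eventually)
    show "\<forall>\<^sub>F N in sequentially. exp (\<i> * of_real (t * (\<beta> / 2 * offd N + 1 / 2 * diag N))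
      + (\<Sum>i=1..N. of_real ((L N i)\<^sup>2) * rest_fun \<beta> t (L N i)) - of_real (t\<^sup>2 / 4) * of_real (\<Sum>i=1..N. (L N i)\<^sup>2))
      = exp (\<i> * of_real (t * U_fixed \<beta> N (\<theta>N N) (adjacency_mat N (A N) \<omega>)))
      * (\<Prod>i=1..N. exp (chi_log (t * coef \<beta> N (\<theta>N N) (adjacency_mat N (A N) \<omega>) i)))"
      using eventually_bounded eventually_good
    proof eventually_elim
      case (elim N)
      then have N: "N \<ge> 1" by simp
      let ?a = "adjacency_mat N (A N) \<omega>"
      have q: "1 - \<beta> * L N i \<noteq> 0" if "i \<in> {1..N}" for i
      proof -
        have "\<bar>L N i\<bar> \<le> b" using elim(1) that by blast
        then have "\<beta> * L N i \<le> \<beta> * b" using \<beta>(1) by (intro mult_left_mono) auto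
        then show ?thesis using b(2) by (simp add: mult.commute)
      qed
      have ent: "?a $$ (i - 1, j - 1) = of_bool (A N i j \<omega>)" if "i \<in> {1..N}" "j \<in> {1..N}" for i j
      proof -
        have "i - 1 < N" "j - 1 < N" "Suc (i - 1) = i" "Suc (j - 1) = j" using that by auto
        then show ?thesis unfolding adjacency_mat_def by (simp only: index_mat prod.case)
      qed
      have "U_fixed \<beta> N (\<theta>N N) ?a = \<beta> / 2 * offd N + 1 / 2 * diag N + (\<Sum>i=1..N. \<beta>\<^sup>2 / 2 * (L N i ^ 3 / (1 - \<beta> * L N i)))"
      proof -
        define SO where "SO = (\<Sum>(i, j)\<in>{(i, j). i \<in> {1..N} \<and> j \<in> {1..N} \<and> i \<noteq> j}. of_bool (A N i j \<omega>) :: real)"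
        define SD where "SD = (\<Sum>i=1..N. of_bool (A N i i \<omega>) :: real)"
        have "(\<Sum>(i, j)\<in>{(i, j). i \<in> {1..N} \<and> j \<in> {1..N} \<and> i \<noteq> j}. ?a $$ (i - 1, j - 1)) = SO"
          unfolding SO_def by (intro sum.cong refl) (use ent in \<open>auto simp del: One_nat_def\<close>)
        moreover have "(\<Sum>i=1..N. ?a $$ (i - 1, i - 1)) = SD" unfolding SD_def by (intro sum.cong refl ent)
        ultimately show ?thesis
          unfolding U_fixed_def L_def[symmetric] sum_distrib_left[symmetric] offd_def diag_def SO_def[symmetric] SD_def[symmetric]
          by (simp add: mult.assoc)
      qed
      then have "\<i> * of_real (t * U_fixed \<beta> N (\<theta>N N) ?a) = \<i> * of_real (t * (\<beta> / 2 * offd N + 1 / 2 * diag N))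
        + (\<Sum>i=1..N. \<i> * of_real (t * (\<beta>\<^sup>2 / 2 * (L N i ^ 3 / (1 - \<beta> * L N i)))))"
        by (simp only: distrib_left of_real_add of_real_sum sum_distrib_left)
      moreover have "(\<Prod>i=1..N. exp (chi_log (t * coef \<beta> N (\<theta>N N) ?a i))) = exp (\<Sum>i=1..N. chi_log (t * (L N i / (1 - \<beta> * L N i))))"
        unfolding coef_def L_def[symmetric] by (rule exp_sum[symmetric]) simp
      moreover have "(\<Sum>i=1..N. \<i> * of_real (t * (\<beta>\<^sup>2 / 2 * (L N i ^ 3 / (1 - \<beta> * L N i))))) + (\<Sum>i=1..N. chi_log (t * (L N i / (1 - \<beta> * L N i))))
        = (\<Sum>i=1..N. of_real ((L N i)\<^sup>2) * rest_fun \<beta> t (L N i)) - of_real (t\<^sup>2 / 4) * of_real (\<Sum>i=1..N. (L N i)\<^sup>2)"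
        unfolding sum.distrib[symmetric] of_real_sum sum_distrib_left sum_subtractf[symmetric]
      proof (rule sum.cong[OF refl])
        fix i assume i: "i \<in> {1..N}"
        show "\<i> * of_real (t * (\<beta>\<^sup>2 / 2 * (L N i ^ 3 / (1 - \<beta> * L N i)))) + chi_log (t * (L N i / (1 - \<beta> * L N i)))
          = of_real ((L N i)\<^sup>2) * rest_fun \<beta> t (L N i) - of_real (t\<^sup>2 / 4) * of_real ((L N i)\<^sup>2)"
          unfolding rest_fun_eq[OF q[OF i]] of_real_mult[symmetric] by simp
      qed
      ultimately show ?case by (simp only: exp_add[symmetric] add.assoc add_diff_eq[symmetric])
    qed
  qed
qed

end

lemma (in graphon_version) sigma_W_sq:
  assumes \<theta>: "0 < \<theta>" "\<theta> \<le> 1"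
  shows "(sigma_W W \<theta>)\<^sup>2 = (U.dint V - \<theta> * U.hs V V) / (2 * \<theta>)"
proof -
  define K where "K x y = V x y * (1 - \<theta> * V x y)" for x y
  have bK: "U.bker K" unfolding K_def by (intro U.bker_mult U.bker_diff bV U.bker_const)
  have m: "case_prod K \<in> borel_measurable borel"
    using bK unfolding U.bker_def measurable_UU by simp
  have "AE p in U \<Otimes>\<^sub>M U. (\<lambda>(x, y). W x y * (1 - \<theta> * W x y)) p = case_prod K p"
    using ae by eventually_elim (simp add: K_def split_beta)
  from integral_lebesgue_on_UU[OF m this]
  have "(LINT (x, y)|lebesgue_on ({0..1} \<times> {0..1}). W x y * (1 - \<theta> * W x y)) = U.dint K"
    unfolding dint_eq_integral[OF bK] .
  moreover have "U.dint K = U.dint V - \<theta> * U.hs V V"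
  proof -
    have "K = (\<lambda>x y. V x y - \<theta> * (V x y * V x y))" by (simp add: K_def fun_eq_iff algebra_simps)
    then show ?thesis unfolding U.hs_def U.dint_cmult[symmetric]
      by (simp only:) (intro U.dint_diff U.bker_cmult U.bker_mult bV)
  qed
  moreover have "0 \<le> U.dint K"
  proof (rule U.dint_nonneg)
    fix x y
    have "\<theta> * V x y \<le> 1 * 1" using \<theta> V0 V1 by (intro mult_mono) auto
    then show "0 \<le> K x y" unfolding K_def using V0 by simp
  qed
  ultimately show ?thesis unfolding sigma_W_def using \<theta> by simp
qed

theorem theorem3p3:
  fixes W :: "real \<Rightarrow> real \<Rightarrow> real"
    and \<beta> \<theta> :: real
    and \<theta>N :: "nat \<Rightarrow> real"
    and M :: "'w measure"
    and A :: "nat \<Rightarrow> nat \<Rightarrow> nat \<Rightarrow> 'w \<Rightarrow> bool"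
    and \<eta> :: "nat \<Rightarrow> 'w \<Rightarrow> real"
    and P :: "'v measure"
    and Z0 :: "'v \<Rightarrow> real"
    and Z :: "real \<times> nat \<Rightarrow> 'v \<Rightarrow> real"
  assumes "graphon W"
    and "riemann_integrable (\<lambda>(x, y). W x y) (0, 0) (1, 1)"
    and "riemann_integrable (\<lambda>x. W x x) 0 1"
    and "(LINT (x, y)|lebesgue_on ({0..1} \<times> {0..1}). W x y) > 0"
    and "0 < \<beta>" and "\<beta> < 1 / graphon_op_norm W"
    and "\<And>N. N \<ge> 1 \<Longrightarrow> 0 < \<theta>N N \<and> \<theta>N N < 1"
    and "\<theta>N \<longlonglongrightarrow> \<theta>" and "0 < \<theta>" and "\<theta> \<le> 1"
    and "prob_space M"
    and "\<And>N. N \<ge> 1 \<Longrightarrow> random_graph M N (\<theta>N N) W (A N)"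
    and "iid_std_normal M \<eta> {1..}"
    and "\<And>N. N \<ge> 1 \<Longrightarrow>
           indep_elements M (count_space UNIV) (adjacency_mat N (A N))
             (\<Pi>\<^sub>M i\<in>{1..}. borel) (\<lambda>\<omega>. \<lambda>i\<in>{1..}. \<eta> i \<omega>)"
    and "prob_space P"
    and "iid_std_normal P (\<lambda>s. case s of None \<Rightarrow> Z0 | Some p \<Rightarrow> Z p) (insert None (Some ` Spec W))"
  shows "AE \<omega> in M.
           weak_conv_m (\<lambda>N. cond_distr M (U_hat \<beta> N (\<theta>N N) (A N) \<eta>) (adjacency_mat N (A N)) \<omega>)
             (distr P borel (U_lim W \<beta> \<theta> P Z0 Z))"
proof -
  note gr = assms(1) and R = assms(2) and RD = assms(3) and \<beta> = assms(5,6) and \<theta>N = assms(7) and lim = assms(8)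
    and \<theta> = assms(9,10) and M = assms(11) and rg = assms(12) and iid = assms(13) and ie = assms(14)
    and P = assms(15) and iidP = assms(16)
  obtain V where V: "U.bker V" "U.ksym V" "\<And>x y. 0 \<le> V x y" "\<And>x y. V x y \<le> 1"
    "AE p in U \<Otimes>\<^sub>M U. W (fst p) (snd p) = V (fst p) (snd p)"
    using graphon_borel_version[OF gr] by blast
  interpret graphon_version W V by unfold_locales (fact gr V)+
  interpret P: prob_space P by (rule P)
  define \<mu> where "\<mu> N \<omega> = cond_distr M (U_hat \<beta> N (\<theta>N N) (A N) \<eta>) (adjacency_mat N (A N)) \<omega>" for N \<omega>
  define \<nu> where "\<nu> = distr P borel (U_lim W \<beta> \<theta> P Z0 Z)"
  \<comment> \<open>Countably many tolerances suffice and permit a single null set.\<close>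
  have conc: "AE \<omega> in M. \<forall>m. \<forall>\<^sub>F N in sequentially.
     (\<forall>s\<in>signs N. \<forall>u\<in>signs N. \<bar>\<Sum>i=1..N. \<Sum>j=1..N. centred N (\<theta>N N) W (A N) \<omega> i j * (s i * u j)\<bar> < inverse (real (Suc m)) * (real N)\<^sup>2) \<and>
     \<bar>\<Sum>i=1..N. centred N (\<theta>N N) W (A N) \<omega> i i\<bar> < inverse (real (Suc m)) * real N"
    unfolding AE_all_countable by (intro allI random_graph_concentration[OF M rg \<theta>N gr]) auto
  have pos: "AE \<omega> in M. \<forall>N. 1 \<le> N \<longrightarrow> 0 < measure M {\<omega>' \<in> space M. adjacency_mat N (A N) \<omega>' = adjacency_mat N (A N) \<omega>}"
    unfolding AE_all_countable
  proof
    fix N :: nat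
    show "AE \<omega> in M. 1 \<le> N \<longrightarrow> 0 < measure M {\<omega>' \<in> space M. adjacency_mat N (A N) \<omega>' = adjacency_mat N (A N) \<omega>}"
    proof (cases "1 \<le> N")
      case True
      then have "AE \<omega> in M. 0 < measure M {\<omega>' \<in> space M. adjacency_mat N (A N) \<omega>' = adjacency_mat N (A N) \<omega>}"
        using ie[OF True] by (intro AE_pos_event M adjacency_finite_range) (simp add: indep_elements_def)
      then show ?thesis by eventually_elim simp
    qed simp
  qed
  have "AE \<omega> in M. weak_conv_m (\<lambda>N. \<mu> N \<omega>) \<nu>"
    using conc pos AE_space
  proof eventually_elim
    case (elim \<omega>)
    note conc = elim(1) and pos = elim(2) and \<omega> = elim(3)
    interpret concentrated_graphs W V A \<omega> \<theta>N \<theta>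
    proof unfold_locales
      show "0 < \<theta>N N" if "1 \<le> N" for N using \<theta>N[OF that] by simp
      show "A N i j \<omega> = A N j i \<omega>" if "1 \<le> N" "i \<in> {1..N}" "j \<in> {1..N}" for N i j
        using rg[OF that(1)] \<omega> that(2,3) unfolding random_graph_def by blast
      show "\<forall>\<^sub>F N in sequentially.
        (\<forall>s\<in>signs N. \<forall>u\<in>signs N. \<bar>\<Sum>i=1..N. \<Sum>j=1..N. centred N (\<theta>N N) W (A N) \<omega> i j * (s i * u j)\<bar> < \<delta> * (real N)\<^sup>2) \<and>
        \<bar>\<Sum>i=1..N. centred N (\<theta>N N) W (A N) \<omega> i i\<bar> < \<delta> * real N" if \<delta>: "0 < \<delta>" for \<delta>
      proof -
        obtain m where m: "inverse (real (Suc m)) < \<delta>" using reals_Archimedean[OF \<delta>] by blast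
        show ?thesis using conc[rule_format, of m]
        proof eventually_elim
          case (elim N)
          have "inverse (real (Suc m)) * (real N)\<^sup>2 \<le> \<delta> * (real N)\<^sup>2" "inverse (real (Suc m)) * real N \<le> \<delta> * real N"
            using m by (auto intro!: mult_right_mono)
          then show ?case using elim by (meson order_less_le_trans)
        qed
      qed
    qed (fact R RD lim \<theta>)+
    have \<mu>: "\<mu> N \<omega> = distr M borel (\<lambda>\<omega>'. U_fixed \<beta> N (\<theta>N N) (adjacency_mat N (A N) \<omega>)
        + 1 / 2 * (\<Sum>i=1..N. coef \<beta> N (\<theta>N N) (adjacency_mat N (A N) \<omega>) i * ((\<eta> i \<omega>')\<^sup>2 - 1)))" if N: "1 \<le> N" for N
      unfolding \<mu>_def using pos N by (intro cond_distr_eq[OF M N ie[OF N]]) auto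
    have \<eta>m: "\<eta> i \<in> borel_measurable M" if "i \<ge> 1" for i
      using iid that by (auto simp: iid_std_normal_def distributed_def)
    \<comment> \<open>For \<open>N = 0\<close> the measure is unrestricted, so the continuity theorem is applied from \<open>N = 1\<close> on.\<close>
    have "weak_conv_m (\<lambda>n. \<mu> (Suc n) \<omega>) \<nu>"
    proof (rule levy_continuity)
      show "real_distribution (\<mu> (Suc n) \<omega>)" for n
        unfolding real_distribution_def real_distribution_axioms_def \<mu>[of "Suc n", simplified]
        using \<eta>m by (auto intro!: prob_space.prob_space_distr[OF M])
      show "real_distribution \<nu>"
        unfolding \<nu>_def using U_lim_char(1)[OF \<beta> P iidP, of \<theta>] by simp
      fix t
      let ?\<phi> = "\<lambda>N. exp (\<i> * of_real (t * U_fixed \<beta> N (\<theta>N N) (adjacency_mat N (A N) \<omega>)))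
        * (\<Prod>i=1..N. exp (chi_log (t * coef \<beta> N (\<theta>N N) (adjacency_mat N (A N) \<omega>) i)))"
      have ch: "char (\<mu> (Suc n) \<omega>) t = ?\<phi> (Suc n)" for n
        by (subst \<mu>) (simp, rule char_quadratic_form[OF M iid])
      have "char \<nu> t = exp (\<i> * of_real (t * (\<beta> / 2 * (U.dint V / \<theta>) + 1 / 2 * (LINT x|lebesgue_on {0..1}. W x x)))
        + (\<Sum>j. of_real ((lam j)\<^sup>2) * rest_fun \<beta> t (lam j)) - of_real (t\<^sup>2 / 4) * of_real (U.dint V / \<theta>))"
      proof -
        have T: "(\<Sum>j. (lam j)\<^sup>2) = U.hs V V"
          using U.eigv_sq_sums[OF bV sV separably_approximable[OF R]] by (simp add: sums_iff)
        \<comment> \<open>The excess of the limiting edge count over the sum of the squared eigenvalues is \<open>2 \<sigma>\<^sub>W\<^sup>2\<close>.\<close>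
        have w: "U.dint V / \<theta> = 2 * (sigma_W W \<theta>)\<^sup>2 + U.hs V V"
          unfolding sigma_W_sq[OF \<theta>] using \<theta> by (simp add: field_simps)
        show ?thesis unfolding \<nu>_def U_lim_char(2)[OF \<beta> P iidP] T w
          by (simp add: algebra_simps)
      qed
      then show "(\<lambda>n. char (\<mu> (Suc n) \<omega>) t) \<longlonglongrightarrow> char \<nu> t"
        unfolding ch using LIMSEQ_Suc[OF U_fixed_char_tendsto[OF \<beta>, of t]] by (simp only:)
    qed
    then have suc: "(\<lambda>n. cdf (\<mu> (Suc n) \<omega>) x) \<longlonglongrightarrow> cdf \<nu> x" if "isCont (cdf \<nu>) x" for x
      unfolding weak_conv_m_def weak_conv_def using that by simp
    show "weak_conv_m (\<lambda>N. \<mu> N \<omega>) \<nu>"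
      unfolding weak_conv_m_def weak_conv_def
    proof (intro allI impI)
      fix x assume "isCont (cdf \<nu>) x"
      from suc[OF this] show "(\<lambda>N. cdf (\<mu> N \<omega>) x) \<longlonglongrightarrow> cdf \<nu> x" by (rule LIMSEQ_imp_Suc)
    qed
  qed
  then show ?thesis unfolding \<mu>_def \<nu>_def .
qed

end
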